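(* Let $(G,P)$ be a lattice ordered group and let $X$ be an associative product system of finite type over $P$ of right Hilbert $A$--$A$-bimodules such that the maps $\mathfrak m_{s,r}$ are bijective and respect co-prime pairs, for all $s,r\in P$. Let $N:G\to(0,\infty)$ be an injective homomorphism, with associated dynamics $\sigma^N$ on $\mathcal{NT}(X)$. Assume that the series $$\zeta_N(\beta):=\sum_{s\in P}N(s)^{-\beta}N_s$$ is convergent in an interval $(\beta_c,\infty)$ for some $\beta_c>0$. Let $\beta>\beta_c$. Then for every tracial state $\tau$ of $A$ there is a state $\omega_\tau:\mathcal F\to\mathbb C$ given by $$\omega_\tau(y)=\sum_{\{s\in P:\,r\le s\}}\frac{N(s)^{-\beta}}{\zeta_N(\beta)}\sum_{j=0}^{N_s-1}\tau\Bigl(\bigl\langle\varphi_{r^{-1}s}(\langle\xi,1^r_{j(r)}\rangle_r)1^{r^{-1}s}_{j'},\ \varphi_{r^{-1}s}(\langle\eta,1^r_{j(r)}\rangle_r)1^{r^{-1}s}_{j'}\bigr\rangle_{r^{-1}s}\Bigr)$$ for $y=i^{(r)}(\theta_{\xi,\eta})$ with $r\in P$, $\xi,\eta\in X_r$, where for each $j\in\{0,\dots,N_s-1\}$ in the summation, $j(r)\in\{0,\dots,N_r-1\}$ and $j'=j(r^{-1}s)\in\{0,\dots,N_{r^{-1}s}-1\}$ are the unique elements with $\mathfrak m_{r,r^{-1}s}(j(r),j')=j$. Further, the assignment $\tau\mapsto\omega_\tau\circ\Phi^\delta$ is an affine continuous map (for the weak$^*$ topologies) from the set of tracial states of $A$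 to a subset of the KMS$_\beta$ states of $(\mathcal{NT}(X),\sigma^N)$.
   Context: $A$ is a unital $C^*$-algebra. A right Hilbert $A$--$A$-bimodule is a right Hilbert $A$-module $Y$ (inner product $A$-valued, conjugate-linear in the first variable) with a $*$-homomorphism $\varphi:A\to\mathcal L(Y)$ (adjointable operators) giving the left action. $\theta_{\xi,\eta}(\zeta)=\xi\cdot\langle\eta,\zeta\rangle$ and $\mathcal K(Y)=\overline{\mathrm{span}}\{\theta_{\xi,\eta}\}$. The balanced tensor product $X\otimes_A Y$ has inner product $\langle\xi_1\otimes\eta_1,\xi_2\otimes\eta_2\rangle=\langle\langle\xi_2,\xi_1\rangle\cdot\eta_1,\eta_2\rangle$ and left action $a\mapsto\varphi(a)\otimes I$. $(G,P)$ is a lattice ordered group: $P$ is an abelian cancellative semigroup with identity $e$, $G=PP^{-1}$ is its Grothendieck enveloping group, $P\cap P^{-1}=\{e\}$, and any $s,r\in G$ have a least common upper bound $s\vee r\in G$ for the order $s\le r\Leftrightarrow s^{-1}r\in P$. For $s,r\in P$, $s\wedge r=(s\vee r)^{-1}sr$ is their greatest lower bound. A product system over $P$ is $X=\bigsqcup_{s\in P}X_s$ where each $X_s$ is a right Hilbert $A$--$A$-bimodule (inner product $\langle\cdot,\cdot\rangle_s$, left action $\varphi_s$, right action $\rho_s$, so $\rho_s(b)\xi=\xi\cdot b$), $X_e={}_AA_A$ with $\langle a,b\rangle=a^*b$, and $X$ is a semigroup with $X_sX_r\subseteq X_{sr}$, such that for $s,r\neq e$ the product extends to an isomorphism $F^{s,r}:X_s\otimes_AX_r\to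 X_{sr}$ of right Hilbert $A$--$A$-bimodules, while products with elements of $X_e=A$ are given by the bimodule actions. $X$ is associative if $F^{sr,q}(F^{s,r}\otimes_AI_q)=F^{s,rq}(I_s\otimes_AF^{r,q})$ for all $s,r,q\in P$. For $S\in\mathcal L(X_s)$, $i_s^{sr}(S)=F^{s,r}(S\otimes_AI_r)(F^{s,r})^*\in\mathcal L(X_{sr})$; $i_e^r=\varphi_r$, $i_s^s=\mathrm{id}$. $X$ is of finite type if for every $s\in P$ there are an integer $N_s\ge1$ and elements $1^s_0,\dots,1^s_{N_s-1}\in X_s$ with: (1) $X_s=\{\sum_j\varphi_s(a_j)1^s_j:a_j\in A\}$; (2) $X_s=\{\sum_j\rho_s(b_j)1^s_j:b_j\in A\}$; (3) $\langle1^s_j,1^s_k\rangle_s=\delta_{j,k}$; (4) for all $s,r\in P$ there is a map $\mathfrak m_{s,r}:\{0,\dots,N_s-1\}\times\{0,\dots,N_r-1\}\to\{0,\dots,N_{sr}-1\}$ with $F^{s,r}(1^s_j\otimes_A1^r_k)=1^{sr}_{\mathfrak m_{s,r}(j,k)}$. Then $\mathcal L(X_s)=\mathcal K(X_s)$ for all $s$, and $X$ is automatically compactly aligned, i.e. $i_s^{s\vee r}(S)i_r^{s\vee r}(T)\in\mathcal K(X_{s\vee r})$ for compact $S,T$. The maps $\mathfrak m_{s,r}$ respect co-prime pairs if for all $s,r\in P$ with $s\wedge r=e$, all $j,g,h\in\{0,\dots,N_s-1\}$ and all $l,m,n\in\{0,\dots,N_r-1\}$: $\mathfrak m_{s,r}(j,m)=\mathfrak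 m_{r,s}(l,g)$ and $\mathfrak m_{s,r}(j,n)=\mathfrak m_{r,s}(l,h)$ imply $m=n$ and $g=h$. A Toeplitz representation $\psi:X\to C$ in a $C^*$-algebra $C$: $\psi_s=\psi|_{X_s}$ linear, $\psi_e$ a $*$-homomorphism, $\psi_s(\xi)\psi_r(\eta)=\psi_{sr}(\xi\eta)$, and $\psi_s(\xi)^*\psi_s(\eta)=\psi_e(\langle\xi,\eta\rangle_s)$. It induces $*$-homomorphisms $\psi^{(s)}:\mathcal K(X_s)\to C$, $\psi^{(s)}(\theta_{\xi,\eta})=\psi_s(\xi)\psi_s(\eta)^*$. It is Nica covariant if $\psi^{(s)}(S)\psi^{(r)}(T)=\psi^{(s\vee r)}(i_s^{s\vee r}(S)i_r^{s\vee r}(T))$ for $s,r\in P$, $S\in\mathcal K(X_s)$, $T\in\mathcal K(X_r)$. $\mathcal{NT}(X)$ is the $C^*$-algebra generated by a universal Nica covariant Toeplitz representation $i_X$, with $i_s=i_X|_{X_s}$ and $i^{(s)}$ the induced homomorphism of $\mathcal K(X_s)$; it is the closed span of the elements $i_s(\xi)i_r(\eta)^*$. The core $\mathcal F$ is the closed span of the elements $i^{(s)}(\theta_{\xi,\eta})=i_s(\xi)i_s(\eta)^*$, $\xi,\eta\in X_s$, $s\in P$. There is a conditional expectation $\Phi^\delta:\mathcal{NT}(X)\to\mathcal F$ with $\Phi^\delta(i_s(\xi)i_r(\eta)^* )=\delta_{s,r}\,i_s(\xi)i_s(\eta)^*$. For a homomorphism $N:G\to(0,\infty)$ (multiplicative),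 $\sigma^N:\mathbb R\to\mathrm{Aut}(\mathcal{NT}(X))$ is the dynamics with $\sigma^N_t(i_e(a))=i_e(a)$, $\sigma^N_t(i_s(\xi))=N(s)^{it}i_s(\xi)$. An element $c$ is $\sigma$-analytic if $t\mapsto\sigma_t(c)$ extends to an entire function. For $0<\beta<\infty$, a KMS$_\beta$ state of $(C,\sigma)$ is a state $\omega$ with $\omega(cd)=\omega(d\sigma_{i\beta}(c))$ for all $\sigma$-analytic $c,d$. *)

theory Defs
  imports "HOL-Analysis.Analysis" "HOL-Library.Lattice_Algebras" "HOL-Library.Function_Algebras"
begin

section \<open>Complex vector spaces\<close>

class complex_vector = ab_group_add +
  fixes scaleC :: "complex \<Rightarrow> 'a \<Rightarrow> 'a" (infixr "*\<^sub>C" 75)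
  assumes scaleC_add_right: "c *\<^sub>C (x + y) = c *\<^sub>C x + c *\<^sub>C y"
    and scaleC_add_left: "(c + d) *\<^sub>C x = c *\<^sub>C x + d *\<^sub>C x"
    and scaleC_scaleC: "c *\<^sub>C d *\<^sub>C x = (c * d) *\<^sub>C x"
    and scaleC_one: "1 *\<^sub>C x = x"

interpretation complex_vector:
  vector_space "scaleC :: complex \<Rightarrow> 'a \<Rightarrow> 'a::complex_vector"
  by unfold_locales (simp_all add: scaleC_add_right scaleC_add_left scaleC_scaleC scaleC_one)

abbreviation csubspace :: "'a::complex_vector set \<Rightarrow> bool"
  where "csubspace \<equiv> module.subspace scaleC"

abbreviation cspan :: "'a::complex_vector set \<Rightarrow> 'a set"
  where "cspan \<equiv> module.span scaleC"

instantiation complex :: complex_vector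
begin

definition scaleC_complex_def: "c *\<^sub>C (x::complex) = c * x"

instance
  by standard (simp_all add: scaleC_complex_def algebra_simps)

end

instantiation "fun" :: (type, complex_vector) complex_vector
begin

definition scaleC_fun_def: "c *\<^sub>C f = (\<lambda>x. c *\<^sub>C f x)"

instance
  by standard (simp_all add: scaleC_fun_def fun_eq_iff
      scaleC_add_right scaleC_add_left scaleC_scaleC scaleC_one)

end

definition clinear_on :: "'a::complex_vector set \<Rightarrow> ('a \<Rightarrow> 'b::complex_vector) \<Rightarrow> bool"
  where "clinear_on V f \<longleftrightarrow>
    (\<forall>x\<in>V. \<forall>y\<in>V. f (x + y) = f x + f y) \<and> (\<forall>c. \<forall>x\<in>V. f (c *\<^sub>C x) = c *\<^sub>C f x)"

definition complete_wrt :: "('a::complex_vector \<Rightarrow> real) \<Rightarrow> 'a set \<Rightarrow> bool"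
  where "complete_wrt nrm V \<longleftrightarrow>
    (\<forall>x::nat \<Rightarrow> 'a. (\<forall>k. x k \<in> V) \<longrightarrow>
       (\<forall>\<epsilon>>0. \<exists>K. \<forall>k\<ge>K. \<forall>l\<ge>K. nrm (x k - x l) < \<epsilon>) \<longrightarrow>
       (\<exists>y\<in>V. (\<lambda>k. nrm (x k - y)) \<longlonglongrightarrow> 0))"

definition closure_wrt :: "('a::complex_vector \<Rightarrow> real) \<Rightarrow> 'a set \<Rightarrow> 'a set \<Rightarrow> 'a set"
  where "closure_wrt nrm V S = {x \<in> V. \<forall>\<epsilon>>0. \<exists>y\<in>S. nrm (x - y) < \<epsilon>}"


section \<open>C*-algebras\<close>

text \<open>The carrier of a C*-algebra (and of a Hilbert module) is a linear subspace of an ambient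
  complex vector space, whose addition and scalar multiplication it inherits; the remaining
  operations are only meaningful on the carrier.\<close>

record 'a cstar =
  cs_carrier :: "'a set"
  cs_mult :: "'a \<Rightarrow> 'a \<Rightarrow> 'a"
  cs_star :: "'a \<Rightarrow> 'a"
  cs_norm :: "'a \<Rightarrow> real"

locale cstar_algebra =
  fixes A :: "'a::complex_vector cstar"
  assumes subspace: "csubspace (cs_carrier A)"
    and mult_closed: "\<lbrakk>x \<in> cs_carrier A; y \<in> cs_carrier A\<rbrakk> \<Longrightarrow> cs_mult A x y \<in> cs_carrier A"
    and star_closed: "x \<in> cs_carrier A \<Longrightarrow> cs_star A x \<in> cs_carrier A"
    and mult_linear_left: "y \<in> cs_carrier A \<Longrightarrow> clinear_on (cs_carrier A) (\<lambda>x. cs_mult A x y)"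
    and mult_linear_right: "x \<in> cs_carrier A \<Longrightarrow> clinear_on (cs_carrier A) (cs_mult A x)"
    and mult_assoc: "\<lbrakk>x \<in> cs_carrier A; y \<in> cs_carrier A; z \<in> cs_carrier A\<rbrakk> \<Longrightarrow>
      cs_mult A (cs_mult A x y) z = cs_mult A x (cs_mult A y z)"
    and star_add: "\<lbrakk>x \<in> cs_carrier A; y \<in> cs_carrier A\<rbrakk> \<Longrightarrow>
      cs_star A (x + y) = cs_star A x + cs_star A y"
    and star_scale: "x \<in> cs_carrier A \<Longrightarrow> cs_star A (c *\<^sub>C x) = cnj c *\<^sub>C cs_star A x"
    and star_mult: "\<lbrakk>x \<in> cs_carrier A; y \<in> cs_carrier A\<rbrakk> \<Longrightarrow>
      cs_star A (cs_mult A x y) = cs_mult A (cs_star A y) (cs_star A x)"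
    and star_star: "x \<in> cs_carrier A \<Longrightarrow> cs_star A (cs_star A x) = x"
    and norm_nonneg: "x \<in> cs_carrier A \<Longrightarrow> 0 \<le> cs_norm A x"
    and norm_eq_0: "x \<in> cs_carrier A \<Longrightarrow> cs_norm A x = 0 \<longleftrightarrow> x = 0"
    and norm_triangle: "\<lbrakk>x \<in> cs_carrier A; y \<in> cs_carrier A\<rbrakk> \<Longrightarrow>
      cs_norm A (x + y) \<le> cs_norm A x + cs_norm A y"
    and norm_scale: "x \<in> cs_carrier A \<Longrightarrow> cs_norm A (c *\<^sub>C x) = cmod c * cs_norm A x"
    and norm_mult: "\<lbrakk>x \<in> cs_carrier A; y \<in> cs_carrier A\<rbrakk> \<Longrightarrow>
      cs_norm A (cs_mult A x y) \<le> cs_norm A x * cs_norm A y"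
    and cstar_identity: "x \<in> cs_carrier A \<Longrightarrow>
      cs_norm A (cs_mult A (cs_star A x) x) = (cs_norm A x)\<^sup>2"
    and complete: "complete_wrt (cs_norm A) (cs_carrier A)"

definition is_unit :: "'a cstar \<Rightarrow> 'a \<Rightarrow> bool"
  where "is_unit A u \<longleftrightarrow> u \<in> cs_carrier A \<and>
    (\<forall>a\<in>cs_carrier A. cs_mult A u a = a \<and> cs_mult A a u = a)"

definition cs_one :: "'a cstar \<Rightarrow> 'a"
  where "cs_one A = (THE u. is_unit A u)"

locale unital_cstar_algebra = cstar_algebra +
  assumes unit_exists: "\<exists>u. is_unit A u"

definition cs_positive :: "'a cstar \<Rightarrow> 'a \<Rightarrow> bool"
  where "cs_positive A x \<longleftrightarrow> (\<exists>a\<in>cs_carrier A. x = cs_mult A (cs_star A a) a)"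

definition star_hom :: "'a::complex_vector cstar \<Rightarrow> 'b::complex_vector cstar \<Rightarrow> ('a \<Rightarrow> 'b) \<Rightarrow> bool"
  where "star_hom A B f \<longleftrightarrow>
    f ` cs_carrier A \<subseteq> cs_carrier B \<and> clinear_on (cs_carrier A) f \<and>
    (\<forall>x\<in>cs_carrier A. \<forall>y\<in>cs_carrier A. f (cs_mult A x y) = cs_mult B (f x) (f y)) \<and>
    (\<forall>x\<in>cs_carrier A. f (cs_star A x) = cs_star B (f x))"

definition cstar_subalgebra :: "'a::complex_vector cstar \<Rightarrow> 'a set \<Rightarrow> bool"
  where "cstar_subalgebra A B \<longleftrightarrow> B \<subseteq> cs_carrier A \<and> csubspace B \<and>
    (\<forall>x\<in>B. \<forall>y\<in>B. cs_mult A x y \<in> B) \<and> (\<forall>x\<in>B. cs_star A x \<in> B) \<and>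
    closure_wrt (cs_norm A) (cs_carrier A) B = B"

text \<open>Functionals are extensional (\<open>undefined\<close> off the carrier), so that sets of states are subsets
  of a product space and the weak* topology is the topology of that product.\<close>

definition states :: "'a::complex_vector cstar \<Rightarrow> ('a \<Rightarrow> complex) set"
  where "states A = {\<omega> \<in> extensional (cs_carrier A).
    clinear_on (cs_carrier A) \<omega> \<and>
    (\<forall>a\<in>cs_carrier A. \<omega> (cs_mult A (cs_star A a) a) \<in> \<real>\<^sub>\<ge>\<^sub>0) \<and>
    (\<forall>a\<in>cs_carrier A. cmod (\<omega> a) \<le> cs_norm A a) \<and>
    (SUP a\<in>{a \<in> cs_carrier A. cs_norm A a \<le> 1}. cmod (\<omega> a)) = 1}"

definition tracial_states :: "'a::complex_vector cstar \<Rightarrow> ('a \<Rightarrow> complex) set"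
  where "tracial_states A = {\<tau> \<in> states A.
    \<forall>a\<in>cs_carrier A. \<forall>b\<in>cs_carrier A. \<tau> (cs_mult A a b) = \<tau> (cs_mult A b a)}"

definition weak_star :: "'a cstar \<Rightarrow> ('a \<Rightarrow> complex) set \<Rightarrow> ('a \<Rightarrow> complex) topology"
  where "weak_star A S = subtopology (product_topology (\<lambda>_. euclidean) (cs_carrier A)) S"

definition convex_comb ::
  "'a cstar \<Rightarrow> real \<Rightarrow> ('a \<Rightarrow> complex) \<Rightarrow> ('a \<Rightarrow> complex) \<Rightarrow> 'a \<Rightarrow> complex"
  where "convex_comb A t \<omega>\<^sub>1 \<omega>\<^sub>2 =
    (\<lambda>a\<in>cs_carrier A. complex_of_real t * \<omega>\<^sub>1 a + complex_of_real (1 - t) * \<omega>\<^sub>2 a)"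


section \<open>Dynamics and KMS states\<close>

definition dynamics :: "'c::complex_vector cstar \<Rightarrow> (real \<Rightarrow> 'c \<Rightarrow> 'c) \<Rightarrow> bool"
  where "dynamics C \<sigma> \<longleftrightarrow>
    (\<forall>t. star_hom C C (\<sigma> t) \<and> bij_betw (\<sigma> t) (cs_carrier C) (cs_carrier C)) \<and>
    (\<forall>c\<in>cs_carrier C. \<sigma> 0 c = c) \<and>
    (\<forall>s t. \<forall>c\<in>cs_carrier C. \<sigma> (s + t) c = \<sigma> s (\<sigma> t c)) \<and>
    (\<forall>c\<in>cs_carrier C. \<forall>t. ((\<lambda>s. cs_norm C (\<sigma> s c - \<sigma> t c)) \<longlongrightarrow> 0) (at t))"

definition entire_in :: "'c::complex_vector cstar \<Rightarrow> (complex \<Rightarrow> 'c) \<Rightarrow> bool"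
  where "entire_in C f \<longleftrightarrow> (\<forall>z. f z \<in> cs_carrier C) \<and>
    (\<forall>z. \<exists>d\<in>cs_carrier C.
       ((\<lambda>w. cs_norm C (inverse (w - z) *\<^sub>C (f w - f z) - d)) \<longlongrightarrow> 0) (at z))"

text \<open>\<open>f\<close> is the (unique) entire extension \<open>z \<mapsto> \<sigma>\<^sub>z(c)\<close> of \<open>t \<mapsto> \<sigma>\<^sub>t(c)\<close>.\<close>

definition analytic_extension ::
  "'c::complex_vector cstar \<Rightarrow> (real \<Rightarrow> 'c \<Rightarrow> 'c) \<Rightarrow> 'c \<Rightarrow> (complex \<Rightarrow> 'c) \<Rightarrow> bool"
  where "analytic_extension C \<sigma> c f \<longleftrightarrow>
    entire_in C f \<and> (\<forall>t. f (complex_of_real t) = \<sigma> t c)"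

definition analytic_elements :: "'c::complex_vector cstar \<Rightarrow> (real \<Rightarrow> 'c \<Rightarrow> 'c) \<Rightarrow> 'c set"
  where "analytic_elements C \<sigma> = {c \<in> cs_carrier C. \<exists>f. analytic_extension C \<sigma> c f}"

definition kms_states ::
  "'c::complex_vector cstar \<Rightarrow> (real \<Rightarrow> 'c \<Rightarrow> 'c) \<Rightarrow> real \<Rightarrow> ('c \<Rightarrow> complex) set"
  where "kms_states C \<sigma> \<beta> = {\<omega> \<in> states C.
    \<forall>c\<in>analytic_elements C \<sigma>. \<forall>d\<in>analytic_elements C \<sigma>. \<forall>f. analytic_extension C \<sigma> c f \<longrightarrow>
      \<omega> (cs_mult C c d) = \<omega> (cs_mult C d (f (\<i> * complex_of_real \<beta>)))}"

definition conditional_expectation ::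
  "'c::complex_vector cstar \<Rightarrow> 'c set \<Rightarrow> ('c \<Rightarrow> 'c) \<Rightarrow> bool"
  where "conditional_expectation C B E \<longleftrightarrow>
    E ` cs_carrier C \<subseteq> B \<and> clinear_on (cs_carrier C) E \<and> (\<forall>b\<in>B. E b = b) \<and>
    (\<forall>c\<in>cs_carrier C. cs_norm C (E c) \<le> cs_norm C c) \<and>
    (\<forall>c\<in>cs_carrier C. cs_positive C c \<longrightarrow> cs_positive C (E c)) \<and>
    (\<forall>a\<in>B. \<forall>b\<in>B. \<forall>c\<in>cs_carrier C.
       E (cs_mult C (cs_mult C a c) b) = cs_mult C (cs_mult C a (E c)) b)"


section \<open>Hilbert modules and bimodules\<close>

record ('a, 'x) hmod =
  hm_carrier :: "'x set"
  hm_ract :: "'x \<Rightarrow> 'a \<Rightarrow> 'x"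
  hm_inner :: "'x \<Rightarrow> 'x \<Rightarrow> 'a"
  hm_lact :: "'a \<Rightarrow> 'x \<Rightarrow> 'x"

definition hm_norm :: "'a cstar \<Rightarrow> ('a, 'x) hmod \<Rightarrow> 'x \<Rightarrow> real"
  where "hm_norm A Y \<xi> = sqrt (cs_norm A (hm_inner Y \<xi> \<xi>))"

text \<open>The component \<^const>\<open>hm_lact\<close> is irrelevant for right Hilbert modules.\<close>

locale hilbert_module = cstar_algebra A
  for A :: "'a::complex_vector cstar" +
  fixes Y :: "('a, 'x::complex_vector) hmod"
  assumes module_subspace: "csubspace (hm_carrier Y)"
    and ract_closed: "\<lbrakk>\<xi> \<in> hm_carrier Y; a \<in> cs_carrier A\<rbrakk> \<Longrightarrow> hm_ract Y \<xi> a \<in> hm_carrier Y"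
    and ract_linear_left: "a \<in> cs_carrier A \<Longrightarrow> clinear_on (hm_carrier Y) (\<lambda>\<xi>. hm_ract Y \<xi> a)"
    and ract_linear_right: "\<xi> \<in> hm_carrier Y \<Longrightarrow> clinear_on (cs_carrier A) (hm_ract Y \<xi>)"
    and ract_mult: "\<lbrakk>\<xi> \<in> hm_carrier Y; a \<in> cs_carrier A; b \<in> cs_carrier A\<rbrakk> \<Longrightarrow>
      hm_ract Y \<xi> (cs_mult A a b) = hm_ract Y (hm_ract Y \<xi> a) b"
    and inner_closed: "\<lbrakk>\<xi> \<in> hm_carrier Y; \<eta> \<in> hm_carrier Y\<rbrakk> \<Longrightarrow> hm_inner Y \<xi> \<eta> \<in> cs_carrier A"
    and inner_linear_right: "\<xi> \<in> hm_carrier Y \<Longrightarrow> clinear_on (hm_carrier Y) (hm_inner Y \<xi>)"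
    and inner_ract: "\<lbrakk>\<xi> \<in> hm_carrier Y; \<eta> \<in> hm_carrier Y; a \<in> cs_carrier A\<rbrakk> \<Longrightarrow>
      hm_inner Y \<xi> (hm_ract Y \<eta> a) = cs_mult A (hm_inner Y \<xi> \<eta>) a"
    and inner_star: "\<lbrakk>\<xi> \<in> hm_carrier Y; \<eta> \<in> hm_carrier Y\<rbrakk> \<Longrightarrow>
      cs_star A (hm_inner Y \<xi> \<eta>) = hm_inner Y \<eta> \<xi>"
    and inner_positive: "\<xi> \<in> hm_carrier Y \<Longrightarrow> cs_positive A (hm_inner Y \<xi> \<xi>)"
    and inner_definite: "\<lbrakk>\<xi> \<in> hm_carrier Y; hm_inner Y \<xi> \<xi> = 0\<rbrakk> \<Longrightarrow> \<xi> = 0"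
    and module_complete: "complete_wrt (hm_norm A Y) (hm_carrier Y)"

text \<open>Operators on a module are extended by \<open>0\<close> off the carrier, so that equality of operators is
  equality of functions and sums and scalar multiples of operators are those of functions.\<close>

definition adjoint_pair ::
  "('a, 'x) hmod \<Rightarrow> ('a, 'y) hmod \<Rightarrow> ('x \<Rightarrow> 'y) \<Rightarrow> ('y \<Rightarrow> 'x) \<Rightarrow> bool"
  where "adjoint_pair Y Z S T \<longleftrightarrow>
    S ` hm_carrier Y \<subseteq> hm_carrier Z \<and> T ` hm_carrier Z \<subseteq> hm_carrier Y \<and>
    (\<forall>\<xi>\<in>hm_carrier Y. \<forall>\<eta>\<in>hm_carrier Z. hm_inner Z (S \<xi>) \<eta> = hm_inner Y \<xi> (T \<eta>))"

definition hm_adjoint ::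
  "('a, 'x::zero) hmod \<Rightarrow> ('a, 'y) hmod \<Rightarrow> ('x \<Rightarrow> 'y) \<Rightarrow> 'y \<Rightarrow> 'x"
  where "hm_adjoint Y Z S =
    (THE T. adjoint_pair Y Z S T \<and> (\<forall>\<eta>. \<eta> \<notin> hm_carrier Z \<longrightarrow> T \<eta> = 0))"

definition op_norm :: "'a cstar \<Rightarrow> ('a, 'x) hmod \<Rightarrow> ('x \<Rightarrow> 'x) \<Rightarrow> real"
  where "op_norm A Y S = (SUP \<xi>\<in>{\<xi> \<in> hm_carrier Y. hm_norm A Y \<xi> \<le> 1}. hm_norm A Y (S \<xi>))"

definition adjointables :: "('a, 'x::zero) hmod \<Rightarrow> ('x \<Rightarrow> 'x) set"
  where "adjointables Y =
    {S. (\<exists>T. adjoint_pair Y Y S T) \<and> (\<forall>\<xi>. \<xi> \<notin> hm_carrier Y \<longrightarrow> S \<xi> = 0)}"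

definition adjointable_alg :: "'a cstar \<Rightarrow> ('a, 'x::zero) hmod \<Rightarrow> ('x \<Rightarrow> 'x) cstar"
  where "adjointable_alg A Y = \<lparr>cs_carrier = adjointables Y, cs_mult = (\<lambda>S T. S \<circ> T),
    cs_star = hm_adjoint Y Y, cs_norm = op_norm A Y\<rparr>"

definition rank_one :: "('a, 'x::zero) hmod \<Rightarrow> 'x \<Rightarrow> 'x \<Rightarrow> 'x \<Rightarrow> 'x"
  where "rank_one Y \<xi> \<eta> = (\<lambda>\<zeta>. if \<zeta> \<in> hm_carrier Y then hm_ract Y \<xi> (hm_inner Y \<eta> \<zeta>) else 0)"

definition compacts :: "'a cstar \<Rightarrow> ('a, 'x::complex_vector) hmod \<Rightarrow> ('x \<Rightarrow> 'x) set"
  where "compacts A Y = closure_wrt (op_norm A Y) (adjointables Y)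
    (cspan {rank_one Y \<xi> \<eta> |\<xi> \<eta>. \<xi> \<in> hm_carrier Y \<and> \<eta> \<in> hm_carrier Y})"

definition compact_alg :: "'a cstar \<Rightarrow> ('a, 'x::complex_vector) hmod \<Rightarrow> ('x \<Rightarrow> 'x) cstar"
  where "compact_alg A Y = (adjointable_alg A Y)\<lparr>cs_carrier := compacts A Y\<rparr>"

definition left_op :: "('a, 'x::zero) hmod \<Rightarrow> 'a \<Rightarrow> 'x \<Rightarrow> 'x"
  where "left_op Y a = (\<lambda>\<xi>. if \<xi> \<in> hm_carrier Y then hm_lact Y a \<xi> else 0)"

locale hilbert_bimodule = hilbert_module +
  assumes left_action: "star_hom A (adjointable_alg A Y) (left_op Y)"

text \<open>The bimodule \<open>\<^sub>AA\<^sub>A\<close>.\<close>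

definition trivial_bimodule :: "'a cstar \<Rightarrow> ('a, 'a) hmod"
  where "trivial_bimodule A = \<lparr>hm_carrier = cs_carrier A, hm_ract = cs_mult A,
    hm_inner = (\<lambda>a b. cs_mult A (cs_star A a) b), hm_lact = cs_mult A\<rparr>"

definition bimodule_iso ::
  "'a::complex_vector cstar \<Rightarrow> ('a, 'x::complex_vector) hmod \<Rightarrow> ('a, 'y::complex_vector) hmod \<Rightarrow>
    ('x \<Rightarrow> 'y) \<Rightarrow> bool"
  where "bimodule_iso A Y Z U \<longleftrightarrow>
    bij_betw U (hm_carrier Y) (hm_carrier Z) \<and> clinear_on (hm_carrier Y) U \<and>
    (\<forall>\<xi>\<in>hm_carrier Y. \<forall>\<eta>\<in>hm_carrier Y. hm_inner Z (U \<xi>) (U \<eta>) = hm_inner Y \<xi> \<eta>) \<and>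
    (\<forall>\<xi>\<in>hm_carrier Y. \<forall>a\<in>cs_carrier A.
       U (hm_ract Y \<xi> a) = hm_ract Z (U \<xi>) a \<and> U (hm_lact Y a \<xi>) = hm_lact Z a (U \<xi>))"

text \<open>The balanced tensor product is the completion of the span of the elementary tensors in the
  stated inner product: a bimodule \<open>T\<close> with a balanced map \<open>(\<xi>, \<eta>) \<mapsto> \<xi> \<otimes> \<eta>\<close> whose values have
  that inner product and span a dense subspace. Completeness of \<open>T\<close> is part of
  \<^locale>\<open>hilbert_bimodule\<close>; \<open>(T, \<otimes>)\<close> is unique up to a unique isomorphism.\<close>

locale balanced_tensor_product =
  M: hilbert_bimodule A Y + N: hilbert_bimodule A Z + T: hilbert_bimodule A T
  for A :: "'a::complex_vector cstar" and Y :: "('a, 'x::complex_vector) hmod"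
    and Z :: "('a, 'y::complex_vector) hmod" and T :: "('a, 't::complex_vector) hmod" +
  fixes tensor :: "'x \<Rightarrow> 'y \<Rightarrow> 't"
  assumes tensor_closed: "\<lbrakk>\<xi> \<in> hm_carrier Y; \<eta> \<in> hm_carrier Z\<rbrakk> \<Longrightarrow> tensor \<xi> \<eta> \<in> hm_carrier T"
    and tensor_linear_left: "\<eta> \<in> hm_carrier Z \<Longrightarrow> clinear_on (hm_carrier Y) (\<lambda>\<xi>. tensor \<xi> \<eta>)"
    and tensor_linear_right: "\<xi> \<in> hm_carrier Y \<Longrightarrow> clinear_on (hm_carrier Z) (tensor \<xi>)"
    and tensor_balanced: "\<lbrakk>\<xi> \<in> hm_carrier Y; \<eta> \<in> hm_carrier Z; a \<in> cs_carrier A\<rbrakk> \<Longrightarrow>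
      tensor (hm_ract Y \<xi> a) \<eta> = tensor \<xi> (hm_lact Z a \<eta>)"
    and tensor_ract: "\<lbrakk>\<xi> \<in> hm_carrier Y; \<eta> \<in> hm_carrier Z; a \<in> cs_carrier A\<rbrakk> \<Longrightarrow>
      hm_ract T (tensor \<xi> \<eta>) a = tensor \<xi> (hm_ract Z \<eta> a)"
    and tensor_lact: "\<lbrakk>\<xi> \<in> hm_carrier Y; \<eta> \<in> hm_carrier Z; a \<in> cs_carrier A\<rbrakk> \<Longrightarrow>
      hm_lact T a (tensor \<xi> \<eta>) = tensor (hm_lact Y a \<xi>) \<eta>"
    and tensor_inner: "\<lbrakk>\<xi>\<^sub>1 \<in> hm_carrier Y; \<eta>\<^sub>1 \<in> hm_carrier Z; \<xi>\<^sub>2 \<in> hm_carrier Y; \<eta>\<^sub>2 \<in> hm_carrier Z\<rbrakk> \<Longrightarrow>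
      hm_inner T (tensor \<xi>\<^sub>1 \<eta>\<^sub>1) (tensor \<xi>\<^sub>2 \<eta>\<^sub>2) =
      hm_inner Z (hm_lact Z (hm_inner Y \<xi>\<^sub>2 \<xi>\<^sub>1) \<eta>\<^sub>1) \<eta>\<^sub>2"
    and tensor_dense: "closure_wrt (hm_norm A T) (hm_carrier T)
      (cspan {tensor \<xi> \<eta> |\<xi> \<eta>. \<xi> \<in> hm_carrier Y \<and> \<eta> \<in> hm_carrier Z}) = hm_carrier T"

text \<open>The operator \<open>S \<otimes> I\<close> on the tensor product \<open>T\<close> of \<open>Y\<close> and \<open>Z\<close>.\<close>

definition tensor_op ::
  "('a, 'x) hmod \<Rightarrow> ('a, 'y) hmod \<Rightarrow> ('a, 't::zero) hmod \<Rightarrow> ('x \<Rightarrow> 'y \<Rightarrow> 't) \<Rightarrow> ('x \<Rightarrow> 'x) \<Rightarrow> 't \<Rightarrow> 't"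
  where "tensor_op Y Z T tensor S =
    (THE R. R \<in> adjointables T \<and>
       (\<forall>\<xi>\<in>hm_carrier Y. \<forall>\<eta>\<in>hm_carrier Z. R (tensor \<xi> \<eta>) = tensor (S \<xi>) \<eta>))"


section \<open>Product systems\<close>

text \<open>A lattice ordered abelian group \<open>(G, P)\<close> is a type of class
  \<^class>\<open>lattice_ab_group_add\<close>, written additively: \<open>P = {s. 0 \<le> s}\<close>, \<open>e = 0\<close>, and
  \<open>\<or>\<close>, \<open>\<and>\<close> are \<^const>\<open>sup\<close>, \<^const>\<open>inf\<close>.

  The coefficient algebra and all fibres \<open>X\<^sub>s\<close> are subspaces of one ambient space, so that
  \<open>X\<^sub>e = \<^sub>AA\<^sub>A\<close> can be an equality; this costs no generality. The fibres are not assumed to have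
  disjoint carriers: an element of the product system is a pair of an index and an element of that
  fibre. The fields \<open>ps_tensor\<close> and \<open>ps_tens\<close> hold the balanced tensor product of two
  fibres, and \<open>ps_F\<close> the isomorphisms \<open>F\<^sup>s\<^sup>,\<^sup>r\<close>.\<close>

record ('g, 'u, 't) prod_sys =
  ps_fib :: "'g \<Rightarrow> ('u, 'u) hmod"
  ps_mult :: "'g \<Rightarrow> 'g \<Rightarrow> 'u \<Rightarrow> 'u \<Rightarrow> 'u"
  ps_tensor :: "'g \<Rightarrow> 'g \<Rightarrow> ('u, 't) hmod"
  ps_tens :: "'g \<Rightarrow> 'g \<Rightarrow> 'u \<Rightarrow> 'u \<Rightarrow> 't"
  ps_F :: "'g \<Rightarrow> 'g \<Rightarrow> 't \<Rightarrow> 'u"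

abbreviation ps_carrier :: "('g, 'u, 't) prod_sys \<Rightarrow> 'g \<Rightarrow> 'u set"
  where "ps_carrier X s \<equiv> hm_carrier (ps_fib X s)"

abbreviation ps_inner :: "('g, 'u, 't) prod_sys \<Rightarrow> 'g \<Rightarrow> 'u \<Rightarrow> 'u \<Rightarrow> 'u"
  where "ps_inner X s \<equiv> hm_inner (ps_fib X s)"

abbreviation ps_lact :: "('g, 'u, 't) prod_sys \<Rightarrow> 'g \<Rightarrow> 'u \<Rightarrow> 'u \<Rightarrow> 'u"
  where "ps_lact X s \<equiv> hm_lact (ps_fib X s)"

abbreviation ps_ract :: "('g, 'u, 't) prod_sys \<Rightarrow> 'g \<Rightarrow> 'u \<Rightarrow> 'u \<Rightarrow> 'u"
  where "ps_ract X s \<equiv> hm_ract (ps_fib X s)"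

locale product_system = unital_cstar_algebra A
  for A :: "'u::complex_vector cstar" +
  fixes X :: "('g::lattice_ab_group_add, 'u, 't::complex_vector) prod_sys"
  assumes fib_bimodule: "0 \<le> s \<Longrightarrow> hilbert_bimodule A (ps_fib X s)"
    and fib_0: "ps_fib X 0 = trivial_bimodule A"
    and mult_0_left: "\<lbrakk>0 \<le> s; a \<in> cs_carrier A; \<xi> \<in> ps_carrier X s\<rbrakk> \<Longrightarrow>
      ps_mult X 0 s a \<xi> = ps_lact X s a \<xi>"
    and mult_0_right: "\<lbrakk>0 \<le> s; a \<in> cs_carrier A; \<xi> \<in> ps_carrier X s\<rbrakk> \<Longrightarrow>
      ps_mult X s 0 \<xi> a = ps_ract X s \<xi> a"
    and tensor_product: "\<lbrakk>0 < s; 0 < r\<rbrakk> \<Longrightarrow>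
      balanced_tensor_product A (ps_fib X s) (ps_fib X r) (ps_tensor X s r) (ps_tens X s r)"
    and F_iso: "\<lbrakk>0 < s; 0 < r\<rbrakk> \<Longrightarrow>
      bimodule_iso A (ps_tensor X s r) (ps_fib X (s + r)) (ps_F X s r)"
    and F_tens: "\<lbrakk>0 < s; 0 < r; \<xi> \<in> ps_carrier X s; \<eta> \<in> ps_carrier X r\<rbrakk> \<Longrightarrow>
      ps_F X s r (ps_tens X s r \<xi> \<eta>) = ps_mult X s r \<xi> \<eta>"

text \<open>On elementary tensors the identity
  \<open>F\<^sup>s\<^sup>r\<^sup>,\<^sup>q (F\<^sup>s\<^sup>,\<^sup>r \<otimes> I) = F\<^sup>s\<^sup>,\<^sup>r\<^sup>q (I \<otimes> F\<^sup>r\<^sup>,\<^sup>q)\<close> reads \<open>(\<xi>\<eta>)\<zeta> = \<xi>(\<eta>\<zeta>)\<close>, which is also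
  the associative law of the semigroup \<open>X\<close>.\<close>

definition associative_ps :: "('g::lattice_ab_group_add, 'u, 't) prod_sys \<Rightarrow> bool"
  where "associative_ps X \<longleftrightarrow>
    (\<forall>s\<ge>0. \<forall>r\<ge>0. \<forall>q\<ge>0.
       \<forall>\<xi>\<in>ps_carrier X s. \<forall>\<eta>\<in>ps_carrier X r. \<forall>\<zeta>\<in>ps_carrier X q.
         ps_mult X (s + r) q (ps_mult X s r \<xi> \<eta>) \<zeta> = ps_mult X s (r + q) \<xi> (ps_mult X r q \<eta> \<zeta>))"

text \<open>The map \<open>i\<^sub>s\<^sup>p\<close> for \<open>s \<le> p\<close>. For \<open>s = e\<close> an operator \<open>S\<close> on \<open>A\<^sub>A\<close> is identified with
  the element \<open>S 1\<close> of \<open>A\<close>.\<close>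

definition ps_incl ::
  "'u cstar \<Rightarrow> ('g::lattice_ab_group_add, 'u::complex_vector, 't::complex_vector) prod_sys \<Rightarrow>
    'g \<Rightarrow> 'g \<Rightarrow> ('u \<Rightarrow> 'u) \<Rightarrow> 'u \<Rightarrow> 'u"
  where "ps_incl A X s p S =
    (if s = 0 then left_op (ps_fib X p) (S (cs_one A))
     else if p = s then S
     else let r = p - s in
       ps_F X s r \<circ>
       tensor_op (ps_fib X s) (ps_fib X r) (ps_tensor X s r) (ps_tens X s r) S \<circ>
       hm_adjoint (ps_tensor X s r) (ps_fib X p) (ps_F X s r))"

text \<open>Product systems of finite type: \<open>n s\<close> is \<open>N\<^sub>s\<close>, \<open>b s j\<close> is \<open>1\<^sup>s\<^sub>j\<close>.\<close>

locale finite_type_system = product_system A X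
  for A :: "'u::complex_vector cstar"
    and X :: "('g::lattice_ab_group_add, 'u, 't::complex_vector) prod_sys" +
  fixes n :: "'g \<Rightarrow> nat" and b :: "'g \<Rightarrow> nat \<Rightarrow> 'u" and m :: "'g \<Rightarrow> 'g \<Rightarrow> nat \<times> nat \<Rightarrow> nat"
  assumes n_pos: "0 \<le> s \<Longrightarrow> 1 \<le> n s"
    and b_carrier: "\<lbrakk>0 \<le> s; j < n s\<rbrakk> \<Longrightarrow> b s j \<in> ps_carrier X s"
    and left_generating: "0 \<le> s \<Longrightarrow>
      ps_carrier X s = {\<Sum>j<n s. ps_lact X s (a j) (b s j) |a. \<forall>j<n s. a j \<in> cs_carrier A}"
    and right_generating: "0 \<le> s \<Longrightarrow>
      ps_carrier X s = {\<Sum>j<n s. ps_ract X s (b s j) (a j) |a. \<forall>j<n s. a j \<in> cs_carrier A}"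
    and orthonormal: "\<lbrakk>0 \<le> s; j < n s; k < n s\<rbrakk> \<Longrightarrow>
      ps_inner X s (b s j) (b s k) = (if j = k then cs_one A else 0)"
    and m_range: "\<lbrakk>0 \<le> s; 0 \<le> r; j < n s; k < n r\<rbrakk> \<Longrightarrow> m s r (j, k) < n (s + r)"
    and b_mult: "\<lbrakk>0 \<le> s; 0 \<le> r; j < n s; k < n r\<rbrakk> \<Longrightarrow>
      ps_mult X s r (b s j) (b r k) = b (s + r) (m s r (j, k))"

definition bijective_maps ::
  "('g::lattice_ab_group_add \<Rightarrow> nat) \<Rightarrow> ('g \<Rightarrow> 'g \<Rightarrow> nat \<times> nat \<Rightarrow> nat) \<Rightarrow> bool"
  where "bijective_maps n m \<longleftrightarrow>
    (\<forall>s\<ge>0. \<forall>r\<ge>0. bij_betw (m s r) ({..<n s} \<times> {..<n r}) {..<n (s + r)})"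

definition respects_coprime_pairs ::
  "('g::lattice_ab_group_add \<Rightarrow> nat) \<Rightarrow> ('g \<Rightarrow> 'g \<Rightarrow> nat \<times> nat \<Rightarrow> nat) \<Rightarrow> bool"
  where "respects_coprime_pairs n m \<longleftrightarrow>
    (\<forall>s\<ge>0. \<forall>r\<ge>0. inf s r = 0 \<longrightarrow>
      (\<forall>j<n s. \<forall>g<n s. \<forall>h<n s. \<forall>l<n r. \<forall>k<n r. \<forall>k'<n r.
         m s r (j, k) = m r s (l, g) \<and> m s r (j, k') = m r s (l, h) \<longrightarrow> k = k' \<and> g = h))"


section \<open>Nica covariant Toeplitz representations\<close>

locale toeplitz_representation = product_system A X + C: cstar_algebra C
  for A :: "'u::complex_vector cstar"
    and X :: "('g::lattice_ab_group_add, 'u, 't::complex_vector) prod_sys"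
    and C :: "'c::complex_vector cstar" +
  fixes \<psi> :: "'g \<Rightarrow> 'u \<Rightarrow> 'c"
  assumes rep_closed: "\<lbrakk>0 \<le> s; \<xi> \<in> ps_carrier X s\<rbrakk> \<Longrightarrow> \<psi> s \<xi> \<in> cs_carrier C"
    and rep_linear: "0 \<le> s \<Longrightarrow> clinear_on (ps_carrier X s) (\<psi> s)"
    and rep_hom: "star_hom A C (\<psi> 0)"
    and rep_mult: "\<lbrakk>0 \<le> s; 0 \<le> r; \<xi> \<in> ps_carrier X s; \<eta> \<in> ps_carrier X r\<rbrakk> \<Longrightarrow>
      cs_mult C (\<psi> s \<xi>) (\<psi> r \<eta>) = \<psi> (s + r) (ps_mult X s r \<xi> \<eta>)"
    and rep_inner: "\<lbrakk>0 \<le> s; \<xi> \<in> ps_carrier X s; \<eta> \<in> ps_carrier X s\<rbrakk> \<Longrightarrow>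
      cs_mult C (cs_star C (\<psi> s \<xi>)) (\<psi> s \<eta>) = \<psi> 0 (ps_inner X s \<xi> \<eta>)"

text \<open>The induced homomorphism \<open>\<psi>\<^sup>(\<^sup>s\<^sup>)\<close>; its values on \<open>\<K>(X\<^sub>s)\<close> are uniquely determined.\<close>

definition induced_hom ::
  "'u cstar \<Rightarrow> ('g, 'u::complex_vector, 't) prod_sys \<Rightarrow> 'c::complex_vector cstar \<Rightarrow>
    ('g \<Rightarrow> 'u \<Rightarrow> 'c) \<Rightarrow> 'g \<Rightarrow> ('u \<Rightarrow> 'u) \<Rightarrow> 'c"
  where "induced_hom A X C \<psi> s =
    (SOME \<kappa>. star_hom (compact_alg A (ps_fib X s)) C \<kappa> \<and>
       (\<forall>\<xi>\<in>ps_carrier X s. \<forall>\<eta>\<in>ps_carrier X s.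
          \<kappa> (rank_one (ps_fib X s) \<xi> \<eta>) = cs_mult C (\<psi> s \<xi>) (cs_star C (\<psi> s \<eta>))))"

locale nica_representation = toeplitz_representation +
  assumes nica_covariant:
    "\<lbrakk>0 \<le> s; 0 \<le> r; S \<in> compacts A (ps_fib X s); T \<in> compacts A (ps_fib X r)\<rbrakk> \<Longrightarrow>
      cs_mult C (induced_hom A X C \<psi> s S) (induced_hom A X C \<psi> r T) =
      induced_hom A X C \<psi> (sup s r) (ps_incl A X s (sup s r) S \<circ> ps_incl A X r (sup s r) T)"

text \<open>A type to carry test objects for the universal property. A representation \<open>\<psi>\<close> takes values
  in the C*-subalgebra generated by its range, each element of which is the limit of a sequence of
  finite sums of words in the elements \<open>\<psi>\<^sub>s(\<xi>)\<close> and \<open>\<psi>\<^sub>s(\<xi>)\<^sup>*\<close>. Its cardinality, hence its linear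
  dimension, is at most that of \<open>nat \<Rightarrow> (bool \<times> 'g \<times> 'u) list list\<close>, so it is isomorphic to a
  C*-algebra carried by a subspace of the following type. Quantifying over C*-algebras carried by
  that type therefore amounts to quantifying over all C*-algebras.\<close>

type_synonym ('g, 'u) nt_universe = "(nat \<Rightarrow> (bool \<times> 'g \<times> 'u) list list) \<Rightarrow> complex"

text \<open>\<open>(C, \<iota>)\<close> is the Nica--Toeplitz algebra \<open>\<N>\<T>(X)\<close> with its universal representation. Uniqueness
  of the homomorphism in \<open>universal\<close> follows from \<open>generated\<close>.\<close>

locale nica_toeplitz_algebra = nica_representation A X C \<iota>
  for A :: "'u::complex_vector cstar"
    and X :: "('g::lattice_ab_group_add, 'u, 't::complex_vector) prod_sys"
    and C :: "'c::complex_vector cstar" and \<iota> :: "'g \<Rightarrow> 'u \<Rightarrow> 'c" +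
  assumes generated: "\<lbrakk>cstar_subalgebra C B; \<And>s \<xi>. \<lbrakk>0 \<le> s; \<xi> \<in> ps_carrier X s\<rbrakk> \<Longrightarrow> \<iota> s \<xi> \<in> B\<rbrakk> \<Longrightarrow>
      B = cs_carrier C"
    and universal: "nica_representation A X (D :: ('g, 'u) nt_universe cstar) \<psi> \<Longrightarrow>
      \<exists>\<pi>. star_hom C D \<pi> \<and> (\<forall>s\<ge>0. \<forall>\<xi>\<in>ps_carrier X s. \<pi> (\<iota> s \<xi>) = \<psi> s \<xi>)"

definition nt_core ::
  "'u cstar \<Rightarrow> ('g::lattice_ab_group_add, 'u::complex_vector, 't) prod_sys \<Rightarrow>
    'c::complex_vector cstar \<Rightarrow> ('g \<Rightarrow> 'u \<Rightarrow> 'c) \<Rightarrow> 'c set"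
  where "nt_core A X C \<iota> = closure_wrt (cs_norm C) (cs_carrier C)
    (cspan {induced_hom A X C \<iota> s (rank_one (ps_fib X s) \<xi> \<eta>) |s \<xi> \<eta>.
       0 \<le> s \<and> \<xi> \<in> ps_carrier X s \<and> \<eta> \<in> ps_carrier X s})"

definition core_alg ::
  "'u cstar \<Rightarrow> ('g::lattice_ab_group_add, 'u::complex_vector, 't) prod_sys \<Rightarrow>
    'c::complex_vector cstar \<Rightarrow> ('g \<Rightarrow> 'u \<Rightarrow> 'c) \<Rightarrow> 'c cstar"
  where "core_alg A X C \<iota> = C\<lparr>cs_carrier := nt_core A X C \<iota>\<rparr>"

text \<open>The expectation \<open>\<Phi>\<^sup>\<delta>\<close>, which is determined by its values on the elements
  \<open>\<iota>\<^sub>s(\<xi>)\<iota>\<^sub>r(\<eta>)\<^sup>*\<close>.\<close>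

definition core_expectation ::
  "'u cstar \<Rightarrow> ('g::lattice_ab_group_add, 'u::complex_vector, 't) prod_sys \<Rightarrow>
    'c::complex_vector cstar \<Rightarrow> ('g \<Rightarrow> 'u \<Rightarrow> 'c) \<Rightarrow> ('c \<Rightarrow> 'c) \<Rightarrow> bool"
  where "core_expectation A X C \<iota> \<Phi> \<longleftrightarrow>
    conditional_expectation C (nt_core A X C \<iota>) \<Phi> \<and>
    (\<forall>s\<ge>0. \<forall>r\<ge>0. \<forall>\<xi>\<in>ps_carrier X s. \<forall>\<eta>\<in>ps_carrier X r.
       \<Phi> (cs_mult C (\<iota> s \<xi>) (cs_star C (\<iota> r \<eta>))) =
       (if s = r then cs_mult C (\<iota> s \<xi>) (cs_star C (\<iota> r \<eta>)) else 0))"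

text \<open>The dynamics \<open>\<sigma>\<^sup>N\<close>, determined by its values on the generators.\<close>

definition nt_dynamics ::
  "'u cstar \<Rightarrow> ('g::lattice_ab_group_add, 'u::complex_vector, 't) prod_sys \<Rightarrow>
    'c::complex_vector cstar \<Rightarrow> ('g \<Rightarrow> 'u \<Rightarrow> 'c) \<Rightarrow> ('g \<Rightarrow> real) \<Rightarrow> (real \<Rightarrow> 'c \<Rightarrow> 'c) \<Rightarrow> bool"
  where "nt_dynamics A X C \<iota> N \<sigma> \<longleftrightarrow> dynamics C \<sigma> \<and>
    (\<forall>t. \<forall>a\<in>cs_carrier A. \<sigma> t (\<iota> 0 a) = \<iota> 0 a) \<and>
    (\<forall>t. \<forall>s\<ge>0. \<forall>\<xi>\<in>ps_carrier X s.
       \<sigma> t (\<iota> s \<xi>) = (complex_of_real (N s) powr (\<i> * complex_of_real t)) *\<^sub>C \<iota> s \<xi>)"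

definition zeta_N :: "('g::lattice_ab_group_add \<Rightarrow> real) \<Rightarrow> ('g \<Rightarrow> nat) \<Rightarrow> real \<Rightarrow> real"
  where "zeta_N N n \<beta> = (\<Sum>\<^sub>\<infinity>s\<in>{s. 0 \<le> s}. N s powr - \<beta> * real (n s))"

text \<open>The \<open>s\<close>-th term of the series for \<open>\<omega>\<^sub>\<tau>(i\<^sup>(\<^sup>r\<^sup>)(\<theta>\<^sub>\<xi>\<^sub>,\<^sub>\<eta>))\<close>, where \<open>p = r\<^sup>-\<^sup>1s\<close>, \<open>j\<^sub>r = j(r)\<close>
  and \<open>j' = j(r\<^sup>-\<^sup>1s)\<close>.\<close>

definition omega_term ::
  "('g::lattice_ab_group_add, 'u, 't) prod_sys \<Rightarrow> ('g \<Rightarrow> nat) \<Rightarrow> ('g \<Rightarrow> nat \<Rightarrow> 'u) \<Rightarrow>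
    ('g \<Rightarrow> 'g \<Rightarrow> nat \<times> nat \<Rightarrow> nat) \<Rightarrow> ('g \<Rightarrow> real) \<Rightarrow> real \<Rightarrow> ('u \<Rightarrow> complex) \<Rightarrow>
    'g \<Rightarrow> 'u \<Rightarrow> 'u \<Rightarrow> 'g \<Rightarrow> complex"
  where "omega_term X n b m N \<beta> \<tau> r \<xi> \<eta> s =
    complex_of_real (N s powr - \<beta> / zeta_N N n \<beta>) *
    (\<Sum>j<n s.
       let p = s - r; (j\<^sub>r, j') = the_inv_into ({..<n r} \<times> {..<n p}) (m r p) j
       in \<tau> (ps_inner X p
              (ps_lact X p (ps_inner X r \<xi> (b r j\<^sub>r)) (b p j'))
              (ps_lact X p (ps_inner X r \<eta> (b r j\<^sub>r)) (b p j'))))"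

definition is_omega ::
  "'u cstar \<Rightarrow> ('g::lattice_ab_group_add, 'u::complex_vector, 't) prod_sys \<Rightarrow> ('g \<Rightarrow> nat) \<Rightarrow>
    ('g \<Rightarrow> nat \<Rightarrow> 'u) \<Rightarrow> ('g \<Rightarrow> 'g \<Rightarrow> nat \<times> nat \<Rightarrow> nat) \<Rightarrow> ('g \<Rightarrow> real) \<Rightarrow> real \<Rightarrow>
    'c::complex_vector cstar \<Rightarrow> ('g \<Rightarrow> 'u \<Rightarrow> 'c) \<Rightarrow> ('u \<Rightarrow> complex) \<Rightarrow> ('c \<Rightarrow> complex) \<Rightarrow> bool"
  where "is_omega A X n b m N \<beta> C \<iota> \<tau> \<omega> \<longleftrightarrow>
    \<omega> \<in> states (core_alg A X C \<iota>) \<and>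
    (\<forall>r\<ge>0. \<forall>\<xi>\<in>ps_carrier X r. \<forall>\<eta>\<in>ps_carrier X r.
       (omega_term X n b m N \<beta> \<tau> r \<xi> \<eta> has_sum
        \<omega> (induced_hom A X C \<iota> r (rank_one (ps_fib X r) \<xi> \<eta>))) {s. r \<le> s})"

end

theory Submission
  imports Defs "HOL-Complex_Analysis.Complex_Analysis"
begin

text \<open>The representation of \<open>X\<close> on the Fock module \<open>\<Oplus>\<^sub>s X\<^sub>s\<close> by left multiplication is Nica covariant.
  Pairing with a trace \<open>\<tau>\<close> turns the algebraic direct sum into a semi-inner product space, and the
  bounded operators on it become a C*-algebra of sesquilinear forms, small enough to be a test object
  for \<open>\<N>\<T>(X)\<close>. So each \<open>c\<close> in \<open>\<N>\<T>(X)\<close> has a matrix over \<open>A\<close> indexed by the \<open>1\<^sup>s\<^sub>j\<close>, seen through \<open>\<tau>\<close>,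
  and the sum of the diagonal entries at \<open>(s, j)\<close> with weights \<open>N(s)\<^sup>-\<^sup>\<beta> / \<zeta>\<^sub>N(\<beta>)\<close> is a state. It vanishes on
  \<open>\<iota>\<^sub>s(\<xi>)\<iota>\<^sub>r(\<eta>)\<^sup>*\<close> for \<open>s \<noteq> r\<close> and is the series of the theorem for \<open>s = r\<close>, hence equals
  \<open>\<omega>\<^sub>\<tau> \<circ> \<Phi>\<^sup>\<delta>\<close>. The dynamics multiplies the block \<open>(p, q)\<close> of a matrix by \<open>(N(p) / N(q))\<^sup>i\<^sup>t\<close>, by analytic
  continuation also for complex \<open>t\<close>, so the KMS condition becomes the trace property of \<open>\<tau>\<close> applied to
  each pair of blocks. Continuity in \<open>\<tau>\<close> holds because the series converges uniformly in \<open>\<tau>\<close>.\<close>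

section \<open>Linear maps and sesquilinear forms\<close>

text \<open>The universal property can only be tested on algebras carried by
  \<open>nt_universe\<close>, whose elements are scalar functions of sequences of finite lists. This
  dictates the model: Fock vectors have finite support, so that a list codes one, and an operator is
  recorded by the scalar form \<open>ip x (T y)\<close>, a function of two coded vectors. Null
  vectors are never divided out and the space is never completed; completeness is obtained on the
  side of the forms, as the norm closure of the forms of adjointable operators, at the price that
  the product must be defined by a limit. The main analytic input is that \<open>1 - h\<close> is a
  square when \<open>h\<close> is self-adjoint of norm less than one: it bounds positive
  functionals, and through them creation operators and star homomorphisms. The finite orthonormal
  bases and the bijections \<open>m\<close> keep the rest algebraic: products span
  \<open>X (s + r)\<close> without closure, adjointable operators are finite sums of rank one
  operators, and the trace over a fibre is a finite sum.\<close>

lemma clinear_on_add: "clinear_on V f \<Longrightarrow> x \<in> V \<Longrightarrow> y \<in> V \<Longrightarrow> f (x + y) = f x + f y"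
  by (simp add: clinear_on_def)

lemma clinear_on_scale: "clinear_on V f \<Longrightarrow> x \<in> V \<Longrightarrow> f (c *\<^sub>C x) = c *\<^sub>C f x"
  by (simp add: clinear_on_def)

lemma scaleC_minus_one: "(- 1) *\<^sub>C x = - (x :: 'a::complex_vector)"
  by (metis complex_vector.scale_minus_left scaleC_one)

lemma clinear_on_zero: "clinear_on V f \<Longrightarrow> csubspace V \<Longrightarrow> f 0 = 0"
  by (metis clinear_on_scale complex_vector.scale_zero_left complex_vector.subspace_0)

lemma clinear_on_minus: "clinear_on V f \<Longrightarrow> x \<in> V \<Longrightarrow> f (- x) = - f x"
  by (metis clinear_on_scale scaleC_minus_one)

lemma clinear_on_diff:
  "clinear_on V f \<Longrightarrow> csubspace V \<Longrightarrow> x \<in> V \<Longrightarrow> y \<in> V \<Longrightarrow> f (x - y) = f x - f y"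
  using clinear_on_add[of V f x "- y"] clinear_on_minus[of V f y] complex_vector.subspace_neg[of V y]
  by simp

lemma clinear_on_sum:
  assumes "clinear_on V f" "csubspace V" "\<And>i. i \<in> I \<Longrightarrow> x i \<in> V"
  shows "f (\<Sum>i\<in>I. x i) = (\<Sum>i\<in>I. f (x i))"
  using assms(3)
proof (induction I rule: infinite_finite_induct)
  case (insert i I)
  have "(\<Sum>i\<in>I. x i) \<in> V"
    by (rule complex_vector.subspace_sum[OF assms(2)]) (use insert in auto)
  then show ?case using insert by (simp add: clinear_on_add[OF assms(1)])
qed (simp_all add: clinear_on_zero[OF assms(1,2)])

lemma clinear_on_subset: "clinear_on V f \<Longrightarrow> W \<subseteq> V \<Longrightarrow> clinear_on W f"
  unfolding clinear_on_def by blast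

lemma clinear_on_eq_span:
  assumes f: "clinear_on V f" and g: "clinear_on V g" and V: "csubspace V" and S: "S \<subseteq> V"
    and eq: "\<And>x. x \<in> S \<Longrightarrow> f x = g x" and x: "x \<in> cspan S"
  shows "f x = g x"
proof -
  have "csubspace {x \<in> V. f x = g x}"
    using complex_vector.subspace_0[OF V] complex_vector.subspace_add[OF V]
      complex_vector.subspace_scale[OF V]
    by (auto simp: complex_vector.subspace_def clinear_on_zero[OF f V] clinear_on_zero[OF g V]
        clinear_on_add[OF f] clinear_on_add[OF g] clinear_on_scale[OF f] clinear_on_scale[OF g])
  then have "cspan S \<subseteq> {x \<in> V. f x = g x}"
    by (intro complex_vector.span_minimal) (use S eq in auto)
  then show ?thesis using x by auto
qed

text \<open>Neither definiteness nor completeness is asked for, so that the pairing of a Hilbert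
  module with a state qualifies. Besides the Fock space, the locale serves for the GNS pairing of a
  positive functional and for the positive form \<open>\<rho> h\<close> in
  \<open>star_hom_contractive\<close>.\<close>

locale form_space =
  fixes V :: "'v::complex_vector set" and ip :: "'v \<Rightarrow> 'v \<Rightarrow> complex"
  assumes subspace_V: "csubspace V"
    and ip_linear: "x \<in> V \<Longrightarrow> clinear_on V (ip x)"
    and ip_add_left: "\<lbrakk>x \<in> V; y \<in> V; z \<in> V\<rbrakk> \<Longrightarrow> ip (x + y) z = ip x z + ip y z"
    and ip_scale_left: "\<lbrakk>x \<in> V; z \<in> V\<rbrakk> \<Longrightarrow> ip (c *\<^sub>C x) z = cnj c * ip x z"
    and ip_pos: "x \<in> V \<Longrightarrow> ip x x \<in> \<real>\<^sub>\<ge>\<^sub>0"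
begin

lemma V_zero [simp]: "0 \<in> V" by (rule complex_vector.subspace_0[OF subspace_V])
lemma V_add [simp]: "x \<in> V \<Longrightarrow> y \<in> V \<Longrightarrow> x + y \<in> V" by (rule complex_vector.subspace_add[OF subspace_V])
lemma V_diff [simp]: "x \<in> V \<Longrightarrow> y \<in> V \<Longrightarrow> x - y \<in> V" by (rule complex_vector.subspace_diff[OF subspace_V])
lemma V_scale [simp]: "x \<in> V \<Longrightarrow> c *\<^sub>C x \<in> V" by (rule complex_vector.subspace_scale[OF subspace_V])

lemma ip_add_right: "\<lbrakk>x \<in> V; y \<in> V; z \<in> V\<rbrakk> \<Longrightarrow> ip x (y + z) = ip x y + ip x z"
  using clinear_on_add[OF ip_linear] by blast

lemma ip_scale_right: "\<lbrakk>x \<in> V; y \<in> V\<rbrakk> \<Longrightarrow> ip x (c *\<^sub>C y) = c * ip x y"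
  using clinear_on_scale[OF ip_linear] by (simp add: scaleC_complex_def)

lemma ip_diff_right: "\<lbrakk>x \<in> V; y \<in> V; z \<in> V\<rbrakk> \<Longrightarrow> ip x (y - z) = ip x y - ip x z"
  using clinear_on_diff[OF ip_linear subspace_V] by blast

lemma ip_zero [simp]: "x \<in> V \<Longrightarrow> ip x 0 = 0"
  using clinear_on_zero[OF ip_linear subspace_V] .

lemma ip_zero_left [simp]: "z \<in> V \<Longrightarrow> ip 0 z = 0"
  using ip_scale_left[of 0 z 0] by simp

lemma ip_diff_left: "\<lbrakk>x \<in> V; y \<in> V; z \<in> V\<rbrakk> \<Longrightarrow> ip (x - y) z = ip x z - ip y z"
  using ip_add_left[of "x - y" y z] by simp

text \<open>Polarisation: positivity forces the values at \<open>x + y\<close> and at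
  \<open>x + i y\<close> to be real, and these two conditions are the imaginary and the real part of
  the identity.\<close>

lemma ip_hermitian:
  assumes x: "x \<in> V" and y: "y \<in> V"
  shows "ip y x = cnj (ip x y)"
proof -
  have "Im (ip z z) = 0" if "z \<in> V" for z
    using ip_pos[OF that] by (auto simp: nonneg_Reals_def)
  from this[of "x + y"] this[of "x + \<i> *\<^sub>C y"] this[of x] this[of y] x y
  have "Im (ip x y) + Im (ip y x) = 0" "Re (ip x y) - Re (ip y x) = 0"
    by (simp_all add: ip_add_left ip_add_right ip_scale_left ip_scale_right)
  then show ?thesis by (simp add: complex_eq_iff)
qed

definition nrm :: "'v \<Rightarrow> real" where "nrm x = sqrt (Re (ip x x))"

lemma Re_ip_nonneg: "x \<in> V \<Longrightarrow> 0 \<le> Re (ip x x)"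
  using ip_pos[of x] by (auto simp: nonneg_Reals_def)

lemma nrm_nonneg [simp]: "x \<in> V \<Longrightarrow> 0 \<le> nrm x"
  by (simp add: nrm_def Re_ip_nonneg)

lemma ip_self: "x \<in> V \<Longrightarrow> ip x x = complex_of_real ((nrm x)\<^sup>2)"
  using ip_pos[of x] Re_ip_nonneg[of x]
  by (auto simp: nrm_def complex_eq_iff nonneg_Reals_def)

lemma nrm_sq: "x \<in> V \<Longrightarrow> (nrm x)\<^sup>2 = Re (ip x x)"
  by (simp add: nrm_def Re_ip_nonneg)

lemma cauchy_schwarz:
  assumes x: "x \<in> V" and y: "y \<in> V"
  shows "cmod (ip x y) \<le> nrm x * nrm y"
proof -
  define a b z where "a = Re (ip x x)" and "b = Re (ip y y)" and "z = ip x y"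
  have a0: "0 \<le> a" and b0: "0 \<le> b" using x y by (simp_all add: a_def b_def Re_ip_nonneg)
  \<comment> \<open>Positivity at \<open>x - t (cnj z) y\<close>; the factor \<open>cnj z\<close>
    makes the mixed terms real, which leaves a real quadratic in \<open>t\<close>. It is minimal at
    \<open>t = 1 / b\<close>. For a null vector \<open>y\<close> it is linear in \<open>t\<close>
    and becomes negative for large \<open>t\<close>.\<close>
  have key: "0 \<le> a - 2 * t * (cmod z)\<^sup>2 + t\<^sup>2 * (cmod z)\<^sup>2 * b" for t :: real
  proof -
    define c where "c = complex_of_real t * cnj z"
    have "0 \<le> Re (ip (x - c *\<^sub>C y) (x - c *\<^sub>C y))" using x y by (simp add: Re_ip_nonneg)
    also have "ip (x - c *\<^sub>C y) (x - c *\<^sub>C y)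
        = ip x x - c * z - cnj c * cnj z + cnj c * c * ip y y"
      using x y by (simp add: ip_diff_left ip_diff_right ip_scale_left ip_scale_right
          ip_hermitian[of x y] z_def algebra_simps)
    also have "c * z = complex_of_real (t * (cmod z)\<^sup>2)"
      unfolding c_def of_real_mult complex_norm_square by (simp add: algebra_simps)
    also have "cnj c * cnj z = complex_of_real (t * (cmod z)\<^sup>2)"
      unfolding c_def of_real_mult complex_norm_square by (simp add: algebra_simps)
    also have "cnj c * c = complex_of_real (t\<^sup>2 * (cmod z)\<^sup>2)"
      unfolding c_def of_real_mult complex_norm_square by (simp add: algebra_simps power2_eq_square)
    finally show ?thesis by (simp add: a_def b_def)
  qed
  have "(cmod z)\<^sup>2 \<le> a * b"
  proof (cases "b = 0")
    case True
    have "(cmod z)\<^sup>2 = 0"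
    proof (rule ccontr)
      assume "(cmod z)\<^sup>2 \<noteq> 0"
      then have z0: "0 < (cmod z)\<^sup>2" by simp
      have "0 \<le> a * (cmod z)\<^sup>2" using a0 by simp
      then show False using key[of "(a + 1) / (cmod z)\<^sup>2"] True z0 a0
        by (simp add: divide_simps)
    qed
    then show ?thesis using True by simp
  next
    case False
    then show ?thesis using key[of "1 / b"] b0 by (simp add: field_simps power2_eq_square)
  qed
  then have "sqrt ((cmod z)\<^sup>2) \<le> sqrt (a * b)" by (rule real_sqrt_le_mono)
  then show ?thesis by (simp add: z_def a_def b_def nrm_def real_sqrt_mult)
qed

lemma nrm_scale: "x \<in> V \<Longrightarrow> nrm (c *\<^sub>C x) = cmod c * nrm x"
proof -
  assume x: "x \<in> V"
  have "ip (c *\<^sub>C x) (c *\<^sub>C x) = complex_of_real ((cmod c)\<^sup>2) * ip x x"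
    using x by (simp add: ip_scale_left ip_scale_right complex_norm_square algebra_simps
        flip: of_real_power)
  then show ?thesis by (simp add: nrm_def real_sqrt_mult)
qed

end


section \<open>C*-algebras\<close>

context cstar_algebra
begin

lemma zero_closed [simp]: "0 \<in> cs_carrier A"
  by (rule complex_vector.subspace_0[OF subspace])
lemma add_closed [simp]: "x \<in> cs_carrier A \<Longrightarrow> y \<in> cs_carrier A \<Longrightarrow> x + y \<in> cs_carrier A"
  by (rule complex_vector.subspace_add[OF subspace])
lemma diff_closed [simp]: "x \<in> cs_carrier A \<Longrightarrow> y \<in> cs_carrier A \<Longrightarrow> x - y \<in> cs_carrier A"
  by (rule complex_vector.subspace_diff[OF subspace])
lemma uminus_closed [simp]: "x \<in> cs_carrier A \<Longrightarrow> - x \<in> cs_carrier A"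
  by (rule complex_vector.subspace_neg[OF subspace])
lemma scale_closed [simp]: "x \<in> cs_carrier A \<Longrightarrow> c *\<^sub>C x \<in> cs_carrier A"
  by (rule complex_vector.subspace_scale[OF subspace])
lemma sum_closed: "(\<And>i. i \<in> I \<Longrightarrow> x i \<in> cs_carrier A) \<Longrightarrow> (\<Sum>i\<in>I. x i) \<in> cs_carrier A"
  by (rule complex_vector.subspace_sum[OF subspace])

declare mult_closed [simp] star_closed [simp] norm_nonneg [simp] star_star [simp]

lemma add_mult: "\<lbrakk>x \<in> cs_carrier A; y \<in> cs_carrier A; z \<in> cs_carrier A\<rbrakk> \<Longrightarrow>
    cs_mult A (x + y) z = cs_mult A x z + cs_mult A y z"
  using clinear_on_add[OF mult_linear_left] by blast
lemma diff_mult: "\<lbrakk>x \<in> cs_carrier A; y \<in> cs_carrier A; z \<in> cs_carrier A\<rbrakk> \<Longrightarrow>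
    cs_mult A (x - y) z = cs_mult A x z - cs_mult A y z"
  using clinear_on_diff[OF mult_linear_left subspace] by blast
lemma scale_mult: "\<lbrakk>x \<in> cs_carrier A; z \<in> cs_carrier A\<rbrakk> \<Longrightarrow>
    cs_mult A (c *\<^sub>C x) z = c *\<^sub>C cs_mult A x z"
  using clinear_on_scale[OF mult_linear_left] by blast
lemma mult_add: "\<lbrakk>x \<in> cs_carrier A; y \<in> cs_carrier A; z \<in> cs_carrier A\<rbrakk> \<Longrightarrow>
    cs_mult A z (x + y) = cs_mult A z x + cs_mult A z y"
  using clinear_on_add[OF mult_linear_right] by blast
lemma mult_diff: "\<lbrakk>x \<in> cs_carrier A; y \<in> cs_carrier A; z \<in> cs_carrier A\<rbrakk> \<Longrightarrow>
    cs_mult A z (x - y) = cs_mult A z x - cs_mult A z y"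
  using clinear_on_diff[OF mult_linear_right subspace] by blast
lemma mult_scale: "\<lbrakk>x \<in> cs_carrier A; z \<in> cs_carrier A\<rbrakk> \<Longrightarrow>
    cs_mult A z (c *\<^sub>C x) = c *\<^sub>C cs_mult A z x"
  using clinear_on_scale[OF mult_linear_right] by blast
lemma mult_zero [simp]: "x \<in> cs_carrier A \<Longrightarrow> cs_mult A x 0 = 0"
  using clinear_on_zero[OF mult_linear_right subspace] .
lemma zero_mult [simp]: "x \<in> cs_carrier A \<Longrightarrow> cs_mult A 0 x = 0"
  using clinear_on_zero[OF mult_linear_left subspace] .
lemma mult_sum: "\<lbrakk>\<And>i. i \<in> I \<Longrightarrow> x i \<in> cs_carrier A; z \<in> cs_carrier A\<rbrakk> \<Longrightarrow>
    cs_mult A z (\<Sum>i\<in>I. x i) = (\<Sum>i\<in>I. cs_mult A z (x i))"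
  using clinear_on_sum[OF mult_linear_right subspace] by blast
lemma sum_mult: "\<lbrakk>\<And>i. i \<in> I \<Longrightarrow> x i \<in> cs_carrier A; z \<in> cs_carrier A\<rbrakk> \<Longrightarrow>
    cs_mult A (\<Sum>i\<in>I. x i) z = (\<Sum>i\<in>I. cs_mult A (x i) z)"
  using clinear_on_sum[OF mult_linear_left subspace] by blast

lemma star_zero [simp]: "cs_star A 0 = 0"
  using star_scale[of 0 0] by simp
lemma star_minus: "x \<in> cs_carrier A \<Longrightarrow> cs_star A (- x) = - cs_star A x"
  using star_scale[of x "- 1"] by (simp add: scaleC_minus_one)
lemma star_diff: "x \<in> cs_carrier A \<Longrightarrow> y \<in> cs_carrier A \<Longrightarrow> cs_star A (x - y) = cs_star A x - cs_star A y"
  using star_add[of x "- y"] by (simp add: star_minus)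
lemma star_sum: "(\<And>i. i \<in> I \<Longrightarrow> x i \<in> cs_carrier A) \<Longrightarrow> cs_star A (\<Sum>i\<in>I. x i) = (\<Sum>i\<in>I. cs_star A (x i))"
  by (induction I rule: infinite_finite_induct) (simp_all add: star_add sum_closed)

lemma norm_zero [simp]: "cs_norm A 0 = 0"
  using norm_eq_0[of 0] by simp
lemma norm_minus: "x \<in> cs_carrier A \<Longrightarrow> cs_norm A (- x) = cs_norm A x"
  using norm_scale[of x "- 1"] by (simp add: scaleC_minus_one)
lemma norm_minus_commute: "x \<in> cs_carrier A \<Longrightarrow> y \<in> cs_carrier A \<Longrightarrow> cs_norm A (x - y) = cs_norm A (y - x)"
  using norm_minus[of "x - y"] by simp
lemma norm_diff_triangle: "x \<in> cs_carrier A \<Longrightarrow> y \<in> cs_carrier A \<Longrightarrow> z \<in> cs_carrier A \<Longrightarrow>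
    cs_norm A (x - z) \<le> cs_norm A (x - y) + cs_norm A (y - z)"
  using norm_triangle[of "x - y" "y - z"] by simp

text \<open>The C*-identity and submultiplicativity give \<open>norm y <= norm (star y)\<close> for
  every \<open>y\<close>; applied to \<open>star x\<close> as well, this is an equality.\<close>

lemma norm_star [simp]: "x \<in> cs_carrier A \<Longrightarrow> cs_norm A (cs_star A x) = cs_norm A x"
proof -
  have *: "cs_norm A y \<le> cs_norm A (cs_star A y)" if y: "y \<in> cs_carrier A" for y
  proof (cases "cs_norm A y = 0")
    case False
    have "(cs_norm A y)\<^sup>2 \<le> cs_norm A (cs_star A y) * cs_norm A y"
      using cstar_identity[OF y] norm_mult[of "cs_star A y" y] y by simp
    then show ?thesis using False norm_nonneg[OF y] by (simp add: power2_eq_square mult_le_cancel_right)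
  qed (use y in simp)
  assume "x \<in> cs_carrier A"
  then show ?thesis using *[of x] *[of "cs_star A x"] by simp
qed

lemma limit_unique:
  assumes "x \<in> cs_carrier A" "y \<in> cs_carrier A" "\<And>k. a k \<in> cs_carrier A"
    "(\<lambda>k. cs_norm A (a k - x)) \<longlonglongrightarrow> 0" "(\<lambda>k. cs_norm A (a k - y)) \<longlonglongrightarrow> 0"
  shows "x = y"
proof -
  have "(\<lambda>k. cs_norm A (a k - x) + cs_norm A (a k - y)) \<longlonglongrightarrow> 0"
    using tendsto_add[OF assms(4,5)] by simp
  moreover have "cs_norm A (x - y) \<le> cs_norm A (a k - x) + cs_norm A (a k - y)" for k
    using norm_diff_triangle[of x "a k" y] norm_minus_commute[of x "a k"] assms(1-3) by simp
  ultimately have "cs_norm A (x - y) \<le> 0"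
    by (meson LIMSEQ_le_const)
  then have "cs_norm A (x - y) = 0" using norm_nonneg[OF diff_closed[OF assms(1,2)]] by linarith
  then show ?thesis using norm_eq_0[of "x - y"] assms(1,2) by simp
qed

lemma unit_unique: "is_unit A u \<Longrightarrow> is_unit A v \<Longrightarrow> u = v"
  unfolding is_unit_def by metis

lemma cs_one_eq: "is_unit A u \<Longrightarrow> cs_one A = u"
  unfolding cs_one_def using unit_unique by blast

lemma star_unit: "is_unit A u \<Longrightarrow> cs_star A u = u"
  unfolding is_unit_def by (metis star_closed star_mult star_star)

text \<open>The norm of the unit equals its own square. Only an inequality is claimed, because in
  the zero algebra the unit is \<open>0\<close>.\<close>

lemma norm_unit_le: "is_unit A u \<Longrightarrow> cs_norm A u \<le> 1"
proof -
  assume u: "is_unit A u"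
  then have "cs_norm A u = (cs_norm A u)\<^sup>2"
    using cstar_identity[of u] star_unit[OF u] by (simp add: is_unit_def)
  then have "cs_norm A u * (cs_norm A u - 1) = 0" by (simp add: power2_eq_square algebra_simps)
  then show ?thesis by auto
qed

text \<open>The fixed point \<open>y = (h + y\<^sup>2) / 2\<close> of a contraction satisfies \<open>(1 - y)\<^sup>2 = 1 - h\<close>.\<close>

lemma unit_minus_is_square:
  assumes u: "is_unit A u" and h: "h \<in> cs_carrier A" "cs_star A h = h" "cs_norm A h < 1"
  shows "\<exists>y\<in>cs_carrier A. cs_star A y = y \<and> cs_mult A y y = u - h"
proof -
  define r where "r = cs_norm A h"
  have r: "0 \<le> r" "r < 1" using h by (simp_all add: r_def)
  define step where "step y = (1/2) *\<^sub>C (h + cs_mult A y y)" for y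
  define y where "y k = (step ^^ k) 0" for k
  have y_Suc: "y (Suc k) = step (y k)" for k by (simp add: y_def)
  have step_closed: "step x \<in> cs_carrier A" if "x \<in> cs_carrier A" for x
    using that h by (simp add: step_def)
  have yc [simp]: "y k \<in> cs_carrier A" for k
    by (induction k) (simp_all add: y_Suc step_closed, simp add: y_def)
  have ystar: "cs_star A (y k) = y k" for k
  proof (induction k)
    case (Suc k)
    then show ?case using h by (simp add: y_Suc step_def star_scale star_add star_mult)
  qed (simp add: y_def)
  \<comment> \<open>The ball of radius \<open>r\<close> is invariant under \<open>step\<close>, as
    \<open>(r + r * r) / 2 <= r\<close>.\<close>
  have ynorm: "cs_norm A (y k) \<le> r" for k
  proof (induction k)
    case (Suc k)
    have "cs_norm A (h + cs_mult A (y k) (y k)) \<le> r + r * r"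
      using norm_triangle[of h "cs_mult A (y k) (y k)"] norm_mult[of "y k" "y k"] h
        mult_mono[OF Suc Suc] r by (simp add: r_def)
    also have "\<dots> \<le> 2 * r" using r by (simp add: mult_left_le)
    finally show ?case using h by (simp add: y_Suc step_def norm_scale)
  qed (simp add: y_def r)
  \<comment> \<open>The difference of the squares is \<open>x (x - z) + (x - z) z\<close>, so the
    Lipschitz constant of \<open>step\<close> is the mean of the two norms. On the ball of radius
    \<open>r\<close> this is at most \<open>r < 1\<close>, hence the geometric estimate
    \<open>geo\<close>.\<close>
  have step_diff: "cs_norm A (step x - step z) \<le> (cs_norm A x + cs_norm A z) / 2 * cs_norm A (x - z)"
    if [simp]: "x \<in> cs_carrier A" "z \<in> cs_carrier A" for x z
  proof -
    have "step x - step z = (1/2) *\<^sub>C (cs_mult A x x - cs_mult A z z)"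
      by (simp add: step_def flip: complex_vector.scale_right_diff_distrib)
    also have "cs_mult A x x - cs_mult A z z = cs_mult A x (x - z) + cs_mult A (x - z) z"
      by (simp add: mult_diff diff_mult)
    finally have "cs_norm A (step x - step z) = cs_norm A (cs_mult A x (x - z) + cs_mult A (x - z) z) / 2"
      by (simp add: norm_scale)
    also have "\<dots> \<le> (cs_norm A x * cs_norm A (x - z) + cs_norm A (x - z) * cs_norm A z) / 2"
      using norm_triangle[of "cs_mult A x (x - z)" "cs_mult A (x - z) z"]
        norm_mult[of x "x - z"] norm_mult[of "x - z" z] by simp
    finally show ?thesis by (simp add: field_simps)
  qed
  have geo: "cs_norm A (y (k + d) - y k) \<le> r ^ k" for k d
  proof (induction k)
    case 0
    then show ?case using ynorm[of d] r by (simp add: y_def)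
  next
    case (Suc k)
    have "cs_norm A (y (Suc k + d) - y (Suc k)) \<le> (cs_norm A (y (k + d)) + cs_norm A (y k)) / 2 * cs_norm A (y (k + d) - y k)"
      using step_diff[of "y (k + d)" "y k"] by (simp add: y_Suc)
    also have "\<dots> \<le> r * r ^ k"
      using ynorm[of k] ynorm[of "k + d"] Suc r by (intro mult_mono) simp_all
    finally show ?case by simp
  qed
  have "\<exists>K. \<forall>k\<ge>K. \<forall>l\<ge>K. cs_norm A (y k - y l) < \<epsilon>" if "0 < \<epsilon>" for \<epsilon>
  proof -
    have "(\<lambda>k. r ^ k) \<longlonglongrightarrow> 0" using r by (intro LIMSEQ_realpow_zero)
    then have "\<forall>\<^sub>F k in sequentially. r ^ k < \<epsilon> / 2"
      using that by (intro order_tendstoD(2)[of _ 0]) simp_all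
    then obtain K where K: "\<And>k. k \<ge> K \<Longrightarrow> r ^ k < \<epsilon> / 2"
      by (auto simp: eventually_sequentially)
    have "cs_norm A (y k - y l) < \<epsilon>" if "K \<le> k" "K \<le> l" for k l
    proof -
      have "cs_norm A (y k - y K) < \<epsilon> / 2" "cs_norm A (y l - y K) < \<epsilon> / 2"
        using geo[of K "k - K"] geo[of K "l - K"] K[of K] that by simp_all
      then show ?thesis
        using norm_diff_triangle[of "y k" "y K" "y l"] norm_minus_commute[of "y K" "y l"] by simp
    qed
    then show ?thesis by blast
  qed
  then obtain z where z [simp]: "z \<in> cs_carrier A" and lim: "(\<lambda>k. cs_norm A (y k - z)) \<longlonglongrightarrow> 0"
    using complete yc unfolding complete_wrt_def by blast
  have "cs_norm A (y k - cs_star A z) = cs_norm A (y k - z)" for k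
    using norm_star[of "y k - z"] by (simp add: star_diff ystar)
  then have zstar: "cs_star A z = z"
    using limit_unique[of "cs_star A z" z y] lim by simp
  have "cs_norm A (y (Suc k) - step z) \<le> (r + cs_norm A z) / 2 * cs_norm A (y k - z)" for k
    unfolding y_Suc using step_diff[of "y k" z] ynorm[of k] norm_nonneg[of "y k - z"]
    by (smt (verit, best) z yc diff_closed divide_right_mono mult_right_mono norm_nonneg)
  moreover have "(\<lambda>k. (r + cs_norm A z) / 2 * cs_norm A (y k - z)) \<longlonglongrightarrow> 0"
    using tendsto_mult_right_zero[OF lim] by simp
  ultimately have "(\<lambda>k. cs_norm A (y (Suc k) - step z)) \<longlonglongrightarrow> 0"
    using step_closed[OF z]
    by (intro tendsto_sandwich[where f = "\<lambda>_. 0" and g = "\<lambda>k. cs_norm A (y (Suc k) - step z)"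
          and h = "\<lambda>k. (r + cs_norm A z) / 2 * cs_norm A (y k - z)",
          OF always_eventually always_eventually tendsto_const]) simp_all
  then have fix_z: "z = step z"
    using limit_unique[of z "step z" "\<lambda>k. y (Suc k)"] lim step_closed[OF z] LIMSEQ_Suc[OF lim] by simp
  have "z + z = 2 *\<^sub>C z" using scaleC_add_left[of 1 1 z] by (simp add: scaleC_one)
  also have "\<dots> = 2 *\<^sub>C step z" by (rule arg_cong[OF fix_z])
  also have "\<dots> = h + cs_mult A z z" by (simp add: step_def)
  finally have "z + z = h + cs_mult A z z" .
  then have "cs_mult A (u - z) (u - z) = u - h"
    using u by (simp add: mult_diff diff_mult is_unit_def algebra_simps)
  moreover have "cs_star A (u - z) = u - z"
    using u by (simp add: star_diff star_unit[OF u] zstar is_unit_def)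
  ultimately show ?thesis using u by (auto simp: is_unit_def intro!: bexI[of _ "u - z"])
qed

section \<open>Positive functionals, their GNS pairing, and states of a unital C*-algebra\<close>

lemma positive_functional_form_space:
  assumes "clinear_on (cs_carrier A) \<phi>" "\<And>a. a \<in> cs_carrier A \<Longrightarrow> \<phi> (cs_mult A (cs_star A a) a) \<in> \<real>\<^sub>\<ge>\<^sub>0"
  shows "form_space (cs_carrier A) (\<lambda>a b. \<phi> (cs_mult A (cs_star A a) b))"
proof unfold_locales
  fix x assume "x \<in> cs_carrier A"
  then show "clinear_on (cs_carrier A) (\<lambda>b. \<phi> (cs_mult A (cs_star A x) b))"
    unfolding clinear_on_def
    by (simp add: mult_add mult_scale clinear_on_add[OF assms(1)] clinear_on_scale[OF assms(1)])
qed (simp_all add: subspace assms(2) add_mult scale_mult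
      star_add star_scale clinear_on_add[OF assms(1)] clinear_on_scale[OF assms(1)] scaleC_complex_def)

text \<open>If \<open>t\<close> exceeds \<open>(norm x)^2\<close>, then
  \<open>u - star x x / t\<close> is the square of a self-adjoint element, so \<open>\<phi>\<close>
  is nonnegative on it. The strict inequality is what \<open>unit_minus_is_square\<close> demands;
  afterwards \<open>t\<close> decreases to \<open>(norm x)^2\<close>. The second bound is
  Cauchy-Schwarz for the GNS pairing of \<open>u\<close> with \<open>x\<close>.\<close>

lemma positive_functional_le:
  assumes u: "is_unit A u" and lin: "clinear_on (cs_carrier A) \<phi>"
    and pos: "\<And>a. a \<in> cs_carrier A \<Longrightarrow> \<phi> (cs_mult A (cs_star A a) a) \<in> \<real>\<^sub>\<ge>\<^sub>0"
    and x: "x \<in> cs_carrier A"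
  shows "Re (\<phi> (cs_mult A (cs_star A x) x)) \<le> (cs_norm A x)\<^sup>2 * Re (\<phi> u)"
    and "cmod (\<phi> x) \<le> cs_norm A x * Re (\<phi> u)"
    and "\<phi> u \<in> \<real>\<^sub>\<ge>\<^sub>0"
proof -
  interpret F: form_space "cs_carrier A" "\<lambda>a b. \<phi> (cs_mult A (cs_star A a) b)"
    by (rule positive_functional_form_space[OF lin pos])
  have uc [simp]: "u \<in> cs_carrier A" and uu: "cs_mult A (cs_star A u) u = u"
    and ux: "cs_mult A (cs_star A u) x = x" using u x by (auto simp: is_unit_def star_unit[OF u])
  show pu: "\<phi> u \<in> \<real>\<^sub>\<ge>\<^sub>0" using pos[OF uc] uu by simp
  then have ru: "0 \<le> Re (\<phi> u)" by (auto simp: nonneg_Reals_def)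
  define c where "c = cs_mult A (cs_star A x) x"
  have c [simp]: "c \<in> cs_carrier A" "cs_star A c = c" using x by (simp_all add: c_def star_mult)
  have *: "Re (\<phi> c) \<le> t * Re (\<phi> u)" if t: "(cs_norm A x)\<^sup>2 < t" for t
  proof -
    have t0: "0 < t" using t by (smt (verit) zero_le_power2)
    define h where "h = complex_of_real (1 / t) *\<^sub>C c"
    have h: "h \<in> cs_carrier A" "cs_star A h = h" by (simp_all add: h_def star_scale)
    have "cs_norm A h < 1"
      using t t0 x by (simp add: h_def norm_scale c_def cstar_identity norm_divide)
    then obtain y where y: "y \<in> cs_carrier A" "cs_star A y = y" "cs_mult A y y = u - h"
      using unit_minus_is_square[OF u h] by blast
    then have "\<phi> (u - h) \<in> \<real>\<^sub>\<ge>\<^sub>0" using pos[OF y(1)] by simp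
    then have "Re (\<phi> h) \<le> Re (\<phi> u)"
      using h by (auto simp: clinear_on_diff[OF lin subspace] nonneg_Reals_def complex_eq_iff)
    moreover have "\<phi> h = complex_of_real (1 / t) * \<phi> c"
      by (simp add: h_def clinear_on_scale[OF lin] scaleC_complex_def)
    ultimately show ?thesis using t0 by (simp add: field_simps)
  qed
  show 1: "Re (\<phi> (cs_mult A (cs_star A x) x)) \<le> (cs_norm A x)\<^sup>2 * Re (\<phi> u)"
    unfolding c_def[symmetric]
  proof (rule field_le_epsilon)
    fix e :: real assume e: "0 < e"
    define d where "d = e / (Re (\<phi> u) + 1)"
    have "0 < d" using e ru by (simp add: d_def)
    then have "Re (\<phi> c) \<le> ((cs_norm A x)\<^sup>2 + d) * Re (\<phi> u)" by (intro *) simp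
    also have "\<dots> \<le> (cs_norm A x)\<^sup>2 * Re (\<phi> u) + e"
      using e ru by (simp add: d_def field_simps)
    finally show "Re (\<phi> c) \<le> (cs_norm A x)\<^sup>2 * Re (\<phi> u) + e" .
  qed
  have "cmod (\<phi> x) \<le> F.nrm u * F.nrm x" using F.cauchy_schwarz[OF uc x] by (simp add: ux)
  also have "\<dots> \<le> sqrt (Re (\<phi> u)) * sqrt ((cs_norm A x)\<^sup>2 * Re (\<phi> u))"
    using 1 ru by (auto simp: F.nrm_def uu intro!: mult_left_mono real_sqrt_le_mono)
  also have "\<dots> = cs_norm A x * Re (\<phi> u)"
    using x ru by (simp add: real_sqrt_mult)
  finally show "cmod (\<phi> x) \<le> cs_norm A x * Re (\<phi> u)" .
qed

text \<open>Positivity bounds \<open>\<omega> a\<close> by \<open>cs_norm A a\<close> times the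
  value \<open>1\<close> at the unit, and the supremum in \<open>states\<close> is attained at the
  unit, whose norm is at most one.\<close>

lemma stateI:
  assumes u: "is_unit A u" and ext: "\<omega> \<in> extensional (cs_carrier A)"
    and lin: "clinear_on (cs_carrier A) \<omega>"
    and pos: "\<And>a. a \<in> cs_carrier A \<Longrightarrow> \<omega> (cs_mult A (cs_star A a) a) \<in> \<real>\<^sub>\<ge>\<^sub>0"
    and one: "\<omega> u = 1"
  shows "\<omega> \<in> states A"
proof -
  have le: "cmod (\<omega> a) \<le> cs_norm A a" if "a \<in> cs_carrier A" for a
    using positive_functional_le(2)[OF u lin pos that] one by simp
  have "(SUP a\<in>{a \<in> cs_carrier A. cs_norm A a \<le> 1}. cmod (\<omega> a)) = 1"
  proof (rule cSup_eq_maximum)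
    show "1 \<in> (\<lambda>a. cmod (\<omega> a)) ` {a \<in> cs_carrier A. cs_norm A a \<le> 1}"
      using u norm_unit_le[OF u] one by (auto simp: is_unit_def intro!: image_eqI[of _ _ u])
  qed (use le in fastforce)
  then show ?thesis using ext lin pos le by (simp add: states_def)
qed

lemma state_linear: "\<omega> \<in> states A \<Longrightarrow> clinear_on (cs_carrier A) \<omega>"
  and state_pos: "\<omega> \<in> states A \<Longrightarrow> a \<in> cs_carrier A \<Longrightarrow> \<omega> (cs_mult A (cs_star A a) a) \<in> \<real>\<^sub>\<ge>\<^sub>0"
  and state_le: "\<omega> \<in> states A \<Longrightarrow> a \<in> cs_carrier A \<Longrightarrow> cmod (\<omega> a) \<le> cs_norm A a"
  and state_extensional: "\<omega> \<in> states A \<Longrightarrow> \<omega> \<in> extensional (cs_carrier A)"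
  by (simp_all add: states_def)

text \<open>Positivity bounds every \<open>cmod (\<omega> a)\<close> by
  \<open>cs_norm A a * Re (\<omega> u)\<close>, so a supremum of \<open>1\<close> over the unit ball
  forces \<open>Re (\<omega> u) \<ge> 1\<close>; contractivity gives the other inequality.\<close>

lemma state_unit:
  assumes u: "is_unit A u" and \<omega>: "\<omega> \<in> states A"
  shows "\<omega> u = 1"
proof -
  have uc: "u \<in> cs_carrier A" using u by (simp add: is_unit_def)
  have le: "cmod (\<omega> a) \<le> cs_norm A a * Re (\<omega> u)" if "a \<in> cs_carrier A" for a
    using positive_functional_le(2)[OF u state_linear[OF \<omega>] state_pos[OF \<omega>] that] .
  have pu: "\<omega> u \<in> \<real>\<^sub>\<ge>\<^sub>0"
    using positive_functional_le(3)[OF u state_linear[OF \<omega>] state_pos[OF \<omega>] uc] .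
  then have ru: "0 \<le> Re (\<omega> u)" by (auto simp: nonneg_Reals_def)
  have "1 = (SUP a\<in>{a \<in> cs_carrier A. cs_norm A a \<le> 1}. cmod (\<omega> a))"
    using \<omega> by (simp add: states_def)
  also have "\<dots> \<le> Re (\<omega> u)"
  proof (rule cSUP_least)
    show "{a \<in> cs_carrier A. cs_norm A a \<le> 1} \<noteq> {}" using norm_unit_le[OF u] uc by blast
  next
    fix a assume "a \<in> {a \<in> cs_carrier A. cs_norm A a \<le> 1}"
    then show "cmod (\<omega> a) \<le> Re (\<omega> u)"
      using le[of a] ru mult_right_mono[of "cs_norm A a" 1 "Re (\<omega> u)"] by simp
  qed
  finally have "1 \<le> Re (\<omega> u)" .
  moreover have "cmod (\<omega> u) \<le> 1" using state_le[OF \<omega> uc] norm_unit_le[OF u] by simp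
  moreover have "\<omega> u = complex_of_real (Re (\<omega> u))" using pu by (auto simp: nonneg_Reals_def)
  ultimately show ?thesis
    by (smt (verit) complex_Re_le_cmod of_real_1)
qed

text \<open>Agreement on \<open>S\<close> spreads to the span by linearity and to the closure by
  boundedness. Identities between functionals of the Nica-Toeplitz algebra are later checked on
  generators only, through this lemma.\<close>

lemma bounded_linear_eq_closure:
  assumes f: "clinear_on (cs_carrier A) f" "\<And>x. x \<in> cs_carrier A \<Longrightarrow> cmod (f x) \<le> K * cs_norm A x"
    and g: "clinear_on (cs_carrier A) g" "\<And>x. x \<in> cs_carrier A \<Longrightarrow> cmod (g x) \<le> L * cs_norm A x"
    and S: "S \<subseteq> cs_carrier A" "\<And>x. x \<in> S \<Longrightarrow> f x = g x"
    and x: "x \<in> closure_wrt (cs_norm A) (cs_carrier A) (cspan S)"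
  shows "f x = g x"
proof -
  have span: "cspan S \<subseteq> cs_carrier A" by (intro complex_vector.span_minimal S(1) subspace)
  have xc: "x \<in> cs_carrier A" using x by (simp add: closure_wrt_def)
  have "cmod (f x - g x) \<le> e" if e: "0 < e" for e
  proof -
    \<comment> \<open>The bounds \<open>K\<close> and \<open>L\<close> may have any sign, hence the
      absolute values; the added \<open>1\<close> keeps the denominator positive.\<close>
    define d where "d = e / (\<bar>K\<bar> + \<bar>L\<bar> + 1)"
    have d: "0 < d" using e by (simp add: d_def add_nonneg_pos)
    then obtain y where y: "y \<in> cspan S" "cs_norm A (x - y) < d"
      using x by (auto simp: closure_wrt_def)
    have yc: "y \<in> cs_carrier A" using y span by auto
    have "f y = g y" by (rule clinear_on_eq_span[OF f(1) g(1) subspace S y(1)])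
    then have "f x - g x = f (x - y) - g (x - y)"
      using xc yc by (simp add: clinear_on_diff[OF f(1) subspace] clinear_on_diff[OF g(1) subspace])
    also have "cmod \<dots> \<le> K * cs_norm A (x - y) + L * cs_norm A (x - y)"
      using f(2)[of "x - y"] g(2)[of "x - y"] xc yc norm_triangle_ineq4[of "f (x - y)" "g (x - y)"] by simp
    also have "\<dots> \<le> \<bar>K\<bar> * cs_norm A (x - y) + \<bar>L\<bar> * cs_norm A (x - y)"
      using xc yc by (intro add_mono mult_right_mono) auto
    also have "\<dots> \<le> \<bar>K\<bar> * d + \<bar>L\<bar> * d"
      using y by (intro add_mono mult_left_mono) auto
    also have "\<dots> = (\<bar>K\<bar> + \<bar>L\<bar>) * d" by (simp add: algebra_simps)
    also have "\<dots> \<le> (\<bar>K\<bar> + \<bar>L\<bar> + 1) * d" using d by (intro mult_right_mono) auto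
    also have "\<dots> = e" by (simp add: d_def)
    finally show ?thesis .
  qed
  then have "cmod (f x - g x) \<le> 0" by (meson field_le_epsilon add_0 le_add_same_cancel1 dense_ge)
  then show ?thesis by simp
qed

end

section \<open>The C*-algebra of a space with a semi-inner product\<close>

text \<open>The premise is required only for \<open>e \<le> 1\<close>, so that callers may absorb
  \<open>e * e\<close> into a multiple of \<open>e\<close>.\<close>

lemma le_of_le_eps:
  fixes a c K :: real
  assumes "\<And>e. 0 < e \<Longrightarrow> e \<le> 1 \<Longrightarrow> a \<le> c + K * e"
  shows "a \<le> c"
proof (rule field_le_epsilon)
  fix d :: real assume d: "0 < d"
  define e where "e = min 1 (d / (\<bar>K\<bar> + 1))"
  have e: "0 < e" "e \<le> 1" using d by (auto simp: e_def)
  have "K * e \<le> \<bar>K\<bar> * e" using e by (intro mult_right_mono) auto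
  also have "\<dots> \<le> (\<bar>K\<bar> + 1) * (d / (\<bar>K\<bar> + 1))" using e by (intro mult_mono) (auto simp: e_def)
  also have "\<dots> = d" by simp
  finally show "a \<le> c + d" using assms[OF e] by simp
qed

lemma eq_zero_of_le_eps:
  assumes "\<And>e. 0 < e \<Longrightarrow> e \<le> 1 \<Longrightarrow> cmod z \<le> K * e"
  shows "z = 0"
  using le_of_le_eps[of "cmod z" 0 K] assms by simp

context form_space
begin

lemma nrm_triangle:
  assumes "x \<in> V" "y \<in> V" shows "nrm (x + y) \<le> nrm x + nrm y"
proof -
  have "(nrm (x + y))\<^sup>2 = Re (ip x x) + Re (ip y y) + Re (ip x y) + Re (ip y x)"
    using assms by (simp add: nrm_sq ip_add_left ip_add_right)
  also have "\<dots> \<le> (nrm x)\<^sup>2 + (nrm y)\<^sup>2 + nrm x * nrm y + nrm y * nrm x"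
    unfolding nrm_sq[OF assms(1)] nrm_sq[OF assms(2)]
    using assms by (intro add_mono order_refl order_trans[OF complex_Re_le_cmod cauchy_schwarz])
  also have "\<dots> = (nrm x + nrm y)\<^sup>2" by (simp add: power2_eq_square algebra_simps)
  finally show ?thesis by (rule power2_le_imp_le) (use assms in simp)
qed

text \<open>The adjoint is carried along: without completeness it need not exist, and without
  definiteness it is fixed only up to null vectors. The pairing with \<open>T'\<close> also makes
  the form of \<open>T\<close> linear in its second argument.\<close>

definition adjoint_ops :: "('v \<Rightarrow> 'v) \<Rightarrow> ('v \<Rightarrow> 'v) \<Rightarrow> bool" where
  "adjoint_ops T T' \<longleftrightarrow> (\<forall>x\<in>V. T x \<in> V) \<and> (\<forall>x\<in>V. T' x \<in> V) \<and>
     (\<forall>x\<in>V. \<forall>y\<in>V. ip x (T y) = ip (T' x) y) \<and> (\<exists>M\<ge>0. \<forall>x\<in>V. nrm (T x) \<le> M * nrm x)"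

lemma adjoint_opsD:
  assumes "adjoint_ops T T'"
  shows "x \<in> V \<Longrightarrow> T x \<in> V" "x \<in> V \<Longrightarrow> T' x \<in> V"
    "x \<in> V \<Longrightarrow> y \<in> V \<Longrightarrow> ip x (T y) = ip (T' x) y"
    "\<exists>M\<ge>0. \<forall>x\<in>V. nrm (T x) \<le> M * nrm x"
  using assms by (auto simp: adjoint_ops_def)

text \<open>The bound passes to the adjoint through
  \<open>nrm (T' x)^2 = ip x (T (T' x)) <= nrm x * M * nrm (T' x)\<close>, after cancelling one
  factor.\<close>

lemma adjoint_ops_swap:
  assumes T: "adjoint_ops T T'" shows "adjoint_ops T' T"
proof -
  note D = adjoint_opsD[OF T]
  obtain M where M: "0 \<le> M" "\<And>x. x \<in> V \<Longrightarrow> nrm (T x) \<le> M * nrm x" using D(4) by blast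
  have "nrm (T' x) \<le> M * nrm x" if x: "x \<in> V" for x
  proof (cases "nrm (T' x) = 0")
    case False
    have "(nrm (T' x))\<^sup>2 = Re (ip x (T (T' x)))" using D x by (simp add: nrm_sq)
    also have "\<dots> \<le> nrm x * nrm (T (T' x))"
      using D x cauchy_schwarz[of x "T (T' x)"] complex_Re_le_cmod order_trans by blast
    also have "\<dots> \<le> nrm x * (M * nrm (T' x))"
      using D x M by (intro mult_left_mono) auto
    finally have "nrm (T' x) * nrm (T' x) \<le> (M * nrm x) * nrm (T' x)"
      by (simp add: power2_eq_square algebra_simps)
    then show ?thesis by (rule mult_right_le_imp_le) (use False D x in \<open>simp add: less_le\<close>)
  qed (use M x in simp)
  moreover have "ip x (T' y) = ip (T x) y" if "x \<in> V" "y \<in> V" for x y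
    using that D by (simp add: ip_hermitian[of "T' y" x] ip_hermitian[of y "T x"])
  ultimately show ?thesis using D M by (auto simp: adjoint_ops_def)
qed

lemma adjoint_ops_zero: "adjoint_ops (\<lambda>x. 0) (\<lambda>x. 0)"
  by (auto simp: adjoint_ops_def nrm_def intro!: exI[of _ 0])

lemma adjoint_ops_comp:
  assumes T: "adjoint_ops T T'" and S: "adjoint_ops S S'"
  shows "adjoint_ops (\<lambda>x. T (S x)) (\<lambda>x. S' (T' x))"
proof -
  obtain M L where M: "0 \<le> M" "\<And>x. x \<in> V \<Longrightarrow> nrm (T x) \<le> M * nrm x"
    and L: "0 \<le> L" "\<And>x. x \<in> V \<Longrightarrow> nrm (S x) \<le> L * nrm x"
    using adjoint_opsD(4)[OF T] adjoint_opsD(4)[OF S] by blast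
  have "nrm (T (S x)) \<le> (M * L) * nrm x" if "x \<in> V" for x
    using M(2)[of "S x"] mult_left_mono[OF L(2)[OF that] M(1)] adjoint_opsD(1)[OF S that] by simp
  then show ?thesis
    using M(1) L(1) adjoint_opsD(1-3)[OF T] adjoint_opsD(1-3)[OF S]
    by (auto simp: adjoint_ops_def intro!: exI[of _ "M * L"])
qed

lemma adjoint_ops_add:
  assumes T: "adjoint_ops T T'" and S: "adjoint_ops S S'"
  shows "adjoint_ops (\<lambda>x. T x + S x) (\<lambda>x. T' x + S' x)"
proof -
  obtain M L where M: "0 \<le> M" "\<And>x. x \<in> V \<Longrightarrow> nrm (T x) \<le> M * nrm x"
    and L: "0 \<le> L" "\<And>x. x \<in> V \<Longrightarrow> nrm (S x) \<le> L * nrm x"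
    using adjoint_opsD(4)[OF T] adjoint_opsD(4)[OF S] by blast
  have "nrm (T x + S x) \<le> (M + L) * nrm x" if "x \<in> V" for x
    using nrm_triangle[of "T x" "S x"] M(2)[OF that] L(2)[OF that]
      adjoint_opsD(1)[OF S that] adjoint_opsD(1)[OF T that] by (simp add: algebra_simps)
  then show ?thesis
    using M(1) L(1) adjoint_opsD(1-3)[OF T] adjoint_opsD(1-3)[OF S]
    by (auto simp: adjoint_ops_def ip_add_left ip_add_right intro!: exI[of _ "M + L"])
qed

lemma adjoint_ops_scale:
  assumes T: "adjoint_ops T T'"
  shows "adjoint_ops (\<lambda>x. c *\<^sub>C T x) (\<lambda>x. cnj c *\<^sub>C T' x)"
proof -
  obtain M where M: "0 \<le> M" "\<And>x. x \<in> V \<Longrightarrow> nrm (T x) \<le> M * nrm x"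
    using adjoint_opsD(4)[OF T] by blast
  have "nrm (c *\<^sub>C T x) \<le> (cmod c * M) * nrm x" if "x \<in> V" for x
    using mult_left_mono[OF M(2)[OF that], of "cmod c"] adjoint_opsD(1)[OF T that]
    by (simp add: nrm_scale)
  then show ?thesis
    using M(1) adjoint_opsD(1-3)[OF T]
    by (auto simp: adjoint_ops_def ip_scale_left ip_scale_right intro!: exI[of _ "cmod c * M"])
qed

text \<open>Passing to the form identifies operators that differ by null vectors; the value
  \<open>0\<close> off \<open>V\<close> makes equality of forms an equality of functions.\<close>

definition form :: "('v \<Rightarrow> 'v) \<Rightarrow> 'v \<Rightarrow> 'v \<Rightarrow> complex" where
  "form T x y = (if x \<in> V \<and> y \<in> V then ip x (T y) else 0)"

definition form_le :: "real \<Rightarrow> ('v \<Rightarrow> 'v \<Rightarrow> complex) \<Rightarrow> bool" where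
  "form_le M F \<longleftrightarrow> (\<forall>x\<in>V. \<forall>y\<in>V. cmod (F x y) \<le> M * (nrm x * nrm y))"

text \<open>The condition \<open>0 \<le> M\<close> keeps the set bounded below even when every
  vector of \<open>V\<close> is null.\<close>

definition form_norm :: "('v \<Rightarrow> 'v \<Rightarrow> complex) \<Rightarrow> real" where
  "form_norm F = Inf {M. 0 \<le> M \<and> form_le M F}"

lemma form_leD: "form_le M F \<Longrightarrow> x \<in> V \<Longrightarrow> y \<in> V \<Longrightarrow> cmod (F x y) \<le> M * (nrm x * nrm y)"
  by (simp add: form_le_def)

lemma form_le_mono: "form_le M F \<Longrightarrow> M \<le> L \<Longrightarrow> form_le L F"
  unfolding form_le_def by (meson mult_nonneg_nonneg mult_right_mono nrm_nonneg order_trans)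

lemma form_le_add: "form_le M F \<Longrightarrow> form_le L G \<Longrightarrow> form_le (M + L) (F + G)"
  unfolding form_le_def
  by (simp add: distrib_right) (meson add_mono norm_triangle_ineq order_trans)

lemma form_le_minus: "form_le M F \<Longrightarrow> form_le M (- F)"
  by (simp add: form_le_def)

lemma form_le_diff: "form_le M F \<Longrightarrow> form_le L G \<Longrightarrow> form_le (M + L) (F - G)"
  using form_le_add[of M F L "- G"] form_le_minus[of L G] by simp

lemma form_le_scale: "form_le M F \<Longrightarrow> form_le (cmod c * M) (c *\<^sub>C F)"
  by (simp add: form_le_def scaleC_fun_def scaleC_complex_def norm_mult mult.assoc mult_left_mono)

lemma form_norm_le: "0 \<le> M \<Longrightarrow> form_le M F \<Longrightarrow> form_norm F \<le> M"
  unfolding form_norm_def by (intro cInf_lower) (auto intro: bdd_belowI[of _ 0])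

lemma form_norm_nonneg: "0 \<le> M \<Longrightarrow> form_le M F \<Longrightarrow> 0 \<le> form_norm F"
  unfolding form_norm_def by (intro cInf_greatest) auto

lemma form_le_norm:
  assumes "0 \<le> M" "form_le M F" shows "form_le (form_norm F) F"
proof -
  have "cmod (F x y) \<le> form_norm F * (nrm x * nrm y)" if xy: "x \<in> V" "y \<in> V" for x y
  proof (cases "nrm x * nrm y = 0")
    case True
    then show ?thesis using form_leD[OF assms(2) xy] by auto
  next
    case False
    then have pos: "0 < nrm x * nrm y" using xy by (simp add: less_le)
    have "cmod (F x y) / (nrm x * nrm y) \<le> form_norm F"
      unfolding form_norm_def
    proof (rule cInf_greatest)
      fix L assume "L \<in> {M. 0 \<le> M \<and> form_le M F}"
      then show "cmod (F x y) / (nrm x * nrm y) \<le> L"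
        using form_leD[of L F, OF _ xy] pos by (simp add: divide_le_eq)
    qed (use assms in auto)
    then show ?thesis using pos by (simp add: divide_le_eq)
  qed
  then show ?thesis by (simp add: form_le_def)
qed

text \<open>The closure, in \<open>form_norm\<close>, of the forms of adjointable operators. Taking
  the closure among functions on \<open>V\<close> yields a complete algebra although
  \<open>V\<close> itself is not complete.\<close>

definition form_set :: "('v \<Rightarrow> 'v \<Rightarrow> complex) set" where
  "form_set = {F. (\<forall>x y. x \<notin> V \<or> y \<notin> V \<longrightarrow> F x y = 0) \<and>
     (\<forall>e>0. \<exists>T T'. adjoint_ops T T' \<and> form_le e (F - form T))}"

lemma form_setD: "F \<in> form_set \<Longrightarrow> x \<notin> V \<or> y \<notin> V \<Longrightarrow> F x y = 0"
  by (auto simp: form_set_def)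

lemma form_approx:
  assumes "F \<in> form_set" "0 < e"
  obtains T T' where "adjoint_ops T T'" "form_le e (F - form T)"
  using assms by (auto simp: form_set_def)

lemma form_le_form:
  assumes "adjoint_ops T T'" shows "\<exists>M\<ge>0. form_le M (form T)"
proof -
  obtain M where M: "0 \<le> M" "\<And>x. x \<in> V \<Longrightarrow> nrm (T x) \<le> M * nrm x"
    using adjoint_opsD(4)[OF assms] by blast
  have "cmod (ip x (T y)) \<le> M * (nrm x * nrm y)" if "x \<in> V" "y \<in> V" for x y
    using cauchy_schwarz[of x "T y"] mult_left_mono[OF M(2)[of y], of "nrm x"] that
      adjoint_opsD(1)[OF assms] by (simp add: algebra_simps)
  then show ?thesis using M(1) by (auto simp: form_le_def form_def)
qed

lemma form_in_form_set: "adjoint_ops T T' \<Longrightarrow> form T \<in> form_set"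
  unfolding form_set_def by (auto simp: form_def form_le_def) 

text \<open>Some operator form lies within distance \<open>1\<close> and is bounded, so
  \<open>F\<close> is bounded and the infimum that defines its norm is attained.\<close>

lemma form_set_le_norm:
  assumes "F \<in> form_set" shows "form_le (form_norm F) F" and "0 \<le> form_norm F"
proof -
  obtain T T' where T: "adjoint_ops T T'" "form_le 1 (F - form T)"
    by (rule form_approx[OF assms, of 1]) auto
  obtain M where "0 \<le> M" "form_le M (form T)" using form_le_form[OF T(1)] by blast
  with T(2) have "0 \<le> 1 + M" "form_le (1 + M) (F - form T + form T)"
    using form_le_add[of 1 "F - form T" M "form T"] by auto
  then have "0 \<le> 1 + M" "form_le (1 + M) F" by simp_all
  then show "form_le (form_norm F) F" "0 \<le> form_norm F" by (rule form_le_norm, rule form_norm_nonneg)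
qed

lemmas form_set_norm_bound = form_leD[OF form_set_le_norm(1)]

lemma form_zero: "form (\<lambda>x. 0) = 0"
  by (auto simp: form_def fun_eq_iff)

lemma form_add: "adjoint_ops T T' \<Longrightarrow> adjoint_ops S S' \<Longrightarrow> form (\<lambda>x. T x + S x) = form T + form S"
  by (auto simp: form_def fun_eq_iff ip_add_right adjoint_opsD(1))

lemma form_scale: "adjoint_ops T T' \<Longrightarrow> form (\<lambda>x. c *\<^sub>C T x) = c *\<^sub>C form T"
  by (auto simp: form_def fun_eq_iff ip_scale_right scaleC_fun_def scaleC_complex_def adjoint_opsD(1))

lemma form_set_add: assumes F: "F \<in> form_set" and G: "G \<in> form_set" shows "F + G \<in> form_set"
proof -
  have "\<exists>R R'. adjoint_ops R R' \<and> form_le e (F + G - form R)" if e: "0 < e" for e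
  proof -
    obtain T T' where T: "adjoint_ops T T'" "form_le (e/2) (F - form T)"
      by (rule form_approx[OF F, of "e/2"]) (use e in auto)
    obtain S S' where S: "adjoint_ops S S'" "form_le (e/2) (G - form S)"
      by (rule form_approx[OF G, of "e/2"]) (use e in auto)
    have "form_le (e/2 + e/2) (F - form T + (G - form S))" by (rule form_le_add[OF T(2) S(2)])
    then have "form_le e (F + G - form (\<lambda>x. T x + S x))"
      unfolding form_add[OF T(1) S(1)] by (simp add: algebra_simps)
    then show ?thesis using adjoint_ops_add[OF T(1) S(1)] by blast
  qed
  then show ?thesis using F G by (simp add: form_set_def)
qed

lemma form_set_scale: assumes F: "F \<in> form_set" shows "c *\<^sub>C F \<in> form_set"
proof -
  have "\<exists>R R'. adjoint_ops R R' \<and> form_le e (c *\<^sub>C F - form R)" if e: "0 < e" for e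
  proof -
    define d where "d = e / (cmod c + 1)"
    have "0 < d" using e by (simp add: d_def add_nonneg_pos)
    then obtain T T' where T: "adjoint_ops T T'" "form_le d (F - form T)"
      by (rule form_approx[OF F]) auto
    have "cmod c * d \<le> (cmod c + 1) * d" using \<open>0 < d\<close> by (intro mult_right_mono) auto
    also have "\<dots> = e" by (simp add: d_def) (metis add_nonneg_pos norm_ge_zero order_less_irrefl zero_less_one)
    finally have "form_le e (c *\<^sub>C (F - form T))"
      using form_le_scale[OF T(2)] form_le_mono by blast
    then have "form_le e (c *\<^sub>C F - form (\<lambda>x. c *\<^sub>C T x))"
      by (simp add: form_scale[OF T(1)] complex_vector.scale_right_diff_distrib)
    then show ?thesis using adjoint_ops_scale[OF T(1)] by blast
  qed
  then show ?thesis using F by (simp add: form_set_def scaleC_fun_def scaleC_complex_def)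
qed

lemma form_set_subspace: "csubspace form_set"
  using form_in_form_set[OF adjoint_ops_zero] form_set_add form_set_scale
  by (simp add: complex_vector.subspace_def form_zero)

lemma form_set_diff: "F \<in> form_set \<Longrightarrow> G \<in> form_set \<Longrightarrow> F - G \<in> form_set"
  by (rule complex_vector.subspace_diff[OF form_set_subspace])

text \<open>For an operator form, \<open>ip x (T y) = ip (T' x) y\<close> is additive in
  \<open>y\<close> because \<open>ip\<close> is; the approximation by \<open>e\<close> carries this
  over to limits of operator forms.\<close>

lemma form_set_right_add:
  assumes F: "F \<in> form_set" and V: "x \<in> V" "y \<in> V" "z \<in> V"
  shows "F x (y + z) = F x y + F x z"
proof -
  have "F x (y + z) - F x y - F x z = 0"
  proof (rule eq_zero_of_le_eps)
    fix e :: real assume "0 < e"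
    then obtain T T' where T: "adjoint_ops T T'" "form_le e (F - form T)"
      by (rule form_approx[OF F])
    have *: "cmod (F x w - ip (T' x) w) \<le> e * (nrm x * nrm w)" if "w \<in> V" for w
      using form_leD[OF T(2) V(1) that] V that adjoint_opsD(3)[OF T(1)] by (simp add: form_def)
    have "F x (y + z) - F x y - F x z =
        (F x (y + z) - ip (T' x) (y + z)) - (F x y - ip (T' x) y) - (F x z - ip (T' x) z)"
      using V adjoint_opsD(2)[OF T(1) V(1)] by (simp add: ip_add_right)
    also have "cmod \<dots> \<le> e * (nrm x * nrm (y + z)) + e * (nrm x * nrm y) + e * (nrm x * nrm z)"
      using *[of "y + z"] *[of y] *[of z] V
      by (smt (verit, best) V_add norm_triangle_ineq4)
    finally show "cmod (F x (y + z) - F x y - F x z) \<le> (nrm x * (nrm (y + z) + nrm y + nrm z)) * e"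
      by (simp add: algebra_simps)
  qed
  then show ?thesis by (simp add: algebra_simps)
qed

lemma form_set_right_scale:
  assumes F: "F \<in> form_set" and V: "x \<in> V" "y \<in> V"
  shows "F x (c *\<^sub>C y) = c * F x y"
proof -
  have "F x (c *\<^sub>C y) - c * F x y = 0"
  proof (rule eq_zero_of_le_eps)
    fix e :: real assume "0 < e"
    then obtain T T' where T: "adjoint_ops T T'" "form_le e (F - form T)"
      by (rule form_approx[OF F])
    have *: "cmod (F x w - ip (T' x) w) \<le> e * (nrm x * nrm w)" if "w \<in> V" for w
      using form_leD[OF T(2) V(1) that] V that adjoint_opsD(3)[OF T(1)] by (simp add: form_def)
    have "F x (c *\<^sub>C y) - c * F x y = (F x (c *\<^sub>C y) - ip (T' x) (c *\<^sub>C y)) - c * (F x y - ip (T' x) y)"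
      using V adjoint_opsD(2)[OF T(1) V(1)] by (simp add: ip_scale_right algebra_simps)
    also have "cmod \<dots> \<le> e * (nrm x * nrm (c *\<^sub>C y)) + cmod c * (e * (nrm x * nrm y))"
      using *[of "c *\<^sub>C y"] mult_left_mono[OF *[of y], of "cmod c"] V
      by (smt (verit, best) V_scale norm_ge_zero norm_triangle_ineq4 norm_mult)
    finally show "cmod (F x (c *\<^sub>C y) - c * F x y) \<le> (nrm x * (nrm (c *\<^sub>C y) + cmod c * nrm y)) * e"
      by (simp add: algebra_simps)
  qed
  then show ?thesis by simp
qed

lemma form_set_clinear: "F \<in> form_set \<Longrightarrow> x \<in> V \<Longrightarrow> clinear_on V (F x)"
  by (simp add: clinear_on_def form_set_right_add form_set_right_scale scaleC_complex_def)

lemma form_set_right_diff: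
  "F \<in> form_set \<Longrightarrow> x \<in> V \<Longrightarrow> y \<in> V \<Longrightarrow> z \<in> V \<Longrightarrow> F x (y - z) = F x y - F x z"
  using clinear_on_diff[OF form_set_clinear subspace_V] by blast

text \<open>The form is tested on the vector \<open>z = T y - S y\<close> itself, and one factor
  \<open>nrm z\<close> cancels.\<close>

lemma nrm_le_of_form_le:
  assumes T: "adjoint_ops T T'" and S: "adjoint_ops S S'" and e: "0 \<le> e" "form_le e (form T - form S)"
    and y: "y \<in> V"
  shows "nrm (T y - S y) \<le> e * nrm y"
proof (cases "nrm (T y - S y) = 0")
  case False
  define z where "z = T y - S y"
  have z: "z \<in> V" "T y \<in> V" "S y \<in> V"
    using adjoint_opsD(1)[OF T y] adjoint_opsD(1)[OF S y] by (simp_all add: z_def)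
  have "(nrm z)\<^sup>2 = Re (ip z (T y) - ip z (S y))"
    using z by (simp add: nrm_sq z_def ip_diff_right)
  also have "\<dots> \<le> e * (nrm z * nrm y)"
    using form_leD[OF e(2) z(1) y] z y complex_Re_le_cmod[of "ip z (T y) - ip z (S y)"]
    by (simp add: form_def)
  finally have "nrm z * nrm z \<le> (e * nrm y) * nrm z" by (simp add: power2_eq_square algebra_simps)
  then have "nrm z \<le> e * nrm y"
    by (rule mult_right_le_imp_le) (use False z in \<open>simp add: less_le z_def\<close>)
  then show ?thesis by (simp add: z_def)
qed (use e y in simp)

lemma nrm_le_approx:
  assumes G: "G \<in> form_set" and S: "adjoint_ops S S'" and e: "0 \<le> e" "form_le e (G - form S)" and y: "y \<in> V"
  shows "nrm (S y) \<le> (form_norm G + e) * nrm y"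
proof -
  have "form_le (form_norm G + e) (G - (G - form S))"
    by (rule form_le_diff[OF form_set_le_norm(1)[OF G] e(2)])
  then show ?thesis
    using nrm_le_of_form_le[OF S adjoint_ops_zero, of "form_norm G + e" y] y e form_set_le_norm(2)[OF G]
    by (simp add: form_zero)
qed

text \<open>The product extends the composition of operators by continuity.\<close>

definition form_mult :: "('v \<Rightarrow> 'v \<Rightarrow> complex) \<Rightarrow> ('v \<Rightarrow> 'v \<Rightarrow> complex) \<Rightarrow> 'v \<Rightarrow> 'v \<Rightarrow> complex" where
  "form_mult F G x y = (if x \<in> V \<and> y \<in> V then SOME v. \<forall>e S S'. 0 \<le> e \<and> adjoint_ops S S' \<and> form_le e (G - form S) \<longrightarrow>
      cmod (v - F x (S y)) \<le> form_norm F * e * (nrm x * nrm y) else 0)"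

text \<open>Two operators within \<open>d\<close> and \<open>e\<close> of \<open>G\<close> differ on
  \<open>y\<close> by at most \<open>(d + e) * nrm y\<close>, so along operators approaching
  \<open>G\<close> the numbers \<open>F x (S y)\<close> form a Cauchy sequence. Its limit satisfies
  the estimate for all approximants at once, which is what the choice in \<open>form_mult\<close>
  asks for.\<close>

lemma form_mult_approx:
  assumes F: "F \<in> form_set" and G: "G \<in> form_set" and V: "x \<in> V" "y \<in> V"
    and S: "adjoint_ops S S'" "0 \<le> e" "form_le e (G - form S)"
  shows "cmod (form_mult F G x y - F x (S y)) \<le> form_norm F * e * (nrm x * nrm y)"
proof -
  have two: "cmod (F x (S y) - F x (R y)) \<le> form_norm F * (d + e) * (nrm x * nrm y)"
    if S: "adjoint_ops S S'" "0 \<le> d" "form_le d (G - form S)"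
      and R: "adjoint_ops R R'" "0 \<le> e" "form_le e (G - form R)" for S S' R R' d e
  proof -
    have "form_le (e + d) ((G - form R) - (G - form S))" by (rule form_le_diff[OF R(3) S(3)])
    then have "form_le (d + e) (form S - form R)" by (simp add: add.commute)
    then have *: "nrm (S y - R y) \<le> (d + e) * nrm y"
      using nrm_le_of_form_le[OF S(1) R(1)] S(2) R(2) V by simp
    have "cmod (F x (S y) - F x (R y)) = cmod (F x (S y - R y))"
      using V S(1) R(1) by (simp add: form_set_right_diff[OF F] adjoint_opsD(1))
    also have "\<dots> \<le> form_norm F * (nrm x * nrm (S y - R y))"
      using form_set_norm_bound[OF F V(1), of "S y - R y"] V S(1) R(1) by (simp add: adjoint_opsD(1))
    also have "\<dots> \<le> form_norm F * (nrm x * ((d + e) * nrm y))"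
      using * V form_set_le_norm(2)[OF F] by (intro mult_left_mono) auto
    finally show ?thesis by (simp add: algebra_simps)
  qed
  define e' where "e' k = inverse (real (Suc k))" for k
  have e': "0 < e' k" for k by (simp add: e'_def)
  have "\<forall>k. \<exists>T T'. adjoint_ops T T' \<and> form_le (e' k) (G - form T)"
    using form_approx[OF G e'] by metis
  then obtain T T' where T: "\<And>k. adjoint_ops (T k) (T' k)" "\<And>k. form_le (e' k) (G - form (T k))"
    by metis
  have lim0: "e' \<longlonglongrightarrow> 0" unfolding e'_def using LIMSEQ_inverse_real_of_nat .
  define K where "K = form_norm F * (nrm x * nrm y)"
  have K0: "0 \<le> K" using V form_set_le_norm(2)[OF F] by (simp add: K_def)
  have "Cauchy (\<lambda>k. F x (T k y))"
  proof (rule CauchyI)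
    fix d :: real assume d: "0 < d"
    have "(\<lambda>k. K * e' k) \<longlonglongrightarrow> 0" using tendsto_mult_right_zero[OF lim0] .
    then have "\<forall>\<^sub>F k in sequentially. K * e' k < d / 2"
      using d by (intro order_tendstoD(2)[of _ 0]) simp_all
    then obtain M where M: "\<And>k. k \<ge> M \<Longrightarrow> K * e' k < d / 2" by (auto simp: eventually_sequentially)
    have "cmod (F x (T k y) - F x (T l y)) < d" if "M \<le> k" "M \<le> l" for k l
      using two[OF T(1) less_imp_le[OF e'] T(2) T(1) less_imp_le[OF e'] T(2), of k l] M[of k] M[of l] that
      by (simp add: K_def algebra_simps)
    then show "\<exists>M. \<forall>m\<ge>M. \<forall>n\<ge>M. cmod (F x (T m y) - F x (T n y)) < d" by blast
  qed
  then obtain v where v: "(\<lambda>k. F x (T k y)) \<longlonglongrightarrow> v"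
    using Cauchy_convergent_iff convergent_def by blast
  have "cmod (v - F x (S y)) \<le> form_norm F * e * (nrm x * nrm y)"
    if S: "adjoint_ops S S'" "0 \<le> e" "form_le e (G - form S)" for S S' e
  proof -
    have "(\<lambda>k. cmod (F x (T k y) - F x (S y))) \<longlonglongrightarrow> cmod (v - F x (S y))"
      by (intro tendsto_intros v)
    moreover have "(\<lambda>k. K * (e' k + e)) \<longlonglongrightarrow> K * (0 + e)"
      by (intro tendsto_intros lim0)
    moreover have "cmod (F x (T k y) - F x (S y)) \<le> K * (e' k + e)" for k
      using two[OF T(1) less_imp_le[OF e'] T(2) S, of k] by (simp add: K_def algebra_simps)
    ultimately have "cmod (v - F x (S y)) \<le> K * (0 + e)" by (meson LIMSEQ_le)
    then show ?thesis by (simp add: K_def algebra_simps)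
  qed
  then have ex: "\<exists>v. \<forall>e S S'. 0 \<le> e \<and> adjoint_ops S S' \<and> form_le e (G - form S) \<longrightarrow>
      cmod (v - F x (S y)) \<le> form_norm F * e * (nrm x * nrm y)" (is "\<exists>v. ?P v") by blast
  have "form_mult F G x y = (SOME v. ?P v)"
    unfolding form_mult_def using V by (simp only: if_True simp_thms)
  then have "?P (form_mult F G x y)" using someI_ex[OF ex] by (simp only:)
  then show ?thesis using S by blast
qed

lemma form_mult_outside: "x \<notin> V \<or> y \<notin> V \<Longrightarrow> form_mult F G x y = 0"
  by (auto simp: form_mult_def)

text \<open>An operator approximates its own form with error \<open>0\<close>, so the estimate
  becomes an equality.\<close>

lemma form_mult_form_right:
  assumes F: "F \<in> form_set" and S: "adjoint_ops S S'" and V: "x \<in> V" "y \<in> V"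
  shows "form_mult F (form S) x y = F x (S y)"
  using form_mult_approx[OF F form_in_form_set[OF S] V S, of 0] by (simp add: form_le_def)

text \<open>Moving \<open>T\<close> to the first argument as \<open>T'\<close> is exact when the
  second factor is an operator form, and it survives approximation of \<open>G\<close>.\<close>

lemma form_mult_form_left:
  assumes T: "adjoint_ops T T'" and G: "G \<in> form_set" and V: "x \<in> V" "y \<in> V"
  shows "form_mult (form T) G x y = G (T' x) y"
proof -
  note T' = adjoint_opsD(2)[OF T V(1)]
  have "form_mult (form T) G x y - G (T' x) y = 0"
  proof (rule eq_zero_of_le_eps)
    fix e :: real assume e: "0 < e"
    then obtain S S' where S: "adjoint_ops S S'" "form_le e (G - form S)" by (rule form_approx[OF G])
    have *: "form T x (S y) = form S (T' x) y"
      using V T' adjoint_opsD(1)[OF S(1) V(2)] adjoint_opsD(3)[OF T] by (simp add: form_def)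
    have "cmod (form_mult (form T) G x y - form T x (S y)) \<le> form_norm (form T) * e * (nrm x * nrm y)"
      by (rule form_mult_approx[OF form_in_form_set[OF T] G V S(1) _ S(2)]) (use e in simp)
    moreover have "cmod (G (T' x) y - form S (T' x) y) \<le> e * (nrm (T' x) * nrm y)"
      using form_leD[OF S(2) T' V(2)] by simp
    ultimately have "cmod (form_mult (form T) G x y - G (T' x) y)
        \<le> form_norm (form T) * e * (nrm x * nrm y) + e * (nrm (T' x) * nrm y)"
      unfolding * by (smt (verit) norm_triangle_ineq4 diff_diff_eq2 diff_add_cancel norm_minus_commute norm_triangle_le_diff)
    then show "cmod (form_mult (form T) G x y - G (T' x) y)
        \<le> (form_norm (form T) * (nrm x * nrm y) + nrm (T' x) * nrm y) * e"
      by (simp add: algebra_simps)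
  qed
  then show ?thesis by simp
qed

text \<open>Replacing \<open>G\<close> by \<open>S\<close> costs \<open>form_norm F * e\<close>;
  replacing \<open>F\<close> by \<open>T\<close> then costs \<open>d\<close> times the bound
  \<open>form_norm G + e\<close> of \<open>S\<close>. Through this estimate laws of composition
  become laws of \<open>form_mult\<close>.\<close>

lemma form_mult_approx2:
  assumes F: "F \<in> form_set" and G: "G \<in> form_set"
    and T: "adjoint_ops T T'" "0 \<le> d" "form_le d (F - form T)"
    and S: "adjoint_ops S S'" "0 \<le> e" "form_le e (G - form S)"
  shows "form_le (form_norm F * e + d * (form_norm G + e)) (form_mult F G - form (\<lambda>x. T (S x)))"
proof -
  have "cmod (form_mult F G x y - ip x (T (S y))) \<le> (form_norm F * e + d * (form_norm G + e)) * (nrm x * nrm y)"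
    if V: "x \<in> V" "y \<in> V" for x y
  proof -
    have Sy: "S y \<in> V" using adjoint_opsD(1)[OF S(1) V(2)] .
    have "cmod (F x (S y) - ip x (T (S y))) \<le> d * (nrm x * nrm (S y))"
      using form_leD[OF T(3) V(1) Sy] V Sy by (simp add: form_def)
    also have "\<dots> \<le> d * (nrm x * ((form_norm G + e) * nrm y))"
      using nrm_le_approx[OF G S V(2)] V T(2) by (intro mult_left_mono) auto
    finally have "cmod (F x (S y) - ip x (T (S y))) \<le> d * (form_norm G + e) * (nrm x * nrm y)"
      by (simp add: algebra_simps)
    moreover have "cmod (form_mult F G x y - F x (S y)) \<le> form_norm F * e * (nrm x * nrm y)"
      by (rule form_mult_approx[OF F G V S])
    ultimately show ?thesis
      using norm_triangle_ineq[of "form_mult F G x y - F x (S y)" "F x (S y) - ip x (T (S y))"]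
      by (simp add: algebra_simps)
  qed
  then show ?thesis by (simp add: form_le_def form_def)
qed

lemma form_mult_comp:
  assumes T: "adjoint_ops T T'" and S: "adjoint_ops S S'"
  shows "form_mult (form T) (form S) = form (\<lambda>x. T (S x))"
proof (intro ext)
  fix x y show "form_mult (form T) (form S) x y = form (\<lambda>x. T (S x)) x y"
    using form_mult_form_right[OF form_in_form_set[OF T] S, of x y] adjoint_opsD(1)[OF S, of y]
    by (cases "x \<in> V \<and> y \<in> V") (auto simp: form_mult_outside form_def)
qed

lemma form_mult_closed:
  assumes F: "F \<in> form_set" and G: "G \<in> form_set" shows "form_mult F G \<in> form_set"
proof -
  note F0 = form_set_le_norm(2)[OF F] and G0 = form_set_le_norm(2)[OF G]
  have "\<exists>R R'. adjoint_ops R R' \<and> form_le e (form_mult F G - form R)" if e: "0 < e" for e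
  proof -
    \<comment> \<open>The total error \<open>form_norm F * d + d * (form_norm G + d)\<close> is at
      most \<open>d * (form_norm F + form_norm G + 1)\<close>, because
      \<open>d \<le> 1\<close>.\<close>
    define d where "d = min 1 (e / (form_norm F + form_norm G + 1))"
    have d: "0 < d" "d \<le> 1" using e F0 G0 by (auto simp: d_def add_nonneg_pos)
    obtain T T' where T: "adjoint_ops T T'" "form_le d (F - form T)" by (rule form_approx[OF F d(1)])
    obtain S S' where S: "adjoint_ops S S'" "form_le d (G - form S)" by (rule form_approx[OF G d(1)])
    have "d * (form_norm F + form_norm G + 1) \<le> e / (form_norm F + form_norm G + 1) * (form_norm F + form_norm G + 1)"
      using F0 G0 by (intro mult_right_mono) (auto simp: d_def)
    also have "\<dots> = e" using F0 G0 by simp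
    finally have "d * (form_norm F + form_norm G + 1) \<le> e" .
    moreover have "form_norm F * d + d * (form_norm G + d) \<le> d * (form_norm F + form_norm G + 1)"
      using d by (simp add: algebra_simps mult_left_le)
    ultimately have "form_le e (form_mult F G - form (\<lambda>x. T (S x)))"
      using form_mult_approx2[OF F G T(1) less_imp_le[OF d(1)] T(2) S(1) less_imp_le[OF d(1)] S(2)]
      by (meson form_le_mono order_trans)
    then show ?thesis using adjoint_ops_comp[OF T(1) S(1)] by blast
  qed
  then show ?thesis by (simp add: form_set_def form_mult_outside)
qed

text \<open>The zero operator approximates \<open>G\<close> with error \<open>form_norm G\<close>;
  for it the approximation estimate is the norm inequality.\<close>

lemma form_mult_le:
  assumes F: "F \<in> form_set" and G: "G \<in> form_set"
  shows "form_le (form_norm F * form_norm G) (form_mult F G)"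
  unfolding form_le_def
proof (intro ballI)
  fix x y assume V: "x \<in> V" "y \<in> V"
  show "cmod (form_mult F G x y) \<le> form_norm F * form_norm G * (nrm x * nrm y)"
    using form_mult_approx[OF F G V adjoint_ops_zero form_set_le_norm(2)[OF G]] form_set_le_norm(1)[OF G]
      form_set_right_scale[OF F V(1), of 0 0] V by (simp add: form_zero)
qed

lemma form_eqI:
  assumes "F \<in> form_set" "G \<in> form_set"
    and "\<And>e. 0 < e \<Longrightarrow> e \<le> 1 \<Longrightarrow> form_le (K * e) (F - G)"
  shows "F = G"
proof (intro ext)
  fix x y
  show "F x y = G x y"
  proof (cases "x \<in> V \<and> y \<in> V")
    case True
    have "F x y - G x y = 0"
      by (rule eq_zero_of_le_eps[of _ "K * (nrm x * nrm y)"])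
        (use form_leD[OF assms(3), of _ x y] True in \<open>simp add: algebra_simps\<close>)
    then show ?thesis by simp
  next
    case False
    then show ?thesis using form_setD[OF assms(1), of x y] form_setD[OF assms(2), of x y] by auto
  qed
qed

lemma form_mult_add_left:
  assumes F: "F \<in> form_set" and F': "F' \<in> form_set" and G: "G \<in> form_set"
  shows "form_mult (F + F') G = form_mult F G + form_mult F' G"
proof (rule form_eqI[where K = "form_norm (F + F') + (form_norm F + form_norm F')"])
  fix e :: real assume e: "0 < e"
  obtain S S' where S: "adjoint_ops S S'" "form_le e (G - form S)" by (rule form_approx[OF G e])
  show "form_le ((form_norm (F + F') + (form_norm F + form_norm F')) * e) (form_mult (F + F') G - (form_mult F G + form_mult F' G))"
    unfolding form_le_def
  proof (intro ballI)
    fix x y assume V: "x \<in> V" "y \<in> V"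
    note a = form_mult_approx[OF _ G V S(1) less_imp_le[OF e] S(2)]
    have eq: "(form_mult (F + F') G - (form_mult F G + form_mult F' G)) x y
        = (form_mult (F + F') G x y - (F + F') x (S y)) - ((form_mult F G x y - F x (S y)) + (form_mult F' G x y - F' x (S y)))"
      by simp
    have "cmod ((form_mult (F + F') G x y - (F + F') x (S y)) - ((form_mult F G x y - F x (S y)) + (form_mult F' G x y - F' x (S y))))
        \<le> form_norm (F + F') * e * (nrm x * nrm y) + (form_norm F * e * (nrm x * nrm y) + form_norm F' * e * (nrm x * nrm y))"
      by (intro norm_triangle_le_diff add_mono norm_triangle_le a form_set_add F F')
    then show "cmod ((form_mult (F + F') G - (form_mult F G + form_mult F' G)) x y) \<le> (form_norm (F + F') + (form_norm F + form_norm F')) * e * (nrm x * nrm y)"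
      unfolding eq by (simp only: distrib_right)
  qed
qed (intro form_mult_closed form_set_add F F' G)+

lemma form_mult_scale_left:
  assumes F: "F \<in> form_set" and G: "G \<in> form_set"
  shows "form_mult (c *\<^sub>C F) G = c *\<^sub>C form_mult F G"
proof (rule form_eqI[where K = "form_norm (c *\<^sub>C F) + cmod c * form_norm F"])
  fix e :: real assume e: "0 < e"
  obtain S S' where S: "adjoint_ops S S'" "form_le e (G - form S)" by (rule form_approx[OF G e])
  show "form_le ((form_norm (c *\<^sub>C F) + cmod c * form_norm F) * e) (form_mult (c *\<^sub>C F) G - c *\<^sub>C form_mult F G)"
    unfolding form_le_def
  proof (intro ballI)
    fix x y assume V: "x \<in> V" "y \<in> V"
    note a = form_mult_approx[OF _ G V S(1) less_imp_le[OF e] S(2)]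
    have "(form_mult (c *\<^sub>C F) G - c *\<^sub>C form_mult F G) x y
        = (form_mult (c *\<^sub>C F) G x y - (c *\<^sub>C F) x (S y)) - c * (form_mult F G x y - F x (S y))"
      by (simp add: scaleC_fun_def scaleC_complex_def algebra_simps)
    also have "cmod \<dots> \<le> form_norm (c *\<^sub>C F) * e * (nrm x * nrm y) + cmod c * (form_norm F * e * (nrm x * nrm y))"
      unfolding norm_mult[symmetric]
      by (intro norm_triangle_le_diff add_mono a form_set_scale F) (simp add: norm_mult mult_left_mono a F)
    finally show "cmod ((form_mult (c *\<^sub>C F) G - c *\<^sub>C form_mult F G) x y) \<le> (form_norm (c *\<^sub>C F) + cmod c * form_norm F) * e * (nrm x * nrm y)"
      by (simp add: algebra_simps)
  qed
qed (intro form_mult_closed form_set_scale F G)+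

section \<open>Adjoints of forms, associativity and the C*-identity\<close>

definition form_star :: "('v \<Rightarrow> 'v \<Rightarrow> complex) \<Rightarrow> 'v \<Rightarrow> 'v \<Rightarrow> complex" where
  "form_star F x y = cnj (F y x)"

lemma form_star_form: "adjoint_ops T T' \<Longrightarrow> form_star (form T) = form T'"
  using adjoint_opsD[of T T']
  by (auto simp: form_star_def form_def fun_eq_iff ip_hermitian[symmetric])

lemma form_le_star: "form_le M (form_star F) \<longleftrightarrow> form_le M F"
  by (simp add: form_le_def form_star_def) (metis mult.commute)

lemma form_norm_star: "form_norm (form_star F) = form_norm F"
  by (simp add: form_norm_def form_le_star)

lemma form_star_diff: "form_star (F - G) = form_star F - form_star G"
  by (simp add: form_star_def fun_eq_iff)

lemma form_star_closed: assumes F: "F \<in> form_set" shows "form_star F \<in> form_set"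
proof -
  have "\<exists>T T'. adjoint_ops T T' \<and> form_le e (form_star F - form T)" if e: "0 < e" for e
  proof -
    obtain T T' where T: "adjoint_ops T T'" "form_le e (F - form T)" by (rule form_approx[OF F e])
    have "form_le e (form_star F - form T')"
      using T(2) by (simp add: form_le_star flip: form_star_form[OF T(1)] form_star_diff)
    then show ?thesis using adjoint_ops_swap[OF T(1)] by blast
  qed
  then show ?thesis using F by (auto simp: form_set_def form_star_def)
qed

text \<open>Both sides lie within a multiple of \<open>e\<close> of the form of one operator,
  \<open>S'\<close> after \<open>T'\<close>; the constant adds the two errors, with
  \<open>e * e\<close> absorbed into \<open>e\<close>. Associativity is proved in the same
  way.\<close>

lemma form_star_mult:
  assumes F: "F \<in> form_set" and G: "G \<in> form_set"
  shows "form_star (form_mult F G) = form_mult (form_star G) (form_star F)"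
proof (rule form_eqI[where K = "2 * (form_norm F + form_norm G + 1)"])
  fix e :: real assume e: "0 < e" "e \<le> 1"
  obtain T T' where T: "adjoint_ops T T'" "form_le e (F - form T)" by (rule form_approx[OF F e(1)])
  obtain S S' where S: "adjoint_ops S S'" "form_le e (G - form S)" by (rule form_approx[OF G e(1)])
  have T': "form_le e (form_star F - form T')" and S': "form_le e (form_star G - form S')"
    using T(2) S(2) by (simp_all add: form_le_star flip: form_star_form[OF T(1)] form_star_form[OF S(1)] form_star_diff)
  have e2: "e * e \<le> e" using e by (simp add: mult_left_le)
  have 1: "form_le ((form_norm F + form_norm G + 1) * e) (form_star (form_mult F G) - form (\<lambda>x. S' (T' x)))"
    using form_mult_approx2[OF F G T(1) less_imp_le[OF e(1)] T(2) S(1) less_imp_le[OF e(1)] S(2)] e2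
    unfolding form_star_form[OF adjoint_ops_comp[OF T(1) S(1)], symmetric]  form_star_diff[symmetric] form_le_star
    by (elim form_le_mono) (simp add: algebra_simps)
  have 2: "form_le ((form_norm F + form_norm G + 1) * e) (form_mult (form_star G) (form_star F) - form (\<lambda>x. S' (T' x)))"
    using form_mult_approx2[OF form_star_closed[OF G] form_star_closed[OF F] adjoint_ops_swap[OF S(1)] less_imp_le[OF e(1)] S'
       adjoint_ops_swap[OF T(1)] less_imp_le[OF e(1)] T'] e2
    by (elim form_le_mono) (simp add: algebra_simps form_norm_star)
  show "form_le (2 * (form_norm F + form_norm G + 1) * e) (form_star (form_mult F G) - form_mult (form_star G) (form_star F))"
    using form_le_diff[OF 1 2] by (simp add: algebra_simps)
qed (intro form_mult_closed form_star_closed F G)+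

lemma form_mult_assoc:
  assumes F: "F \<in> form_set" and G: "G \<in> form_set" and H: "H \<in> form_set"
  shows "form_mult (form_mult F G) H = form_mult F (form_mult G H)"
proof -
  define K1 K2 where "K1 = form_norm F + form_norm G + 1" and "K2 = form_norm G + form_norm H + 1"
  note pos = form_set_le_norm(2)[OF F] form_set_le_norm(2)[OF G] form_set_le_norm(2)[OF H]
    form_set_le_norm(2)[OF form_mult_closed[OF F G]] form_set_le_norm(2)[OF form_mult_closed[OF G H]]
  have K: "0 \<le> K1" "0 \<le> K2" using pos by (simp_all add: K1_def K2_def)
  define K where "K = (form_norm (form_mult F G) + K1 * (form_norm H + 1)) +
      (form_norm F * K2 + (form_norm (form_mult G H) + K2))"
  show ?thesis
  proof (rule form_eqI[where K = K])
    fix e :: real assume e: "0 < e" "e \<le> 1"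
    obtain T T' where T: "adjoint_ops T T'" "form_le e (F - form T)" by (rule form_approx[OF F e(1)])
    obtain S S' where S: "adjoint_ops S S'" "form_le e (G - form S)" by (rule form_approx[OF G e(1)])
    obtain R R' where R: "adjoint_ops R R'" "form_le e (H - form R)" by (rule form_approx[OF H e(1)])
    have e2: "e * e \<le> e" and e0: "0 \<le> e" using e by (simp_all add: mult_left_le)
    have FG: "form_le (K1 * e) (form_mult F G - form (\<lambda>x. T (S x)))"
      using form_mult_approx2[OF F G T(1) e0 T(2) S(1) e0 S(2)] e2
      by (elim form_le_mono) (simp add: algebra_simps K1_def)
    have GH: "form_le (K2 * e) (form_mult G H - form (\<lambda>x. S (R x)))"
      using form_mult_approx2[OF G H S(1) e0 S(2) R(1) e0 R(2)] e2
      by (elim form_le_mono) (simp add: algebra_simps K2_def)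
    have "form_norm (form_mult F G) * e + K1 * e * (form_norm H + e) \<le> (form_norm (form_mult F G) + K1 * (form_norm H + 1)) * e"
      using mult_left_mono[OF e2 K(1)] by (simp add: algebra_simps)
    then have 1: "form_le ((form_norm (form_mult F G) + K1 * (form_norm H + 1)) * e) (form_mult (form_mult F G) H - form (\<lambda>x. T (S (R x))))"
      using form_mult_approx2[OF form_mult_closed[OF F G] H adjoint_ops_comp[OF T(1) S(1)] _ FG R(1) e0 R(2)] K e0
      by (meson form_le_mono mult_nonneg_nonneg)
    have "form_norm F * (K2 * e) + e * (form_norm (form_mult G H) + K2 * e) \<le> (form_norm F * K2 + (form_norm (form_mult G H) + K2)) * e"
      using mult_left_mono[OF e2 K(2)] by (simp add: algebra_simps)
    then have 2: "form_le ((form_norm F * K2 + (form_norm (form_mult G H) + K2)) * e) (form_mult F (form_mult G H) - form (\<lambda>x. T (S (R x))))"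
      using form_mult_approx2[OF F form_mult_closed[OF G H] T(1) e0 T(2) adjoint_ops_comp[OF S(1) R(1)] _ GH] K e0
      by (meson form_le_mono mult_nonneg_nonneg)
    show "form_le (K * e) (form_mult (form_mult F G) H - form_mult F (form_mult G H))"
      using form_le_diff[OF 1 2] by (simp add: K_def algebra_simps)
  qed (intro form_mult_closed F G H)+
qed

lemma form_star_star: "form_star (form_star F) = F"
  by (simp add: form_star_def fun_eq_iff)

lemma form_star_add: "form_star (F + G) = form_star F + form_star G"
  by (simp add: form_star_def fun_eq_iff)

lemma form_star_scale: "form_star (c *\<^sub>C F) = cnj c *\<^sub>C form_star F"
  by (simp add: form_star_def fun_eq_iff scaleC_fun_def scaleC_complex_def)

text \<open>The star exchanges the two factors, so additivity on the left suffices.\<close>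

lemma form_mult_add_right:
  assumes F: "F \<in> form_set" and G: "G \<in> form_set" and G': "G' \<in> form_set"
  shows "form_mult F (G + G') = form_mult F G + form_mult F G'"
proof -
  have "form_star (form_mult F (G + G')) = form_star (form_mult F G + form_mult F G')"
    by (simp add: form_star_mult form_star_add form_star_closed form_mult_add_left form_set_add F G G')
  then show ?thesis by (metis form_star_star)
qed

lemma form_mult_scale_right:
  assumes F: "F \<in> form_set" and G: "G \<in> form_set"
  shows "form_mult F (c *\<^sub>C G) = c *\<^sub>C form_mult F G"
proof -
  have "form_star (form_mult F (c *\<^sub>C G)) = form_star (c *\<^sub>C form_mult F G)"
    by (simp add: form_star_mult form_star_scale form_star_closed form_mult_scale_left form_set_scale F G)
  then show ?thesis by (metis form_star_star)
qed

text \<open>For an operator \<open>T\<close> the value is \<open>ip y (T' (T y))\<close>, the square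
  of \<open>nrm (T y)\<close>. This estimate yields both positivity of the diagonal and the
  C*-identity.\<close>

lemma form_star_mult_self:
  assumes F: "F \<in> form_set" and y: "y \<in> V" and e: "0 < e" "e \<le> 1"
    and T: "adjoint_ops T T'" "form_le e (F - form T)"
  shows "cmod (form_mult (form_star F) F y y - complex_of_real ((nrm (T y))\<^sup>2)) \<le> (2 * form_norm F + 1) * e * (nrm y)\<^sup>2"
proof -
  have T': "form_le e (form_star F - form T')"
    using T(2) by (simp add: form_le_star flip: form_star_form[OF T(1)] form_star_diff)
  have e2: "e * e \<le> e" using e by (simp add: mult_left_le)
  have "form_le ((2 * form_norm F + 1) * e) (form_mult (form_star F) F - form (\<lambda>x. T' (T x)))"
    using form_mult_approx2[OF form_star_closed[OF F] F adjoint_ops_swap[OF T(1)] less_imp_le[OF e(1)] T'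
       T(1) less_imp_le[OF e(1)] T(2)] e2
    by (elim form_le_mono) (simp add: algebra_simps form_norm_star)
  from form_leD[OF this y y] show ?thesis
    using y adjoint_opsD(3)[OF adjoint_ops_swap[OF T(1)] y, of "T y"] adjoint_opsD(1)[OF T(1) y]
    by (simp add: form_def ip_self power2_eq_square)
qed

lemma form_star_mult_self_pos:
  assumes F: "F \<in> form_set" and y: "y \<in> V"
  shows "form_mult (form_star F) F y y \<in> \<real>\<^sub>\<ge>\<^sub>0"
proof -
  define z where "z = form_mult (form_star F) F y y"
  define K where "K = (2 * form_norm F + 1) * (nrm y)\<^sup>2"
  have *: "\<bar>Im z\<bar> \<le> 0 + K * e \<and> - Re z \<le> 0 + K * e" if e: "0 < e" "e \<le> 1" for e
  proof -
    obtain T T' where T: "adjoint_ops T T'" "form_le e (F - form T)" by (rule form_approx[OF F e(1)])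
    have le: "cmod (z - complex_of_real ((nrm (T y))\<^sup>2)) \<le> K * e"
      using form_star_mult_self[OF F y e T] by (simp add: z_def K_def algebra_simps)
    have "\<bar>Im z\<bar> \<le> K * e" "\<bar>Re z - (nrm (T y))\<^sup>2\<bar> \<le> K * e"
      using order_trans[OF abs_Im_le_cmod le] order_trans[OF abs_Re_le_cmod le] by simp_all
    then show ?thesis using zero_le_power2[of "nrm (T y)"] by linarith
  qed
  have "\<bar>Im z\<bar> \<le> 0" "- Re z \<le> 0" by (rule le_of_le_eps[where K = K], use * in blast)+
  then show ?thesis unfolding z_def[symmetric] by (auto simp: nonneg_Reals_def complex_eq_iff intro!: image_eqI[of _ _ "Re z"])
qed

text \<open>One inequality is submultiplicativity, as the star preserves the norm. For the other,
  \<open>F x y\<close> is compared with \<open>ip x (T y)\<close> for an approximating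
  \<open>T\<close>, so \<open>nrm (T y)\<close> must be bounded; its square is close to the diagonal
  value of \<open>form_mult (form_star F) F\<close> at \<open>y\<close>.\<close>

lemma form_norm_cstar:
  assumes F: "F \<in> form_set"
  shows "form_norm (form_mult (form_star F) F) = (form_norm F)\<^sup>2"
proof (rule antisym)
  define N where "N = form_norm (form_mult (form_star F) F)"
  note F0 = form_set_le_norm(2)[OF F]
  have FF: "form_mult (form_star F) F \<in> form_set" by (intro form_mult_closed form_star_closed F)
  show "N \<le> (form_norm F)\<^sup>2"
    using form_norm_le[OF _ form_mult_le[OF form_star_closed[OF F] F]] F0
    by (simp add: form_norm_star power2_eq_square N_def)
  have N0: "0 \<le> N" unfolding N_def by (rule form_set_le_norm(2)[OF FF])
  define K where "K = 2 * form_norm F + 1"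
  have K0: "0 \<le> K" using F0 by (simp add: K_def)
  have le: "form_norm F \<le> sqrt (N + K * e) + e" if e: "0 < e" "e \<le> 1" for e
  proof (rule form_norm_le)
    show "0 \<le> sqrt (N + K * e) + e" using N0 K0 e by simp
    obtain T T' where T: "adjoint_ops T T'" "form_le e (F - form T)" by (rule form_approx[OF F e(1)])
    show "form_le (sqrt (N + K * e) + e) F"
      unfolding form_le_def
    proof (intro ballI)
      fix x y assume V: "x \<in> V" "y \<in> V"
      have Ty: "T y \<in> V" using adjoint_opsD(1)[OF T(1) V(2)] .
      define z where "z = form_mult (form_star F) F y y"
      have "(nrm (T y))\<^sup>2 = cmod (complex_of_real ((nrm (T y))\<^sup>2))" by (simp only: norm_of_real) simp
      also have "\<dots> \<le> cmod z + cmod (z - complex_of_real ((nrm (T y))\<^sup>2))"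
        by (metis norm_minus_commute norm_triangle_sub)
      also have "\<dots> \<le> N * (nrm y * nrm y) + K * e * (nrm y)\<^sup>2"
        using form_set_norm_bound[OF FF V(2) V(2)] form_star_mult_self[OF F V(2) e T]
        by (intro add_mono) (simp_all add: z_def N_def K_def)
      finally have "(nrm (T y))\<^sup>2 \<le> (N + K * e) * (nrm y)\<^sup>2" by (simp add: algebra_simps power2_eq_square)
      then have "nrm (T y) \<le> sqrt ((N + K * e) * (nrm y)\<^sup>2)" by (simp add: real_le_rsqrt)
      then have nT: "nrm (T y) \<le> sqrt (N + K * e) * nrm y" using V by (simp add: real_sqrt_mult)
      have "cmod (F x y) \<le> cmod (ip x (T y)) + cmod (F x y - ip x (T y))" by (rule norm_triangle_sub)
      also have "\<dots> \<le> nrm x * nrm (T y) + e * (nrm x * nrm y)"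
        using cauchy_schwarz[OF V(1) Ty] form_leD[OF T(2) V] V by (intro add_mono) (simp_all add: form_def)
      also have "\<dots> \<le> nrm x * (sqrt (N + K * e) * nrm y) + e * (nrm x * nrm y)"
        using nT V e by (intro add_mono mult_left_mono order_refl) auto
      finally show "cmod (F x y) \<le> (sqrt (N + K * e) + e) * (nrm x * nrm y)" by (simp add: algebra_simps)
    qed
  qed
  \<comment> \<open>The bound \<open>le\<close> holds for all small \<open>e\<close>, and its right
    hand side tends to \<open>sqrt N\<close> as \<open>e\<close> tends to \<open>0\<close>.\<close>
  have "((\<lambda>e. sqrt (N + K * e) + e) \<longlongrightarrow> sqrt (N + K * 0) + 0) (at_right 0)"
    by (intro tendsto_intros)
  moreover have "\<forall>\<^sub>F e in at_right 0. form_norm F \<le> sqrt (N + K * e) + e"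
    using le by (auto simp: eventually_at_right_field intro!: exI[of _ 1])
  ultimately have "form_norm F \<le> sqrt N"
    using tendsto_lowerbound[of "\<lambda>e. sqrt (N + K * e) + e" "sqrt (N + K * 0) + 0" "at_right (0::real)" "form_norm F"] by simp
  then have "(form_norm F)\<^sup>2 \<le> (sqrt N)\<^sup>2" using F0 by (intro power_mono)
  then show "(form_norm F)\<^sup>2 \<le> N" using N0 by simp
qed

text \<open>The limit is taken entry by entry. The Cauchy estimates are uniform relative to
  \<open>nrm x * nrm y\<close>, so they persist for the limit, which is therefore again approximated
  by operator forms.\<close>

lemma form_set_complete: "complete_wrt form_norm form_set"
  unfolding complete_wrt_def
proof (intro allI impI)
  fix F :: "nat \<Rightarrow> 'v \<Rightarrow> 'v \<Rightarrow> complex"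
  assume F: "\<forall>k. F k \<in> form_set" and cau: "\<forall>e>0. \<exists>K. \<forall>k\<ge>K. \<forall>l\<ge>K. form_norm (F k - F l) < e"
  have cau': "\<exists>K. \<forall>k\<ge>K. \<forall>l\<ge>K. form_le e (F k - F l)" if e: "0 < e" for e
  proof -
    obtain K where "\<forall>k\<ge>K. \<forall>l\<ge>K. form_norm (F k - F l) < e"
      using cau e by blast
    moreover have "form_le (form_norm (F k - F l)) (F k - F l)" for k l
      using form_set_le_norm(1)[OF form_set_diff] F by blast
    ultimately show ?thesis by (meson form_le_mono less_imp_le)
  qed
  have "convergent (\<lambda>k. F k x y)" for x y
  proof (cases "x \<in> V \<and> y \<in> V")
    case True
    have "Cauchy (\<lambda>k. F k x y)"
    proof (rule CauchyI)
      fix d :: real assume d: "0 < d"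
      define e where "e = d / (nrm x * nrm y + 1)"
      have p: "0 < nrm x * nrm y + 1" using True by (simp add: add_nonneg_pos)
      then have "0 < e" using d by (simp add: e_def)
      then obtain K where K: "\<And>k l. k \<ge> K \<Longrightarrow> l \<ge> K \<Longrightarrow> form_le e (F k - F l)" using cau' by blast
      have "e * (nrm x * nrm y) < d" using p d by (simp add: e_def field_simps)
      then have "cmod (F k x y - F l x y) < d" if "k \<ge> K" "l \<ge> K" for k l
        using form_leD[OF K[OF that], of x y] True by simp
      then show "\<exists>M. \<forall>m\<ge>M. \<forall>n\<ge>M. cmod (F m x y - F n x y) < d" by blast
    qed
    then show ?thesis by (simp add: Cauchy_convergent_iff)
  next
    case False
    then have "F k x y = 0" for k using F form_setD by blast
    then show ?thesis by (simp add: convergent_const)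
  qed
  then obtain G where G: "\<And>x y. (\<lambda>k. F k x y) \<longlonglongrightarrow> G x y"
    unfolding convergent_def by metis
  have lim: "\<exists>K. \<forall>k\<ge>K. form_le e (F k - G)" if e: "0 < e" for e
  proof -
    obtain K where K: "\<And>k l. k \<ge> K \<Longrightarrow> l \<ge> K \<Longrightarrow> form_le e (F k - F l)" using cau' e by blast
    have "form_le e (F k - G)" if k: "k \<ge> K" for k
      unfolding form_le_def
    proof (intro ballI)
      fix x y assume V: "x \<in> V" "y \<in> V"
      have "(\<lambda>l. cmod (F k x y - F l x y)) \<longlonglongrightarrow> cmod (F k x y - G x y)" by (intro tendsto_intros G)
      moreover have "\<forall>l\<ge>K. cmod (F k x y - F l x y) \<le> e * (nrm x * nrm y)"
        using form_leD[OF K[OF k] V] by simp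
      ultimately show "cmod ((F k - G) x y) \<le> e * (nrm x * nrm y)"
        using LIMSEQ_le_const2 by fastforce
    qed
    then show ?thesis by blast
  qed
  have "G \<in> form_set"
    unfolding form_set_def
  proof (intro CollectI conjI allI impI)
    fix x y assume "x \<notin> V \<or> y \<notin> V"
    then have "F k x y = 0" for k using F form_setD by blast
    then show "G x y = 0" using LIMSEQ_unique[OF G] by simp
  next
    fix e :: real assume e: "0 < e"
    then obtain k where k: "form_le (e/2) (F k - G)" using lim[of "e/2"] by auto
    obtain T T' where T: "adjoint_ops T T'" "form_le (e/2) (F k - form T)"
      by (rule form_approx[of "F k" "e/2"]) (use F e in auto)
    have "form_le (e/2 + e/2) ((F k - form T) - (F k - G))" by (rule form_le_diff[OF T(2) k])
    then have "form_le e (G - form T)" by simp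
    then show "\<exists>T T'. adjoint_ops T T' \<and> form_le e (G - form T)" using T(1) by blast
  qed
  moreover have "(\<lambda>k. form_norm (F k - G)) \<longlonglongrightarrow> 0"
  proof (rule LIMSEQ_I)
    fix e :: real assume e: "0 < e"
    then obtain K where K: "\<And>k. k \<ge> K \<Longrightarrow> form_le (e/2) (F k - G)" using lim[of "e/2"] by auto
    have "norm (form_norm (F k - G) - 0) < e" if "k \<ge> K" for k
      using form_norm_le[OF _ K[OF that]] form_norm_nonneg[OF _ K[OF that]] e by simp
    then show "\<exists>K. \<forall>k\<ge>K. norm (form_norm (F k - G) - 0) < e" by blast
  qed
  ultimately show "\<exists>G\<in>form_set. (\<lambda>k. form_norm (F k - G)) \<longlonglongrightarrow> 0" by blast
qed

section \<open>The C*-algebra of forms\<close>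

definition form_alg :: "('v \<Rightarrow> 'v \<Rightarrow> complex) cstar" where
  "form_alg = \<lparr>cs_carrier = form_set, cs_mult = form_mult, cs_star = form_star, cs_norm = form_norm\<rparr>"

lemma form_alg_sel [simp]:
  "cs_carrier form_alg = form_set" "cs_mult form_alg = form_mult"
  "cs_star form_alg = form_star" "cs_norm form_alg = form_norm"
  by (simp_all add: form_alg_def)

lemma form_norm_scale:
  assumes F: "F \<in> form_set" shows "form_norm (c *\<^sub>C F) = cmod c * form_norm F"
proof -
  have le: "form_norm (d *\<^sub>C G) \<le> cmod d * form_norm G" if "G \<in> form_set" for d G
    using form_norm_le[OF _ form_le_scale[OF form_set_le_norm(1)[OF that]]] form_set_le_norm(2)[OF that]
    by simp
  show ?thesis
  proof (cases "c = 0")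
    case True
    then show ?thesis using le[OF F, of 0] form_set_le_norm(2)[OF form_set_scale[OF F, of 0]] by simp
  next
    case False
    have "form_norm F = form_norm (inverse c *\<^sub>C c *\<^sub>C F)" using False by simp
    also have "\<dots> \<le> cmod (inverse c) * form_norm (c *\<^sub>C F)" by (rule le[OF form_set_scale[OF F]])
    finally have "cmod c * form_norm F \<le> cmod c * (cmod (inverse c) * form_norm (c *\<^sub>C F))"
      by (rule mult_left_mono) simp
    also have "\<dots> = form_norm (c *\<^sub>C F)" using False by (simp flip: mult.assoc norm_mult)
    finally have "cmod c * form_norm F \<le> form_norm (c *\<^sub>C F)" .
    then show ?thesis using le[OF F, of c] by simp
  qed
qed

lemma form_alg_cstar: "cstar_algebra form_alg"
proof (unfold_locales, simp_all)
  show "csubspace form_set" by (rule form_set_subspace)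
  show "complete_wrt form_norm form_set" by (rule form_set_complete)
next
  fix F G assume F: "F \<in> form_set" and G: "G \<in> form_set"
  show "form_norm (F + G) \<le> form_norm F + form_norm G"
    using form_norm_le[OF _ form_le_add[OF form_set_le_norm(1)[OF F] form_set_le_norm(1)[OF G]]]
      form_set_le_norm(2)[OF F] form_set_le_norm(2)[OF G] by simp
  show "form_norm (form_mult F G) \<le> form_norm F * form_norm G"
    using form_norm_le[OF _ form_mult_le[OF F G]] form_set_le_norm(2)[OF F] form_set_le_norm(2)[OF G] by simp
next
  fix F assume F: "F \<in> form_set"
  show "(form_norm F = 0) = (F = 0)"
  proof
    assume 0: "form_norm F = 0"
    show "F = 0"
    proof (intro ext)
      fix x y show "F x y = 0 x y"
        using form_set_norm_bound[OF F, of x y] 0 form_setD[OF F, of x y] by (cases "x \<in> V \<and> y \<in> V") auto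
    qed
  next
    assume "F = 0"
    then have "form_norm F \<le> 0" by (intro form_norm_le) (simp_all add: form_le_def)
    then show "form_norm F = 0" using form_set_le_norm(2)[OF F] by simp
  qed
qed (simp_all add: form_mult_closed form_star_closed form_mult_assoc form_star_add form_star_scale
    form_star_mult form_star_star form_set_le_norm(2) form_norm_scale form_norm_cstar
    clinear_on_def form_mult_add_left form_mult_add_right form_mult_scale_left form_mult_scale_right)

end


section \<open>Transport of a C*-algebra along a linear injection\<close>

text \<open>\<open>universal\<close> speaks only of algebras carried by \<open>nt_universe\<close>,
  so the algebra of forms has to be copied to that type. The operations are meaningful only on the
  image of \<open>e\<close>.\<close>

definition image_cstar :: "('a \<Rightarrow> 'b) \<Rightarrow> 'a cstar \<Rightarrow> 'b cstar" where
  "image_cstar e D = \<lparr>cs_carrier = e ` cs_carrier D,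
     cs_mult = (\<lambda>x y. e (cs_mult D (inv_into (cs_carrier D) e x) (inv_into (cs_carrier D) e y))),
     cs_star = (\<lambda>x. e (cs_star D (inv_into (cs_carrier D) e x))),
     cs_norm = (\<lambda>x. cs_norm D (inv_into (cs_carrier D) e x))\<rparr>"

locale cstar_transport = cstar_algebra D for D :: "'a::complex_vector cstar" +
  fixes e :: "'a \<Rightarrow> 'b::complex_vector"
  assumes e_linear: "clinear_on (cs_carrier D) e" and e_inj: "inj_on e (cs_carrier D)"
begin

lemma image_sel [simp]:
  "cs_carrier (image_cstar e D) = e ` cs_carrier D"
  "x \<in> cs_carrier D \<Longrightarrow> y \<in> cs_carrier D \<Longrightarrow> cs_mult (image_cstar e D) (e x) (e y) = e (cs_mult D x y)"
  "x \<in> cs_carrier D \<Longrightarrow> cs_star (image_cstar e D) (e x) = e (cs_star D x)"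
  "x \<in> cs_carrier D \<Longrightarrow> cs_norm (image_cstar e D) (e x) = cs_norm D x"
  by (simp_all add: image_cstar_def e_inj)

lemma e_simps:
  "x \<in> cs_carrier D \<Longrightarrow> y \<in> cs_carrier D \<Longrightarrow> e x + e y = e (x + y)"
  "x \<in> cs_carrier D \<Longrightarrow> c *\<^sub>C e x = e (c *\<^sub>C x)"
  "x \<in> cs_carrier D \<Longrightarrow> y \<in> cs_carrier D \<Longrightarrow> e x - e y = e (x - y)"
  using clinear_on_add[OF e_linear] clinear_on_scale[OF e_linear]
      clinear_on_diff[OF e_linear subspace] by metis+

lemma image_subspace: "csubspace (e ` cs_carrier D)"
  unfolding complex_vector.subspace_def
  using clinear_on_zero[OF e_linear subspace] e_simps zero_closed
  by (auto simp: image_iff)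

lemma image_cstar_algebra: "cstar_algebra (image_cstar e D)"
proof (unfold_locales, simp_all add: image_subspace)
  show "complete_wrt (cs_norm (image_cstar e D)) (e ` cs_carrier D)"
    unfolding complete_wrt_def
  proof (intro allI impI)
    fix x :: "nat \<Rightarrow> 'b"
    assume "\<forall>k. x k \<in> e ` cs_carrier D"
    then have "\<forall>k. \<exists>a. a \<in> cs_carrier D \<and> x k = e a" by blast
    from choice[OF this] obtain y where y: "\<And>k. y k \<in> cs_carrier D" "\<And>k. x k = e (y k)" by blast
    assume "\<forall>\<epsilon>>0. \<exists>K. \<forall>k\<ge>K. \<forall>l\<ge>K. cs_norm (image_cstar e D) (x k - x l) < \<epsilon>"
    then have "\<forall>\<epsilon>>0. \<exists>K. \<forall>k\<ge>K. \<forall>l\<ge>K. cs_norm D (y k - y l) < \<epsilon>"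
      by (simp add: y e_simps)
    then obtain z where "z \<in> cs_carrier D" "(\<lambda>k. cs_norm D (y k - z)) \<longlonglongrightarrow> 0"
      using complete y(1) unfolding complete_wrt_def by blast
    then show "\<exists>z\<in>e ` cs_carrier D. (\<lambda>k. cs_norm (image_cstar e D) (x k - z)) \<longlonglongrightarrow> 0"
      by (intro bexI[of _ "e z"]) (simp_all add: y e_simps)
  qed
next
  fix x assume "x \<in> e ` cs_carrier D"
  then obtain a where [simp]: "a \<in> cs_carrier D" "x = e a" by blast
  have "e a = 0 \<longleftrightarrow> a = 0"
    using inj_on_eq_iff[OF e_inj, of a 0] clinear_on_zero[OF e_linear subspace] by simp
  then show "(cs_norm (image_cstar e D) x = 0) = (x = 0)"
    by (simp add: norm_eq_0)
qed (auto simp: clinear_on_def e_simps mult_add add_mult mult_scale scale_mult mult_assoc star_add star_scale star_mult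
     norm_triangle norm_scale norm_mult cstar_identity)

lemma star_hom_e: "star_hom D (image_cstar e D) e"
  by (auto simp: star_hom_def e_linear)

lemma star_hom_inv: "star_hom (image_cstar e D) D (inv_into (cs_carrier D) e)"
  by (auto simp: star_hom_def clinear_on_def e_simps e_inj)

end

section \<open>Hilbert modules\<close>

context hilbert_module
begin

lemma hm_zero [simp]: "0 \<in> hm_carrier Y"
  by (rule complex_vector.subspace_0[OF module_subspace])
lemma hm_add [simp]: "\<xi> \<in> hm_carrier Y \<Longrightarrow> \<eta> \<in> hm_carrier Y \<Longrightarrow> \<xi> + \<eta> \<in> hm_carrier Y"
  by (rule complex_vector.subspace_add[OF module_subspace])
lemma hm_diff [simp]: "\<xi> \<in> hm_carrier Y \<Longrightarrow> \<eta> \<in> hm_carrier Y \<Longrightarrow> \<xi> - \<eta> \<in> hm_carrier Y"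
  by (rule complex_vector.subspace_diff[OF module_subspace])
lemma hm_scale [simp]: "\<xi> \<in> hm_carrier Y \<Longrightarrow> c *\<^sub>C \<xi> \<in> hm_carrier Y"
  by (rule complex_vector.subspace_scale[OF module_subspace])
lemma hm_sum: "(\<And>i. i \<in> I \<Longrightarrow> x i \<in> hm_carrier Y) \<Longrightarrow> (\<Sum>i\<in>I. x i) \<in> hm_carrier Y"
  by (rule complex_vector.subspace_sum[OF module_subspace])

declare ract_closed [simp] inner_closed [simp]

lemma inner_add_right: "\<lbrakk>\<xi> \<in> hm_carrier Y; \<eta> \<in> hm_carrier Y; \<zeta> \<in> hm_carrier Y\<rbrakk> \<Longrightarrow>
    hm_inner Y \<xi> (\<eta> + \<zeta>) = hm_inner Y \<xi> \<eta> + hm_inner Y \<xi> \<zeta>"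
  using clinear_on_add[OF inner_linear_right] by blast
lemma inner_diff_right: "\<lbrakk>\<xi> \<in> hm_carrier Y; \<eta> \<in> hm_carrier Y; \<zeta> \<in> hm_carrier Y\<rbrakk> \<Longrightarrow>
    hm_inner Y \<xi> (\<eta> - \<zeta>) = hm_inner Y \<xi> \<eta> - hm_inner Y \<xi> \<zeta>"
  using clinear_on_diff[OF inner_linear_right module_subspace] by blast
lemma inner_scale_right: "\<lbrakk>\<xi> \<in> hm_carrier Y; \<eta> \<in> hm_carrier Y\<rbrakk> \<Longrightarrow>
    hm_inner Y \<xi> (c *\<^sub>C \<eta>) = c *\<^sub>C hm_inner Y \<xi> \<eta>"
  using clinear_on_scale[OF inner_linear_right] by blast
lemma inner_zero_right [simp]: "\<xi> \<in> hm_carrier Y \<Longrightarrow> hm_inner Y \<xi> 0 = 0"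
  using clinear_on_zero[OF inner_linear_right module_subspace] .
lemma inner_sum_right: "\<lbrakk>\<xi> \<in> hm_carrier Y; \<And>i. i \<in> I \<Longrightarrow> x i \<in> hm_carrier Y\<rbrakk> \<Longrightarrow>
    hm_inner Y \<xi> (\<Sum>i\<in>I. x i) = (\<Sum>i\<in>I. hm_inner Y \<xi> (x i))"
  using clinear_on_sum[OF inner_linear_right module_subspace] by blast
lemma inner_add_left: "\<lbrakk>\<xi> \<in> hm_carrier Y; \<eta> \<in> hm_carrier Y; \<zeta> \<in> hm_carrier Y\<rbrakk> \<Longrightarrow>
    hm_inner Y (\<xi> + \<eta>) \<zeta> = hm_inner Y \<xi> \<zeta> + hm_inner Y \<eta> \<zeta>"
  by (metis inner_star inner_add_right star_add inner_closed hm_add)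
lemma inner_scale_left: "\<lbrakk>\<xi> \<in> hm_carrier Y; \<zeta> \<in> hm_carrier Y\<rbrakk> \<Longrightarrow>
    hm_inner Y (c *\<^sub>C \<xi>) \<zeta> = cnj c *\<^sub>C hm_inner Y \<xi> \<zeta>"
  by (metis inner_star inner_scale_right star_scale inner_closed hm_scale)
lemma inner_zero_left [simp]: "\<xi> \<in> hm_carrier Y \<Longrightarrow> hm_inner Y 0 \<xi> = 0"
  by (metis inner_star inner_zero_right hm_zero star_zero)
lemma inner_sum_left: "\<lbrakk>\<xi> \<in> hm_carrier Y; \<And>i. i \<in> I \<Longrightarrow> x i \<in> hm_carrier Y\<rbrakk> \<Longrightarrow>
    hm_inner Y (\<Sum>i\<in>I. x i) \<xi> = (\<Sum>i\<in>I. hm_inner Y (x i) \<xi>)"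
  by (induction I rule: infinite_finite_induct) (simp_all add: inner_add_left hm_sum)
lemma inner_ract_left: "\<lbrakk>\<xi> \<in> hm_carrier Y; \<eta> \<in> hm_carrier Y; a \<in> cs_carrier A\<rbrakk> \<Longrightarrow>
    hm_inner Y (hm_ract Y \<xi> a) \<eta> = cs_mult A (cs_star A a) (hm_inner Y \<xi> \<eta>)"
  by (metis inner_star inner_ract star_mult inner_closed ract_closed)

lemma inner_eqI:
  assumes "\<xi> \<in> hm_carrier Y" "\<eta> \<in> hm_carrier Y"
    "\<And>\<zeta>. \<zeta> \<in> hm_carrier Y \<Longrightarrow> hm_inner Y \<zeta> \<xi> = hm_inner Y \<zeta> \<eta>"
  shows "\<xi> = \<eta>"
proof -
  have "hm_inner Y (\<xi> - \<eta>) (\<xi> - \<eta>) = 0"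
    using assms by (simp add: inner_diff_right)
  then show ?thesis using inner_definite[of "\<xi> - \<eta>"] assms by simp
qed

lemma ract_add_right: "\<lbrakk>\<xi> \<in> hm_carrier Y; a \<in> cs_carrier A; c \<in> cs_carrier A\<rbrakk> \<Longrightarrow>
    hm_ract Y \<xi> (a + c) = hm_ract Y \<xi> a + hm_ract Y \<xi> c"
  using clinear_on_add[OF ract_linear_right] by blast
lemma ract_scale_right: "\<lbrakk>\<xi> \<in> hm_carrier Y; a \<in> cs_carrier A\<rbrakk> \<Longrightarrow>
    hm_ract Y \<xi> (c *\<^sub>C a) = c *\<^sub>C hm_ract Y \<xi> a"
  using clinear_on_scale[OF ract_linear_right] by blast

lemma ract_unit:
  assumes "is_unit A u" "\<xi> \<in> hm_carrier Y" shows "hm_ract Y \<xi> u = \<xi>"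
  by (rule inner_eqI) (use assms in \<open>auto simp: inner_ract is_unit_def\<close>)

lemma hm_adjoint_eq:
  assumes "adjoint_pair Y Z S T"
  shows "hm_adjoint Y Z S = (\<lambda>\<eta>. if \<eta> \<in> hm_carrier Z then T \<eta> else 0)"
  unfolding hm_adjoint_def
proof (rule the_equality)
  show "adjoint_pair Y Z S (\<lambda>\<eta>. if \<eta> \<in> hm_carrier Z then T \<eta> else 0) \<and>
    (\<forall>\<eta>. \<eta> \<notin> hm_carrier Z \<longrightarrow> (if \<eta> \<in> hm_carrier Z then T \<eta> else 0) = 0)"
    using assms by (auto simp: adjoint_pair_def)
next
  fix T' assume T': "adjoint_pair Y Z S T' \<and> (\<forall>\<eta>. \<eta> \<notin> hm_carrier Z \<longrightarrow> T' \<eta> = 0)"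
  show "T' = (\<lambda>\<eta>. if \<eta> \<in> hm_carrier Z then T \<eta> else 0)"
  proof
    fix \<eta> show "T' \<eta> = (if \<eta> \<in> hm_carrier Z then T \<eta> else 0)"
    proof (cases "\<eta> \<in> hm_carrier Z")
      case True
      have "T' \<eta> = T \<eta>"
        by (rule inner_eqI) (use assms T' True in \<open>auto simp: adjoint_pair_def image_subset_iff\<close>)
      then show ?thesis using True by simp
    qed (use T' in simp)
  qed
qed

lemma adjointablesE:
  assumes "S \<in> adjointables Y"
  obtains T where "adjoint_pair Y Y S T" "\<And>\<xi>. \<xi> \<notin> hm_carrier Y \<Longrightarrow> T \<xi> = 0"
    "\<And>\<xi>. \<xi> \<notin> hm_carrier Y \<Longrightarrow> S \<xi> = 0" "T = hm_adjoint Y Y S" "T \<in> adjointables Y"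
proof -
  obtain T where T: "adjoint_pair Y Y S T" and S: "\<And>\<xi>. \<xi> \<notin> hm_carrier Y \<Longrightarrow> S \<xi> = 0"
    using assms by (auto simp: adjointables_def)
  define T' where "T' = hm_adjoint Y Y S"
  have T': "T' = (\<lambda>\<eta>. if \<eta> \<in> hm_carrier Y then T \<eta> else 0)"
    unfolding T'_def by (rule hm_adjoint_eq[OF T])
  have "adjoint_pair Y Y S T'" using T by (auto simp: adjoint_pair_def T')
  moreover have "adjoint_pair Y Y T' S"
    using T unfolding adjoint_pair_def T'
    by (auto simp: image_subset_iff) (metis inner_star)
  moreover have "T' \<xi> = 0" if "\<xi> \<notin> hm_carrier Y" for \<xi> using that by (simp add: T')
  ultimately show ?thesis using S that[OF _ _ S T'_def] by (auto simp: adjointables_def)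
qed

end

lemma adjoint_pairD:
  assumes "adjoint_pair Y Z S T"
  shows "\<xi> \<in> hm_carrier Y \<Longrightarrow> S \<xi> \<in> hm_carrier Z" "\<eta> \<in> hm_carrier Z \<Longrightarrow> T \<eta> \<in> hm_carrier Y"
    "\<xi> \<in> hm_carrier Y \<Longrightarrow> \<eta> \<in> hm_carrier Z \<Longrightarrow> hm_inner Z (S \<xi>) \<eta> = hm_inner Y \<xi> (T \<eta>)"
  using assms by (auto simp: adjoint_pair_def)

context hilbert_module
begin

lemma adjoint_pair_swap:
  assumes T: "adjoint_pair Y Y S T" shows "adjoint_pair Y Y T S"
  unfolding adjoint_pair_def
proof (intro conjI ballI)
  fix \<xi> \<eta> assume "\<xi> \<in> hm_carrier Y" "\<eta> \<in> hm_carrier Y"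
  then show "hm_inner Y (T \<xi>) \<eta> = hm_inner Y \<xi> (S \<eta>)"
    using adjoint_pairD[OF T] by (metis inner_star)
qed (use adjoint_pairD[OF T] in auto)

text \<open>Linearity and compatibility with the right action are not part of
  \<open>adjointables\<close>; the existence of an adjoint forces them, by comparing inner products
  with all vectors.\<close>

lemma adjointable_linear:
  assumes "S \<in> adjointables Y"
  shows "\<xi> \<in> hm_carrier Y \<Longrightarrow> S \<xi> \<in> hm_carrier Y"
    and "clinear_on (hm_carrier Y) S"
    and "\<xi> \<in> hm_carrier Y \<Longrightarrow> a \<in> cs_carrier A \<Longrightarrow> S (hm_ract Y \<xi> a) = hm_ract Y (S \<xi>) a"
proof -
  obtain T where T: "adjoint_pair Y Y S T" by (rule adjointablesE[OF assms]) blast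
  note D = adjoint_pairD[OF adjoint_pair_swap[OF T]]
  show "S \<xi> \<in> hm_carrier Y" if "\<xi> \<in> hm_carrier Y" for \<xi> using D(2) that .
  have add: "S (\<xi> + \<eta>) = S \<xi> + S \<eta>" if "\<xi> \<in> hm_carrier Y" "\<eta> \<in> hm_carrier Y" for \<xi> \<eta>
    by (rule inner_eqI) (use that D in \<open>simp_all add: inner_add_right flip: D(3)\<close>)
  have scale: "S (c *\<^sub>C \<xi>) = c *\<^sub>C S \<xi>" if "\<xi> \<in> hm_carrier Y" for c \<xi>
    by (rule inner_eqI) (use that D in \<open>simp_all add: inner_scale_right flip: D(3)\<close>)
  show "clinear_on (hm_carrier Y) S" using add scale by (simp add: clinear_on_def)
  show "S (hm_ract Y \<xi> a) = hm_ract Y (S \<xi>) a" if "\<xi> \<in> hm_carrier Y" "a \<in> cs_carrier A"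
    by (rule inner_eqI) (use that D in \<open>simp_all add: inner_ract flip: D(3)\<close>)
qed

lemma adjointables_add:
  assumes "S \<in> adjointables Y" "T \<in> adjointables Y" shows "S + T \<in> adjointables Y"
proof -
  obtain S' where S: "adjoint_pair Y Y S S'" "\<And>\<xi>. \<xi> \<notin> hm_carrier Y \<Longrightarrow> S \<xi> = 0" by (rule adjointablesE[OF assms(1)]) blast
  obtain T' where T: "adjoint_pair Y Y T T'" "\<And>\<xi>. \<xi> \<notin> hm_carrier Y \<Longrightarrow> T \<xi> = 0" by (rule adjointablesE[OF assms(2)]) blast
  have "adjoint_pair Y Y (S + T) (\<lambda>\<xi>. S' \<xi> + T' \<xi>)"
    using adjoint_pairD[OF S(1)] adjoint_pairD[OF T(1)]
    by (auto simp: adjoint_pair_def inner_add_left inner_add_right)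
  then show ?thesis using S(2) T(2) by (auto simp: adjointables_def)
qed

lemma adjointables_scale:
  assumes "S \<in> adjointables Y" shows "c *\<^sub>C S \<in> adjointables Y"
proof -
  obtain S' where S: "adjoint_pair Y Y S S'" "\<And>\<xi>. \<xi> \<notin> hm_carrier Y \<Longrightarrow> S \<xi> = 0" by (rule adjointablesE[OF assms(1)]) blast
  have "adjoint_pair Y Y (c *\<^sub>C S) (\<lambda>\<xi>. cnj c *\<^sub>C S' \<xi>)"
    using adjoint_pairD[OF S(1)]
    by (auto simp: adjoint_pair_def scaleC_fun_def inner_scale_left inner_scale_right)
  then show ?thesis using S(2) by (auto simp: adjointables_def scaleC_fun_def)
qed

lemma adjointables_zero: "0 \<in> adjointables Y"
  by (auto simp: adjointables_def adjoint_pair_def intro!: exI[of _ "\<lambda>_. 0"])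

lemma adjointables_subspace: "csubspace (adjointables Y)"
  by (simp add: complex_vector.subspace_def adjointables_zero adjointables_add adjointables_scale)

lemma adjointables_comp:
  assumes "S \<in> adjointables Y" "T \<in> adjointables Y" shows "S \<circ> T \<in> adjointables Y"
proof -
  obtain S' where S: "adjoint_pair Y Y S S'" "\<And>\<xi>. \<xi> \<notin> hm_carrier Y \<Longrightarrow> S \<xi> = 0" by (rule adjointablesE[OF assms(1)]) blast
  obtain T' where T: "adjoint_pair Y Y T T'" "\<And>\<xi>. \<xi> \<notin> hm_carrier Y \<Longrightarrow> T \<xi> = 0" by (rule adjointablesE[OF assms(2)]) blast
  have "adjoint_pair Y Y (S \<circ> T) (T' \<circ> S')"
    using adjoint_pairD[OF S(1)] adjoint_pairD[OF T(1)] by (auto simp: adjoint_pair_def)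
  moreover have "S 0 = 0" using clinear_on_zero[OF adjointable_linear(2)[OF assms(1)] module_subspace] .
  ultimately show ?thesis using T(2) by (auto simp: adjointables_def)
qed

lemma rank_one_adjoint_pair:
  assumes "\<xi> \<in> hm_carrier Y" "\<eta> \<in> hm_carrier Y"
  shows "adjoint_pair Y Y (rank_one Y \<xi> \<eta>) (rank_one Y \<eta> \<xi>)"
proof -
  have "cs_mult A (cs_star A (hm_inner Y \<eta> \<zeta>)) (hm_inner Y \<xi> \<zeta>') = cs_mult A (hm_inner Y \<zeta> \<eta>) (hm_inner Y \<xi> \<zeta>')"
    if "\<zeta> \<in> hm_carrier Y" for \<zeta> \<zeta>' using that assms by (simp add: inner_star)
  then show ?thesis using assms
    by (auto simp: adjoint_pair_def rank_one_def inner_ract inner_ract_left)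
qed

lemma rank_one_adjointable:
  "\<xi> \<in> hm_carrier Y \<Longrightarrow> \<eta> \<in> hm_carrier Y \<Longrightarrow> rank_one Y \<xi> \<eta> \<in> adjointables Y"
  using rank_one_adjoint_pair[of \<xi> \<eta>] by (auto simp: adjointables_def rank_one_def)

lemma compacts_subset: "compacts A Y \<subseteq> adjointables Y"
  by (auto simp: compacts_def closure_wrt_def)

lemma op_norm_zero: "op_norm A Y 0 = 0"
proof -
  have "{\<xi> \<in> hm_carrier Y. hm_norm A Y \<xi> \<le> 1} \<noteq> {}"
    by (auto simp: hm_norm_def intro!: exI[of _ 0])
  then show ?thesis by (simp add: op_norm_def hm_norm_def)
qed

lemma span_rank_one_compacts:
  "cspan {rank_one Y \<xi> \<eta> |\<xi> \<eta>. \<xi> \<in> hm_carrier Y \<and> \<eta> \<in> hm_carrier Y} \<subseteq> compacts A Y"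
proof
  fix S assume S: "S \<in> cspan {rank_one Y \<xi> \<eta> |\<xi> \<eta>. \<xi> \<in> hm_carrier Y \<and> \<eta> \<in> hm_carrier Y}"
  moreover have "cspan {rank_one Y \<xi> \<eta> |\<xi> \<eta>. \<xi> \<in> hm_carrier Y \<and> \<eta> \<in> hm_carrier Y} \<subseteq> adjointables Y"
    by (rule complex_vector.span_minimal[OF _ adjointables_subspace]) (auto simp: rank_one_adjointable)
  ultimately show "S \<in> compacts A Y"
    by (auto simp: compacts_def closure_wrt_def op_norm_zero intro!: bexI[of _ S])
qed

end

context hilbert_bimodule
begin

lemma left_op_adjointable: "a \<in> cs_carrier A \<Longrightarrow> left_op Y a \<in> adjointables Y"
  using left_action by (auto simp: star_hom_def adjointable_alg_def)

lemma lact_closed [simp]: "a \<in> cs_carrier A \<Longrightarrow> \<xi> \<in> hm_carrier Y \<Longrightarrow> hm_lact Y a \<xi> \<in> hm_carrier Y"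
  using adjointable_linear(1)[OF left_op_adjointable, of a \<xi>] by (simp add: left_op_def)

lemma lact_linear_right: "a \<in> cs_carrier A \<Longrightarrow> clinear_on (hm_carrier Y) (hm_lact Y a)"
  using adjointable_linear(2)[OF left_op_adjointable, of a] by (simp add: left_op_def clinear_on_def)

lemma lact_linear_left: assumes "\<xi> \<in> hm_carrier Y" shows "clinear_on (cs_carrier A) (\<lambda>a. hm_lact Y a \<xi>)"
proof -
  have "clinear_on (cs_carrier A) (left_op Y)" using left_action by (simp add: star_hom_def)
  then have "left_op Y (a + c) \<xi> = (left_op Y a + left_op Y c) \<xi>" "left_op Y (k *\<^sub>C a) \<xi> = (k *\<^sub>C left_op Y a) \<xi>"
    if "a \<in> cs_carrier A" "c \<in> cs_carrier A" for a c k using that by (simp_all add: clinear_on_def)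
  then show ?thesis using assms unfolding clinear_on_def by (simp add: left_op_def scaleC_fun_def)
qed

lemma lact_mult: "\<lbrakk>a \<in> cs_carrier A; c \<in> cs_carrier A; \<xi> \<in> hm_carrier Y\<rbrakk> \<Longrightarrow>
    hm_lact Y (cs_mult A a c) \<xi> = hm_lact Y a (hm_lact Y c \<xi>)"
proof -
  assume a: "a \<in> cs_carrier A" "c \<in> cs_carrier A" "\<xi> \<in> hm_carrier Y"
  then have "left_op Y (cs_mult A a c) = left_op Y a \<circ> left_op Y c"
    using left_action by (simp add: star_hom_def adjointable_alg_def)
  from fun_cong[OF this, of \<xi>] show ?thesis using a by (simp add: left_op_def)
qed

lemma inner_lact: "\<lbrakk>a \<in> cs_carrier A; \<xi> \<in> hm_carrier Y; \<eta> \<in> hm_carrier Y\<rbrakk> \<Longrightarrow>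
    hm_inner Y (hm_lact Y a \<xi>) \<eta> = hm_inner Y \<xi> (hm_lact Y (cs_star A a) \<eta>)"
proof -
  assume a: "a \<in> cs_carrier A" "\<xi> \<in> hm_carrier Y" "\<eta> \<in> hm_carrier Y"
  have *: "left_op Y (cs_star A a) = hm_adjoint Y Y (left_op Y a)"
    using left_action a by (simp add: star_hom_def adjointable_alg_def)
  obtain T where "adjoint_pair Y Y (left_op Y a) T" "T = hm_adjoint Y Y (left_op Y a)"
    by (rule adjointablesE[OF left_op_adjointable[OF a(1)]])
  then have "adjoint_pair Y Y (left_op Y a) (left_op Y (cs_star A a))" by (simp add: *)
  from adjoint_pairD(3)[OF this a(2,3)] show ?thesis using a by (simp add: left_op_def)
qed

lemma lact_add_left: "\<lbrakk>a \<in> cs_carrier A; c \<in> cs_carrier A; \<xi> \<in> hm_carrier Y\<rbrakk> \<Longrightarrow>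
    hm_lact Y (a + c) \<xi> = hm_lact Y a \<xi> + hm_lact Y c \<xi>"
  using clinear_on_add[OF lact_linear_left] by blast
lemma lact_scale_left: "\<lbrakk>a \<in> cs_carrier A; \<xi> \<in> hm_carrier Y\<rbrakk> \<Longrightarrow>
    hm_lact Y (c *\<^sub>C a) \<xi> = c *\<^sub>C hm_lact Y a \<xi>"
  using clinear_on_scale[OF lact_linear_left] by blast
lemma lact_sum_right: "\<lbrakk>a \<in> cs_carrier A; \<And>i. i \<in> I \<Longrightarrow> x i \<in> hm_carrier Y\<rbrakk> \<Longrightarrow>
    hm_lact Y a (\<Sum>i\<in>I. x i) = (\<Sum>i\<in>I. hm_lact Y a (x i))"
  using clinear_on_sum[OF lact_linear_right module_subspace] by blast

end


section \<open>Product systems of finite type\<close>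

locale finite_type_product_system = finite_type_system A X n b m
  for A :: "'u::complex_vector cstar"
    and X :: "('g::lattice_ab_group_add, 'u, 't::complex_vector) prod_sys"
    and n b m +
  assumes assoc: "associative_ps X" and bij: "bijective_maps n m"
begin

abbreviation "one \<equiv> cs_one A"

lemma is_unit_one: "is_unit A one"
  using unit_exists cs_one_eq by metis

lemma one_closed [simp]: "one \<in> cs_carrier A" and one_mult [simp]: "a \<in> cs_carrier A \<Longrightarrow> cs_mult A one a = a"
  using is_unit_one by (auto simp: is_unit_def)

lemma star_one [simp]: "cs_star A one = one"
  by (rule star_unit[OF is_unit_one])

lemma fib_module: "0 \<le> s \<Longrightarrow> hilbert_module A (ps_fib X s)"
  using fib_bimodule hilbert_bimodule.axioms(1) by blast

lemmas fib_closed [simp] =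
  hilbert_module.hm_zero[OF fib_module] hilbert_module.hm_add[OF fib_module] hilbert_module.hm_diff[OF fib_module]
  hilbert_module.hm_scale[OF fib_module] hilbert_module.ract_closed[OF fib_module]
  hilbert_module.inner_closed[OF fib_module] hilbert_bimodule.lact_closed[OF fib_bimodule]

declare b_carrier [simp]

lemmas fib_sum = hilbert_module.hm_sum[OF fib_module]

lemma carrier_0 [simp]: "ps_carrier X 0 = cs_carrier A"
  and inner_0: "ps_inner X 0 a c = cs_mult A (cs_star A a) c"
  and lact_0: "ps_lact X 0 a c = cs_mult A a c"
  by (simp_all add: fib_0 trivial_bimodule_def)

text \<open>Right generation provides some coefficients; pairing with \<open>b s k\<close> isolates
  the \<open>k\<close>-th one by orthonormality.\<close>

lemma expand:
  assumes s: "0 \<le> s" and \<xi>: "\<xi> \<in> ps_carrier X s"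
  shows "\<xi> = (\<Sum>j<n s. ps_ract X s (b s j) (ps_inner X s (b s j) \<xi>))"
proof -
  interpret H: hilbert_module A "ps_fib X s" by (rule fib_module[OF s])
  obtain a where a: "\<And>j. j < n s \<Longrightarrow> a j \<in> cs_carrier A" "\<xi> = (\<Sum>j<n s. ps_ract X s (b s j) (a j))"
    using \<xi> right_generating[OF s] by auto
  have "ps_inner X s (b s k) \<xi> = a k" if k: "k < n s" for k
  proof -
    have "ps_inner X s (b s k) \<xi> = (\<Sum>j<n s. cs_mult A (ps_inner X s (b s k) (b s j)) (a j))"
      unfolding a(2) using k s a(1) by (subst H.inner_sum_right) (simp_all add: H.inner_ract)
    also have "\<dots> = (\<Sum>j<n s. if k = j then a j else 0)"
      using k s a(1) by (intro sum.cong) (auto simp: orthonormal)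
    also have "\<dots> = a k" using k by simp
    finally show ?thesis .
  qed
  then show ?thesis using a(2) by simp
qed

text \<open>A left action is not unital by definition. Left generation writes \<open>\<xi>\<close>
  as a sum of elements \<open>a_j b_j\<close>, and the unit is absorbed by the
  \<open>a_j\<close>.\<close>

lemma lact_one [simp]:
  assumes s: "0 \<le> s" and \<xi>: "\<xi> \<in> ps_carrier X s" shows "ps_lact X s one \<xi> = \<xi>"
proof -
  interpret H: hilbert_bimodule A "ps_fib X s" by (rule fib_bimodule[OF s])
  obtain a where a: "\<And>j. j < n s \<Longrightarrow> a j \<in> cs_carrier A" "\<xi> = (\<Sum>j<n s. ps_lact X s (a j) (b s j))"
    using \<xi> left_generating[OF s] by auto
  show ?thesis unfolding a(2) using s a(1) by (subst H.lact_sum_right) (simp_all flip: H.lact_mult)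
qed

lemma ract_one [simp]: "0 \<le> s \<Longrightarrow> \<xi> \<in> ps_carrier X s \<Longrightarrow> ps_ract X s \<xi> one = \<xi>"
  using hilbert_module.ract_unit[OF fib_module is_unit_one] by blast

lemma nonneg_cases:
  fixes s :: 'g assumes "0 \<le> s" obtains "s = 0" | "0 < s"
  using assms by (metis order_le_less)

text \<open>A factor of degree \<open>0\<close> acts through the module structure, while for two
  positive degrees everything is transported from the balanced tensor product along
  \<open>F\<close>. Afterwards tensor products reappear only in \<open>ps_incl_eq\<close>.\<close>

lemma mult_props:
  assumes s: "0 \<le> s" and r: "0 \<le> r"
  shows "\<lbrakk>\<xi> \<in> ps_carrier X s; \<eta> \<in> ps_carrier X r\<rbrakk> \<Longrightarrow> ps_mult X s r \<xi> \<eta> \<in> ps_carrier X (s + r)"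
    and "\<eta> \<in> ps_carrier X r \<Longrightarrow> clinear_on (ps_carrier X s) (\<lambda>\<xi>. ps_mult X s r \<xi> \<eta>)"
    and "\<xi> \<in> ps_carrier X s \<Longrightarrow> clinear_on (ps_carrier X r) (ps_mult X s r \<xi>)"
    and "\<lbrakk>\<xi>\<^sub>1 \<in> ps_carrier X s; \<eta>\<^sub>1 \<in> ps_carrier X r; \<xi>\<^sub>2 \<in> ps_carrier X s; \<eta>\<^sub>2 \<in> ps_carrier X r\<rbrakk> \<Longrightarrow>
      ps_inner X (s + r) (ps_mult X s r \<xi>\<^sub>1 \<eta>\<^sub>1) (ps_mult X s r \<xi>\<^sub>2 \<eta>\<^sub>2) =
      ps_inner X r (ps_lact X r (ps_inner X s \<xi>\<^sub>2 \<xi>\<^sub>1) \<eta>\<^sub>1) \<eta>\<^sub>2"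
proof -
  interpret R: hilbert_bimodule A "ps_fib X r" by (rule fib_bimodule[OF r])
  interpret S: hilbert_bimodule A "ps_fib X s" by (rule fib_bimodule[OF s])
  consider "s = 0" | "0 < s" "r = 0" | "0 < s" "0 < r" using s r nonneg_cases by metis
  then have "(\<forall>\<xi>\<in>ps_carrier X s. \<forall>\<eta>\<in>ps_carrier X r. ps_mult X s r \<xi> \<eta> \<in> ps_carrier X (s + r)) \<and>
    (\<forall>\<eta>\<in>ps_carrier X r. clinear_on (ps_carrier X s) (\<lambda>\<xi>. ps_mult X s r \<xi> \<eta>)) \<and>
    (\<forall>\<xi>\<in>ps_carrier X s. clinear_on (ps_carrier X r) (ps_mult X s r \<xi>)) \<and>
    (\<forall>\<xi>\<^sub>1\<in>ps_carrier X s. \<forall>\<eta>\<^sub>1\<in>ps_carrier X r. \<forall>\<xi>\<^sub>2\<in>ps_carrier X s. \<forall>\<eta>\<^sub>2\<in>ps_carrier X r.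
      ps_inner X (s + r) (ps_mult X s r \<xi>\<^sub>1 \<eta>\<^sub>1) (ps_mult X s r \<xi>\<^sub>2 \<eta>\<^sub>2) =
      ps_inner X r (ps_lact X r (ps_inner X s \<xi>\<^sub>2 \<xi>\<^sub>1) \<eta>\<^sub>1) \<eta>\<^sub>2)"
  proof cases
    case 1
    have m: "ps_mult X 0 r a \<xi> = ps_lact X r a \<xi>" if "a \<in> cs_carrier A" "\<xi> \<in> ps_carrier X r" for a \<xi>
      using mult_0_left[OF r that] .
    have lin: "clinear_on (cs_carrier A) (\<lambda>a. ps_mult X 0 r a \<eta>)" if "\<eta> \<in> ps_carrier X r" for \<eta>
      using R.lact_linear_left[OF that] that by (simp add: clinear_on_def m)
    have lin2: "clinear_on (ps_carrier X r) (ps_mult X 0 r a)" if "a \<in> cs_carrier A" for a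
      using R.lact_linear_right[OF that] that by (simp add: clinear_on_def m)
    show ?thesis unfolding 1
      by (auto simp: lin lin2) (simp_all add: m R.inner_lact inner_0 R.lact_mult star_mult)
  next
    case 2
    have m: "ps_mult X s 0 \<xi> a = ps_ract X s \<xi> a" if "a \<in> cs_carrier A" "\<xi> \<in> ps_carrier X s" for a \<xi>
      using mult_0_right[OF s that] .
    have lin: "clinear_on (ps_carrier X s) (\<lambda>\<xi>. ps_mult X s 0 \<xi> a)" if "a \<in> cs_carrier A" for a
      using S.ract_linear_left[OF that] that by (simp add: clinear_on_def m)
    have lin2: "clinear_on (cs_carrier A) (ps_mult X s 0 \<xi>)" if "\<xi> \<in> ps_carrier X s" for \<xi>
      using S.ract_linear_right[OF that] that by (simp add: clinear_on_def m)
    show ?thesis unfolding 2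
      by (auto simp: lin lin2)
        (simp_all add: m S.inner_ract S.inner_ract_left inner_0 lact_0 star_mult S.inner_star mult_assoc)
  next
    case 3
    interpret T: balanced_tensor_product A "ps_fib X s" "ps_fib X r" "ps_tensor X s r" "ps_tens X s r"
      by (rule tensor_product[OF 3])
    note F = F_iso[OF 3, unfolded bimodule_iso_def]
    have m: "ps_mult X s r \<xi> \<eta> = ps_F X s r (ps_tens X s r \<xi> \<eta>)" if "\<xi> \<in> ps_carrier X s" "\<eta> \<in> ps_carrier X r" for \<xi> \<eta>
      using F_tens[OF 3 that] by simp
    have Fc: "ps_F X s r t \<in> ps_carrier X (s + r)" if "t \<in> hm_carrier (ps_tensor X s r)" for t
      using F that by (auto simp: bij_betw_def)
    have Fl: "clinear_on (hm_carrier (ps_tensor X s r)) (ps_F X s r)" using F by blast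
    have lin: "clinear_on (ps_carrier X s) (\<lambda>\<xi>. ps_mult X s r \<xi> \<eta>)" if "\<eta> \<in> ps_carrier X r" for \<eta>
      using T.tensor_linear_left[OF that] that Fl by (simp add: clinear_on_def m T.tensor_closed)
    have lin2: "clinear_on (ps_carrier X r) (ps_mult X s r \<xi>)" if "\<xi> \<in> ps_carrier X s" for \<xi>
      using T.tensor_linear_right[OF that] that Fl by (simp add: clinear_on_def m T.tensor_closed)
    show ?thesis
      by (auto simp: lin lin2) (use F in \<open>simp_all add: m Fc T.tensor_closed T.tensor_inner\<close>)
  qed
  then show "\<lbrakk>\<xi> \<in> ps_carrier X s; \<eta> \<in> ps_carrier X r\<rbrakk> \<Longrightarrow> ps_mult X s r \<xi> \<eta> \<in> ps_carrier X (s + r)"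
    and "\<eta> \<in> ps_carrier X r \<Longrightarrow> clinear_on (ps_carrier X s) (\<lambda>\<xi>. ps_mult X s r \<xi> \<eta>)"
    and "\<xi> \<in> ps_carrier X s \<Longrightarrow> clinear_on (ps_carrier X r) (ps_mult X s r \<xi>)"
    and "\<lbrakk>\<xi>\<^sub>1 \<in> ps_carrier X s; \<eta>\<^sub>1 \<in> ps_carrier X r; \<xi>\<^sub>2 \<in> ps_carrier X s; \<eta>\<^sub>2 \<in> ps_carrier X r\<rbrakk> \<Longrightarrow>
      ps_inner X (s + r) (ps_mult X s r \<xi>\<^sub>1 \<eta>\<^sub>1) (ps_mult X s r \<xi>\<^sub>2 \<eta>\<^sub>2) =
      ps_inner X r (ps_lact X r (ps_inner X s \<xi>\<^sub>2 \<xi>\<^sub>1) \<eta>\<^sub>1) \<eta>\<^sub>2"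
    by blast+
qed

lemmas ps_mult_closed [simp] = mult_props(1)
lemmas ps_mult_linear_left = mult_props(2)
lemmas ps_mult_linear_right = mult_props(3)
lemmas inner_ps_mult = mult_props(4)

section \<open>Products of fibres and their span\<close>

lemma fib_subspace: "0 \<le> s \<Longrightarrow> csubspace (ps_carrier X s)"
  using hilbert_module.module_subspace[OF fib_module] .

lemma ps_mult_assoc:
  "\<lbrakk>0 \<le> s; 0 \<le> r; 0 \<le> q; \<xi> \<in> ps_carrier X s; \<eta> \<in> ps_carrier X r; \<zeta> \<in> ps_carrier X q\<rbrakk> \<Longrightarrow>
    ps_mult X (s + r) q (ps_mult X s r \<xi> \<eta>) \<zeta> = ps_mult X s (r + q) \<xi> (ps_mult X r q \<eta> \<zeta>)"
  using assoc unfolding associative_ps_def by blast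

text \<open>Associativity with the third factor in degree \<open>0\<close>; the next lemma puts
  degree \<open>0\<close> in the middle.\<close>

lemma ps_mult_ract: "\<lbrakk>0 \<le> s; 0 \<le> r; \<xi> \<in> ps_carrier X s; \<eta> \<in> ps_carrier X r; a \<in> cs_carrier A\<rbrakk> \<Longrightarrow>
    ps_mult X s r \<xi> (ps_ract X r \<eta> a) = ps_ract X (s + r) (ps_mult X s r \<xi> \<eta>) a"
  using ps_mult_assoc[of s r 0 \<xi> \<eta> a] by (simp add: mult_0_right)

lemma ps_ract_mult: "\<lbrakk>0 \<le> s; 0 \<le> r; \<xi> \<in> ps_carrier X s; \<eta> \<in> ps_carrier X r; a \<in> cs_carrier A\<rbrakk> \<Longrightarrow>
    ps_mult X s r (ps_ract X s \<xi> a) \<eta> = ps_mult X s r \<xi> (ps_lact X r a \<eta>)"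
  using ps_mult_assoc[of s 0 r \<xi> a \<eta>] by (simp add: mult_0_right mult_0_left)

lemma ps_mult_sum_right: "\<lbrakk>0 \<le> s; 0 \<le> r; \<xi> \<in> ps_carrier X s; \<And>i. i \<in> I \<Longrightarrow> x i \<in> ps_carrier X r\<rbrakk> \<Longrightarrow>
    ps_mult X s r \<xi> (\<Sum>i\<in>I. x i) = (\<Sum>i\<in>I. ps_mult X s r \<xi> (x i))"
  using clinear_on_sum[OF ps_mult_linear_right fib_subspace] by blast

lemma ps_mult_sum_left: "\<lbrakk>0 \<le> s; 0 \<le> r; \<xi> \<in> ps_carrier X r; \<And>i. i \<in> I \<Longrightarrow> x i \<in> ps_carrier X s\<rbrakk> \<Longrightarrow>
    ps_mult X s r (\<Sum>i\<in>I. x i) \<xi> = (\<Sum>i\<in>I. ps_mult X s r (x i) \<xi>)"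
  using clinear_on_sum[OF ps_mult_linear_left fib_subspace] by blast

lemma b_add_eq:
  assumes "0 \<le> s" "0 \<le> r" "i < n (s + r)"
  obtains j k where "j < n s" "k < n r" "m s r (j, k) = i" "b (s + r) i = ps_mult X s r (b s j) (b r k)"
proof -
  have "m s r ` ({..<n s} \<times> {..<n r}) = {..<n (s + r)}"
    using bij assms by (auto simp: bijective_maps_def bij_betw_def)
  then have "i \<in> m s r ` ({..<n s} \<times> {..<n r})" using assms(3) by simp
  then obtain j k where "j < n s" "k < n r" "m s r (j, k) = i" by blast
  then show ?thesis using that b_mult assms by simp
qed

text \<open>By surjectivity of \<open>m s r\<close> each basis vector of \<open>X (s + r)\<close> is
  a product of basis vectors, and its coefficient is moved into the second factor.\<close>

lemma sum_of_products:
  assumes s: "0 \<le> s" and r: "0 \<le> r" and w: "w \<in> ps_carrier X (s + r)"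
  obtains \<eta> \<zeta> where "\<And>i. i < n (s + r) \<Longrightarrow> \<eta> i \<in> ps_carrier X s"
    "\<And>i. i < n (s + r) \<Longrightarrow> \<zeta> i \<in> ps_carrier X r"
    "w = (\<Sum>i<n (s + r). ps_mult X s r (\<eta> i) (\<zeta> i))"
proof -
  have sr: "0 \<le> s + r" using s r by simp
  define a where "a i = ps_inner X (s + r) (b (s + r) i) w" for i
  have a: "a i \<in> cs_carrier A" if "i < n (s + r)" for i using that sr w by (simp add: a_def)
  have "\<forall>i. \<exists>\<eta> \<zeta>. i < n (s + r) \<longrightarrow> \<eta> \<in> ps_carrier X s \<and> \<zeta> \<in> ps_carrier X r \<and>
      ps_ract X (s + r) (b (s + r) i) (a i) = ps_mult X s r \<eta> \<zeta>"
  proof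
    fix i show "\<exists>\<eta> \<zeta>. i < n (s + r) \<longrightarrow> \<eta> \<in> ps_carrier X s \<and> \<zeta> \<in> ps_carrier X r \<and>
      ps_ract X (s + r) (b (s + r) i) (a i) = ps_mult X s r \<eta> \<zeta>"
    proof (cases "i < n (s + r)")
      case True
      obtain j k where jk: "j < n s" "k < n r" "b (s + r) i = ps_mult X s r (b s j) (b r k)"
        by (rule b_add_eq[OF s r True])
      show ?thesis
        using jk s r a[OF True] ps_mult_ract[OF s r, of "b s j" "b r k" "a i"]
        by (intro exI[of _ "b s j"] exI[of _ "ps_ract X r (b r k) (a i)"]) simp
    qed blast
  qed
  then obtain \<eta> \<zeta> where *: "\<And>i. i < n (s + r) \<Longrightarrow> \<eta> i \<in> ps_carrier X s \<and> \<zeta> i \<in> ps_carrier X r \<and>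
      ps_ract X (s + r) (b (s + r) i) (a i) = ps_mult X s r (\<eta> i) (\<zeta> i)" by metis
  show ?thesis
    by (rule that[of \<eta> \<zeta>]) (use * expand[OF sr w] in \<open>auto simp: a_def\<close>)
qed

text \<open>Products span the fibre algebraically, so linear maps can be compared on them without
  any continuity.\<close>

lemma eq_on_products:
  assumes s: "0 \<le> s" and r: "0 \<le> r" and f: "clinear_on (ps_carrier X (s + r)) f"
    and g: "clinear_on (ps_carrier X (s + r)) g"
    and eq: "\<And>\<eta> \<zeta>. \<eta> \<in> ps_carrier X s \<Longrightarrow> \<zeta> \<in> ps_carrier X r \<Longrightarrow> f (ps_mult X s r \<eta> \<zeta>) = g (ps_mult X s r \<eta> \<zeta>)"
    and w: "w \<in> ps_carrier X (s + r)"
  shows "f w = g w"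
proof -
  have sub: "csubspace (ps_carrier X (s + r))" using s r by (simp add: fib_subspace)
  obtain \<eta> \<zeta> where *: "\<And>i. i < n (s + r) \<Longrightarrow> \<eta> i \<in> ps_carrier X s"
    "\<And>i. i < n (s + r) \<Longrightarrow> \<zeta> i \<in> ps_carrier X r"
    "w = (\<Sum>i<n (s + r). ps_mult X s r (\<eta> i) (\<zeta> i))"
    by (rule sum_of_products[OF s r w]) blast
  show ?thesis unfolding *(3) using * s r
    by (subst clinear_on_sum[OF f sub], simp, subst clinear_on_sum[OF g sub]) (simp_all add: eq)
qed

text \<open>The adjoint of left multiplication by \<open>\<xi>\<close>.\<close>

definition contract :: "'g \<Rightarrow> 'g \<Rightarrow> 'u \<Rightarrow> 'u \<Rightarrow> 'u" where
  "contract s r \<xi> w = (\<Sum>k<n r. ps_ract X r (b r k) (ps_inner X (s + r) (ps_mult X s r \<xi> (b r k)) w))"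

lemma contract_closed [simp]:
  "\<lbrakk>0 \<le> s; 0 \<le> r; \<xi> \<in> ps_carrier X s; w \<in> ps_carrier X (s + r)\<rbrakk> \<Longrightarrow> contract s r \<xi> w \<in> ps_carrier X r"
  unfolding contract_def by (rule fib_sum) auto

lemma inner_contract:
  assumes s: "0 \<le> s" and r: "0 \<le> r" and \<xi>: "\<xi> \<in> ps_carrier X s"
    and \<zeta>: "\<zeta> \<in> ps_carrier X r" and w: "w \<in> ps_carrier X (s + r)"
  shows "ps_inner X r \<zeta> (contract s r \<xi> w) = ps_inner X (s + r) (ps_mult X s r \<xi> \<zeta>) w"
    and "ps_inner X r (contract s r \<xi> w) \<zeta> = ps_inner X (s + r) w (ps_mult X s r \<xi> \<zeta>)"
proof -
  interpret R: hilbert_module A "ps_fib X r" by (rule fib_module[OF r])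
  have sr: "0 \<le> s + r" using s r by simp
  interpret SR: hilbert_module A "ps_fib X (s + r)" by (rule fib_module[OF sr])
  have "ps_mult X s r \<xi> \<zeta> = ps_mult X s r \<xi> (\<Sum>k<n r. ps_ract X r (b r k) (ps_inner X r (b r k) \<zeta>))"
    using expand[OF r \<zeta>] by simp
  also have "\<dots> = (\<Sum>k<n r. ps_ract X (s + r) (ps_mult X s r \<xi> (b r k)) (ps_inner X r (b r k) \<zeta>))"
    using s r \<xi> \<zeta> by (subst ps_mult_sum_right) (simp_all add: ps_mult_ract)
  finally have "ps_inner X (s + r) (ps_mult X s r \<xi> \<zeta>) w =
      ps_inner X (s + r) (\<Sum>k<n r. ps_ract X (s + r) (ps_mult X s r \<xi> (b r k)) (ps_inner X r (b r k) \<zeta>)) w" by simp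
  also have "\<dots> = (\<Sum>k<n r. cs_mult A (cs_star A (ps_inner X r (b r k) \<zeta>)) (ps_inner X (s + r) (ps_mult X s r \<xi> (b r k)) w))"
    using s r \<xi> \<zeta> w by (subst SR.inner_sum_left) (simp_all add: SR.inner_ract_left)
  also have "\<dots> = (\<Sum>k<n r. cs_mult A (ps_inner X r \<zeta> (b r k)) (ps_inner X (s + r) (ps_mult X s r \<xi> (b r k)) w))"
    using r \<zeta> by (simp add: R.inner_star)
  also have "\<dots> = ps_inner X r \<zeta> (contract s r \<xi> w)"
    unfolding contract_def using s r \<xi> \<zeta> w by (subst R.inner_sum_right) (simp_all add: R.inner_ract)
  finally show 1: "ps_inner X r \<zeta> (contract s r \<xi> w) = ps_inner X (s + r) (ps_mult X s r \<xi> \<zeta>) w" by simp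
  then show "ps_inner X r (contract s r \<xi> w) \<zeta> = ps_inner X (s + r) w (ps_mult X s r \<xi> \<zeta>)"
    using s r \<xi> \<zeta> w by (metis R.inner_star SR.inner_star contract_closed ps_mult_closed)
qed

lemma contract_linear:
  assumes s: "0 \<le> s" and r: "0 \<le> r" and \<xi>: "\<xi> \<in> ps_carrier X s"
  shows "clinear_on (ps_carrier X (s + r)) (contract s r \<xi>)"
proof -
  interpret R: hilbert_module A "ps_fib X r" by (rule fib_module[OF r])
  have sr: "0 \<le> s + r" using s r by simp
  interpret SR: hilbert_module A "ps_fib X (s + r)" by (rule fib_module[OF sr])
  show ?thesis unfolding clinear_on_def contract_def
    using s r \<xi> by (auto simp: SR.inner_add_right R.ract_add_right sum.distrib SR.inner_scale_right
        R.ract_scale_right complex_vector.scale_sum_right intro!: sum.cong)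
qed

text \<open>Paired with any vector of \<open>X r\<close>, both sides reduce to the formula for the
  inner product of two products. This is the Toeplitz relation before any representation is
  chosen.\<close>

lemma contract_mult:
  assumes s: "0 \<le> s" and r: "0 \<le> r" and "\<xi> \<in> ps_carrier X s" "\<eta> \<in> ps_carrier X s" "\<zeta> \<in> ps_carrier X r"
  shows "contract s r \<xi> (ps_mult X s r \<eta> \<zeta>) = ps_lact X r (ps_inner X s \<xi> \<eta>) \<zeta>"
proof -
  interpret R: hilbert_bimodule A "ps_fib X r" by (rule fib_bimodule[OF r])
  interpret S: hilbert_bimodule A "ps_fib X s" by (rule fib_bimodule[OF s])
  show ?thesis
    by (rule R.inner_eqI)
      (use assms in \<open>simp_all add: inner_contract inner_ps_mult R.inner_lact S.inner_star\<close>)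
qed

text \<open>The operator \<open>i\<^sub>s\<^sup>s\<^sup>r(S)\<close> on \<open>X\<^sub>s\<^sub>r\<close>, which acts by \<open>\<eta>\<zeta> \<mapsto> (S\<eta>)\<zeta>\<close>.\<close>

definition amplify :: "'g \<Rightarrow> 'g \<Rightarrow> ('u \<Rightarrow> 'u) \<Rightarrow> 'u \<Rightarrow> 'u" where
  "amplify s r S w = (\<Sum>j<n s. ps_mult X s r (S (b s j)) (contract s r (b s j) w))"

lemma adjointable_closed [simp]:
  "0 \<le> s \<Longrightarrow> S \<in> adjointables (ps_fib X s) \<Longrightarrow> \<xi> \<in> ps_carrier X s \<Longrightarrow> S \<xi> \<in> ps_carrier X s"
  using hilbert_module.adjointable_linear(1)[OF fib_module] .

lemma adjointable_expand:
  assumes s: "0 \<le> s" and S: "S \<in> adjointables (ps_fib X s)" and \<xi>: "\<xi> \<in> ps_carrier X s"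
  shows "S \<xi> = (\<Sum>j<n s. ps_ract X s (S (b s j)) (ps_inner X s (b s j) \<xi>))"
proof -
  interpret H: hilbert_module A "ps_fib X s" by (rule fib_module[OF s])
  have "S \<xi> = S (\<Sum>j<n s. ps_ract X s (b s j) (ps_inner X s (b s j) \<xi>))" using expand[OF s \<xi>] by simp
  also have "\<dots> = (\<Sum>j<n s. ps_ract X s (S (b s j)) (ps_inner X s (b s j) \<xi>))" using s \<xi>
    by (subst clinear_on_sum[OF H.adjointable_linear(2)[OF S] H.module_subspace])
      (simp_all add: H.adjointable_linear(3)[OF S])
  finally show ?thesis .
qed

lemma amplify_closed [simp]:
  "\<lbrakk>0 \<le> s; 0 \<le> r; S \<in> adjointables (ps_fib X s); w \<in> ps_carrier X (s + r)\<rbrakk> \<Longrightarrow>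
    amplify s r S w \<in> ps_carrier X (s + r)"
  unfolding amplify_def by (rule fib_sum) auto

lemma amplify_linear:
  assumes s: "0 \<le> s" and r: "0 \<le> r" and S: "S \<in> adjointables (ps_fib X s)"
  shows "clinear_on (ps_carrier X (s + r)) (amplify s r S)"
  unfolding clinear_on_def amplify_def using s r S
  by (auto simp: clinear_on_add[OF contract_linear] clinear_on_scale[OF contract_linear]
      clinear_on_add[OF ps_mult_linear_right] clinear_on_scale[OF ps_mult_linear_right]
      sum.distrib complex_vector.scale_sum_right intro!: sum.cong)

lemma amplify_mult:
  assumes s: "0 \<le> s" and r: "0 \<le> r" and S: "S \<in> adjointables (ps_fib X s)"
    and "\<eta> \<in> ps_carrier X s" "\<zeta> \<in> ps_carrier X r"
  shows "amplify s r S (ps_mult X s r \<eta> \<zeta>) = ps_mult X s r (S \<eta>) \<zeta>"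
proof -
  have "ps_mult X s r (S \<eta>) \<zeta> = ps_mult X s r (\<Sum>j<n s. ps_ract X s (S (b s j)) (ps_inner X s (b s j) \<eta>)) \<zeta>"
    using adjointable_expand[OF s S] assms by simp
  also have "\<dots> = (\<Sum>j<n s. ps_mult X s r (S (b s j)) (ps_lact X r (ps_inner X s (b s j) \<eta>) \<zeta>))"
    using assms by (subst ps_mult_sum_left) (simp_all add: ps_ract_mult)
  finally show ?thesis using assms by (simp add: amplify_def contract_mult)
qed

text \<open>Transitivity of the inclusions of operator algebras: on a triple product both sides let
  \<open>S\<close> act on the factor in \<open>X s\<close> alone.\<close>

lemma amplify_amplify:
  assumes s: "0 \<le> s" and r: "0 \<le> r" and q: "0 \<le> q" and S: "S \<in> adjointables (ps_fib X s)"
    and \<eta>: "\<eta> \<in> ps_carrier X (s + r)" and \<zeta>: "\<zeta> \<in> ps_carrier X q"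
  shows "amplify s (r + q) S (ps_mult X (s + r) q \<eta> \<zeta>) = ps_mult X (s + r) q (amplify s r S \<eta>) \<zeta>"
proof (rule eq_on_products[OF s r _ _ _ \<eta>])
  have lin: "clinear_on (ps_carrier X (s + r)) (\<lambda>\<eta>. ps_mult X (s + r) q \<eta> \<zeta>)"
    using s r q \<zeta> by (intro ps_mult_linear_left) auto
  have cl: "ps_mult X (s + r) q \<eta> \<zeta> \<in> ps_carrier X (s + (r + q))" if "\<eta> \<in> ps_carrier X (s + r)" for \<eta>
    using ps_mult_closed[of "s + r" q \<eta> \<zeta>] s r q \<zeta> that by (simp add: add.assoc)
  show "clinear_on (ps_carrier X (s + r)) (\<lambda>\<eta>. amplify s (r + q) S (ps_mult X (s + r) q \<eta> \<zeta>))"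
    using lin amplify_linear[OF s _ S, of "r + q"] r q cl by (simp add: clinear_on_def)
  show "clinear_on (ps_carrier X (s + r)) (\<lambda>\<eta>. ps_mult X (s + r) q (amplify s r S \<eta>) \<zeta>)"
    using lin amplify_linear[OF s r S] amplify_closed[OF s r S] by (simp add: clinear_on_def)
next
  fix \<alpha> \<gamma> assume "\<alpha> \<in> ps_carrier X s" "\<gamma> \<in> ps_carrier X r"
  then show "amplify s (r + q) S (ps_mult X (s + r) q (ps_mult X s r \<alpha> \<gamma>) \<zeta>) =
      ps_mult X (s + r) q (amplify s r S (ps_mult X s r \<alpha> \<gamma>)) \<zeta>"
    using assms by (simp add: ps_mult_assoc amplify_mult)
qed

text \<open>On products the claim is the inner product formula together with the adjointness of
  \<open>S\<close> and \<open>T\<close>; linearity then extends it in one variable at a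
  time.\<close>

lemma inner_amplify:
  assumes s: "0 \<le> s" and r: "0 \<le> r" and T: "adjoint_pair (ps_fib X s) (ps_fib X s) S T"
    and S: "S \<in> adjointables (ps_fib X s)" and T': "T \<in> adjointables (ps_fib X s)"
    and v: "v \<in> ps_carrier X (s + r)" and w: "w \<in> ps_carrier X (s + r)"
  shows "ps_inner X (s + r) (amplify s r S v) w = ps_inner X (s + r) v (amplify s r T w)"
proof -
  have sr: "0 \<le> s + r" using s r by simp
  interpret S: hilbert_module A "ps_fib X s" by (rule fib_module[OF s])
  interpret SR: hilbert_module A "ps_fib X (s + r)" by (rule fib_module[OF sr])
  note lin = SR.inner_linear_right
  have 1: "ps_inner X (s + r) (amplify s r S (ps_mult X s r \<alpha> \<gamma>)) w = ps_inner X (s + r) (ps_mult X s r \<alpha> \<gamma>) (amplify s r T w)"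
    if \<alpha>: "\<alpha> \<in> ps_carrier X s" "\<gamma> \<in> ps_carrier X r" for \<alpha> \<gamma>
  proof (rule eq_on_products[OF s r _ _ _ w])
    show "clinear_on (ps_carrier X (s + r)) (ps_inner X (s + r) (amplify s r S (ps_mult X s r \<alpha> \<gamma>)))"
      using s r S \<alpha> by (intro lin) simp
    show "clinear_on (ps_carrier X (s + r)) (\<lambda>w. ps_inner X (s + r) (ps_mult X s r \<alpha> \<gamma>) (amplify s r T w))"
      using lin[of "ps_mult X s r \<alpha> \<gamma>"] amplify_linear[OF s r T'] amplify_closed[OF s r T'] \<alpha> s r
      by (simp add: clinear_on_def)
  next
    fix \<alpha>' \<gamma>' assume "\<alpha>' \<in> ps_carrier X s" "\<gamma>' \<in> ps_carrier X r"
    then show "ps_inner X (s + r) (amplify s r S (ps_mult X s r \<alpha> \<gamma>)) (ps_mult X s r \<alpha>' \<gamma>') =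
        ps_inner X (s + r) (ps_mult X s r \<alpha> \<gamma>) (amplify s r T (ps_mult X s r \<alpha>' \<gamma>'))"
      using \<alpha> s r S T' adjoint_pairD(3)[OF S.adjoint_pair_swap[OF T]]
      by (simp add: amplify_mult inner_ps_mult)
  qed
  \<comment> \<open>The inner product is linear only in its second variable, so \<open>v\<close> is
    placed there and the result is starred at the end.\<close>
  have "ps_inner X (s + r) w (amplify s r S v) = ps_inner X (s + r) (amplify s r T w) v"
  proof (rule eq_on_products[OF s r _ _ _ v])
    show "clinear_on (ps_carrier X (s + r)) (\<lambda>v. ps_inner X (s + r) w (amplify s r S v))"
      using lin[OF w] amplify_linear[OF s r S] amplify_closed[OF s r S] by (simp add: clinear_on_def)
    show "clinear_on (ps_carrier X (s + r)) (ps_inner X (s + r) (amplify s r T w))"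
      using s r T' w by (intro lin) simp
  next
    fix \<alpha> \<gamma> assume a: "\<alpha> \<in> ps_carrier X s" "\<gamma> \<in> ps_carrier X r"
    show "ps_inner X (s + r) w (amplify s r S (ps_mult X s r \<alpha> \<gamma>)) = ps_inner X (s + r) (amplify s r T w) (ps_mult X s r \<alpha> \<gamma>)"
      using arg_cong[OF 1[OF a], of "cs_star A"] a s r S T' w by (simp add: SR.inner_star)
  qed
  from arg_cong[OF this, of "cs_star A"] show ?thesis using v w s r S T' by (simp add: SR.inner_star)
qed

lemma amplify_adjoint_pair:
  assumes s: "0 \<le> s" and r: "0 \<le> r" and T: "adjoint_pair (ps_fib X s) (ps_fib X s) S T"
    and S: "S \<in> adjointables (ps_fib X s)" and T': "T \<in> adjointables (ps_fib X s)"
  shows "adjoint_pair (ps_fib X (s + r)) (ps_fib X (s + r)) (amplify s r S) (amplify s r T)"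
  using inner_amplify[OF s r T S T'] s r S T' by (auto simp: adjoint_pair_def)

text \<open>Replaces the definite descriptions behind \<open>ps_incl\<close> by a finite sum.
  Transported along \<open>F\<close>, any operator with the property required by
  \<open>tensor_op\<close> agrees with \<open>amplify s r S\<close> on products, and these
  span.\<close>

lemma ps_incl_eq:
  assumes s: "0 \<le> s" and r: "0 \<le> r" and S: "S \<in> adjointables (ps_fib X s)"
  shows "ps_incl A X s (s + r) S = (\<lambda>w. if w \<in> ps_carrier X (s + r) then amplify s r S w else 0)"
proof
  fix w
  interpret S: hilbert_module A "ps_fib X s" by (rule fib_module[OF s])
  obtain T where T: "adjoint_pair (ps_fib X s) (ps_fib X s) S T" "\<And>\<xi>. \<xi> \<notin> ps_carrier X s \<Longrightarrow> S \<xi> = 0"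
     "T \<in> adjointables (ps_fib X s)"
    by (rule S.adjointablesE[OF S]) blast
  consider "s = 0" | "0 < s" "r = 0" | "0 < s" "0 < r" using s r nonneg_cases by metis
  then show "ps_incl A X s (s + r) S w = (if w \<in> ps_carrier X (s + r) then amplify s r S w else 0)"
  proof cases
    case 1
    \<comment> \<open>With \<open>w\<close> written as the product of the unit and \<open>w\<close>,
      \<open>amplify\<close> becomes the left action of \<open>S one\<close>, which is how
      \<open>ps_incl\<close> reads an operator in degree \<open>0\<close>.\<close>
    have "amplify 0 r S w = ps_lact X r (S one) w" if w: "w \<in> ps_carrier X r"
      using amplify_mult[of 0 r S one w] adjointable_closed[of s S one] S w r 1
      by (simp add: mult_0_left)
    then show ?thesis by (simp add: 1 ps_incl_def left_op_def)
  next
    case 2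
    have "amplify s 0 S w = S w" if w: "w \<in> ps_carrier X s"
      using amplify_mult[OF s order_refl S w, of one] adjointable_closed[OF s S w] w s
      by (simp add: mult_0_right)
    moreover have "s \<noteq> 0" using 2 by auto
    ultimately show ?thesis using 2 T(2) by (simp add: ps_incl_def)
  next
    case 3
    interpret T: balanced_tensor_product A "ps_fib X s" "ps_fib X r" "ps_tensor X s r" "ps_tens X s r"
      by (rule tensor_product[OF 3])
    have sr: "0 \<le> s + r" using s r by simp
    interpret SR: hilbert_module A "ps_fib X (s + r)" by (rule fib_module[OF sr])
    define TT where "TT = ps_tensor X s r"
    define F where "F = ps_F X s r"
    \<comment> \<open>An isometric bijection has its inverse as adjoint, so \<open>G\<close> will
      replace \<open>hm_adjoint\<close>.\<close>
    define G where "G = inv_into (hm_carrier TT) F"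
    note F = F_iso[OF 3, unfolded bimodule_iso_def, folded TT_def F_def]
    have Fbij: "bij_betw F (hm_carrier TT) (ps_carrier X (s + r))" using F by blast
    have Fc: "F t \<in> ps_carrier X (s + r)" if "t \<in> hm_carrier TT" for t
      using Fbij that by (auto simp: bij_betw_def)
    have Gc: "G v \<in> hm_carrier TT" and FG: "F (G v) = v" if "v \<in> ps_carrier X (s + r)" for v
      using Fbij that by (auto simp: G_def bij_betw_def f_inv_into_f inv_into_into)
    have GF: "G (F t) = t" if "t \<in> hm_carrier TT" for t
      using Fbij that by (auto simp: G_def bij_betw_def)
    have Fin: "ps_inner X (s + r) (F t) (F t') = hm_inner TT t t'" if "t \<in> hm_carrier TT" "t' \<in> hm_carrier TT" for t t'
      using F that by blast
    have Fl: "clinear_on (hm_carrier TT) F" using F by blast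
    have Ft: "F (ps_tens X s r \<xi> \<eta>) = ps_mult X s r \<xi> \<eta>" if "\<xi> \<in> ps_carrier X s" "\<eta> \<in> ps_carrier X r" for \<xi> \<eta>
      using F_tens[OF 3 that] by (simp add: F_def)
    have "adjoint_pair TT (ps_fib X (s + r)) F G"
      unfolding adjoint_pair_def
    proof (intro conjI ballI)
      fix t v assume "t \<in> hm_carrier TT" "v \<in> ps_carrier X (s + r)"
      then show "ps_inner X (s + r) (F t) v = hm_inner TT t (G v)"
        using Fin[of t "G v"] Gc[of v] FG[of v] by simp
    qed (use Fc Gc in auto)
    then have adjF: "hm_adjoint TT (ps_fib X (s + r)) F = (\<lambda>v. if v \<in> ps_carrier X (s + r) then G v else 0)"
      unfolding TT_def by (rule T.T.hm_adjoint_eq)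
    define R where "R = (\<lambda>t. if t \<in> hm_carrier TT then G (amplify s r S (F t)) else 0)"
    define R' where "R' = (\<lambda>t. if t \<in> hm_carrier TT then G (amplify s r T (F t)) else 0)"
    have "tensor_op (ps_fib X s) (ps_fib X r) TT (ps_tens X s r) S = R"
      unfolding tensor_op_def
    proof (rule the_equality)
      have "adjoint_pair TT TT R R'"
        unfolding adjoint_pair_def
      proof (intro conjI ballI)
        fix t t' assume t: "t \<in> hm_carrier TT" "t' \<in> hm_carrier TT"
        have c: "amplify s r S (F t) \<in> ps_carrier X (s + r)" "amplify s r T (F t') \<in> ps_carrier X (s + r)"
          using t Fc s r S T by simp_all
        then show "hm_inner TT (R t) t' = hm_inner TT t (R' t')"
          using t Gc FG Fin[of "G (amplify s r S (F t))" t'] Fin[of t "G (amplify s r T (F t'))"]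
            inner_amplify[OF s r T(1) S T(3) Fc Fc] by (simp add: R_def R'_def)
      qed (use Gc Fc s r S T in \<open>auto simp: R_def R'_def\<close>)
      then have "R \<in> adjointables TT" by (auto simp: adjointables_def R_def)
      moreover have "R (ps_tens X s r \<xi> \<eta>) = ps_tens X s r (S \<xi>) \<eta>" if "\<xi> \<in> ps_carrier X s" "\<eta> \<in> ps_carrier X r" for \<xi> \<eta>
        using that s r S GF[of "ps_tens X s r (S \<xi>) \<eta>"]
        by (simp add: R_def TT_def T.tensor_closed Ft amplify_mult)
      ultimately show "R \<in> adjointables TT \<and>
        (\<forall>\<xi>\<in>ps_carrier X s. \<forall>\<eta>\<in>ps_carrier X r. R (ps_tens X s r \<xi> \<eta>) = ps_tens X s r (S \<xi>) \<eta>)" by blast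
    next
      fix Q assume Q: "Q \<in> adjointables TT \<and>
        (\<forall>\<xi>\<in>ps_carrier X s. \<forall>\<eta>\<in>ps_carrier X r. Q (ps_tens X s r \<xi> \<eta>) = ps_tens X s r (S \<xi>) \<eta>)"
      then have Qa: "Q \<in> adjointables (ps_tensor X s r)" by (simp add: TT_def)
      note Ql = T.T.adjointable_linear(2)[OF Qa, folded TT_def]
      note Qc = T.T.adjointable_linear(1)[OF Qa, folded TT_def]
      note sub = T.T.module_subspace[folded TT_def]
      show "Q = R"
      proof
        fix t show "Q t = R t"
        proof (cases "t \<in> hm_carrier TT")
          case True
          have add: "G (v + v') = G v + G v'" if "v \<in> ps_carrier X (s + r)" "v' \<in> ps_carrier X (s + r)" for v v'
            using GF[of "G v + G v'"] clinear_on_add[OF Fl, of "G v" "G v'"] Gc that FG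
              complex_vector.subspace_add[OF sub, of "G v" "G v'"] by simp
          have scale: "G (c *\<^sub>C v) = c *\<^sub>C G v" if "v \<in> ps_carrier X (s + r)" for v c
            using GF[of "c *\<^sub>C G v"] clinear_on_scale[OF Fl, of "G v"] Gc that FG
              complex_vector.subspace_scale[OF sub, of "G v"] by simp
          have "F (Q (G (F t))) = amplify s r S (F t)"
          proof (rule eq_on_products[OF s r _ amplify_linear[OF s r S] _ Fc[OF True]])
            show "clinear_on (ps_carrier X (s + r)) (\<lambda>v. F (Q (G v)))"
              unfolding clinear_on_def
              by (auto simp: add scale Gc Qc clinear_on_add[OF Ql] clinear_on_add[OF Fl]
                  clinear_on_scale[OF Ql] clinear_on_scale[OF Fl])
          next
            fix \<eta> \<zeta> assume e: "\<eta> \<in> ps_carrier X s" "\<zeta> \<in> ps_carrier X r"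
            have "G (ps_mult X s r \<eta> \<zeta>) = ps_tens X s r \<eta> \<zeta>"
              using GF[of "ps_tens X s r \<eta> \<zeta>"] e by (simp add: TT_def T.tensor_closed Ft)
            then show "F (Q (G (ps_mult X s r \<eta> \<zeta>))) = amplify s r S (ps_mult X s r \<eta> \<zeta>)"
              using Q e s r S by (simp add: Ft amplify_mult)
          qed
          then have "F (Q t) = amplify s r S (F t)" using GF True by simp
          then show ?thesis using GF[OF Qc[OF True]] True by (simp add: R_def)
        next
          case False
          then show ?thesis using Q by (simp add: R_def adjointables_def)
        qed
      qed
    qed
    \<comment> \<open>\<open>hm_adjoint\<close> is \<open>0\<close> off the carrier, so the
      composite vanishes there only if both remaining maps send \<open>0\<close> to
      \<open>0\<close>.\<close>
    moreover have "F 0 = 0" "R 0 = 0"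
    proof -
      show F0: "F 0 = 0" using clinear_on_zero[OF Fl T.T.module_subspace[folded TT_def]] .
      have "0 \<in> hm_carrier TT" by (simp add: TT_def)
      then have "G 0 = 0" using GF[of 0] F0 by simp
      moreover have "amplify s r S 0 = 0"
        using clinear_on_zero[OF amplify_linear[OF s r S] fib_subspace[OF sr]] .
      ultimately show "R 0 = 0" by (simp add: R_def F0)
    qed
    moreover have "ps_incl A X s (s + r) S w =
        F (tensor_op (ps_fib X s) (ps_fib X r) TT (ps_tens X s r) S (hm_adjoint TT (ps_fib X (s + r)) F w))"
      using 3 by (auto simp: ps_incl_def Let_def F_def TT_def)
    ultimately show ?thesis
      using amplify_closed[OF s r S, of w] FG Gc by (simp add: adjF) (simp add: R_def)
  qed
qed

end

section \<open>Toeplitz representations\<close>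

lemma sum_fun_apply: "(\<Sum>i\<in>I. f i) x = (\<Sum>i\<in>I. f i x :: 'b::comm_monoid_add)"
  by (induction I rule: infinite_finite_induct) simp_all

lemma nonneg_Reals_sum: "(\<And>i. i \<in> I \<Longrightarrow> f i \<in> \<real>\<^sub>\<ge>\<^sub>0) \<Longrightarrow> (\<Sum>i\<in>I. f i) \<in> (\<real>\<^sub>\<ge>\<^sub>0 :: complex set)"
  by (induction I rule: infinite_finite_induct) simp_all

lemma star_hom_comp: "star_hom A B f \<Longrightarrow> star_hom B D g \<Longrightarrow> star_hom A D (\<lambda>x. g (f x))"
  unfolding star_hom_def clinear_on_def image_subset_iff by simp

lemma compact_alg_sel [simp]:
  "cs_carrier (compact_alg A Y) = compacts A Y" "cs_mult (compact_alg A Y) = (\<lambda>S T. S \<circ> T)"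
  "cs_star (compact_alg A Y) = hm_adjoint Y Y"
  by (simp_all add: compact_alg_def adjointable_alg_def)

locale finite_type_representation =
  finite_type_product_system A X n b m + toeplitz_representation A X C \<psi>
  for A :: "'u::complex_vector cstar"
    and X :: "('g::lattice_ab_group_add, 'u, 't::complex_vector) prod_sys"
    and n b m and C :: "'c::complex_vector cstar" and \<psi> :: "'g \<Rightarrow> 'u \<Rightarrow> 'c"
begin

declare rep_closed [simp]

lemma rep_ract: "\<lbrakk>0 \<le> s; \<xi> \<in> ps_carrier X s; a \<in> cs_carrier A\<rbrakk> \<Longrightarrow>
    \<psi> s (ps_ract X s \<xi> a) = cs_mult C (\<psi> s \<xi>) (\<psi> 0 a)"
  using rep_mult[of s 0 \<xi> a] by (simp add: mult_0_right)

lemma rep_lact: "\<lbrakk>0 \<le> s; \<xi> \<in> ps_carrier X s; a \<in> cs_carrier A\<rbrakk> \<Longrightarrow>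
    \<psi> s (ps_lact X s a \<xi>) = cs_mult C (\<psi> 0 a) (\<psi> s \<xi>)"
  using rep_mult[of 0 s a \<xi>] by (simp add: mult_0_left)

lemma rep_star: "a \<in> cs_carrier A \<Longrightarrow> \<psi> 0 (cs_star A a) = cs_star C (\<psi> 0 a)"
  using rep_hom by (simp add: star_hom_def)

lemma rep_sum: "\<lbrakk>0 \<le> s; \<And>i. i \<in> I \<Longrightarrow> x i \<in> ps_carrier X s\<rbrakk> \<Longrightarrow> \<psi> s (\<Sum>i\<in>I. x i) = (\<Sum>i\<in>I. \<psi> s (x i))"
  using clinear_on_sum[OF rep_linear fib_subspace] by blast

text \<open>The value of the induced homomorphism at \<open>S\<close>, read off from the
  decomposition of \<open>S\<close> into the rank one operators with vectors
  \<open>S (b s j)\<close> and \<open>b s j\<close>; see \<open>adjointable_sum_rank_one\<close> and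
  \<open>induced_hom_eq\<close>.\<close>

definition operator_rep :: "'g \<Rightarrow> ('u \<Rightarrow> 'u) \<Rightarrow> 'c" where
  "operator_rep s S = (\<Sum>j<n s. cs_mult C (\<psi> s (S (b s j))) (cs_star C (\<psi> s (b s j))))"

lemma operator_rep_closed [simp]:
  "0 \<le> s \<Longrightarrow> S \<in> adjointables (ps_fib X s) \<Longrightarrow> operator_rep s S \<in> cs_carrier C"
  unfolding operator_rep_def by (rule C.sum_closed) auto

lemma operator_rep_mult:
  assumes s: "0 \<le> s" and S: "S \<in> adjointables (ps_fib X s)" and \<eta>: "\<eta> \<in> ps_carrier X s"
  shows "cs_mult C (operator_rep s S) (\<psi> s \<eta>) = \<psi> s (S \<eta>)"
proof -
  have "cs_mult C (operator_rep s S) (\<psi> s \<eta>) =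
      (\<Sum>j<n s. cs_mult C (\<psi> s (S (b s j))) (\<psi> 0 (ps_inner X s (b s j) \<eta>)))"
    unfolding operator_rep_def using s S \<eta>
    by (subst C.sum_mult) (simp_all add: C.mult_assoc rep_inner)
  also have "\<dots> = \<psi> s (\<Sum>j<n s. ps_ract X s (S (b s j)) (ps_inner X s (b s j) \<eta>))"
    using s S \<eta> by (subst rep_sum) (simp_all add: rep_ract)
  finally show ?thesis using adjointable_expand[OF s S \<eta>] by simp
qed

lemma operator_rep_comp:
  assumes s: "0 \<le> s" and S: "S \<in> adjointables (ps_fib X s)" and T: "T \<in> adjointables (ps_fib X s)"
  shows "operator_rep s (S \<circ> T) = cs_mult C (operator_rep s S) (operator_rep s T)"
proof -
  have "cs_mult C (operator_rep s S) (operator_rep s T) =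
      (\<Sum>k<n s. cs_mult C (cs_mult C (operator_rep s S) (\<psi> s (T (b s k)))) (cs_star C (\<psi> s (b s k))))"
    unfolding operator_rep_def[of s T] using s S T
    by (subst C.mult_sum) (simp_all add: C.mult_assoc)
  also have "\<dots> = operator_rep s (S \<circ> T)"
    using s S T by (simp add: operator_rep_mult) (simp add: operator_rep_def)
  finally show ?thesis by simp
qed

lemma star_expand:
  assumes s: "0 \<le> s" and \<eta>: "\<eta> \<in> ps_carrier X s"
  shows "(\<Sum>j<n s. cs_mult C (\<psi> 0 (ps_inner X s \<eta> (b s j))) (cs_star C (\<psi> s (b s j)))) = cs_star C (\<psi> s \<eta>)"
proof -
  interpret H: hilbert_module A "ps_fib X s" by (rule fib_module[OF s])
  have "cs_star C (\<psi> s \<eta>) = cs_star C (\<psi> s (\<Sum>j<n s. ps_ract X s (b s j) (ps_inner X s (b s j) \<eta>)))"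
    using expand[OF s \<eta>] by simp
  also have "\<dots> = (\<Sum>j<n s. cs_mult C (cs_star C (\<psi> 0 (ps_inner X s (b s j) \<eta>))) (cs_star C (\<psi> s (b s j))))"
    using s \<eta> by (subst rep_sum, simp, simp, subst C.star_sum) (simp_all add: rep_ract C.star_mult)
  also have "\<dots> = (\<Sum>j<n s. cs_mult C (\<psi> 0 (ps_inner X s \<eta> (b s j))) (cs_star C (\<psi> s (b s j))))"
    using s \<eta> by (simp add: H.inner_star flip: rep_star)
  finally show ?thesis by simp
qed

lemma operator_rep_rank_one:
  assumes s: "0 \<le> s" and \<xi>: "\<xi> \<in> ps_carrier X s" and \<eta>: "\<eta> \<in> ps_carrier X s"
  shows "operator_rep s (rank_one (ps_fib X s) \<xi> \<eta>) = cs_mult C (\<psi> s \<xi>) (cs_star C (\<psi> s \<eta>))"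
proof -
  have "operator_rep s (rank_one (ps_fib X s) \<xi> \<eta>) =
     (\<Sum>j<n s. cs_mult C (\<psi> s \<xi>) (cs_mult C (\<psi> 0 (ps_inner X s \<eta> (b s j))) (cs_star C (\<psi> s (b s j)))))"
    using s \<xi> \<eta> by (simp add: operator_rep_def rank_one_def rep_ract C.mult_assoc)
  also have "\<dots> = cs_mult C (\<psi> s \<xi>) (\<Sum>j<n s. cs_mult C (\<psi> 0 (ps_inner X s \<eta> (b s j))) (cs_star C (\<psi> s (b s j))))"
    using s \<xi> \<eta> by (subst C.mult_sum) simp_all
  finally show ?thesis using star_expand[OF s \<eta>] by simp
qed

text \<open>In the basis the entries of \<open>T\<close> are the inner products of
  \<open>S (b s k)\<close> with \<open>b s j\<close>. Interchanging the sums and collecting the one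
  over \<open>j\<close> by \<open>star_expand\<close> leaves the adjoint of the sum that defines
  \<open>operator_rep s S\<close>.\<close>

lemma operator_rep_star:
  assumes s: "0 \<le> s" and S: "S \<in> adjointables (ps_fib X s)" and T: "T \<in> adjointables (ps_fib X s)"
    and ST: "adjoint_pair (ps_fib X s) (ps_fib X s) S T"
  shows "operator_rep s T = cs_star C (operator_rep s S)"
proof -
  interpret H: hilbert_module A "ps_fib X s" by (rule fib_module[OF s])
  have Tj: "T (b s j) = (\<Sum>k<n s. ps_ract X s (b s k) (ps_inner X s (S (b s k)) (b s j)))" if "j < n s" for j
    using expand[OF s, of "T (b s j)"] adjoint_pairD(3)[OF ST] that s T by simp
  have "operator_rep s T = (\<Sum>j<n s. \<Sum>k<n s. cs_mult C (\<psi> s (b s k))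
      (cs_mult C (\<psi> 0 (ps_inner X s (S (b s k)) (b s j))) (cs_star C (\<psi> s (b s j)))))"
    unfolding operator_rep_def
  proof (rule sum.cong)
    fix j assume "j \<in> {..<n s}"
    then have j: "j < n s" by simp
    have "\<psi> s (T (b s j)) = (\<Sum>k<n s. cs_mult C (\<psi> s (b s k)) (\<psi> 0 (ps_inner X s (S (b s k)) (b s j))))"
      unfolding Tj[OF j] using s S j by (subst rep_sum) (simp_all add: rep_ract)
    then show "cs_mult C (\<psi> s (T (b s j))) (cs_star C (\<psi> s (b s j))) = (\<Sum>k<n s. cs_mult C (\<psi> s (b s k))
      (cs_mult C (\<psi> 0 (ps_inner X s (S (b s k)) (b s j))) (cs_star C (\<psi> s (b s j)))))"
      using s S j by (simp only:) (subst C.sum_mult, simp_all add: C.mult_assoc)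
  qed simp
  also have "\<dots> = (\<Sum>k<n s. \<Sum>j<n s. cs_mult C (\<psi> s (b s k))
      (cs_mult C (\<psi> 0 (ps_inner X s (S (b s k)) (b s j))) (cs_star C (\<psi> s (b s j)))))"
    by (rule sum.swap)
  also have "\<dots> = (\<Sum>k<n s. cs_mult C (\<psi> s (b s k)) (cs_star C (\<psi> s (S (b s k)))))"
  proof (rule sum.cong)
    fix k assume "k \<in> {..<n s}"
    then have k: "k < n s" by simp
    show "(\<Sum>j<n s. cs_mult C (\<psi> s (b s k)) (cs_mult C (\<psi> 0 (ps_inner X s (S (b s k)) (b s j))) (cs_star C (\<psi> s (b s j)))))
      = cs_mult C (\<psi> s (b s k)) (cs_star C (\<psi> s (S (b s k))))"
      unfolding star_expand[OF s adjointable_closed[OF s S b_carrier[OF s k]], symmetric]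
      using s S k by (subst C.mult_sum) simp_all
  qed simp
  also have "\<dots> = cs_star C (operator_rep s S)"
    unfolding operator_rep_def using s S by (subst C.star_sum) (simp_all add: C.star_mult)
  finally show ?thesis .
qed

lemma operator_rep_linear: assumes "0 \<le> s" shows "clinear_on (adjointables (ps_fib X s)) (operator_rep s)"
  unfolding clinear_on_def
proof (intro conjI ballI allI)
  fix S T assume "S \<in> adjointables (ps_fib X s)" "T \<in> adjointables (ps_fib X s)"
  then show "operator_rep s (S + T) = operator_rep s S + operator_rep s T"
    unfolding operator_rep_def sum.distrib[symmetric] using assms
    by (intro sum.cong) (simp_all add: clinear_on_add[OF rep_linear] C.add_mult)
next
  fix c S assume "S \<in> adjointables (ps_fib X s)"
  then show "operator_rep s (c *\<^sub>C S) = c *\<^sub>C operator_rep s S"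
    unfolding operator_rep_def complex_vector.scale_sum_right using assms
    by (intro sum.cong) (simp_all add: scaleC_fun_def clinear_on_scale[OF rep_linear] C.scale_mult)
qed

lemma adjointable_sum_rank_one:
  assumes s: "0 \<le> s" and S: "S \<in> adjointables (ps_fib X s)"
  shows "S = (\<Sum>j<n s. rank_one (ps_fib X s) (S (b s j)) (b s j))"
proof
  fix \<xi>
  interpret H: hilbert_module A "ps_fib X s" by (rule fib_module[OF s])
  show "S \<xi> = (\<Sum>j<n s. rank_one (ps_fib X s) (S (b s j)) (b s j)) \<xi>"
  proof (cases "\<xi> \<in> ps_carrier X s")
    case True
    then show ?thesis by (simp add: sum_fun_apply rank_one_def flip: adjointable_expand[OF s S])
  next
    case False
    then show ?thesis using S by (simp add: sum_fun_apply rank_one_def adjointables_def)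
  qed
qed

text \<open>A finite orthonormal basis makes every adjointable operator a finite sum of rank one
  operators, so it lies in their span before any closure is taken.\<close>

lemma compacts_eq: assumes s: "0 \<le> s" shows "compacts A (ps_fib X s) = adjointables (ps_fib X s)"
proof
  interpret H: hilbert_module A "ps_fib X s" by (rule fib_module[OF s])
  show "compacts A (ps_fib X s) \<subseteq> adjointables (ps_fib X s)" by (rule H.compacts_subset)
  show "adjointables (ps_fib X s) \<subseteq> compacts A (ps_fib X s)"
  proof
    fix S assume S: "S \<in> adjointables (ps_fib X s)"
    let ?R = "{rank_one (ps_fib X s) \<xi> \<eta> |\<xi> \<eta>. \<xi> \<in> ps_carrier X s \<and> \<eta> \<in> ps_carrier X s}"
    have "(\<Sum>j<n s. rank_one (ps_fib X s) (S (b s j)) (b s j)) \<in> cspan ?R"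
    proof (rule complex_vector.span_sum)
      fix j assume "j \<in> {..<n s}"
      then have "S (b s j) \<in> ps_carrier X s" "b s j \<in> ps_carrier X s" using s S by simp_all
      then show "rank_one (ps_fib X s) (S (b s j)) (b s j) \<in> cspan ?R"
        by (intro complex_vector.span_base) blast
    qed
    then show "S \<in> compacts A (ps_fib X s)"
      using H.span_rank_one_compacts adjointable_sum_rank_one[OF s S] by auto
  qed
qed

text \<open>\<open>operator_rep s\<close> witnesses that the choice in \<open>induced_hom\<close>
  succeeds; linearity and the prescribed values on rank one operators then determine the chosen
  map.\<close>

lemma induced_hom_eq:
  assumes s: "0 \<le> s" and S: "S \<in> adjointables (ps_fib X s)"
  shows "induced_hom A X C \<psi> s S = operator_rep s S"
proof -
  interpret H: hilbert_module A "ps_fib X s" by (rule fib_module[OF s])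
  let ?P = "\<lambda>\<kappa>. star_hom (compact_alg A (ps_fib X s)) C \<kappa> \<and>
       (\<forall>\<xi>\<in>ps_carrier X s. \<forall>\<eta>\<in>ps_carrier X s.
          \<kappa> (rank_one (ps_fib X s) \<xi> \<eta>) = cs_mult C (\<psi> s \<xi>) (cs_star C (\<psi> s \<eta>)))"
  have "operator_rep s (hm_adjoint (ps_fib X s) (ps_fib X s) T) = cs_star C (operator_rep s T)"
    if T: "T \<in> adjointables (ps_fib X s)" for T
  proof -
    obtain T' where "adjoint_pair (ps_fib X s) (ps_fib X s) T T'" "T' \<in> adjointables (ps_fib X s)"
      "T' = hm_adjoint (ps_fib X s) (ps_fib X s) T"
      by (rule H.adjointablesE[OF T]) blast
    then show ?thesis using operator_rep_star[OF s T] by blast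
  qed
  then have "?P (operator_rep s)"
    using s operator_rep_linear[OF s]
    by (auto simp: star_hom_def compacts_eq operator_rep_comp operator_rep_rank_one)
  then have P: "?P (induced_hom A X C \<psi> s)" unfolding induced_hom_def by (rule someI[of ?P])
  then have lin: "clinear_on (adjointables (ps_fib X s)) (induced_hom A X C \<psi> s)"
    using s by (simp add: star_hom_def compacts_eq)
  have "induced_hom A X C \<psi> s S = induced_hom A X C \<psi> s (\<Sum>j<n s. rank_one (ps_fib X s) (S (b s j)) (b s j))"
    using adjointable_sum_rank_one[OF s S] by simp
  also have "\<dots> = operator_rep s S"
    unfolding operator_rep_def using s S P
    by (subst clinear_on_sum[OF lin H.adjointables_subspace]) (simp_all add: H.rank_one_adjointable)
  finally show ?thesis .
qed

lemma induced_hom_rank_one: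
  "\<lbrakk>0 \<le> s; \<xi> \<in> ps_carrier X s; \<eta> \<in> ps_carrier X s\<rbrakk> \<Longrightarrow>
    induced_hom A X C \<psi> s (rank_one (ps_fib X s) \<xi> \<eta>) = cs_mult C (\<psi> s \<xi>) (cs_star C (\<psi> s \<eta>))"
  by (simp add: induced_hom_eq operator_rep_rank_one hilbert_module.rank_one_adjointable[OF fib_module])

lemma ps_incl_adjointable:
  assumes s: "0 \<le> s" and sp: "s \<le> p" and S: "S \<in> adjointables (ps_fib X s)"
  shows "ps_incl A X s p S \<in> adjointables (ps_fib X p)"
proof -
  define r where "r = p - s"
  have r: "0 \<le> r" and p: "p = s + r" using sp by (simp_all add: r_def)
  have sr: "0 \<le> s + r" using s r by simp
  interpret H: hilbert_module A "ps_fib X s" by (rule fib_module[OF s])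
  obtain T where T: "adjoint_pair (ps_fib X s) (ps_fib X s) S T" "T \<in> adjointables (ps_fib X s)"
    by (rule H.adjointablesE[OF S]) blast
  have "adjoint_pair (ps_fib X (s + r)) (ps_fib X (s + r)) (ps_incl A X s (s + r) S) (amplify s r T)"
    using amplify_adjoint_pair[OF s r T(1) S T(2)] unfolding adjoint_pair_def ps_incl_eq[OF s r S] by auto
  then show ?thesis unfolding p adjointables_def by (auto simp: ps_incl_eq[OF s r S])
qed

text \<open>Reduces covariance from a chosen homomorphism on compact operators to explicit finite
  sums for adjointable ones.\<close>

lemma nica_representationI:
  assumes "\<And>s r S T. \<lbrakk>0 \<le> s; 0 \<le> r; S \<in> adjointables (ps_fib X s); T \<in> adjointables (ps_fib X r)\<rbrakk> \<Longrightarrow>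
      cs_mult C (operator_rep s S) (operator_rep r T) =
      operator_rep (sup s r) (ps_incl A X s (sup s r) S \<circ> ps_incl A X r (sup s r) T)"
  shows "nica_representation A X C \<psi>"
proof unfold_locales
  fix s r :: 'g and S T
  assume s: "0 \<le> s" and r: "0 \<le> r" and "S \<in> compacts A (ps_fib X s)" "T \<in> compacts A (ps_fib X r)"
  then have S: "S \<in> adjointables (ps_fib X s)" and T: "T \<in> adjointables (ps_fib X r)"
    by (simp_all add: compacts_eq)
  have q: "0 \<le> sup s r" using s by (simp add: le_supI1)
  have "ps_incl A X s (sup s r) S \<circ> ps_incl A X r (sup s r) T \<in> adjointables (ps_fib X (sup s r))"
    by (intro hilbert_module.adjointables_comp[OF fib_module[OF q]] ps_incl_adjointable s r S T sup_ge1 sup_ge2)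
  then show "cs_mult C (induced_hom A X C \<psi> s S) (induced_hom A X C \<psi> r T) =
      induced_hom A X C \<psi> (sup s r) (ps_incl A X s (sup s r) S \<circ> ps_incl A X r (sup s r) T)"
    using assms[OF s r S T] s r S T q by (simp add: induced_hom_eq)
qed

lemma nica_operator_rep:
  assumes "nica_representation A X C \<psi>"
    and s: "0 \<le> s" and r: "0 \<le> r" and S: "S \<in> adjointables (ps_fib X s)" and T: "T \<in> adjointables (ps_fib X r)"
  shows "cs_mult C (operator_rep s S) (operator_rep r T) =
      operator_rep (sup s r) (ps_incl A X s (sup s r) S \<circ> ps_incl A X r (sup s r) T)"
proof -
  have q: "0 \<le> sup s r" using s by (simp add: le_supI1)
  have "ps_incl A X s (sup s r) S \<circ> ps_incl A X r (sup s r) T \<in> adjointables (ps_fib X (sup s r))"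
    by (intro hilbert_module.adjointables_comp[OF fib_module[OF q]] ps_incl_adjointable s r S T sup_ge1 sup_ge2)
  then show ?thesis
    using nica_representation.nica_covariant[OF assms(1) s r, of S T] s r q S T
    by (simp add: induced_hom_eq compacts_eq)
qed

lemma transport_toeplitz:
  assumes D: "cstar_algebra D" and \<rho>: "star_hom C D \<rho>"
  shows "toeplitz_representation A X D (\<lambda>s \<xi>. \<rho> (\<psi> s \<xi>))"
proof -
  interpret D: cstar_algebra D by (rule D)
  have c: "\<rho> x \<in> cs_carrier D" if "x \<in> cs_carrier C" for x using \<rho> that by (auto simp: star_hom_def)
  have m: "\<rho> (cs_mult C x y) = cs_mult D (\<rho> x) (\<rho> y)" if "x \<in> cs_carrier C" "y \<in> cs_carrier C" for x y
    using \<rho> that by (auto simp: star_hom_def)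
  have st: "\<rho> (cs_star C x) = cs_star D (\<rho> x)" if "x \<in> cs_carrier C" for x
    using \<rho> that by (auto simp: star_hom_def)
  have l: "clinear_on (cs_carrier C) \<rho>" using \<rho> by (simp add: star_hom_def)
  show ?thesis
  proof unfold_locales
    show "clinear_on (ps_carrier X s) (\<lambda>\<xi>. \<rho> (\<psi> s \<xi>))" if "0 \<le> s" for s
      using rep_linear[OF that] that l by (simp add: clinear_on_def)
    show "star_hom A D (\<lambda>\<xi>. \<rho> (\<psi> 0 \<xi>))"
      using rep_hom \<rho> by (auto simp: star_hom_def clinear_on_def)
  qed (simp_all add: c rep_mult rep_inner flip: m st)
qed

text \<open>A star homomorphism commutes with the finite sums \<open>operator_rep\<close>, so
  covariance is preserved. Needed to move the Fock representation to the type of test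
  objects.\<close>

lemma transport_nica:
  assumes nica: "nica_representation A X C \<psi>" and D: "cstar_algebra D" and \<rho>: "star_hom C D \<rho>"
  shows "nica_representation A X D (\<lambda>s \<xi>. \<rho> (\<psi> s \<xi>))"
proof -
  interpret R: finite_type_representation A X n b m D "\<lambda>s \<xi>. \<rho> (\<psi> s \<xi>)"
    by (intro finite_type_representation.intro transport_toeplitz[OF D \<rho>] finite_type_product_system_axioms)
  have l: "clinear_on (cs_carrier C) \<rho>" using \<rho> by (simp add: star_hom_def)
  have eq: "R.operator_rep s S = \<rho> (operator_rep s S)" if "0 \<le> s" "S \<in> adjointables (ps_fib X s)" for s S
    unfolding R.operator_rep_def operator_rep_def using \<rho> that
    by (subst clinear_on_sum[OF l C.subspace]) (simp_all add: star_hom_def)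
  show ?thesis
  proof (rule R.nica_representationI)
    fix s r :: 'g and S T
    assume s: "0 \<le> s" and r: "0 \<le> r" and S: "S \<in> adjointables (ps_fib X s)" and T: "T \<in> adjointables (ps_fib X r)"
    have q: "0 \<le> sup s r" using s by (simp add: le_supI1)
    have "ps_incl A X s (sup s r) S \<circ> ps_incl A X r (sup s r) T \<in> adjointables (ps_fib X (sup s r))"
      by (intro hilbert_module.adjointables_comp[OF fib_module[OF q]] ps_incl_adjointable s r S T sup_ge1 sup_ge2)
    then show "cs_mult D (R.operator_rep s S) (R.operator_rep r T) =
      R.operator_rep (sup s r) (ps_incl A X s (sup s r) S \<circ> ps_incl A X r (sup s r) T)"
      using \<rho> s r S T q by (simp add: eq star_hom_def flip: nica_operator_rep[OF nica])
  qed
qed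

end


section \<open>The Fock representation\<close>

context form_space
begin

lemma adjoint_ops_sum:
  assumes "\<And>i. i \<in> I \<Longrightarrow> adjoint_ops (T i) (T' i)"
  shows "adjoint_ops (\<lambda>x. \<Sum>i\<in>I. T i x) (\<lambda>x. \<Sum>i\<in>I. T' i x)"
  using assms
  by (induction I rule: infinite_finite_induct) (simp_all add: adjoint_ops_zero adjoint_ops_add)

lemma form_sum:
  assumes "\<And>i. i \<in> I \<Longrightarrow> adjoint_ops (T i) (T' i)"
  shows "form (\<lambda>x. \<Sum>i\<in>I. T i x) = (\<Sum>i\<in>I. form (T i))"
  using assms
proof (induction I rule: infinite_finite_induct)
  case (insert i I)
  have "form (\<lambda>x. T i x + (\<Sum>i\<in>I. T i x)) = form (T i) + form (\<lambda>x. \<Sum>i\<in>I. T i x)"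
    by (rule form_add[OF insert.prems[of i] adjoint_ops_sum[of I T T']]) (use insert.prems in auto)
  then show ?case using insert by simp
qed (simp_all add: form_zero)

lemma form_cong: "(\<And>x. x \<in> V \<Longrightarrow> T x = S x) \<Longrightarrow> form T = form S"
proof (intro ext)
  fix x y assume "\<And>x. x \<in> V \<Longrightarrow> T x = S x"
  then show "form T x y = form S x y" by (cases "y \<in> V") (simp_all add: form_def)
qed

end

locale fock = finite_type_product_system A X n b m
  for A :: "'u::complex_vector cstar"
    and X :: "('g::lattice_ab_group_add, 'u, 't::complex_vector) prod_sys"
    and n b m +
  fixes \<tau> :: "'u \<Rightarrow> complex"
  assumes state: "\<tau> \<in> states A"
begin

text \<open>The algebraic direct sum: finite support makes every pairing a finite sum and lets a
  list code a vector in \<open>decode\<close>. Components outside the positive cone are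
  \<open>0\<close>.\<close>

definition fock_space :: "('g \<Rightarrow> 'u) set" where
  "fock_space = {v. finite {p. v p \<noteq> 0} \<and> (\<forall>p. 0 \<le> p \<longrightarrow> v p \<in> ps_carrier X p) \<and> (\<forall>p. \<not> 0 \<le> p \<longrightarrow> v p = 0)}"

definition fock_ip :: "('g \<Rightarrow> 'u) \<Rightarrow> ('g \<Rightarrow> 'u) \<Rightarrow> complex" where
  "fock_ip v w = (\<Sum>p | v p \<noteq> 0. \<tau> (ps_inner X p (v p) (w p)))"

lemma fock_spaceI:
  "\<lbrakk>finite {p. v p \<noteq> 0}; \<And>p. 0 \<le> p \<Longrightarrow> v p \<in> ps_carrier X p; \<And>p. \<not> 0 \<le> p \<Longrightarrow> v p = 0\<rbrakk> \<Longrightarrow> v \<in> fock_space"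
  by (simp add: fock_space_def)

lemma fock_finite: "v \<in> fock_space \<Longrightarrow> finite {p. v p \<noteq> 0}"
  and fock_closed [simp]: "v \<in> fock_space \<Longrightarrow> 0 \<le> p \<Longrightarrow> v p \<in> ps_carrier X p"
  and fock_neg: "v \<in> fock_space \<Longrightarrow> v p \<noteq> 0 \<Longrightarrow> 0 \<le> p"
  by (auto simp: fock_space_def)

lemma \<tau>_linear: "clinear_on (cs_carrier A) \<tau>"
  by (rule state_linear[OF state])
lemmas \<tau>_add = clinear_on_add[OF \<tau>_linear]
lemmas \<tau>_zero [simp] = clinear_on_zero[OF \<tau>_linear subspace]
lemma \<tau>_scale: "a \<in> cs_carrier A \<Longrightarrow> \<tau> (c *\<^sub>C a) = c * \<tau> a"
  using clinear_on_scale[OF \<tau>_linear] by (simp add: scaleC_complex_def)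
lemma \<tau>_one [simp]: "\<tau> one = 1"
  by (rule state_unit[OF is_unit_one state])

lemma fib_inner_zero [simp]:
  "0 \<le> p \<Longrightarrow> \<xi> \<in> ps_carrier X p \<Longrightarrow> ps_inner X p 0 \<xi> = 0"
  "0 \<le> p \<Longrightarrow> \<xi> \<in> ps_carrier X p \<Longrightarrow> ps_inner X p \<xi> 0 = 0"
  using hilbert_module.inner_zero_left[OF fib_module] hilbert_module.inner_zero_right[OF fib_module] by blast+

text \<open>The defining sum runs over the support of \<open>v\<close>, which is unsuitable for
  adding in \<open>v\<close>. Terms off the common support vanish, so any finite subset of the cone
  that contains it serves as well.\<close>

lemma fock_ip_eq:
  assumes v: "v \<in> fock_space" and w: "w \<in> fock_space" and S: "finite S" "\<And>p. p \<in> S \<Longrightarrow> 0 \<le> p"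
    and vw: "\<And>p. v p \<noteq> 0 \<Longrightarrow> w p \<noteq> 0 \<Longrightarrow> p \<in> S"
  shows "fock_ip v w = (\<Sum>p\<in>S. \<tau> (ps_inner X p (v p) (w p)))"
proof -
  let ?f = "\<lambda>p. \<tau> (ps_inner X p (v p) (w p))"
  have z: "?f p = 0" if "0 \<le> p" "v p = 0 \<or> w p = 0" for p
    using that v w fock_closed[of v p] fock_closed[of w p] by auto
  have "fock_ip v w = (\<Sum>p\<in>{p. v p \<noteq> 0} \<union> S. ?f p)"
    unfolding fock_ip_def
    by (rule sum.mono_neutral_left) (use fock_finite[OF v] S z in \<open>blast+\<close>)
  also have "\<dots> = (\<Sum>p\<in>S. ?f p)"
    by (rule sum.mono_neutral_right) (use fock_finite[OF v] S z vw fock_neg[OF v] in \<open>blast+\<close>)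
  finally show ?thesis .
qed

lemma fock_ip_eq_right:
  assumes "v \<in> fock_space" "w \<in> fock_space"
  shows "fock_ip v w = (\<Sum>p | w p \<noteq> 0. \<tau> (ps_inner X p (v p) (w p)))"
  using fock_neg[OF assms(2)] by (intro fock_ip_eq[OF assms fock_finite[OF assms(2)]]) auto

lemma fock_outside: "v \<in> fock_space \<Longrightarrow> \<not> 0 \<le> p \<Longrightarrow> v p = 0"
  using fock_neg by blast

lemma fock_zero: "0 \<in> fock_space" by (rule fock_spaceI) simp_all

lemma fock_add:
  assumes v: "v \<in> fock_space" and w: "w \<in> fock_space" shows "v + w \<in> fock_space"
proof -
  have "finite {p. (v + w) p \<noteq> 0}"
    by (rule finite_subset[of _ "{p. v p \<noteq> 0} \<union> {p. w p \<noteq> 0}"])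
      (use fock_finite[OF v] fock_finite[OF w] in auto)
  then show ?thesis by (rule fock_spaceI) (use v w in \<open>simp_all add: fock_outside\<close>)
qed

lemma fock_scale:
  assumes v: "v \<in> fock_space" shows "c *\<^sub>C v \<in> fock_space"
proof -
  have "finite {p. (c *\<^sub>C v) p \<noteq> 0}"
    by (rule finite_subset[OF _ fock_finite[OF v]]) (auto simp: scaleC_fun_def)
  then show ?thesis by (rule fock_spaceI) (use v in \<open>simp_all add: fock_outside scaleC_fun_def\<close>)
qed

sublocale form_space fock_space fock_ip
proof
  show sub: "csubspace fock_space"
    by (simp add: complex_vector.subspace_def fock_zero fock_add fock_scale)
next
  fix x assume x: "x \<in> fock_space"
  show "clinear_on fock_space (fock_ip x)"
    unfolding clinear_on_def
  proof (intro conjI ballI allI)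
    fix v w assume "v \<in> fock_space" "w \<in> fock_space"
    then show "fock_ip x (v + w) = fock_ip x v + fock_ip x w"
      unfolding fock_ip_def sum.distrib[symmetric] using x fock_neg[OF x]
      by (intro sum.cong) (simp_all add: \<tau>_add hilbert_module.inner_add_right[OF fib_module])
  next
    fix c v assume "v \<in> fock_space"
    then show "fock_ip x (c *\<^sub>C v) = c *\<^sub>C fock_ip x v"
      unfolding fock_ip_def scaleC_complex_def sum_distrib_left using x fock_neg[OF x]
      by (intro sum.cong) (simp_all add: scaleC_fun_def \<tau>_scale hilbert_module.inner_scale_right[OF fib_module])
  qed
  show "fock_ip x x \<in> \<real>\<^sub>\<ge>\<^sub>0"
    unfolding fock_ip_def
  proof (rule nonneg_Reals_sum)
    fix p assume "p \<in> {p. x p \<noteq> 0}"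
    then have p: "0 \<le> p" using fock_neg[OF x] by simp
    obtain a where "a \<in> cs_carrier A" "ps_inner X p (x p) (x p) = cs_mult A (cs_star A a) a"
      using hilbert_module.inner_positive[OF fib_module[OF p], of "x p"] x p by (auto simp: cs_positive_def)
    then show "\<tau> (ps_inner X p (x p) (x p)) \<in> \<real>\<^sub>\<ge>\<^sub>0" using state_pos[OF state] by simp
  qed
  \<comment> \<open>In the first variable all sums run over the support of \<open>z\<close>, which
    is the same for all vectors compared.\<close>
  fix z assume z: "z \<in> fock_space"
  show "fock_ip (c *\<^sub>C x) z = cnj c * fock_ip x z" for c
    unfolding fock_ip_eq_right[OF x z] fock_ip_eq_right[OF fock_scale[OF x] z] sum_distrib_left
    using x z fock_neg[OF z]
    by (intro sum.cong) (simp_all add: scaleC_fun_def \<tau>_scale hilbert_module.inner_scale_left[OF fib_module])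
  fix y assume y: "y \<in> fock_space"
  show "fock_ip (x + y) z = fock_ip x z + fock_ip y z"
    unfolding fock_ip_eq_right[OF x z] fock_ip_eq_right[OF y z] fock_ip_eq_right[OF fock_add[OF x y] z] sum.distrib[symmetric]
    using x y z fock_neg[OF z]
    by (intro sum.cong) (simp_all add: \<tau>_add hilbert_module.inner_add_left[OF fib_module])
qed

section \<open>Creation and annihilation operators\<close>

definition create :: "'g \<Rightarrow> 'u \<Rightarrow> ('g \<Rightarrow> 'u) \<Rightarrow> 'g \<Rightarrow> 'u" where
  "create s \<xi> v = (\<lambda>p. if s \<le> p then ps_mult X s (p - s) \<xi> (v (p - s)) else 0)"

definition annih :: "'g \<Rightarrow> 'u \<Rightarrow> ('g \<Rightarrow> 'u) \<Rightarrow> 'g \<Rightarrow> 'u" where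
  "annih s \<xi> v = (\<lambda>p. if 0 \<le> p then contract s p \<xi> (v (s + p)) else 0)"

lemma ps_mult_zero_right [simp]: "0 \<le> s \<Longrightarrow> 0 \<le> r \<Longrightarrow> \<xi> \<in> ps_carrier X s \<Longrightarrow> ps_mult X s r \<xi> 0 = 0"
  using clinear_on_zero[OF ps_mult_linear_right fib_subspace] by blast

lemma contract_zero [simp]: "0 \<le> s \<Longrightarrow> 0 \<le> r \<Longrightarrow> \<xi> \<in> ps_carrier X s \<Longrightarrow> contract s r \<xi> 0 = 0"
  using clinear_on_zero[OF contract_linear fib_subspace[of "s + r"]] by simp

lemma le_index: "0 \<le> (s::'g) \<Longrightarrow> s \<le> p \<Longrightarrow> 0 \<le> p" by (rule order_trans)

lemma create_closed [simp]:
  assumes s: "0 \<le> s" and \<xi>: "\<xi> \<in> ps_carrier X s" and v: "v \<in> fock_space"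
  shows "create s \<xi> v \<in> fock_space"
proof -
  have "{p. create s \<xi> v p \<noteq> 0} \<subseteq> (\<lambda>q. s + q) ` {q. v q \<noteq> 0}"
  proof
    fix p assume "p \<in> {p. create s \<xi> v p \<noteq> 0}"
    then have "v (p - s) \<noteq> 0" using s \<xi> by (auto simp: create_def split: if_splits)
    then show "p \<in> (\<lambda>q. s + q) ` {q. v q \<noteq> 0}" by (intro image_eqI[of _ _ "p - s"]) auto
  qed
  then have "finite {p. create s \<xi> v p \<noteq> 0}" using fock_finite[OF v] finite_subset by blast
  moreover have "create s \<xi> v p \<in> ps_carrier X p" if "0 \<le> p" for p
    using ps_mult_closed[of s "p - s" \<xi> "v (p - s)"] s \<xi> v that by (simp add: create_def)
  moreover have "create s \<xi> v p = 0" if "\<not> 0 \<le> p" for p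
    using that le_index[OF s, of p] by (auto simp: create_def)
  ultimately show ?thesis by (rule fock_spaceI)
qed

lemma annih_closed [simp]:
  assumes s: "0 \<le> s" and \<xi>: "\<xi> \<in> ps_carrier X s" and v: "v \<in> fock_space"
  shows "annih s \<xi> v \<in> fock_space"
proof -
  have "{p. annih s \<xi> v p \<noteq> 0} \<subseteq> (\<lambda>q. q - s) ` {q. v q \<noteq> 0}"
  proof
    fix p assume "p \<in> {p. annih s \<xi> v p \<noteq> 0}"
    then have "v (s + p) \<noteq> 0" using s \<xi> by (auto simp: annih_def split: if_splits)
    then show "p \<in> (\<lambda>q. q - s) ` {q. v q \<noteq> 0}" by (intro image_eqI[of _ _ "s + p"]) auto
  qed
  then have "finite {p. annih s \<xi> v p \<noteq> 0}" using fock_finite[OF v] finite_subset by blast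
  moreover have "annih s \<xi> v p \<in> ps_carrier X p" if "0 \<le> p" for p
    using s \<xi> v that by (simp add: annih_def)
  moreover have "annih s \<xi> v p = 0" if "\<not> 0 \<le> p" for p using that by (simp add: annih_def)
  ultimately show ?thesis by (rule fock_spaceI)
qed

lemma fock_ip_create:
  assumes s: "0 \<le> s" and \<xi>: "\<xi> \<in> ps_carrier X s" and x: "x \<in> fock_space" and y: "y \<in> fock_space"
  shows "fock_ip x (create s \<xi> y) = (\<Sum>q | y q \<noteq> 0. \<tau> (ps_inner X (s + q) (x (s + q)) (ps_mult X s q \<xi> (y q))))"
proof -
  have "fock_ip x (create s \<xi> y) = (\<Sum>p\<in>(\<lambda>q. s + q) ` {q. y q \<noteq> 0}. \<tau> (ps_inner X p (x p) (create s \<xi> y p)))"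
  proof (rule fock_ip_eq[OF x create_closed[OF s \<xi> y]])
    show "finite ((\<lambda>q. s + q) ` {q. y q \<noteq> 0})" using fock_finite[OF y] by simp
    show "0 \<le> p" if "p \<in> (\<lambda>q. s + q) ` {q. y q \<noteq> 0}" for p using that fock_neg[OF y] s by auto
    fix p assume "create s \<xi> y p \<noteq> 0"
    then have "y (p - s) \<noteq> 0" using s \<xi> by (auto simp: create_def split: if_splits)
    then show "p \<in> (\<lambda>q. s + q) ` {q. y q \<noteq> 0}" by (intro image_eqI[of _ _ "p - s"]) auto
  qed
  also have "\<dots> = (\<Sum>q | y q \<noteq> 0. \<tau> (ps_inner X (s + q) (x (s + q)) (create s \<xi> y (s + q))))"
    by (subst sum.reindex) (auto simp: inj_on_def)
  also have "\<dots> = (\<Sum>q | y q \<noteq> 0. \<tau> (ps_inner X (s + q) (x (s + q)) (ps_mult X s q \<xi> (y q))))"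
    using fock_neg[OF y] by (intro sum.cong) (auto simp: create_def)
  finally show ?thesis .
qed

text \<open>The bound is the square root of the norm of \<open>a\<close>, the inner square of
  \<open>\<xi>\<close>. In every fibre \<open>q\<close> the map sending \<open>c\<close> to
  \<open>\<tau>\<close> of the inner product of \<open>y q\<close> with \<open>c (y q)\<close> is a
  positive functional on \<open>A\<close>; its value at \<open>a\<close> is the squared length of
  the created component, and at the unit that of \<open>y q\<close>, so
  \<open>positive_functional_le\<close> applies.\<close>

lemma create_adjoint:
  assumes s: "0 \<le> s" and \<xi>: "\<xi> \<in> ps_carrier X s"
  shows "adjoint_ops (create s \<xi>) (annih s \<xi>)"
  unfolding adjoint_ops_def
proof (intro conjI ballI)
  fix x y assume x: "x \<in> fock_space" and y: "y \<in> fock_space"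
  have "fock_ip (annih s \<xi> x) y = (\<Sum>q | y q \<noteq> 0. \<tau> (ps_inner X q (annih s \<xi> x q) (y q)))"
    by (rule fock_ip_eq[OF annih_closed[OF s \<xi> x] y fock_finite[OF y]]) (use fock_neg[OF y] in auto)
  also have "\<dots> = (\<Sum>q | y q \<noteq> 0. \<tau> (ps_inner X (s + q) (x (s + q)) (ps_mult X s q \<xi> (y q))))"
    using fock_neg[OF y] s \<xi> x y by (intro sum.cong) (auto simp: annih_def inner_contract)
  finally show "fock_ip x (create s \<xi> y) = fock_ip (annih s \<xi> x) y"
    by (simp add: fock_ip_create[OF s \<xi> x y])
next
  define a where "a = ps_inner X s \<xi> \<xi>"
  have a: "a \<in> cs_carrier A" using s \<xi> by (simp add: a_def)
  define M where "M = sqrt (cs_norm A a)"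
  have "nrm (create s \<xi> y) \<le> M * nrm y" if y: "y \<in> fock_space" for y
  proof -
    have *: "Re (\<tau> (ps_inner X (s + q) (create s \<xi> y (s + q)) (ps_mult X s q \<xi> (y q)))) \<le> cs_norm A a * Re (\<tau> (ps_inner X q (y q) (y q)))"
      if "y q \<noteq> 0" for q
    proof -
      have q: "0 \<le> q" using fock_neg[OF y that] .
      interpret Q: hilbert_bimodule A "ps_fib X q" by (rule fib_bimodule[OF q])
      have yq: "y q \<in> ps_carrier X q" using y q by simp
      define \<phi> where "\<phi> c = \<tau> (ps_inner X q (y q) (ps_lact X q c (y q)))" for c
      have lin: "clinear_on (cs_carrier A) \<phi>"
        using yq q by (simp add: clinear_on_def \<phi>_def Q.lact_add_left Q.lact_scale_left Q.inner_add_right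
          Q.inner_scale_right \<tau>_add \<tau>_scale scaleC_complex_def)
      have pos: "\<phi> (cs_mult A (cs_star A c) c) \<in> \<real>\<^sub>\<ge>\<^sub>0" if c: "c \<in> cs_carrier A" for c
      proof -
        have "ps_inner X q (y q) (ps_lact X q (cs_mult A (cs_star A c) c) (y q)) = ps_inner X q (ps_lact X q c (y q)) (ps_lact X q c (y q))"
          using c yq q by (simp add: Q.lact_mult Q.inner_lact)
        moreover obtain d where "d \<in> cs_carrier A" "ps_inner X q (ps_lact X q c (y q)) (ps_lact X q c (y q)) = cs_mult A (cs_star A d) d"
          using Q.inner_positive[of "ps_lact X q c (y q)"] c yq q by (auto simp: cs_positive_def)
        ultimately show ?thesis using state_pos[OF state] by (simp add: \<phi>_def)
      qed
      have "ps_inner X (s + q) (create s \<xi> y (s + q)) (ps_mult X s q \<xi> (y q)) = ps_inner X q (y q) (ps_lact X q a (y q))"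
      proof -
        have "cs_star A a = a" using hilbert_module.inner_star[OF fib_module[OF s] \<xi> \<xi>] by (simp add: a_def)
        then show ?thesis using q s \<xi> yq a by (simp add: create_def inner_ps_mult Q.inner_lact flip: a_def)
      qed
      then have "Re (\<tau> (ps_inner X (s + q) (create s \<xi> y (s + q)) (ps_mult X s q \<xi> (y q)))) \<le> cmod (\<phi> a)"
        by (simp add: \<phi>_def complex_Re_le_cmod)
      also have "\<dots> \<le> cs_norm A a * Re (\<phi> one)"
        by (rule positive_functional_le(2)[OF is_unit_one lin pos a])
      finally show ?thesis using q yq by (simp add: \<phi>_def)
    qed
    have "(nrm (create s \<xi> y))\<^sup>2 = (\<Sum>q | y q \<noteq> 0. Re (\<tau> (ps_inner X (s + q) (create s \<xi> y (s + q)) (ps_mult X s q \<xi> (y q)))))"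
      using s \<xi> y by (simp add: nrm_sq fock_ip_create)
    also have "\<dots> \<le> (\<Sum>q | y q \<noteq> 0. cs_norm A a * Re (\<tau> (ps_inner X q (y q) (y q))))"
      by (intro sum_mono *) simp
    also have "\<dots> = cs_norm A a * (nrm y)\<^sup>2"
      using y by (simp add: nrm_sq fock_ip_def sum_distrib_left)
    also have "\<dots> = (M * nrm y)\<^sup>2" using a by (simp add: M_def power_mult_distrib)
    finally show ?thesis by (rule power2_le_imp_le) (use a y in \<open>simp add: M_def\<close>)
  qed
  then show "\<exists>M\<ge>0. \<forall>x\<in>fock_space. nrm (create s \<xi> x) \<le> M * nrm x"
    using a by (intro exI[of _ M]) (simp add: M_def)
qed (use assms in auto)

lemma create_create:
  assumes s: "0 \<le> s" and r: "0 \<le> r" and \<xi>: "\<xi> \<in> ps_carrier X s" and \<eta>: "\<eta> \<in> ps_carrier X r"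
    and v: "v \<in> fock_space"
  shows "create s \<xi> (create r \<eta> v) = create (s + r) (ps_mult X s r \<xi> \<eta>) v"
proof
  fix p
  have iff: "s + r \<le> p \<longleftrightarrow> s \<le> p \<and> r \<le> p - s"
    using r by (metis add.commute le_diff_eq add_increasing2 order_refl order_trans)
  show "create s \<xi> (create r \<eta> v) p = create (s + r) (ps_mult X s r \<xi> \<eta>) v p"
  proof (cases "s + r \<le> p")
    case True
    define q where "q = p - (s + r)"
    have p: "p = s + r + q" and q: "0 \<le> q" using True by (simp_all add: q_def)
    have "v q \<in> ps_carrier X q" using v q by simp
    then show ?thesis using s r q \<xi> \<eta> ps_mult_assoc[OF s r q \<xi> \<eta>, of "v q"]
      by (simp add: create_def p add.assoc)
  next
    case False
    then show ?thesis using s \<xi> iff by (auto simp: create_def)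
  qed
qed

lemma annih_create:
  assumes s: "0 \<le> s" and \<xi>: "\<xi> \<in> ps_carrier X s" and \<eta>: "\<eta> \<in> ps_carrier X s" and v: "v \<in> fock_space"
  shows "annih s \<xi> (create s \<eta> v) = create 0 (ps_inner X s \<xi> \<eta>) v"
proof
  fix p
  show "annih s \<xi> (create s \<eta> v) p = create 0 (ps_inner X s \<xi> \<eta>) v p"
    using assms by (simp add: annih_def create_def contract_mult mult_0_left)
qed

lemma annih_0:
  assumes a: "a \<in> cs_carrier A" and v: "v \<in> fock_space"
  shows "annih 0 a v = create 0 (cs_star A a) v"
proof
  fix p
  show "annih 0 a v p = create 0 (cs_star A a) v p"
  proof (cases "0 \<le> p")
    case True
    interpret P: hilbert_bimodule A "ps_fib X p" by (rule fib_bimodule[OF True])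
    have "contract 0 p a (v p) = ps_lact X p (cs_star A a) (v p)"
      by (rule P.inner_eqI)
        (use a v True inner_contract(1)[of 0 p a _ "v p"] contract_closed[of 0 p a "v p"] in
          \<open>simp_all add: mult_0_left P.inner_lact\<close>)
    then show ?thesis using True a v by (simp add: annih_def create_def mult_0_left)
  qed (simp add: annih_def create_def)
qed

section \<open>The Fock representation: Toeplitz relations and Nica covariance\<close>

definition fock_rep :: "'g \<Rightarrow> 'u \<Rightarrow> ('g \<Rightarrow> 'u) \<Rightarrow> ('g \<Rightarrow> 'u) \<Rightarrow> complex" where
  "fock_rep s \<xi> = form (create s \<xi>)"

lemma form_create_linear:
  assumes s: "0 \<le> s" shows "clinear_on (ps_carrier X s) (fock_rep s)"
  unfolding clinear_on_def
proof (intro conjI ballI allI)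
  fix \<xi> \<eta> assume x: "\<xi> \<in> ps_carrier X s" "\<eta> \<in> ps_carrier X s"
  have "form (create s (\<xi> + \<eta>)) = form (\<lambda>v. create s \<xi> v + create s \<eta> v)"
  proof (rule form_cong, rule ext)
    fix v p assume "v \<in> fock_space"
    then show "create s (\<xi> + \<eta>) v p = (create s \<xi> v + create s \<eta> v) p"
      using x s by (simp add: create_def clinear_on_add[OF ps_mult_linear_left])
  qed
  then show "fock_rep s (\<xi> + \<eta>) = fock_rep s \<xi> + fock_rep s \<eta>"
    using x by (simp add: fock_rep_def form_add[OF create_adjoint create_adjoint] s)
next
  fix c \<xi> assume x: "\<xi> \<in> ps_carrier X s"
  have "form (create s (c *\<^sub>C \<xi>)) = form (\<lambda>v. c *\<^sub>C create s \<xi> v)"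
  proof (rule form_cong, rule ext)
    fix v p assume "v \<in> fock_space"
    then show "create s (c *\<^sub>C \<xi>) v p = (c *\<^sub>C create s \<xi> v) p"
      using x s by (simp add: create_def scaleC_fun_def clinear_on_scale[OF ps_mult_linear_left])
  qed
  then show "fock_rep s (c *\<^sub>C \<xi>) = c *\<^sub>C fock_rep s \<xi>"
    using x by (simp add: fock_rep_def form_scale[OF create_adjoint] s)
qed

lemma fock_toeplitz: "toeplitz_representation A X form_alg fock_rep"
proof -
  interpret D: cstar_algebra form_alg by (rule form_alg_cstar)
  have mult: "form_mult (fock_rep s \<xi>) (fock_rep r \<eta>) = fock_rep (s + r) (ps_mult X s r \<xi> \<eta>)"
    if "0 \<le> s" "0 \<le> r" "\<xi> \<in> ps_carrier X s" "\<eta> \<in> ps_carrier X r" for s r \<xi> \<eta>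
    unfolding fock_rep_def form_mult_comp[OF create_adjoint[OF that(1,3)] create_adjoint[OF that(2,4)]]
    by (rule form_cong) (simp add: create_create that)
  have star: "form_star (fock_rep s \<xi>) = form (annih s \<xi>)" if "0 \<le> s" "\<xi> \<in> ps_carrier X s" for s \<xi>
    unfolding fock_rep_def by (rule form_star_form[OF create_adjoint[OF that]])
  have closed: "fock_rep s \<xi> \<in> form_set" if "0 \<le> s" "\<xi> \<in> ps_carrier X s" for s \<xi>
    unfolding fock_rep_def by (rule form_in_form_set[OF create_adjoint[OF that]])
  show ?thesis
  proof unfold_locales
    show "star_hom A form_alg (fock_rep 0)"
      unfolding star_hom_def
    proof (intro conjI ballI)
      show "clinear_on (cs_carrier A) (fock_rep 0)" using form_create_linear[of 0] by simp
      show "fock_rep 0 (cs_mult A a c) = cs_mult form_alg (fock_rep 0 a) (fock_rep 0 c)"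
        if "a \<in> cs_carrier A" "c \<in> cs_carrier A" for a c
        using mult[of 0 0 a c] that mult_0_left[of 0 a c] by (simp add: lact_0)
      show "fock_rep 0 (cs_star A a) = cs_star form_alg (fock_rep 0 a)" if a: "a \<in> cs_carrier A" for a
        using star[of 0 a] a by (simp add: fock_rep_def) (rule form_cong, simp add: annih_0 a)
      show "fock_rep 0 ` cs_carrier A \<subseteq> cs_carrier form_alg" using closed[of 0] by auto
    qed
    show "cs_mult form_alg (cs_star form_alg (fock_rep s \<xi>)) (fock_rep s \<eta>) = fock_rep 0 (ps_inner X s \<xi> \<eta>)"
      if "0 \<le> s" "\<xi> \<in> ps_carrier X s" "\<eta> \<in> ps_carrier X s" for s \<xi> \<eta>
    proof -
      have "form_mult (form (annih s \<xi>)) (form (create s \<eta>)) = form (\<lambda>v. annih s \<xi> (create s \<eta> v))"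
        by (rule form_mult_comp[OF adjoint_ops_swap[OF create_adjoint] create_adjoint]) (use that in auto)
      also have "\<dots> = form (create 0 (ps_inner X s \<xi> \<eta>))"
        by (rule form_cong) (simp add: annih_create that)
      finally show ?thesis using that by (simp add: star) (simp add: fock_rep_def)
    qed
  qed (simp_all add: mult closed form_create_linear)
qed

sublocale F: finite_type_representation A X n b m form_alg fock_rep
  by (intro finite_type_representation.intro fock_toeplitz finite_type_product_system_axioms)

text \<open>The block diagonal operator with block \<open>i_s^p(S)\<close> in each fibre
  \<open>p \<ge> s\<close> and \<open>0\<close> in the other fibres; it represents \<open>S\<close>
  on the Fock space, by \<open>operator_rep_diag\<close>.\<close>

definition diag_op :: "'g \<Rightarrow> ('u \<Rightarrow> 'u) \<Rightarrow> ('g \<Rightarrow> 'u) \<Rightarrow> 'g \<Rightarrow> 'u" where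
  "diag_op s S v = (\<lambda>p. if s \<le> p then amplify s (p - s) S (v p) else 0)"

lemma fock_rep_star_form:
  assumes "0 \<le> s" "\<xi> \<in> ps_carrier X s" "0 \<le> r" "\<eta> \<in> ps_carrier X r"
  shows "form_mult (fock_rep s \<xi>) (form_star (fock_rep r \<eta>)) = form (\<lambda>v. create s \<xi> (annih r \<eta> v))"
    and "adjoint_ops (\<lambda>v. create s \<xi> (annih r \<eta> v)) (\<lambda>v. create r \<eta> (annih s \<xi> v))"
proof -
  note c = create_adjoint[OF assms(1,2)] and a = adjoint_ops_swap[OF create_adjoint[OF assms(3,4)]]
  show "form_mult (fock_rep s \<xi>) (form_star (fock_rep r \<eta>)) = form (\<lambda>v. create s \<xi> (annih r \<eta> v))"
    unfolding fock_rep_def form_star_form[OF create_adjoint[OF assms(3,4)]] by (rule form_mult_comp[OF c a])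
  show "adjoint_ops (\<lambda>v. create s \<xi> (annih r \<eta> v)) (\<lambda>v. create r \<eta> (annih s \<xi> v))"
    by (rule adjoint_ops_comp[OF c a])
qed

lemma operator_rep_diag:
  assumes s: "0 \<le> s" and S: "S \<in> adjointables (ps_fib X s)"
  shows "F.operator_rep s S = form (diag_op s S)" and "\<exists>T. adjoint_ops (diag_op s S) T"
proof -
  have eq: "diag_op s S = (\<lambda>v. \<Sum>j<n s. create s (S (b s j)) (annih s (b s j) v))"
    by (intro ext) (auto simp: diag_op_def sum_fun_apply create_def annih_def amplify_def)
  have adj: "adjoint_ops (\<lambda>v. create s (S (b s j)) (annih s (b s j) v)) (\<lambda>v. create s (b s j) (annih s (S (b s j)) v))"
    if "j \<in> {..<n s}" for j
    using fock_rep_star_form(2)[of s "S (b s j)" s "b s j"] s S that by simp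
  show "\<exists>T. adjoint_ops (diag_op s S) T"
    unfolding eq by (rule exI, rule adjoint_ops_sum[OF adj])
  have "F.operator_rep s S = (\<Sum>j<n s. form (\<lambda>v. create s (S (b s j)) (annih s (b s j) v)))"
    unfolding F.operator_rep_def using s S by (intro sum.cong) (simp_all add: fock_rep_star_form(1))
  also have "\<dots> = form (diag_op s S)" unfolding eq by (rule form_sum[OF adj, symmetric])
  finally show "F.operator_rep s S = form (diag_op s S)" .
qed

text \<open>Both factors are block diagonal. The product of their blocks at \<open>p\<close>
  vanishes unless \<open>s \<le> p\<close> and \<open>r \<le> p\<close>, that is, unless
  \<open>p\<close> is above \<open>sup s r\<close>; there \<open>amplify_amplify\<close> factors
  both blocks through the fibre at \<open>sup s r\<close>.\<close>

lemma fock_nica: "nica_representation A X form_alg fock_rep"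
proof (rule F.nica_representationI)
  fix s r :: 'g and S T
  assume s: "0 \<le> s" and r: "0 \<le> r" and S: "S \<in> adjointables (ps_fib X s)" and T: "T \<in> adjointables (ps_fib X r)"
  define q where "q = sup s r"
  define R where "R = ps_incl A X s q S \<circ> ps_incl A X r q T"
  have q: "0 \<le> q" using s by (simp add: q_def le_supI1)
  have sq: "s \<le> q" "r \<le> q" by (simp_all add: q_def)
  have R: "R \<in> adjointables (ps_fib X q)" unfolding R_def
    by (intro hilbert_module.adjointables_comp[OF fib_module[OF q]] F.ps_incl_adjointable s r S T sq)
  have "diag_op s S (diag_op r T v) = diag_op q R v" if v: "v \<in> fock_space" for v
  proof
    fix p
    show "diag_op s S (diag_op r T v) p = diag_op q R v p"
    proof (cases "q \<le> p")
      case True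
      define t where "t = p - q"
      define c d where "c = q - s" and "d = q - r"
      have t: "0 \<le> t" and c: "0 \<le> c" and d: "0 \<le> d" using True sq by (simp_all add: t_def c_def d_def)
      have p: "p = q + t" and qc: "q = s + c" and qd: "q = r + d" by (simp_all add: t_def c_def d_def)
      have ps: "p - s = c + t" "p - r = d + t" by (simp_all add: t_def c_def d_def)
      have sp: "s \<le> p" "r \<le> p" using sq True order_trans by blast+
      have "v p \<in> ps_carrier X (q + t)" using v q t by (simp add: p)
      then have "amplify s (c + t) S (amplify r (d + t) T (v p)) = amplify q t R (v p)"
      proof (rule eq_on_products[OF q t, rotated 3])
        have sct: "s + (c + t) = q + t" "r + (d + t) = q + t" using qc qd by (simp_all add: add.assoc)
        note aS = amplify_linear[OF s add_nonneg_nonneg[OF c t] S, unfolded sct]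
        note aT = amplify_linear[OF r add_nonneg_nonneg[OF d t] T, unfolded sct]
        note cT = amplify_closed[OF r add_nonneg_nonneg[OF d t] T, unfolded sct]
        show "clinear_on (ps_carrier X (q + t)) (\<lambda>w. amplify s (c + t) S (amplify r (d + t) T w))"
          using aS aT cT by (simp add: clinear_on_def)
        show "clinear_on (ps_carrier X (q + t)) (amplify q t R)" by (rule amplify_linear[OF q t R])
        fix \<eta> \<zeta> assume \<eta>: "\<eta> \<in> ps_carrier X q" and \<zeta>: "\<zeta> \<in> ps_carrier X t"
        have Tc: "amplify r d T \<eta> \<in> ps_carrier X q" using amplify_closed[OF r d T] \<eta> qd by simp
        have "amplify r (d + t) T (ps_mult X q t \<eta> \<zeta>) = ps_mult X q t (amplify r d T \<eta>) \<zeta>"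
          using amplify_amplify[OF r d t T, of \<eta> \<zeta>] \<eta> \<zeta> qd by simp
        moreover have "amplify s (c + t) S (ps_mult X q t (amplify r d T \<eta>) \<zeta>) = ps_mult X q t (amplify s c S (amplify r d T \<eta>)) \<zeta>"
          using amplify_amplify[OF s c t S, of "amplify r d T \<eta>" \<zeta>] Tc \<zeta> qc by simp
        moreover have "R \<eta> = amplify s c S (amplify r d T \<eta>)"
          using ps_incl_eq[OF s c S] ps_incl_eq[OF r d T] \<eta> Tc by (simp add: R_def flip: qc qd)
        ultimately show "amplify s (c + t) S (amplify r (d + t) T (ps_mult X q t \<eta> \<zeta>)) = amplify q t R (ps_mult X q t \<eta> \<zeta>)"
          using amplify_mult[OF q t R \<eta> \<zeta>] by simp
      qed
      then show ?thesis using True sp by (simp add: diag_op_def ps flip: t_def)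
    next
      case False
      then have "\<not> (s \<le> p \<and> r \<le> p)" by (auto simp: q_def)
      moreover have "amplify s (p - s) S 0 = 0" if "s \<le> p"
        using clinear_on_zero[OF amplify_linear[OF s _ S, of "p - s"] fib_subspace] that le_index[OF s that] by simp
      ultimately show ?thesis using False by (auto simp: diag_op_def)
    qed
  qed
  then have "form (\<lambda>v. diag_op s S (diag_op r T v)) = form (diag_op q R)" by (rule form_cong)
  moreover obtain S' T' where "adjoint_ops (diag_op s S) S'" "adjoint_ops (diag_op r T) T'"
    using operator_rep_diag(2)[OF s S] operator_rep_diag(2)[OF r T] by blast
  ultimately have "form_mult (form (diag_op s S)) (form (diag_op r T)) = form (diag_op q R)"
    by (simp add: form_mult_comp)
  then show "cs_mult form_alg (F.operator_rep s S) (F.operator_rep r T) =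
      F.operator_rep (sup s r) (ps_incl A X s (sup s r) S \<circ> ps_incl A X r (sup s r) T)"
    using operator_rep_diag(1)[OF s S] operator_rep_diag(1)[OF r T] operator_rep_diag(1)[OF q R]
    by (simp add: R_def q_def)
qed

text \<open>A vector of the Fock space is coded by a list of its nonzero components; forms on the Fock
  space thereby become elements of the universe of test objects.\<close>

definition decode :: "(bool \<times> 'g \<times> 'u) list \<Rightarrow> 'g \<Rightarrow> 'u" where
  "decode l p = (case map_of (map snd l) p of None \<Rightarrow> 0 | Some \<xi> \<Rightarrow> \<xi>)"

definition embed :: "(('g \<Rightarrow> 'u) \<Rightarrow> ('g \<Rightarrow> 'u) \<Rightarrow> complex) \<Rightarrow> ('g, 'u) nt_universe" where
  "embed F w = F (decode (concat (w 0))) (decode (concat (w 1)))"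

lemma decode_surj: assumes "v \<in> fock_space" shows "\<exists>l. decode l = v"
proof -
  obtain xs where xs: "set xs = {p. v p \<noteq> 0}" using finite_list[OF fock_finite[OF assms]] by blast
  have "map_of (map snd (map (\<lambda>p. (True, p, v p)) xs)) p = (if p \<in> set xs then Some (v p) else None)" for p
    by (induction xs) auto
  then have "decode (map (\<lambda>p. (True, p, v p)) xs) = v"
    by (auto simp: decode_def fun_eq_iff xs)
  then show ?thesis by blast
qed

lemma embed_transport: "cstar_transport form_alg embed"
proof -
  have "inj_on embed form_set"
  proof (rule inj_onI, intro ext)
    fix F G x y assume FG: "F \<in> form_set" "G \<in> form_set" "embed F = embed G"
    show "F x y = G x y"
    proof (cases "x \<in> fock_space \<and> y \<in> fock_space")
      case True
      then obtain k l where "decode k = x" "decode l = y" using decode_surj by blast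
      \<comment> \<open>The sequence with \<open>[k]\<close> at \<open>0\<close> and
        \<open>[l]\<close> elsewhere evaluates \<open>embed\<close> at \<open>x\<close> and
        \<open>y\<close>: \<open>concat\<close> removes the extra layer of lists.\<close>
      then show ?thesis using fun_cong[OF FG(3), of "\<lambda>i. if i = 0 then [k] else [l]"] by (simp add: embed_def)
    next
      case False
      then show ?thesis using form_setD[OF FG(1), of x y] form_setD[OF FG(2), of x y] by auto
    qed
  qed
  moreover have "clinear_on form_set embed"
    by (simp add: clinear_on_def embed_def fun_eq_iff scaleC_fun_def)
  ultimately show ?thesis
    using form_alg_cstar by (simp add: cstar_transport_def cstar_transport_axioms_def)
qed

text \<open>The representation is moved into \<open>nt_universe\<close> along \<open>embed\<close>,
  the universal property is applied there, and the resulting homomorphism is moved back by the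
  inverse of \<open>embed\<close>.\<close>

lemma fock_universal:
  assumes "nica_toeplitz_algebra A X C \<iota>"
  obtains \<pi> where "star_hom C form_alg \<pi>"
    "\<And>s \<xi>. \<lbrakk>0 \<le> s; \<xi> \<in> ps_carrier X s\<rbrakk> \<Longrightarrow> \<pi> (\<iota> s \<xi>) = fock_rep s \<xi>"
proof -
  interpret N: nica_toeplitz_algebra A X C \<iota> by (rule assms)
  interpret E: cstar_transport form_alg embed by (rule embed_transport)
  let ?D = "image_cstar embed form_alg"
  have "nica_representation A X ?D (\<lambda>s \<xi>. embed (fock_rep s \<xi>))"
    by (rule F.transport_nica[OF fock_nica E.image_cstar_algebra E.star_hom_e])
  from N.universal[OF this] obtain \<pi> where \<pi>: "star_hom C ?D \<pi>"
    "\<And>s \<xi>. 0 \<le> s \<Longrightarrow> \<xi> \<in> ps_carrier X s \<Longrightarrow> \<pi> (\<iota> s \<xi>) = embed (fock_rep s \<xi>)" by blast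
  let ?i = "inv_into form_set embed"
  have "star_hom C form_alg (\<lambda>c. ?i (\<pi> c))"
    using star_hom_comp[OF \<pi>(1) E.star_hom_inv] by simp
  moreover have "?i (\<pi> (\<iota> s \<xi>)) = fock_rep s \<xi>" if "0 \<le> s" "\<xi> \<in> ps_carrier X s" for s \<xi>
    using \<pi>(2)[OF that] E.e_inj F.rep_closed[OF that] by simp
  ultimately show ?thesis using that by blast
qed

end

section \<open>Generated subalgebras\<close>

context cstar_algebra
begin

abbreviation "cl \<equiv> closure_wrt (cs_norm A) (cs_carrier A)"

lemma subset_cl: "S \<subseteq> cs_carrier A \<Longrightarrow> S \<subseteq> cl S"
  by (force simp: closure_wrt_def)

lemma cl_approx:
  assumes "x \<in> cl S" "0 < e" obtains y where "y \<in> S" "cs_norm A (x - y) < e"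
  using assms by (auto simp: closure_wrt_def)

lemma norm_diff_le: "x \<in> cs_carrier A \<Longrightarrow> y \<in> cs_carrier A \<Longrightarrow> cs_norm A (x - y) \<le> cs_norm A x + cs_norm A y"
  using norm_triangle[of x "- y"] by (simp add: norm_minus)

lemma cl_cl: assumes "S \<subseteq> cs_carrier A" shows "cl (cl S) = cl S"
proof
  show "cl S \<subseteq> cl (cl S)" by (rule subset_cl) (auto simp: closure_wrt_def)
  show "cl (cl S) \<subseteq> cl S"
  proof
    fix x assume x: "x \<in> cl (cl S)"
    have "\<exists>z\<in>S. cs_norm A (x - z) < e" if e: "0 < e" for e
    proof -
      have e2: "0 < e / 2" using e by simp
      obtain y where y: "y \<in> cl S" "cs_norm A (x - y) < e / 2" by (rule cl_approx[OF x e2])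
      obtain z where z: "z \<in> S" "cs_norm A (y - z) < e / 2" by (rule cl_approx[OF y(1) e2])
      have "cs_norm A (x - z) < e"
        using norm_diff_triangle[of x y z] x y z assms by (auto simp: closure_wrt_def)
      then show ?thesis using z by blast
    qed
    then show "x \<in> cl S" using x by (simp add: closure_wrt_def)
  qed
qed

text \<open>An error \<open>K * e\<close> with \<open>e \<le> 1\<close> is allowed, so that
  estimates for sums and products can be used as they arise.\<close>

lemma clI:
  assumes "x \<in> cs_carrier A" "\<And>e. 0 < e \<Longrightarrow> e \<le> 1 \<Longrightarrow> \<exists>y\<in>S. cs_norm A (x - y) \<le> K * e"
  shows "x \<in> cl S"
  unfolding closure_wrt_def
proof (intro CollectI conjI allI impI)
  fix \<epsilon> :: real assume \<epsilon>: "0 < \<epsilon>"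
  define e where "e = min 1 (\<epsilon> / (2 * (\<bar>K\<bar> + 1)))"
  have e: "0 < e" "e \<le> 1" using \<epsilon> by (auto simp: e_def)
  then obtain y where y: "y \<in> S" "cs_norm A (x - y) \<le> K * e" using assms(2) by blast
  have "K * e \<le> (\<bar>K\<bar> + 1) * e" using e by (intro mult_right_mono) auto
  also have "\<dots> \<le> (\<bar>K\<bar> + 1) * (\<epsilon> / (2 * (\<bar>K\<bar> + 1)))" by (intro mult_left_mono) (auto simp: e_def)
  also have "\<dots> = \<epsilon> / 2" by (simp add: field_simps)
  finally show "\<exists>y\<in>S. cs_norm A (x - y) < \<epsilon>" using y \<epsilon> by (intro bexI[of _ y]) auto
qed (rule assms(1))

lemma cl_subalgebra:
  assumes B: "B \<subseteq> cs_carrier A" "csubspace B"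
    and mult: "\<And>x y. x \<in> B \<Longrightarrow> y \<in> B \<Longrightarrow> cs_mult A x y \<in> B"
    and star: "\<And>x. x \<in> B \<Longrightarrow> cs_star A x \<in> B"
  shows "cstar_subalgebra A (cl B)"
proof -
  have c: "x \<in> cs_carrier A" if "x \<in> cl B" for x using that by (simp add: closure_wrt_def)
  have Bc: "x \<in> cs_carrier A" if "x \<in> B" for x using that B by auto
  have sub: "csubspace (cl B)"
    unfolding complex_vector.subspace_def
  proof (intro conjI ballI allI)
    show "0 \<in> cl B" using complex_vector.subspace_0[OF B(2)] subset_cl[OF B(1)] by blast
  next
    fix x y assume x: "x \<in> cl B" and y: "y \<in> cl B"
    show "x + y \<in> cl B"
    proof (rule clI[where K = 2])
      fix e :: real assume "0 < e"
      obtain x' where x': "x' \<in> B" "cs_norm A (x - x') < e" by (rule cl_approx[OF x \<open>0 < e\<close>])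
      obtain y' where y': "y' \<in> B" "cs_norm A (y - y') < e" by (rule cl_approx[OF y \<open>0 < e\<close>])
      have "cs_norm A (x + y - (x' + y')) \<le> 2 * e"
        using norm_triangle[of "x - x'" "y - y'"] c[OF x] c[OF y] x' y' Bc
        by (simp add: algebra_simps)
      then show "\<exists>z\<in>B. cs_norm A (x + y - z) \<le> 2 * e"
        using complex_vector.subspace_add[OF B(2)] x' y' by blast
    qed (use c x y in simp)
  next
    fix k x assume x: "x \<in> cl B"
    show "k *\<^sub>C x \<in> cl B"
    proof (rule clI[where K = "cmod k"])
      fix e :: real assume "0 < e"
      obtain x' where x': "x' \<in> B" "cs_norm A (x - x') < e" by (rule cl_approx[OF x \<open>0 < e\<close>])
      have "cs_norm A (k *\<^sub>C x - k *\<^sub>C x') \<le> cmod k * e"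
        using c[OF x] x' Bc by (simp add: norm_scale mult_left_mono flip: complex_vector.scale_right_diff_distrib)
      then show "\<exists>z\<in>B. cs_norm A (k *\<^sub>C x - z) \<le> cmod k * e"
        using complex_vector.subspace_scale[OF B(2)] x' by blast
    qed (use c x in simp)
  qed
  have mcl: "cs_mult A x y \<in> cl B" if x: "x \<in> cl B" and y: "y \<in> cl B" for x y
  proof (rule clI[where K = "cs_norm A x + cs_norm A y + 1"])
    fix e :: real assume e: "0 < e" "e \<le> 1"
    obtain x' where x': "x' \<in> B" "cs_norm A (x - x') < e" by (rule cl_approx[OF x e(1)])
    obtain y' where y': "y' \<in> B" "cs_norm A (y - y') < e" by (rule cl_approx[OF y e(1)])
    note [simp] = c[OF x] c[OF y] Bc[OF x'(1)] Bc[OF y'(1)]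
    \<comment> \<open>The restriction \<open>e \<le> 1\<close> bounds \<open>y'\<close>
      independently of \<open>e\<close>.\<close>
    have "cs_norm A y' \<le> cs_norm A y + 1"
      using norm_triangle[of y "y' - y"] norm_minus_commute[of y y'] y' e by simp
    have "cs_norm A (cs_mult A x y - cs_mult A x' y') = cs_norm A (cs_mult A x (y - y') + cs_mult A (x - x') y')"
      by (simp add: mult_diff diff_mult)
    also have "\<dots> \<le> cs_norm A x * cs_norm A (y - y') + cs_norm A (x - x') * cs_norm A y'"
      using norm_triangle[of "cs_mult A x (y - y')" "cs_mult A (x - x') y'"] norm_mult[of x "y - y'"] norm_mult[of "x - x'" y']
      by simp
    also have "\<dots> \<le> cs_norm A x * e + e * (cs_norm A y + 1)"
      using x' y' e \<open>cs_norm A y' \<le> cs_norm A y + 1\<close> by (intro add_mono mult_mono) auto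
    finally have "cs_norm A (cs_mult A x y - cs_mult A x' y') \<le> (cs_norm A x + cs_norm A y + 1) * e"
      by (simp add: algebra_simps)
    then show "\<exists>z\<in>B. cs_norm A (cs_mult A x y - z) \<le> (cs_norm A x + cs_norm A y + 1) * e"
      using mult x' y' by blast
  qed (use c x y in simp)
  have scl: "cs_star A x \<in> cl B" if x: "x \<in> cl B" for x
  proof (rule clI[where K = 1])
    fix e :: real assume "0 < e"
    obtain x' where x': "x' \<in> B" "cs_norm A (x - x') < e" by (rule cl_approx[OF x \<open>0 < e\<close>])
    have "cs_norm A (cs_star A x - cs_star A x') \<le> 1 * e"
      using c[OF x] x' Bc by (simp flip: star_diff)
    then show "\<exists>z\<in>B. cs_norm A (cs_star A x - z) \<le> 1 * e" using star x' by blast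
  qed (use c x in simp)
  show ?thesis
    using sub mcl scl cl_cl[OF B(1)] c by (auto simp: cstar_subalgebra_def)
qed

lemma subalgebra_cstar_algebra:
  assumes B: "cstar_subalgebra A B" shows "cstar_algebra (A\<lparr>cs_carrier := B\<rparr>)"
proof -
  have Bc: "x \<in> cs_carrier A" if "x \<in> B" for x using B that by (auto simp: cstar_subalgebra_def)
  have sub: "csubspace B" and clos: "cl B = B"
    and m: "\<And>x y. x \<in> B \<Longrightarrow> y \<in> B \<Longrightarrow> cs_mult A x y \<in> B" and s: "\<And>x. x \<in> B \<Longrightarrow> cs_star A x \<in> B"
    using B by (auto simp: cstar_subalgebra_def)
  show ?thesis
  proof (unfold_locales, simp_all add: Bc m s sub)
    show "clinear_on B (\<lambda>x. cs_mult A x y)" if "y \<in> B" for y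
      by (rule clinear_on_subset[OF mult_linear_left]) (use Bc that in auto)
    show "clinear_on B (cs_mult A x)" if "x \<in> B" for x
      by (rule clinear_on_subset[OF mult_linear_right]) (use Bc that in auto)
    show "complete_wrt (cs_norm A) B"
      unfolding complete_wrt_def
    proof (intro allI impI)
      fix x :: "nat \<Rightarrow> 'a" assume x: "\<forall>k. x k \<in> B"
        and "\<forall>\<epsilon>>0. \<exists>K. \<forall>k\<ge>K. \<forall>l\<ge>K. cs_norm A (x k - x l) < \<epsilon>"
      then obtain y where y: "y \<in> cs_carrier A" "(\<lambda>k. cs_norm A (x k - y)) \<longlonglongrightarrow> 0"
        using complete Bc unfolding complete_wrt_def by blast
      have "\<exists>z\<in>B. cs_norm A (y - z) < e" if "0 < e" for e
      proof -
        have "\<forall>\<^sub>F k in sequentially. cs_norm A (x k - y) < e" using y(2) that by (rule order_tendstoD)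
        then obtain k where "cs_norm A (x k - y) < e" by (auto simp: eventually_sequentially)
        then show ?thesis using x Bc y norm_minus_commute[of "x k" y] by (intro bexI[of _ "x k"]) auto
      qed
      then have "y \<in> cl B" using y by (simp add: closure_wrt_def)
      then show "\<exists>y\<in>B. (\<lambda>k. cs_norm A (x k - y)) \<longlonglongrightarrow> 0" using y clos by auto
    qed
  qed (auto simp: Bc mult_assoc star_add star_scale star_mult norm_eq_0 norm_triangle norm_scale norm_mult cstar_identity)
qed

lemma cspan_mult_closed:
  assumes S: "S \<subseteq> cs_carrier A" and mult: "\<And>x y. x \<in> S \<Longrightarrow> y \<in> S \<Longrightarrow> cs_mult A x y \<in> cspan S"
    and x: "x \<in> cspan S" and y: "y \<in> cspan S"
  shows "cs_mult A x y \<in> cspan S"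
proof -
  have c: "cspan S \<subseteq> cs_carrier A" by (intro complex_vector.span_minimal S subspace)
  note sp = complex_vector.span_add complex_vector.span_scale complex_vector.span_zero
  have 1: "cs_mult A x y \<in> cspan S" if y: "y \<in> S" and x: "x \<in> cspan S" for x y
  proof -
    have "csubspace {x \<in> cs_carrier A. cs_mult A x y \<in> cspan S}"
      using y S by (auto simp: complex_vector.subspace_def add_mult scale_mult sp subset_iff)
    then have "cspan S \<subseteq> {x \<in> cs_carrier A. cs_mult A x y \<in> cspan S}"
      by (intro complex_vector.span_minimal) (use mult y S in auto)
    then show ?thesis using x by auto
  qed
  have xc: "x \<in> cs_carrier A" using x c by auto
  have "csubspace {y \<in> cs_carrier A. cs_mult A x y \<in> cspan S}"
    using xc by (auto simp: complex_vector.subspace_def mult_add mult_scale sp)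
  then have "cspan S \<subseteq> {y \<in> cs_carrier A. cs_mult A x y \<in> cspan S}"
    by (intro complex_vector.span_minimal) (use 1 x S in auto)
  then show ?thesis using y by auto
qed

lemma cspan_star_closed:
  assumes S: "S \<subseteq> cs_carrier A" and star: "\<And>x. x \<in> S \<Longrightarrow> cs_star A x \<in> S" and x: "x \<in> cspan S"
  shows "cs_star A x \<in> cspan S"
proof -
  have "csubspace {x \<in> cs_carrier A. cs_star A x \<in> cspan S}"
    by (auto simp: complex_vector.subspace_def star_add star_scale
        complex_vector.span_add complex_vector.span_scale complex_vector.span_zero)
  then have "cspan S \<subseteq> {x \<in> cs_carrier A. cs_star A x \<in> cspan S}"
    by (intro complex_vector.span_minimal) (use star S complex_vector.span_base[of _ S] in auto)
  then show ?thesis using x by auto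
qed

end

section \<open>The Nica--Toeplitz algebra\<close>

context finite_type_representation
begin

definition elem :: "'g \<Rightarrow> 'u \<Rightarrow> 'g \<Rightarrow> 'u \<Rightarrow> 'c" where
  "elem s \<xi> r \<eta> = cs_mult C (\<psi> s \<xi>) (cs_star C (\<psi> r \<eta>))"

lemma elem_closed [simp]:
  "\<lbrakk>0 \<le> s; 0 \<le> r; \<xi> \<in> ps_carrier X s; \<eta> \<in> ps_carrier X r\<rbrakk> \<Longrightarrow> elem s \<xi> r \<eta> \<in> cs_carrier C"
  by (simp add: elem_def)

lemma star_elem:
  "\<lbrakk>0 \<le> s; 0 \<le> r; \<xi> \<in> ps_carrier X s; \<eta> \<in> ps_carrier X r\<rbrakk> \<Longrightarrow> cs_star C (elem s \<xi> r \<eta>) = elem r \<eta> s \<xi>"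
  by (simp add: elem_def C.star_mult)

text \<open>On a product this is the Toeplitz relation together with \<open>contract_mult\<close>,
  and products span \<open>X (s + t)\<close>.\<close>

lemma rep_star_mult:
  assumes s: "0 \<le> s" and t: "0 \<le> t" and \<xi>: "\<xi> \<in> ps_carrier X s" and w: "w \<in> ps_carrier X (s + t)"
  shows "cs_mult C (cs_star C (\<psi> s \<xi>)) (\<psi> (s + t) w) = \<psi> t (contract s t \<xi> w)"
proof (rule eq_on_products[OF s t _ _ _ w])
  have st: "0 \<le> s + t" using s t by simp
  show "clinear_on (ps_carrier X (s + t)) (\<lambda>w. cs_mult C (cs_star C (\<psi> s \<xi>)) (\<psi> (s + t) w))"
    using s \<xi> st by (simp add: clinear_on_def clinear_on_add[OF rep_linear] clinear_on_scale[OF rep_linear]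
      C.mult_add C.mult_scale)
  show "clinear_on (ps_carrier X (s + t)) (\<lambda>w. \<psi> t (contract s t \<xi> w))"
    using contract_linear[OF s t \<xi>] rep_linear[OF t] contract_closed[OF s t \<xi>] by (simp add: clinear_on_def)
  fix \<eta> \<zeta> assume "\<eta> \<in> ps_carrier X s" "\<zeta> \<in> ps_carrier X t"
  then show "cs_mult C (cs_star C (\<psi> s \<xi>)) (\<psi> (s + t) (ps_mult X s t \<eta> \<zeta>)) = \<psi> t (contract s t \<xi> (ps_mult X s t \<eta> \<zeta>))"
    using s t \<xi> by (simp add: contract_mult rep_lact flip: rep_mult rep_inner) (simp add: C.mult_assoc)
qed

section \<open>Wick ordering by means of the projections that represent the identities of the
  fibres\<close>

definition id_op :: "'g \<Rightarrow> 'u \<Rightarrow> 'u" where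
  "id_op s = (\<lambda>\<xi>. if \<xi> \<in> ps_carrier X s then \<xi> else 0)"

lemma id_op_pair: "adjoint_pair (ps_fib X s) (ps_fib X s) (id_op s) (id_op s)"
  by (auto simp: adjoint_pair_def id_op_def)

lemma id_op_adjointable: "id_op s \<in> adjointables (ps_fib X s)"
  using id_op_pair by (auto simp: adjointables_def id_op_def)

lemma ps_incl_id:
  assumes s: "0 \<le> s" and sp: "s \<le> p" shows "ps_incl A X s p (id_op s) = id_op p"
proof
  fix w
  define r where "r = p - s"
  have r: "0 \<le> r" and p: "p = s + r" using sp by (simp_all add: r_def)
  have "amplify s r (id_op s) w = w" if w: "w \<in> ps_carrier X (s + r)"
  proof (rule eq_on_products[OF s r amplify_linear[OF s r id_op_adjointable] _ _ w])
    show "clinear_on (ps_carrier X (s + r)) (\<lambda>w. w)" by (simp add: clinear_on_def)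
  qed (simp add: amplify_mult[OF s r id_op_adjointable], simp add: id_op_def)
  then show "ps_incl A X s p (id_op s) w = id_op p w"
    unfolding p ps_incl_eq[OF s r id_op_adjointable] by (simp add: id_op_def)
qed

text \<open>Let \<open>E_s\<close> be the image of the identity of \<open>X s\<close>. Inserting
  \<open>E_r E_p\<close> between the factors changes nothing, Nica covariance turns it into
  \<open>E_q\<close>, and \<open>E_q\<close> is the sum of the \<open>\<psi> q (b q l)\<close> times
  their adjoints. By \<open>rep_star_mult\<close> the outer factors then become
  contractions.\<close>

lemma star_mult_rep:
  assumes nica: "nica_representation A X C \<psi>"
    and r: "0 \<le> r" and p: "0 \<le> p" and \<eta>: "\<eta> \<in> ps_carrier X r" and \<alpha>: "\<alpha> \<in> ps_carrier X p"
  defines "q \<equiv> sup r p"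
  shows "cs_mult C (cs_star C (\<psi> r \<eta>)) (\<psi> p \<alpha>) =
    (\<Sum>l<n q. elem (q - r) (contract r (q - r) \<eta> (b q l)) (q - p) (contract p (q - p) \<alpha> (b q l)))"
proof -
  have q: "0 \<le> q" "0 \<le> q - r" "0 \<le> q - p" using r p by (auto simp: q_def le_supI1)
  let ?E = "\<lambda>s. operator_rep s (id_op s)"
  have E: "?E s \<in> cs_carrier C" if "0 \<le> s" for s using that id_op_adjointable by simp
  have Er: "cs_mult C (?E s) (\<psi> s \<xi>) = \<psi> s \<xi>" if "0 \<le> s" "\<xi> \<in> ps_carrier X s" for s \<xi>
    using operator_rep_mult[OF that(1) id_op_adjointable that(2)] that by (simp add: id_op_def)
  have Estar: "cs_star C (?E s) = ?E s" if "0 \<le> s" for s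
    using operator_rep_star[OF that id_op_adjointable id_op_adjointable id_op_pair] by simp
  have El: "cs_mult C (cs_star C (\<psi> r \<eta>)) (?E r) = cs_star C (\<psi> r \<eta>)"
    using arg_cong[OF Er[OF r \<eta>], of "cs_star C"] E[OF r] r \<eta> by (simp add: C.star_mult Estar)
  have "id_op q \<circ> id_op q = id_op q" by (auto simp: id_op_def)
  then have EE: "cs_mult C (?E r) (?E p) = ?E q"
    using nica_operator_rep[OF nica r p id_op_adjointable id_op_adjointable] r p
    by (simp add: ps_incl_id flip: q_def) (simp add: q_def ps_incl_id)
  have "cs_mult C (cs_star C (\<psi> r \<eta>)) (\<psi> p \<alpha>) = cs_mult C (cs_mult C (cs_star C (\<psi> r \<eta>)) (?E r)) (cs_mult C (?E p) (\<psi> p \<alpha>))"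
    using El Er[OF p \<alpha>] by simp
  also have "\<dots> = cs_mult C (cs_star C (\<psi> r \<eta>)) (cs_mult C (cs_mult C (?E r) (?E p)) (\<psi> p \<alpha>))"
    using E[OF r] E[OF p] r p \<eta> \<alpha> by (simp add: C.mult_assoc)
  also have "\<dots> = cs_mult C (cs_star C (\<psi> r \<eta>)) (cs_mult C (?E q) (\<psi> p \<alpha>))" by (simp only: EE)
  also have "\<dots> = (\<Sum>l<n q. cs_mult C (cs_star C (\<psi> r \<eta>)) (cs_mult C (cs_mult C (\<psi> q (b q l)) (cs_star C (\<psi> q (b q l)))) (\<psi> p \<alpha>)))"
  proof -
    have "?E q = (\<Sum>l<n q. cs_mult C (\<psi> q (b q l)) (cs_star C (\<psi> q (b q l))))"
      unfolding operator_rep_def using q by (intro sum.cong) (simp_all add: id_op_def)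
    moreover have "cs_mult C (\<Sum>l<n q. cs_mult C (\<psi> q (b q l)) (cs_star C (\<psi> q (b q l)))) (\<psi> p \<alpha>)
      = (\<Sum>l<n q. cs_mult C (cs_mult C (\<psi> q (b q l)) (cs_star C (\<psi> q (b q l)))) (\<psi> p \<alpha>))"
      using q p \<alpha> by (intro C.sum_mult) simp_all
    moreover have "cs_mult C (cs_star C (\<psi> r \<eta>)) (\<Sum>l<n q. cs_mult C (cs_mult C (\<psi> q (b q l)) (cs_star C (\<psi> q (b q l)))) (\<psi> p \<alpha>))
      = (\<Sum>l<n q. cs_mult C (cs_star C (\<psi> r \<eta>)) (cs_mult C (cs_mult C (\<psi> q (b q l)) (cs_star C (\<psi> q (b q l)))) (\<psi> p \<alpha>)))"
      using q p r \<alpha> \<eta> by (intro C.mult_sum) simp_all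
    ultimately show ?thesis by simp
  qed
  also have "\<dots> = (\<Sum>l<n q. elem (q - r) (contract r (q - r) \<eta> (b q l)) (q - p) (contract p (q - p) \<alpha> (b q l)))"
  proof (rule sum.cong)
    fix l assume "l \<in> {..<n q}"
    then have l: "l < n q" by simp
    have B: "b q l \<in> ps_carrier X q" using q l by simp
    have 1: "cs_mult C (cs_star C (\<psi> r \<eta>)) (\<psi> q (b q l)) = \<psi> (q - r) (contract r (q - r) \<eta> (b q l))"
      using rep_star_mult[OF r q(2) \<eta>, of "b q l"] B by simp
    have "cs_mult C (cs_star C (\<psi> p \<alpha>)) (\<psi> q (b q l)) = \<psi> (q - p) (contract p (q - p) \<alpha> (b q l))"
      using rep_star_mult[OF p q(3) \<alpha>, of "b q l"] B by simp
    then have 2: "cs_mult C (cs_star C (\<psi> q (b q l))) (\<psi> p \<alpha>) = cs_star C (\<psi> (q - p) (contract p (q - p) \<alpha> (b q l)))"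
      using p q B \<alpha> by (simp add: C.star_mult flip: \<open>cs_mult C (cs_star C (\<psi> p \<alpha>)) (\<psi> q (b q l)) = _\<close>)
    have "cs_mult C (cs_star C (\<psi> r \<eta>)) (cs_mult C (cs_mult C (\<psi> q (b q l)) (cs_star C (\<psi> q (b q l)))) (\<psi> p \<alpha>))
      = cs_mult C (cs_mult C (cs_star C (\<psi> r \<eta>)) (\<psi> q (b q l))) (cs_mult C (cs_star C (\<psi> q (b q l))) (\<psi> p \<alpha>))"
      using r p q B \<alpha> \<eta> by (simp add: C.mult_assoc)
    then show "cs_mult C (cs_star C (\<psi> r \<eta>)) (cs_mult C (cs_mult C (\<psi> q (b q l)) (cs_star C (\<psi> q (b q l)))) (\<psi> p \<alpha>))
      = elem (q - r) (contract r (q - r) \<eta> (b q l)) (q - p) (contract p (q - p) \<alpha> (b q l))"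
      by (simp only: 1 2 elem_def)
  qed simp
  finally show ?thesis .
qed

text \<open>\<open>star_mult_rep\<close> reorders the two inner factors, and the outer ones are
  absorbed by multiplication in \<open>X\<close>. The degrees are recorded because equal degrees in
  both factors lead to equal degrees in the product.\<close>

lemma elem_mult:
  assumes nica: "nica_representation A X C \<psi>"
    and s: "0 \<le> s" and r: "0 \<le> r" and p: "0 \<le> p" and t: "0 \<le> t"
    and \<xi>: "\<xi> \<in> ps_carrier X s" and \<eta>: "\<eta> \<in> ps_carrier X r" and \<alpha>: "\<alpha> \<in> ps_carrier X p" and \<gamma>: "\<gamma> \<in> ps_carrier X t"
  defines "q \<equiv> sup r p"
  shows "\<exists>x y. (\<forall>l<n q. x l \<in> ps_carrier X (s + (q - r)) \<and> y l \<in> ps_carrier X (t + (q - p))) \<and>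
    cs_mult C (elem s \<xi> r \<eta>) (elem p \<alpha> t \<gamma>) = (\<Sum>l<n q. elem (s + (q - r)) (x l) (t + (q - p)) (y l))"
proof -
  have q: "0 \<le> q" "0 \<le> q - r" "0 \<le> q - p" using r p by (auto simp: q_def le_supI1)
  define x y where "x l = contract r (q - r) \<eta> (b q l)" and "y l = contract p (q - p) \<alpha> (b q l)" for l
  have xy: "x l \<in> ps_carrier X (q - r)" "y l \<in> ps_carrier X (q - p)" if "l < n q" for l
    using contract_closed[OF r q(2) \<eta>, of "b q l"] contract_closed[OF p q(3) \<alpha>, of "b q l"] q that
    by (simp_all add: x_def y_def)
  have "cs_mult C (elem s \<xi> r \<eta>) (elem p \<alpha> t \<gamma>) =
      cs_mult C (\<psi> s \<xi>) (cs_mult C (cs_mult C (cs_star C (\<psi> r \<eta>)) (\<psi> p \<alpha>)) (cs_star C (\<psi> t \<gamma>)))"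
    using assms by (simp add: elem_def C.mult_assoc)
  also have "cs_mult C (cs_star C (\<psi> r \<eta>)) (\<psi> p \<alpha>) = (\<Sum>l<n q. elem (q - r) (x l) (q - p) (y l))"
    using star_mult_rep[OF nica r p \<eta> \<alpha>] by (simp add: q_def x_def y_def)
  also have "cs_mult C (\<Sum>l<n q. elem (q - r) (x l) (q - p) (y l)) (cs_star C (\<psi> t \<gamma>)) =
      (\<Sum>l<n q. cs_mult C (elem (q - r) (x l) (q - p) (y l)) (cs_star C (\<psi> t \<gamma>)))"
    using q xy t \<gamma> by (intro C.sum_mult) simp_all
  also have "cs_mult C (\<psi> s \<xi>) \<dots> = (\<Sum>l<n q. cs_mult C (\<psi> s \<xi>) (cs_mult C (elem (q - r) (x l) (q - p) (y l)) (cs_star C (\<psi> t \<gamma>))))"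
    using q xy t \<gamma> s \<xi> by (intro C.mult_sum) simp_all
  also have "\<dots> = (\<Sum>l<n q. elem (s + (q - r)) (ps_mult X s (q - r) \<xi> (x l)) (t + (q - p)) (ps_mult X t (q - p) \<gamma> (y l)))"
  proof (rule sum.cong)
    fix l assume "l \<in> {..<n q}"
    then have l: "l < n q" by simp
    have "cs_star C (\<psi> (t + (q - p)) (ps_mult X t (q - p) \<gamma> (y l))) = cs_mult C (cs_star C (\<psi> (q - p) (y l))) (cs_star C (\<psi> t \<gamma>))"
      using rep_mult[OF t q(3) \<gamma> xy(2)[OF l]] t q \<gamma> xy[OF l] by (simp add: C.star_mult flip: rep_mult)
    then show "cs_mult C (\<psi> s \<xi>) (cs_mult C (elem (q - r) (x l) (q - p) (y l)) (cs_star C (\<psi> t \<gamma>)))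
      = elem (s + (q - r)) (ps_mult X s (q - r) \<xi> (x l)) (t + (q - p)) (ps_mult X t (q - p) \<gamma> (y l))"
      using s t q \<xi> \<gamma> xy[OF l] rep_mult[OF s q(2) \<xi> xy(1)[OF l]]
      by (simp add: elem_def C.mult_assoc flip: rep_mult)
  qed simp
  finally show ?thesis
    using xy s t q \<xi> \<gamma>
    by (intro exI[of _ "\<lambda>l. ps_mult X s (q - r) \<xi> (x l)"] exI[of _ "\<lambda>l. ps_mult X t (q - p) \<gamma> (y l)"]) simp
qed

section \<open>The Nica-Toeplitz algebra and its core as closed spans\<close>

definition elems :: "'c set" where
  "elems = {elem s \<xi> r \<eta> |s \<xi> r \<eta>. 0 \<le> s \<and> 0 \<le> r \<and> \<xi> \<in> ps_carrier X s \<and> \<eta> \<in> ps_carrier X r}"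

definition core_elems :: "'c set" where
  "core_elems = {elem s \<xi> s \<eta> |s \<xi> \<eta>. 0 \<le> s \<and> \<xi> \<in> ps_carrier X s \<and> \<eta> \<in> ps_carrier X s}"

lemma elems_carrier: "elems \<subseteq> cs_carrier C" and core_elems_subset: "core_elems \<subseteq> elems"
  by (auto simp: elems_def core_elems_def)

lemma nt_core_eq: "nt_core A X C \<psi> = C.cl (cspan core_elems)"
proof -
  have "{induced_hom A X C \<psi> s (rank_one (ps_fib X s) \<xi> \<eta>) |s \<xi> \<eta>.
       0 \<le> s \<and> \<xi> \<in> ps_carrier X s \<and> \<eta> \<in> ps_carrier X s} = core_elems"
    unfolding core_elems_def elem_def by (force simp: induced_hom_rank_one)
  then show ?thesis by (simp add: nt_core_def)
qed

lemma span_subalgebra: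
  assumes S: "S \<subseteq> cs_carrier C" and "\<And>x y. x \<in> S \<Longrightarrow> y \<in> S \<Longrightarrow> cs_mult C x y \<in> cspan S"
    and "\<And>x. x \<in> S \<Longrightarrow> cs_star C x \<in> S"
  shows "cstar_subalgebra C (C.cl (cspan S))"
proof (rule C.cl_subalgebra)
  show "cspan S \<subseteq> cs_carrier C" by (rule complex_vector.span_minimal[OF S C.subspace])
  show "csubspace (cspan S)" by (rule complex_vector.subspace_span)
qed (rule C.cspan_mult_closed[OF S assms(2)] C.cspan_star_closed[OF S assms(3)], assumption+)+

lemma elems_subalgebra:
  assumes nica: "nica_representation A X C \<psi>"
  shows "cstar_subalgebra C (C.cl (cspan elems))"
proof (rule span_subalgebra[OF elems_carrier])
  fix x y assume "x \<in> elems" "y \<in> elems"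
  then obtain s \<xi> r \<eta> p \<alpha> t \<gamma> where xy: "x = elem s \<xi> r \<eta>" "y = elem p \<alpha> t \<gamma>"
    and c: "0 \<le> s" "0 \<le> r" "0 \<le> p" "0 \<le> t" "\<xi> \<in> ps_carrier X s" "\<eta> \<in> ps_carrier X r" "\<alpha> \<in> ps_carrier X p" "\<gamma> \<in> ps_carrier X t"
    by (auto simp: elems_def)
  define q where "q = sup r p"
  have q: "0 \<le> q - r" "0 \<le> q - p" by (auto simp: q_def)
  obtain f g where "\<forall>l<n q. f l \<in> ps_carrier X (s + (q - r)) \<and> g l \<in> ps_carrier X (t + (q - p))"
    "cs_mult C x y = (\<Sum>l<n q. elem (s + (q - r)) (f l) (t + (q - p)) (g l))"
    using elem_mult[OF nica c] unfolding xy q_def by blast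
  note fg = this
  have "elem (s + (q - r)) (f l) (t + (q - p)) (g l) \<in> elems" if "l < n q" for l
  proof -
    have "0 \<le> s + (q - r)" "0 \<le> t + (q - p)" using c q by (simp_all add: add_nonneg_nonneg)
    then show ?thesis using fg(1) that unfolding elems_def by blast
  qed
  then show "cs_mult C x y \<in> cspan elems"
    unfolding fg(2) by (intro complex_vector.span_sum complex_vector.span_base) simp
next
  fix x assume "x \<in> elems"
  then obtain s \<xi> r \<eta> where x: "x = elem s \<xi> r \<eta>" and c: "0 \<le> s" "0 \<le> r" "\<xi> \<in> ps_carrier X s" "\<eta> \<in> ps_carrier X r"
    by (auto simp: elems_def)
  show "cs_star C x \<in> elems" unfolding x star_elem[OF c] elems_def using c by blast
qed

text \<open>For factors of degrees \<open>r, r\<close> and \<open>p, p\<close> the degrees in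
  \<open>elem_mult\<close> are \<open>r + (q - r)\<close> and \<open>p + (q - p)\<close>, both equal
  to \<open>q\<close>.\<close>

lemma core_subalgebra:
  assumes nica: "nica_representation A X C \<psi>"
  shows "cstar_subalgebra C (nt_core A X C \<psi>)"
  unfolding nt_core_eq
proof (rule span_subalgebra)
  show "core_elems \<subseteq> cs_carrier C" using elems_carrier core_elems_subset by blast
next
  fix x y assume "x \<in> core_elems" "y \<in> core_elems"
  then obtain r \<xi> \<eta> p \<alpha> \<gamma> where xy: "x = elem r \<xi> r \<eta>" "y = elem p \<alpha> p \<gamma>"
    and c: "0 \<le> r" "0 \<le> p" "\<xi> \<in> ps_carrier X r" "\<eta> \<in> ps_carrier X r" "\<alpha> \<in> ps_carrier X p" "\<gamma> \<in> ps_carrier X p"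
    by (auto simp: core_elems_def)
  define q where "q = sup r p"
  have q: "0 \<le> q" using c by (auto simp: q_def le_supI1)
  obtain f g where fg: "\<forall>l<n q. f l \<in> ps_carrier X q \<and> g l \<in> ps_carrier X q"
    "cs_mult C x y = (\<Sum>l<n q. elem q (f l) q (g l))"
    using elem_mult[OF nica c(1,1,2,2,3-6)] unfolding xy q_def by auto
  have "elem q (f l) q (g l) \<in> core_elems" if "l < n q" for l
    using fg(1) that q unfolding core_elems_def by blast
  then show "cs_mult C x y \<in> cspan core_elems"
    unfolding fg(2) by (intro complex_vector.span_sum complex_vector.span_base) simp
next
  fix x assume "x \<in> core_elems"
  then obtain s \<xi> \<eta> where x: "x = elem s \<xi> s \<eta>" and c: "0 \<le> s" "\<xi> \<in> ps_carrier X s" "\<eta> \<in> ps_carrier X s"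
    by (auto simp: core_elems_def)
  show "cs_star C x \<in> core_elems" unfolding x star_elem[OF c(1,1,2,3)] core_elems_def using c by blast
qed

lemma elem_unit: "0 \<le> s \<Longrightarrow> \<xi> \<in> ps_carrier X s \<Longrightarrow> elem s \<xi> 0 one = \<psi> s \<xi>"
  using rep_star[of one] rep_ract[of s \<xi> one] by (simp add: elem_def)

text \<open>\<open>C\<close> comes without a unit. The element \<open>\<psi> 0 one\<close> acts as
  the identity on \<open>elems\<close>, hence on their span, and a general \<open>x\<close> is
  approximated from there with error at most a fixed multiple of \<open>e\<close>.\<close>

lemma rep_one_unit:
  assumes "C.cl (cspan elems) = cs_carrier C" shows "is_unit C (\<psi> 0 one)"
proof -
  let ?u = "\<psi> 0 one"
  have u: "?u \<in> cs_carrier C" and us: "cs_star C ?u = ?u" using rep_star[of one] by simp_all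
  have ul: "cs_mult C ?u (\<psi> s \<xi>) = \<psi> s \<xi>" if "0 \<le> s" "\<xi> \<in> ps_carrier X s" for s \<xi>
    using rep_lact[of s \<xi> one] that by simp
  have ur: "cs_mult C (cs_star C (\<psi> s \<xi>)) ?u = cs_star C (\<psi> s \<xi>)" if "0 \<le> s" "\<xi> \<in> ps_carrier X s" for s \<xi>
    using arg_cong[OF ul[OF that], of "cs_star C"] that u us by (simp add: C.star_mult)
  let ?W = "{y \<in> cs_carrier C. cs_mult C ?u y = y \<and> cs_mult C y ?u = y}"
  have "csubspace ?W"
    using u by (auto simp: complex_vector.subspace_def C.add_mult C.mult_add C.scale_mult C.mult_scale)
  moreover have "elems \<subseteq> ?W"
  proof
    fix x assume "x \<in> elems"
    then obtain s \<xi> r \<eta> where x: "x = elem s \<xi> r \<eta>" and c: "0 \<le> s" "0 \<le> r" "\<xi> \<in> ps_carrier X s" "\<eta> \<in> ps_carrier X r"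
      by (auto simp: elems_def)
    have "cs_mult C ?u x = cs_mult C (cs_mult C ?u (\<psi> s \<xi>)) (cs_star C (\<psi> r \<eta>))"
      using c u by (simp add: x elem_def C.mult_assoc)
    moreover have "cs_mult C x ?u = cs_mult C (\<psi> s \<xi>) (cs_mult C (cs_star C (\<psi> r \<eta>)) ?u)"
      using c u by (simp add: x elem_def C.mult_assoc)
    ultimately show "x \<in> ?W" using c by (simp only: ul ur) (simp add: x elem_def)
  qed
  ultimately have W: "cspan elems \<subseteq> ?W" by (intro complex_vector.span_minimal)
  have "cs_mult C ?u x = x \<and> cs_mult C x ?u = x" if x: "x \<in> cs_carrier C" for x
  proof -
    have *: "cs_norm C (cs_mult C ?u x - x) \<le> 0 + (cs_norm C ?u + 1) * e \<and>
        cs_norm C (cs_mult C x ?u - x) \<le> 0 + (cs_norm C ?u + 1) * e" if e: "0 < e" for e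
    proof -
      have "x \<in> C.cl (cspan elems)" using x assms by simp
      then obtain y where y: "y \<in> cspan elems" "cs_norm C (x - y) < e" by (rule C.cl_approx[OF _ e])
      then have yW: "y \<in> cs_carrier C" "cs_mult C ?u y = y" "cs_mult C y ?u = y" using W by auto
      have n: "cs_norm C (z - (x - y)) \<le> (cs_norm C ?u + 1) * e" if "z \<in> cs_carrier C" "cs_norm C z \<le> cs_norm C ?u * cs_norm C (x - y)" for z
      proof -
        have "cs_norm C (z - (x - y)) \<le> cs_norm C z + cs_norm C (x - y)"
          by (rule C.norm_diff_le) (use that x yW in simp_all)
        also have "\<dots> \<le> cs_norm C ?u * e + e" using that y(2) u
          by (smt (verit, best) C.norm_nonneg mult_left_mono)
        finally show ?thesis by (simp add: algebra_simps)
      qed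
      have eq: "cs_mult C ?u x - x = cs_mult C ?u (x - y) - (x - y)" "cs_mult C x ?u - x = cs_mult C (x - y) ?u - (x - y)"
        using x yW u by (simp_all add: C.mult_diff C.diff_mult)
      have "cs_norm C (cs_mult C (x - y) ?u) \<le> cs_norm C ?u * cs_norm C (x - y)"
        using C.norm_mult[of "x - y" ?u] x yW u by (simp add: mult.commute)
      then show ?thesis unfolding eq using x yW u C.norm_mult[of ?u "x - y"] by (intro conjI) (simp_all add: n)
    qed
    have "cs_norm C (cs_mult C ?u x - x) \<le> 0" "cs_norm C (cs_mult C x ?u - x) \<le> 0"
      by (rule le_of_le_eps[where K = "cs_norm C ?u + 1"], use * in blast)+
    then have "cs_norm C (cs_mult C ?u x - x) = 0" "cs_norm C (cs_mult C x ?u - x) = 0"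
      using x u C.norm_nonneg by (simp_all add: order_antisym)
    then show ?thesis using x u C.norm_eq_0[of "cs_mult C ?u x - x"] C.norm_eq_0[of "cs_mult C x ?u - x"] by simp
  qed
  then show ?thesis using u by (simp add: is_unit_def)
qed

end

section \<open>Contractivity of star homomorphisms into the algebra of forms\<close>

context form_space
begin

text \<open>For each \<open>y\<close> the functional sending \<open>c\<close> to
  \<open>\<rho> c y y\<close> is positive on a unital C*-algebra, which bounds the diagonal of
  \<open>\<rho> h\<close>, where \<open>h\<close> is \<open>star c\<close> times \<open>c\<close>,
  by \<open>(norm c)^2 (nrm y)^2\<close>. Cauchy-Schwarz for the form \<open>\<rho> h\<close> bounds
  the remaining values, and the C*-identity for forms concludes.\<close>

lemma star_hom_contractive:
  assumes C: "cstar_algebra C" and u: "is_unit C u" and \<rho>: "star_hom C form_alg \<rho>" and c: "c \<in> cs_carrier C"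
  shows "form_norm (\<rho> c) \<le> cs_norm C c"
proof -
  interpret C: cstar_algebra C by (rule C)
  have uc: "u \<in> cs_carrier C" using u by (simp add: is_unit_def)
  have cl: "\<rho> x \<in> form_set" if "x \<in> cs_carrier C" for x using \<rho> that by (auto simp: star_hom_def)
  have m: "\<rho> (cs_mult C x y) = form_mult (\<rho> x) (\<rho> y)" if "x \<in> cs_carrier C" "y \<in> cs_carrier C" for x y
    using \<rho> that by (auto simp: star_hom_def)
  have st: "\<rho> (cs_star C x) = form_star (\<rho> x)" if "x \<in> cs_carrier C" for x
    using \<rho> that by (auto simp: star_hom_def)
  have lin: "clinear_on (cs_carrier C) \<rho>" using \<rho> by (simp add: star_hom_def)
  note u0 = form_set_le_norm(2)[OF cl[OF uc]]
  \<comment> \<open>\<open>\<rho> u\<close> is a projection, possibly \<open>0\<close>, so its norm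
    is \<open>0\<close> or \<open>1\<close>.\<close>
  have "form_norm (\<rho> u) = (form_norm (\<rho> u))\<^sup>2"
    using form_norm_cstar[OF cl[OF uc]] m[OF uc uc] st[OF uc] C.star_unit[OF u] u uc by (simp add: is_unit_def)
  then have "form_norm (\<rho> u) * (form_norm (\<rho> u) - 1) = 0" by (simp add: power2_eq_square algebra_simps)
  then have u1: "form_norm (\<rho> u) \<le> 1" by auto
  define h where "h = cs_mult C (cs_star C c) c"
  have h: "h \<in> cs_carrier C" "\<rho> h = form_mult (form_star (\<rho> c)) (\<rho> c)" "form_star (\<rho> h) = \<rho> h"
    using c by (simp_all add: h_def m st cl form_star_mult form_star_closed form_star_star)
  interpret H: form_space V "\<rho> h"
  proof
    show "csubspace V" by (rule subspace_V)
    show "clinear_on V (\<rho> h x)" if "x \<in> V" for x by (rule form_set_clinear[OF cl[OF h(1)] that])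
    have flip: "\<rho> h x z = cnj (\<rho> h z x)" for x z
      using fun_cong[OF fun_cong[OF h(3), of x], of z] by (simp add: form_star_def)
    show "\<rho> h (x + y) z = \<rho> h x z + \<rho> h y z" if "x \<in> V" "y \<in> V" "z \<in> V" for x y z
      using form_set_right_add[OF cl[OF h(1)], of z x y] that flip[of _ z] by simp
    show "\<rho> h (k *\<^sub>C x) z = cnj k * \<rho> h x z" if "x \<in> V" "z \<in> V" for k x z
      using form_set_right_scale[OF cl[OF h(1)], of z x k] that flip[of _ z] by simp
    show "\<rho> h x x \<in> \<real>\<^sub>\<ge>\<^sub>0" if "x \<in> V" for x
      using form_star_mult_self_pos[OF cl[OF c] that] by (simp add: h)
  qed
  have diag: "H.nrm y \<le> cs_norm C c * nrm y" if y: "y \<in> V" for y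
  proof -
    have "Re (\<rho> h y y) \<le> (cs_norm C c)\<^sup>2 * Re (\<rho> u y y)"
      unfolding h_def
    proof (rule C.positive_functional_le(1)[OF u _ _ c, of "\<lambda>c. \<rho> c y y"])
      show "clinear_on (cs_carrier C) (\<lambda>c. \<rho> c y y)"
        using lin by (simp add: clinear_on_def scaleC_fun_def)
      show "\<rho> (cs_mult C (cs_star C a) a) y y \<in> \<real>\<^sub>\<ge>\<^sub>0" if "a \<in> cs_carrier C" for a
        using form_star_mult_self_pos[OF cl[OF that] y] that by (simp add: m st)
    qed
    also have "\<dots> \<le> (cs_norm C c)\<^sup>2 * (nrm y)\<^sup>2"
    proof (rule mult_left_mono)
      have "Re (\<rho> u y y) \<le> form_norm (\<rho> u) * (nrm y * nrm y)"
        by (rule order_trans[OF complex_Re_le_cmod form_set_norm_bound[OF cl[OF uc] y y]])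
      also have "\<dots> \<le> 1 * (nrm y * nrm y)" using u1 y by (intro mult_right_mono) auto
      finally show "Re (\<rho> u y y) \<le> (nrm y)\<^sup>2" by (simp add: power2_eq_square)
    qed simp
    finally have "Re (\<rho> h y y) \<le> (cs_norm C c * nrm y)\<^sup>2" by (simp add: power_mult_distrib)
    then have "H.nrm y \<le> sqrt ((cs_norm C c * nrm y)\<^sup>2)"
      unfolding H.nrm_def by (rule real_sqrt_le_mono)
    then show ?thesis using c y by simp
  qed
  have "form_le ((cs_norm C c)\<^sup>2) (\<rho> h)"
    unfolding form_le_def
  proof (intro ballI)
    fix x y assume V: "x \<in> V" "y \<in> V"
    have "cmod (\<rho> h x y) \<le> H.nrm x * H.nrm y" by (rule H.cauchy_schwarz[OF V])
    also have "\<dots> \<le> (cs_norm C c * nrm x) * (cs_norm C c * nrm y)"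
      using diag V c by (intro mult_mono) auto
    finally show "cmod (\<rho> h x y) \<le> (cs_norm C c)\<^sup>2 * (nrm x * nrm y)"
      by (simp add: power2_eq_square algebra_simps)
  qed
  then have "(form_norm (\<rho> c))\<^sup>2 \<le> (cs_norm C c)\<^sup>2"
    using form_norm_le[of "(cs_norm C c)\<^sup>2" "\<rho> h"] form_norm_cstar[OF cl[OF c]] by (simp add: h)
  then show ?thesis by (rule power2_le_imp_le) (use c in simp)
qed

end

section \<open>The trace on the Fock space\<close>

context fock
begin

definition single :: "'g \<Rightarrow> 'u \<Rightarrow> 'g \<Rightarrow> 'u" where
  "single p \<xi> = (\<lambda>q. if q = p then \<xi> else 0)"

lemma single_closed [simp]: "0 \<le> p \<Longrightarrow> \<xi> \<in> ps_carrier X p \<Longrightarrow> single p \<xi> \<in> fock_space"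
  by (rule fock_spaceI) (auto simp: single_def)

lemma fock_ip_single_left:
  assumes p: "0 \<le> p" and \<xi>: "\<xi> \<in> ps_carrier X p" and v: "v \<in> fock_space"
  shows "fock_ip (single p \<xi>) v = \<tau> (ps_inner X p \<xi> (v p))"
proof -
  have "fock_ip (single p \<xi>) v = (\<Sum>q\<in>{p}. \<tau> (ps_inner X q (single p \<xi> q) (v q)))"
    by (rule fock_ip_eq[OF single_closed[OF p \<xi>] v]) (use p in \<open>auto simp: single_def split: if_splits\<close>)
  then show ?thesis by (simp add: single_def)
qed

lemma fock_ip_single:
  assumes p: "0 \<le> p" and q: "0 \<le> q" and \<xi>: "\<xi> \<in> ps_carrier X p" and \<eta>: "\<eta> \<in> ps_carrier X q"
  shows "fock_ip (single p \<xi>) (single q \<eta>) = (if p = q then \<tau> (ps_inner X p \<xi> \<eta>) else 0)"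
  unfolding fock_ip_single_left[OF p \<xi> single_closed[OF q \<eta>]] using p \<xi> by (simp add: single_def)

lemma nrm_basis: "0 \<le> p \<Longrightarrow> j < n p \<Longrightarrow> nrm (single p (b p j)) = 1"
  by (simp add: nrm_def fock_ip_single orthonormal)

lemma create_single:
  assumes s: "0 \<le> s" and p: "0 \<le> p" and \<xi>: "\<xi> \<in> ps_carrier X s"
  shows "create s \<xi> (single p \<eta>) = single (s + p) (ps_mult X s p \<xi> \<eta>)"
proof
  fix q
  have "q - s = p \<longleftrightarrow> q = s + p" by (auto simp: algebra_simps)
  then show "create s \<xi> (single p \<eta>) q = single (s + p) (ps_mult X s p \<xi> \<eta>) q"
    using s p \<xi> by (auto simp: create_def single_def)
qed

lemma annih_single:
  assumes s: "0 \<le> s" and \<xi>: "\<xi> \<in> ps_carrier X s"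
  shows "annih s \<xi> (single p \<eta>) = (if s \<le> p then single (p - s) (contract s (p - s) \<xi> \<eta>) else 0)"
proof
  fix q
  have "s + q = p \<longleftrightarrow> q = p - s" by (auto simp: algebra_simps)
  then show "annih s \<xi> (single p \<eta>) q = (if s \<le> p then single (p - s) (contract s (p - s) \<xi> \<eta>) else 0) q"
    using s \<xi> by (auto simp: annih_def single_def)
qed

lemma create_zero: "0 \<le> s \<Longrightarrow> \<xi> \<in> ps_carrier X s \<Longrightarrow> create s \<xi> 0 = 0"
  by (rule ext) (simp add: create_def)

lemma fock_ip_elem:
  assumes "0 \<le> s" "\<xi> \<in> ps_carrier X s" "0 \<le> r" "\<eta> \<in> ps_carrier X r" "x \<in> fock_space" "y \<in> fock_space"
  shows "fock_ip x (create s \<xi> (annih r \<eta> y)) = fock_ip (annih s \<xi> x) (annih r \<eta> y)"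
  by (rule adjoint_opsD(3)[OF create_adjoint[OF assms(1,2)] assms(5) annih_closed[OF assms(3,4,6)]])

definition fib_trace :: "(('g \<Rightarrow> 'u) \<Rightarrow> ('g \<Rightarrow> 'u) \<Rightarrow> complex) \<Rightarrow> 'g \<Rightarrow> complex" where
  "fib_trace F p = (\<Sum>j<n p. F (single p (b p j)) (single p (b p j)))"

lemma fib_trace_le:
  assumes F: "F \<in> form_set" and p: "0 \<le> p"
  shows "cmod (fib_trace F p) \<le> real (n p) * form_norm F"
proof -
  have "cmod (fib_trace F p) \<le> (\<Sum>j<n p. form_norm F)"
    unfolding fib_trace_def
  proof (rule sum_norm_le)
    fix j assume "j \<in> {..<n p}"
    then have j: "j < n p" by simp
    have c: "single p (b p j) \<in> fock_space" using p j by simp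
    show "cmod (F (single p (b p j)) (single p (b p j))) \<le> form_norm F"
      using form_set_norm_bound[OF F c c] by (simp add: nrm_basis p j)
  qed
  then show ?thesis by simp
qed

text \<open>The matrix of \<open>L\<close> has entries \<open>\<langle>1\<^sub>k, L 1\<^sub>j\<rangle>\<close>, which the trace moves across those of \<open>K\<close>.\<close>

lemma trace_commute:
  assumes tr: "\<And>a c. a \<in> cs_carrier A \<Longrightarrow> c \<in> cs_carrier A \<Longrightarrow> \<tau> (cs_mult A a c) = \<tau> (cs_mult A c a)"
    and p: "0 \<le> p" and q: "0 \<le> q"
    and K: "\<And>x. x \<in> ps_carrier X q \<Longrightarrow> K x \<in> ps_carrier X p" "clinear_on (ps_carrier X q) K"
      "\<And>x a. x \<in> ps_carrier X q \<Longrightarrow> a \<in> cs_carrier A \<Longrightarrow> K (ps_ract X q x a) = ps_ract X p (K x) a"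
    and L: "\<And>x. x \<in> ps_carrier X p \<Longrightarrow> L x \<in> ps_carrier X q" "\<And>y. y \<in> ps_carrier X q \<Longrightarrow> L' y \<in> ps_carrier X p"
      "\<And>x y. x \<in> ps_carrier X p \<Longrightarrow> y \<in> ps_carrier X q \<Longrightarrow> ps_inner X q y (L x) = ps_inner X p (L' y) x"
  shows "(\<Sum>j<n p. \<tau> (ps_inner X p (b p j) (K (L (b p j))))) = (\<Sum>k<n q. \<tau> (ps_inner X p (L' (b q k)) (K (b q k))))"
proof -
  interpret P: hilbert_module A "ps_fib X p" by (rule fib_module[OF p])
  interpret Q: hilbert_module A "ps_fib X q" by (rule fib_module[OF q])
  define a where "a k j = ps_inner X q (b q k) (L (b p j))" for k j
  have a: "a k j \<in> cs_carrier A" if "j < n p" "k < n q" for j k using that p q L by (simp add: a_def)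
  define c where "c j k = ps_inner X p (b p j) (K (b q k))" for j k
  have c: "c j k \<in> cs_carrier A" if "j < n p" "k < n q" for j k using that p q K by (simp add: c_def)
  have 1: "\<tau> (ps_inner X p (b p j) (K (L (b p j)))) = (\<Sum>k<n q. \<tau> (cs_mult A (c j k) (a k j)))" if j: "j < n p" for j
  proof -
    have "K (L (b p j)) = K (\<Sum>k<n q. ps_ract X q (b q k) (a k j))"
      using expand[OF q, of "L (b p j)"] p j L by (simp add: a_def)
    also have "\<dots> = (\<Sum>k<n q. ps_ract X p (K (b q k)) (a k j))"
      using a j q by (subst clinear_on_sum[OF K(2) Q.module_subspace]) (simp_all add: K(3))
    finally have "ps_inner X p (b p j) (K (L (b p j))) = ps_inner X p (b p j) (\<Sum>k<n q. ps_ract X p (K (b q k)) (a k j))"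
      by simp
    also have "\<dots> = (\<Sum>k<n q. cs_mult A (c j k) (a k j))"
      using a j p q K(1) by (subst P.inner_sum_right) (simp_all add: P.inner_ract c_def)
    finally show ?thesis using a c j by (simp only:) (subst clinear_on_sum[OF \<tau>_linear subspace], simp_all)
  qed
  have 2: "\<tau> (ps_inner X p (L' (b q k)) (K (b q k))) = (\<Sum>j<n p. \<tau> (cs_mult A (a k j) (c j k)))" if k: "k < n q" for k
  proof -
    \<comment> \<open>The entries of \<open>L'\<close> are the adjoints of those of
      \<open>L\<close>, so this side lists the products \<open>a c\<close> where the other one has
      \<open>c a\<close>.\<close>
    have Lk: "L' (b q k) = (\<Sum>j<n p. ps_ract X p (b p j) (cs_star A (a k j)))"
    proof -
      have "ps_inner X p (b p j) (L' (b q k)) = cs_star A (a k j)" if j: "j < n p" for j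
        using L(2)[of "b q k"] L(3)[of "b p j" "b q k"] P.inner_star[of "L' (b q k)" "b p j"] p q j k by (simp add: a_def)
      then show ?thesis using expand[OF p, of "L' (b q k)"] L(2)[of "b q k"] q k by simp
    qed
    have "ps_inner X p (L' (b q k)) (K (b q k)) = (\<Sum>j<n p. cs_mult A (a k j) (c j k))"
      unfolding Lk using a k p q K(1) by (subst P.inner_sum_left) (simp_all add: P.inner_ract_left c_def)
    then show ?thesis using a c k by (simp only:) (subst clinear_on_sum[OF \<tau>_linear subspace], simp_all)
  qed
  have "(\<Sum>j<n p. \<tau> (ps_inner X p (b p j) (K (L (b p j))))) = (\<Sum>j<n p. \<Sum>k<n q. \<tau> (cs_mult A (c j k) (a k j)))"
    by (intro sum.cong) (simp_all add: 1)
  also have "\<dots> = (\<Sum>k<n q. \<Sum>j<n p. \<tau> (cs_mult A (c j k) (a k j)))" by (rule sum.swap)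
  also have "\<dots> = (\<Sum>k<n q. \<Sum>j<n p. \<tau> (cs_mult A (a k j) (c j k)))"
    using tr a c by (intro sum.cong) simp_all
  also have "\<dots> = (\<Sum>k<n q. \<tau> (ps_inner X p (L' (b q k)) (K (b q k))))"
    by (intro sum.cong) (simp_all add: 2)
  finally show ?thesis .
qed

end


section \<open>The state of the Nica--Toeplitz algebra\<close>

locale nt_system = finite_type_product_system A X n b m + NT: nica_toeplitz_algebra A X C \<iota>
  for A :: "'u::complex_vector cstar"
    and X :: "('g::lattice_ab_group_add, 'u, 't::complex_vector) prod_sys"
    and n b m and C :: "'c::complex_vector cstar" and \<iota> :: "'g \<Rightarrow> 'u \<Rightarrow> 'c" +
  fixes N :: "'g \<Rightarrow> real" and \<beta> :: real
  assumes N_pos: "0 < N s" and N_add: "N (s + r) = N s * N r"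
    and summable: "(\<lambda>s. N s powr - \<beta> * real (n s)) summable_on {s. 0 \<le> s}"
begin

sublocale R: finite_type_representation A X n b m C \<iota>
  by (intro finite_type_representation.intro finite_type_product_system_axioms NT.toeplitz_representation_axioms)

lemma nica: "nica_representation A X C \<iota>" by (rule NT.nica_representation_axioms)

text \<open>The closed span is a C*-subalgebra, and it contains the generators because
  \<open>\<iota> s \<xi>\<close> equals \<open>elem s \<xi> 0 one\<close>.\<close>

lemma span_dense: "NT.C.cl (cspan R.elems) = cs_carrier C"
proof (rule NT.generated[OF R.elems_subalgebra[OF nica]])
  fix s \<xi> assume "0 \<le> s" "\<xi> \<in> ps_carrier X s"
  then have "\<iota> s \<xi> \<in> R.elems" using R.elem_unit[of s \<xi>, symmetric] unfolding R.elems_def by force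
  moreover have "cspan R.elems \<subseteq> cs_carrier C"
    by (rule complex_vector.span_minimal[OF R.elems_carrier NT.C.subspace])
  ultimately show "\<iota> s \<xi> \<in> NT.C.cl (cspan R.elems)"
    using NT.C.subset_cl complex_vector.span_base by blast
qed

lemma unit: "is_unit C (\<iota> 0 one)" by (rule R.rep_one_unit[OF span_dense])

lemma functional_eqI:
  assumes "clinear_on (cs_carrier C) f" "\<And>x. x \<in> cs_carrier C \<Longrightarrow> cmod (f x) \<le> K * cs_norm C x"
    and "clinear_on (cs_carrier C) g" "\<And>x. x \<in> cs_carrier C \<Longrightarrow> cmod (g x) \<le> L * cs_norm C x"
    and "\<And>s \<xi> r \<eta>. \<lbrakk>0 \<le> s; 0 \<le> r; \<xi> \<in> ps_carrier X s; \<eta> \<in> ps_carrier X r\<rbrakk> \<Longrightarrow> f (R.elem s \<xi> r \<eta>) = g (R.elem s \<xi> r \<eta>)"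
    and "x \<in> cs_carrier C"
  shows "f x = g x"
proof (rule NT.C.bounded_linear_eq_closure[OF assms(1,2,3,4) R.elems_carrier])
  show "f y = g y" if "y \<in> R.elems" for y using that assms(5) unfolding R.elems_def by blast
  show "x \<in> NT.C.cl (cspan R.elems)" using span_dense assms(6) by simp
qed

end

locale nt_state = fock A X n b m \<tau> + nt_system A X n b m C \<iota> N \<beta>
  for A :: "'u::complex_vector cstar"
    and X :: "('g::lattice_ab_group_add, 'u, 't::complex_vector) prod_sys"
    and n b m \<tau> and C :: "'c::complex_vector cstar" and \<iota> N \<beta> +
  assumes tracial: "\<And>a c. a \<in> cs_carrier A \<Longrightarrow> c \<in> cs_carrier A \<Longrightarrow> \<tau> (cs_mult A a c) = \<tau> (cs_mult A c a)"
begin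

definition rho :: "'c \<Rightarrow> ('g \<Rightarrow> 'u) \<Rightarrow> ('g \<Rightarrow> 'u) \<Rightarrow> complex" where
  "rho = (SOME \<pi>. star_hom C form_alg \<pi> \<and> (\<forall>s\<ge>0. \<forall>\<xi>\<in>ps_carrier X s. \<pi> (\<iota> s \<xi>) = fock_rep s \<xi>))"

lemma rho: "star_hom C form_alg rho"
  and rho_rep: "0 \<le> s \<Longrightarrow> \<xi> \<in> ps_carrier X s \<Longrightarrow> rho (\<iota> s \<xi>) = fock_rep s \<xi>"
proof -
  have "\<exists>\<pi>. star_hom C form_alg \<pi> \<and> (\<forall>s\<ge>0. \<forall>\<xi>\<in>ps_carrier X s. \<pi> (\<iota> s \<xi>) = fock_rep s \<xi>)"
    by (rule fock_universal[OF NT.nica_toeplitz_algebra_axioms]) blast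
  from someI_ex[OF this] show "star_hom C form_alg rho" "0 \<le> s \<Longrightarrow> \<xi> \<in> ps_carrier X s \<Longrightarrow> rho (\<iota> s \<xi>) = fock_rep s \<xi>"
    unfolding rho_def by blast+
qed

lemma rho_closed [simp]: "c \<in> cs_carrier C \<Longrightarrow> rho c \<in> form_set"
  and rho_linear: "clinear_on (cs_carrier C) rho"
  and rho_mult: "c \<in> cs_carrier C \<Longrightarrow> d \<in> cs_carrier C \<Longrightarrow> rho (cs_mult C c d) = form_mult (rho c) (rho d)"
  and rho_star: "c \<in> cs_carrier C \<Longrightarrow> rho (cs_star C c) = form_star (rho c)"
  using rho by (auto simp: star_hom_def)

lemma rho_elem:
  assumes "0 \<le> s" "0 \<le> r" "\<xi> \<in> ps_carrier X s" "\<eta> \<in> ps_carrier X r"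
  shows "rho (R.elem s \<xi> r \<eta>) = form (\<lambda>v. create s \<xi> (annih r \<eta> v))"
  unfolding R.elem_def using assms by (simp add: rho_mult rho_star rho_rep fock_rep_star_form(1))

lemma rho_le: "c \<in> cs_carrier C \<Longrightarrow> form_norm (rho c) \<le> cs_norm C c"
  by (rule star_hom_contractive[OF NT.C.cstar_algebra_axioms unit rho])

text \<open>Stated for any \<open>\<pi>\<close>, since besides \<open>rho\<close> it is applied to
  \<open>rho\<close> composed with the dynamics.\<close>

lemma star_hom_bound:
  assumes "star_hom C form_alg \<pi>" "x \<in> fock_space" "y \<in> fock_space"
  shows "clinear_on (cs_carrier C) (\<lambda>c. \<pi> c x y)"
    and "c \<in> cs_carrier C \<Longrightarrow> cmod (\<pi> c x y) \<le> (nrm x * nrm y) * cs_norm C c"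
proof -
  have "clinear_on (cs_carrier C) \<pi>" using assms by (simp add: star_hom_def)
  then show "clinear_on (cs_carrier C) (\<lambda>c. \<pi> c x y)"
    by (simp add: clinear_on_def scaleC_fun_def)
  assume c: "c \<in> cs_carrier C"
  then have "\<pi> c \<in> form_set" using assms by (auto simp: star_hom_def)
  then have "cmod (\<pi> c x y) \<le> form_norm (\<pi> c) * (nrm x * nrm y)"
    using form_set_norm_bound assms by blast
  also have "\<dots> \<le> cs_norm C c * (nrm x * nrm y)"
    using star_hom_contractive[OF NT.C.cstar_algebra_axioms unit assms(1) c] assms by (intro mult_right_mono) auto
  finally show "cmod (\<pi> c x y) \<le> (nrm x * nrm y) * cs_norm C c" by (simp add: mult.commute)
qed

definition weight :: "'g \<Rightarrow> real" where
  "weight p = N p powr - \<beta> / zeta_N N n \<beta>"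

lemma N_zero [simp]: "N 0 = 1"
  using N_add[of 0 0] N_pos[of 0] by simp

lemma zeta_has_sum: "((\<lambda>s. N s powr - \<beta> * real (n s)) has_sum zeta_N N n \<beta>) {s. 0 \<le> s}"
  unfolding zeta_N_def by (rule has_sum_infsum[OF summable])

lemma zeta_pos: "0 < zeta_N N n \<beta>"
proof -
  \<comment> \<open>The series has nonnegative terms, and the one at \<open>0\<close> is
    \<open>n 0\<close>, which is at least \<open>1\<close>.\<close>
  have "N 0 powr - \<beta> * real (n 0) \<le> zeta_N N n \<beta>"
    using has_sum_mono_neutral[OF has_sum_finite[of "{0}" "\<lambda>s. N s powr - \<beta> * real (n s)"] zeta_has_sum] by auto
  moreover have "1 \<le> real (n 0)" using n_pos[of 0] by simp
  ultimately show ?thesis by simp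
qed

lemma weight_nonneg [simp]: "0 \<le> weight p"
  using zeta_pos by (simp add: weight_def)

lemma weight_has_sum: "((\<lambda>p. weight p * real (n p)) has_sum 1) {p. 0 \<le> p}"
  using has_sum_cmult_right[OF zeta_has_sum, of "1 / zeta_N N n \<beta>"] zeta_pos by (simp add: weight_def)

section \<open>The weighted sum of fibre traces\<close>

definition omega :: "'c \<Rightarrow> complex" where
  "omega = (\<lambda>c\<in>cs_carrier C. \<Sum>\<^sub>\<infinity>p\<in>{p. 0 \<le> p}. complex_of_real (weight p) * fib_trace (rho c) p)"

text \<open>The right hand side does not involve \<open>\<tau>\<close>. It dominates the series for
  the existence of the sum and, through \<open>omega_term_bound\<close>, for convergence uniform in
  \<open>\<tau>\<close>.\<close>

lemma trace_bound:
  assumes "c \<in> cs_carrier C" "0 \<le> p"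
  shows "cmod (complex_of_real (weight p) * fib_trace (rho c) p) \<le> weight p * real (n p) * cs_norm C c"
proof -
  have "cmod (fib_trace (rho c) p) \<le> real (n p) * cs_norm C c"
    using fib_trace_le[OF rho_closed[OF assms(1)] assms(2)] mult_left_mono[OF rho_le[OF assms(1)], of "real (n p)"] by simp
  then have "weight p * cmod (fib_trace (rho c) p) \<le> weight p * (real (n p) * cs_norm C c)"
    by (rule mult_left_mono) simp
  then show ?thesis by (simp add: Real_Vector_Spaces.norm_mult mult.assoc)
qed

lemma omega_has_sum:
  assumes c: "c \<in> cs_carrier C"
  shows "((\<lambda>p. complex_of_real (weight p) * fib_trace (rho c) p) has_sum omega c) {p. 0 \<le> p}"
proof -
  have "(\<lambda>p. weight p * real (n p) * cs_norm C c) summable_on {p. 0 \<le> p}"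
    by (rule has_sum_imp_summable[OF has_sum_cmult_left[OF weight_has_sum]])
  then have "(\<lambda>p. cmod (complex_of_real (weight p) * fib_trace (rho c) p)) summable_on {p. 0 \<le> p}"
  proof (rule summable_on_comparison_test)
    fix p :: 'g assume "p \<in> {p. 0 \<le> p}"
    then show "cmod (complex_of_real (weight p) * fib_trace (rho c) p) \<le> weight p * real (n p) * cs_norm C c"
      using trace_bound[OF c] by simp
  qed simp
  then have "(\<lambda>p. complex_of_real (weight p) * fib_trace (rho c) p) summable_on {p. 0 \<le> p}"
    by (rule abs_summable_summable)
  then show ?thesis using c by (simp add: omega_def)
qed

lemma omega_linear: "clinear_on (cs_carrier C) omega"
  unfolding clinear_on_def
proof (intro conjI ballI allI)
  fix c d assume c: "c \<in> cs_carrier C" and d: "d \<in> cs_carrier C"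
  have "((\<lambda>p. complex_of_real (weight p) * fib_trace (rho (c + d)) p) has_sum (omega c + omega d)) {p. 0 \<le> p}"
    using has_sum_add[OF omega_has_sum[OF c] omega_has_sum[OF d]] c d
    by (simp add: fib_trace_def clinear_on_add[OF rho_linear] sum.distrib algebra_simps)
  from has_sum_unique[OF omega_has_sum this] show "omega (c + d) = omega c + omega d" using c d by simp
next
  fix k c assume c: "c \<in> cs_carrier C"
  have "((\<lambda>p. complex_of_real (weight p) * fib_trace (rho (k *\<^sub>C c)) p) has_sum (k * omega c)) {p. 0 \<le> p}"
    using has_sum_cmult_right[OF omega_has_sum[OF c], of k] c
    by (simp add: fib_trace_def clinear_on_scale[OF rho_linear] scaleC_fun_def scaleC_complex_def
        sum_distrib_left algebra_simps)
  from has_sum_unique[OF omega_has_sum this] show "omega (k *\<^sub>C c) = k *\<^sub>C omega c"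
    using c by (simp add: scaleC_complex_def)
qed

lemma omega_pos:
  assumes c: "c \<in> cs_carrier C" shows "omega (cs_mult C (cs_star C c) c) \<in> \<real>\<^sub>\<ge>\<^sub>0"
proof -
  let ?f = "\<lambda>p. complex_of_real (weight p) * fib_trace (rho (cs_mult C (cs_star C c) c)) p"
  have f: "?f p \<in> \<real>\<^sub>\<ge>\<^sub>0" if "0 \<le> p" for p
  proof (rule nonneg_Reals_mult_I)
    show "complex_of_real (weight p) \<in> \<real>\<^sub>\<ge>\<^sub>0" by simp
    show "fib_trace (rho (cs_mult C (cs_star C c) c)) p \<in> \<real>\<^sub>\<ge>\<^sub>0"
      unfolding fib_trace_def using c that
      by (intro nonneg_Reals_sum) (simp add: rho_mult rho_star form_star_mult_self_pos)
  qed
  have "(sum ?f \<longlongrightarrow> omega (cs_mult C (cs_star C c) c)) (finite_subsets_at_top {p. 0 \<le> p})"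
    using omega_has_sum[of "cs_mult C (cs_star C c) c"] c by (simp add: has_sum_def)
  moreover have "\<forall>\<^sub>F F in finite_subsets_at_top {p::'g. 0 \<le> p}. sum ?f F \<in> \<real>\<^sub>\<ge>\<^sub>0"
  proof (rule eventually_finite_subsets_at_top_weakI)
    show "sum ?f F \<in> \<real>\<^sub>\<ge>\<^sub>0" if "F \<subseteq> {p. 0 \<le> p}" for F
      using that by (intro nonneg_Reals_sum f) blast
  qed
  ultimately show ?thesis
    by (intro Lim_in_closed_set[OF closed_nonneg_Reals_complex _ finite_subsets_at_top_neq_bot])
qed

text \<open>Each diagonal entry of the identity is \<open>\<tau> one = 1\<close>, so the fibre
  \<open>p\<close> contributes \<open>weight p * n p\<close>; this is why the weights are divided by
  the zeta value.\<close>

lemma omega_unit: "omega (\<iota> 0 one) = 1"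
proof -
  have "fib_trace (rho (\<iota> 0 one)) p = real (n p)" if p: "0 \<le> p" for p
  proof -
    have "create 0 one (single p \<xi>) = single p \<xi>" if "\<xi> \<in> ps_carrier X p" for \<xi>
      using create_single[OF order_refl p, of one \<xi>]
      by (simp only: carrier_0 one_closed mult_0_left[OF p one_closed that] lact_one[OF p that] add_0 simp_thms)
    then show ?thesis using p
      by (simp add: fib_trace_def rho_rep fock_rep_def form_def fock_ip_single orthonormal)
  qed
  then have "((\<lambda>p. complex_of_real (weight p * real (n p))) has_sum omega (\<iota> 0 one)) {p. 0 \<le> p}"
    by (intro has_sum_cong[THEN iffD1, OF _ omega_has_sum]) simp_all
  then show ?thesis using has_sum_unique[OF _ has_sum_of_real[OF weight_has_sum]] by simp
qed

lemma omega_state: "omega \<in> states C"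
  by (rule NT.C.stateI[OF unit _ omega_linear omega_pos omega_unit]) (simp add: omega_def restrict_def extensional_def)

lemma omega_le: "c \<in> cs_carrier C \<Longrightarrow> cmod (omega c) \<le> 1 * cs_norm C c"
  using NT.C.state_le[OF omega_state] by simp

text \<open>The basis vector at \<open>j\<close> is the product of \<open>b r i\<close> and
  \<open>b q k\<close>, where \<open>(i, k)\<close> is the preimage of \<open>j\<close> under
  \<open>m r q\<close>. Annihilation by \<open>\<xi>\<close> leaves the inner product of
  \<open>\<xi>\<close> and \<open>b r i\<close> acting on \<open>b q k\<close>, and pairing with the
  same for \<open>\<eta>\<close> gives the summand. Without \<open>r \<le> p\<close> annihilation
  gives \<open>0\<close>.\<close>

lemma trace_elem:
  assumes r: "0 \<le> r" and p: "0 \<le> p" and \<xi>: "\<xi> \<in> ps_carrier X r" and \<eta>: "\<eta> \<in> ps_carrier X r"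
  shows "complex_of_real (weight p) * fib_trace (rho (R.elem r \<xi> r \<eta>)) p =
    (if r \<le> p then omega_term X n b m N \<beta> \<tau> r \<xi> \<eta> p else 0)"
proof -
  have e: "rho (R.elem r \<xi> r \<eta>) (single p (b p j)) (single p (b p j)) =
      fock_ip (annih r \<xi> (single p (b p j))) (annih r \<eta> (single p (b p j)))" if "j < n p" for j
    using that r p \<xi> \<eta> by (simp add: rho_elem form_def fock_ip_elem)
  show ?thesis
  proof (cases "r \<le> p")
    case False
    then show ?thesis using r \<xi> \<eta> e by (simp add: fib_trace_def annih_single)
  next
    case True
    define q where "q = p - r"
    have q: "0 \<le> q" and pq: "p = r + q" using True by (simp_all add: q_def)
    have bij: "bij_betw (m r q) ({..<n r} \<times> {..<n q}) {..<n p}"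
      using bij r q pq by (auto simp: bijective_maps_def)
    have "rho (R.elem r \<xi> r \<eta>) (single p (b p j)) (single p (b p j)) =
      (case the_inv_into ({..<n r} \<times> {..<n q}) (m r q) j of (j\<^sub>r, j') \<Rightarrow>
         \<tau> (ps_inner X q (ps_lact X q (ps_inner X r \<xi> (b r j\<^sub>r)) (b q j')) (ps_lact X q (ps_inner X r \<eta> (b r j\<^sub>r)) (b q j'))))"
      if j: "j < n p" for j
    proof -
      obtain i k where ik: "the_inv_into ({..<n r} \<times> {..<n q}) (m r q) j = (i, k)" by fastforce
      have "(i, k) \<in> {..<n r} \<times> {..<n q}" "m r q (i, k) = j"
        using the_inv_into_into[of "m r q" "{..<n r} \<times> {..<n q}" j "{..<n r} \<times> {..<n q}"]
          f_the_inv_into_f[of "m r q" "{..<n r} \<times> {..<n q}" j] bij j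
        by (auto simp: bij_betw_def ik)
      then have i: "i < n r" and k: "k < n q" and bj: "b p j = ps_mult X r q (b r i) (b q k)"
        using b_mult[OF r q, of i k] by (auto simp: pq)
      show ?thesis
        unfolding e[OF j] ik using r q i k \<xi> \<eta> p True
        by (simp add: annih_single bj contract_mult fock_ip_single flip: q_def)
    qed
    then show ?thesis using True
      by (simp add: fib_trace_def omega_term_def Let_def weight_def flip: q_def)
  qed
qed

lemma omega_elem_has_sum:
  assumes r: "0 \<le> r" and \<xi>: "\<xi> \<in> ps_carrier X r" and \<eta>: "\<eta> \<in> ps_carrier X r"
  shows "(omega_term X n b m N \<beta> \<tau> r \<xi> \<eta> has_sum omega (R.elem r \<xi> r \<eta>)) {s. r \<le> s}"
proof -
  have c: "R.elem r \<xi> r \<eta> \<in> cs_carrier C" using assms by simp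
  show ?thesis
    using omega_has_sum[OF c]
    by (rule has_sum_cong_neutral[THEN iffD1, rotated -1]) (use trace_elem[OF r _ \<xi> \<eta>] le_index[OF r] in auto)
qed

text \<open>Annihilation by \<open>\<xi>\<close> and by \<open>\<eta>\<close> sends
  \<open>b p j\<close> into the fibres \<open>p - s\<close> and \<open>p - r\<close>, or to
  \<open>0\<close>; distinct fibres are orthogonal.\<close>

lemma omega_elem_zero:
  assumes s: "0 \<le> s" and r: "0 \<le> r" and \<xi>: "\<xi> \<in> ps_carrier X s" and \<eta>: "\<eta> \<in> ps_carrier X r" and sr: "s \<noteq> r"
  shows "omega (R.elem s \<xi> r \<eta>) = 0"
proof -
  have "fib_trace (rho (R.elem s \<xi> r \<eta>)) p = 0" if p: "0 \<le> p" for p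
    unfolding fib_trace_def
  proof (rule sum.neutral, rule ballI)
    fix j assume "j \<in> {..<n p}"
    then have B: "b p j \<in> ps_carrier X p" using p by simp
    have c: "contract s (p - s) \<xi> (b p j) \<in> ps_carrier X (p - s)" if "s \<le> p"
      using contract_closed[of s "p - s" \<xi> "b p j"] s \<xi> B that by simp
    have d: "contract r (p - r) \<eta> (b p j) \<in> ps_carrier X (p - r)" if "r \<le> p"
      using contract_closed[of r "p - r" \<eta> "b p j"] r \<eta> B that by simp
    have "rho (R.elem s \<xi> r \<eta>) (single p (b p j)) (single p (b p j)) =
      fock_ip (annih s \<xi> (single p (b p j))) (annih r \<eta> (single p (b p j)))"
      using B s r p \<xi> \<eta> by (simp add: rho_elem form_def fock_ip_elem)
    also have "\<dots> = 0"
      using c d s r \<xi> \<eta> sr by (auto simp: annih_single fock_ip_single)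
    finally show "rho (R.elem s \<xi> r \<eta>) (single p (b p j)) (single p (b p j)) = 0" .
  qed
  then have "((\<lambda>p. complex_of_real (weight p) * fib_trace (rho (R.elem s \<xi> r \<eta>)) p) has_sum 0) {p. 0 \<le> p}"
    by (intro has_sum_0) simp
  moreover have "R.elem s \<xi> r \<eta> \<in> cs_carrier C" using s r \<xi> \<eta> by simp
  ultimately show ?thesis using has_sum_unique[OF omega_has_sum] by blast
qed

lemma omega_term_bound:
  assumes "0 \<le> r" "\<xi> \<in> ps_carrier X r" "\<eta> \<in> ps_carrier X r" "r \<le> p"
  shows "cmod (omega_term X n b m N \<beta> \<tau> r \<xi> \<eta> p) \<le> weight p * real (n p) * cs_norm C (R.elem r \<xi> r \<eta>)"
  using trace_bound[of "R.elem r \<xi> r \<eta>" p] trace_elem[of r p \<xi> \<eta>] assms le_index[of r p] by simp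

section \<open>Restriction to the core and composition with the expectation\<close>

lemma core_cstar: "cstar_algebra (core_alg A X C \<iota>)"
  unfolding core_alg_def by (rule NT.C.subalgebra_cstar_algebra[OF R.core_subalgebra[OF nica]])

lemma core_sel [simp]:
  "cs_carrier (core_alg A X C \<iota>) = nt_core A X C \<iota>" "cs_mult (core_alg A X C \<iota>) = cs_mult C"
  "cs_star (core_alg A X C \<iota>) = cs_star C" "cs_norm (core_alg A X C \<iota>) = cs_norm C"
  by (simp_all add: core_alg_def)

lemma core_subset: "nt_core A X C \<iota> \<subseteq> cs_carrier C"
  by (auto simp: nt_core_def closure_wrt_def)

lemma core_elem:
  assumes "0 \<le> r" "\<xi> \<in> ps_carrier X r" "\<eta> \<in> ps_carrier X r"
  shows "R.elem r \<xi> r \<eta> \<in> nt_core A X C \<iota>"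
proof -
  have "R.elem r \<xi> r \<eta> \<in> cspan R.core_elems"
    using assms by (intro complex_vector.span_base) (auto simp: R.core_elems_def)
  moreover have "cspan R.core_elems \<subseteq> cs_carrier C"
    using R.core_elems_subset R.elems_carrier by (intro complex_vector.span_minimal NT.C.subspace) blast
  ultimately show ?thesis unfolding R.nt_core_eq using NT.C.subset_cl by blast
qed

text \<open>The values on the generators of the core are sums of the same series. States are
  contractive, so they agree on the closed span, and being extensional they agree as
  functions.\<close>

lemma is_omega_unique:
  assumes w: "is_omega A X n b m N \<beta> C \<iota> \<tau> w" and w': "is_omega A X n b m N \<beta> C \<iota> \<tau> w'"
  shows "w = w'"
proof -
  interpret K: cstar_algebra "core_alg A X C \<iota>" by (rule core_cstar)
  have st: "w \<in> states (core_alg A X C \<iota>)" "w' \<in> states (core_alg A X C \<iota>)" using w w' by (simp_all add: is_omega_def)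
  have gen: "w x = w' x" if x: "x \<in> R.core_elems" for x
  proof -
    obtain r \<xi> \<eta> where x: "x = R.elem r \<xi> r \<eta>" and c: "0 \<le> r" "\<xi> \<in> ps_carrier X r" "\<eta> \<in> ps_carrier X r"
      using x by (auto simp: R.core_elems_def)
    have "(omega_term X n b m N \<beta> \<tau> r \<xi> \<eta> has_sum w x) {s. r \<le> s}" "(omega_term X n b m N \<beta> \<tau> r \<xi> \<eta> has_sum w' x) {s. r \<le> s}"
      using w w' c by (simp_all add: is_omega_def x R.elem_def flip: R.induced_hom_rank_one)
    then show ?thesis by (rule has_sum_unique)
  qed
  have "w x = w' x" if x: "x \<in> nt_core A X C \<iota>" for x
  proof (rule K.bounded_linear_eq_closure[of w 1 w' 1 R.core_elems])
    show "R.core_elems \<subseteq> cs_carrier (core_alg A X C \<iota>)"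
      using core_elem by (auto simp: R.core_elems_def)
    show "x \<in> K.cl (cspan R.core_elems)"
      using x by (auto simp: R.nt_core_eq closure_wrt_def)
  qed (use K.state_linear[OF st(1)] K.state_linear[OF st(2)] K.state_le[OF st(1)] K.state_le[OF st(2)] gen in auto)
  moreover have "w \<in> extensional (nt_core A X C \<iota>)" "w' \<in> extensional (nt_core A X C \<iota>)"
    using K.state_extensional[OF st(1)] K.state_extensional[OF st(2)] by simp_all
  ultimately show ?thesis by (intro extensionalityI)
qed

text \<open>The unit \<open>\<iota> 0 one\<close> equals \<open>elem 0 one 0 one\<close> and so lies
  in the core, which makes \<open>stateI\<close> applicable to the restriction.\<close>

lemma is_omega_omega: "is_omega A X n b m N \<beta> C \<iota> \<tau> (restrict omega (nt_core A X C \<iota>))"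
proof -
  interpret K: cstar_algebra "core_alg A X C \<iota>" by (rule core_cstar)
  have "R.elem 0 one 0 one = \<iota> 0 one" by (rule R.elem_unit) simp_all
  then have u: "\<iota> 0 one \<in> nt_core A X C \<iota>" using core_elem[of 0 one one] by simp
  have "restrict omega (nt_core A X C \<iota>) \<in> states (core_alg A X C \<iota>)"
  proof (rule K.stateI)
    show "is_unit (core_alg A X C \<iota>) (\<iota> 0 one)" using unit u core_subset by (auto simp: is_unit_def)
    show "clinear_on (cs_carrier (core_alg A X C \<iota>)) (restrict omega (nt_core A X C \<iota>))"
      using clinear_on_subset[OF omega_linear core_subset] K.add_closed K.scale_closed
      by (simp add: clinear_on_def)
    show "restrict omega (nt_core A X C \<iota>) (cs_mult (core_alg A X C \<iota>) (cs_star (core_alg A X C \<iota>) a) a) \<in> \<real>\<^sub>\<ge>\<^sub>0"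
      if "a \<in> cs_carrier (core_alg A X C \<iota>)" for a
      using that K.mult_closed[OF K.star_closed[OF that] that] omega_pos core_subset by auto
  qed (use u omega_unit in simp_all)
  then show ?thesis
    using omega_elem_has_sum core_elem unfolding is_omega_def
    by (simp add: R.elem_def R.induced_hom_rank_one)
qed

text \<open>Both functionals are contractive, so generators suffice: \<open>\<Phi>\<close> fixes
  \<open>elem s \<xi> r \<eta>\<close> for \<open>s = r\<close> and kills it otherwise, where
  \<open>omega\<close> vanishes too by \<open>omega_elem_zero\<close>.\<close>

lemma omega_expectation:
  assumes w: "is_omega A X n b m N \<beta> C \<iota> \<tau> w" and \<Phi>: "core_expectation A X C \<iota> \<Phi>"
  shows "(\<lambda>c\<in>cs_carrier C. w (\<Phi> c)) = omega"
proof -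
  interpret K: cstar_algebra "core_alg A X C \<iota>" by (rule core_cstar)
  have w_eq: "w = restrict omega (nt_core A X C \<iota>)" by (rule is_omega_unique[OF w is_omega_omega])
  have \<Phi>c: "\<Phi> c \<in> nt_core A X C \<iota>" if "c \<in> cs_carrier C" for c
    using \<Phi> that by (auto simp: core_expectation_def conditional_expectation_def)
  have \<Phi>n: "cs_norm C (\<Phi> c) \<le> cs_norm C c" if "c \<in> cs_carrier C" for c
    using \<Phi> that by (auto simp: core_expectation_def conditional_expectation_def)
  have \<Phi>l: "clinear_on (cs_carrier C) \<Phi>" using \<Phi> by (simp add: core_expectation_def conditional_expectation_def)
  have w\<Phi>: "w (\<Phi> c) = omega (\<Phi> c)" "\<Phi> c \<in> cs_carrier C" if "c \<in> cs_carrier C" for c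
    using \<Phi>c[OF that] core_subset by (auto simp: w_eq)
  have "w (\<Phi> c) = omega c" if c: "c \<in> cs_carrier C" for c
  proof (rule functional_eqI[where K = 1 and L = 1, OF _ _ omega_linear omega_le _ c])
    show "clinear_on (cs_carrier C) (\<lambda>c. w (\<Phi> c))"
    proof -
      have "clinear_on (cs_carrier C) (\<lambda>c. omega (\<Phi> c))"
        using \<Phi>l w\<Phi>(2) omega_linear by (simp add: clinear_on_def)
      then show ?thesis by (simp add: clinear_on_def w\<Phi>(1))
    qed
    show "cmod (w (\<Phi> x)) \<le> 1 * cs_norm C x" if "x \<in> cs_carrier C" for x
      using omega_le[of "\<Phi> x"] w\<Phi>[OF that] \<Phi>n[OF that] by simp
    show "w (\<Phi> (R.elem s \<xi> r \<eta>)) = omega (R.elem s \<xi> r \<eta>)"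
      if "0 \<le> s" "0 \<le> r" "\<xi> \<in> ps_carrier X s" "\<eta> \<in> ps_carrier X r" for s \<xi> r \<eta>
    proof -
      have "\<Phi> (R.elem s \<xi> r \<eta>) = (if s = r then R.elem s \<xi> r \<eta> else 0)"
        using \<Phi> that unfolding core_expectation_def R.elem_def by blast
      then show ?thesis
        using w\<Phi>[of "R.elem s \<xi> r \<eta>"] that omega_elem_zero[OF that] clinear_on_zero[OF omega_linear NT.C.subspace] by auto
    qed
  qed
  then show ?thesis by (auto simp: omega_def fun_eq_iff)
qed

subsection \<open>The KMS condition\<close>

text \<open>The block, from the fibre \<open>r + t\<close> to the fibre \<open>s + t\<close>, of the
  operator that represents \<open>elem s \<xi> r \<eta>\<close>; the adjoint block is
  \<open>shift r \<eta> s \<xi> t\<close>.\<close>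

definition shift :: "'g \<Rightarrow> 'u \<Rightarrow> 'g \<Rightarrow> 'u \<Rightarrow> 'g \<Rightarrow> 'u \<Rightarrow> 'u" where
  "shift s \<xi> r \<eta> t x = ps_mult X s t \<xi> (contract r t \<eta> x)"

lemma shift_closed [simp]:
  "\<lbrakk>0 \<le> s; 0 \<le> r; 0 \<le> t; \<xi> \<in> ps_carrier X s; \<eta> \<in> ps_carrier X r; x \<in> ps_carrier X (r + t)\<rbrakk> \<Longrightarrow>
    shift s \<xi> r \<eta> t x \<in> ps_carrier X (s + t)"
  by (simp add: shift_def)

lemma elem_single:
  assumes s: "0 \<le> s" and r: "0 \<le> r" and \<xi>: "\<xi> \<in> ps_carrier X s" and \<eta>: "\<eta> \<in> ps_carrier X r"
  shows "create s \<xi> (annih r \<eta> (single p x)) = (if r \<le> p then single (s + (p - r)) (shift s \<xi> r \<eta> (p - r) x) else 0)"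
  using assms by (simp add: annih_single create_single create_zero shift_def)

text \<open>By linearity and boundedness in \<open>c\<close> it suffices to take
  \<open>c = elem a \<alpha> g \<gamma>\<close>, whose block between these fibres is again a
  \<open>shift\<close> or \<open>0\<close>. For two such blocks the claim is
  \<open>trace_commute\<close>.\<close>

lemma trace_shift:
  assumes c: "c \<in> cs_carrier C" and s: "0 \<le> s" and r: "0 \<le> r" and t: "0 \<le> t"
    and \<xi>: "\<xi> \<in> ps_carrier X s" and \<eta>: "\<eta> \<in> ps_carrier X r"
  shows "(\<Sum>j<n (r + t). rho c (single (r + t) (b (r + t) j)) (single (s + t) (shift s \<xi> r \<eta> t (b (r + t) j)))) =
    (\<Sum>k<n (s + t). rho c (single (r + t) (shift r \<eta> s \<xi> t (b (s + t) k))) (single (s + t) (b (s + t) k)))"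
proof -
  have rt: "0 \<le> r + t" and st: "0 \<le> s + t" using s r t by simp_all
  let ?x = "\<lambda>j. single (r + t) (b (r + t) j)" and ?y = "\<lambda>j. single (s + t) (shift s \<xi> r \<eta> t (b (r + t) j))"
  let ?x' = "\<lambda>k. single (r + t) (shift r \<eta> s \<xi> t (b (s + t) k))" and ?y' = "\<lambda>k. single (s + t) (b (s + t) k)"
  have cl: "?x j \<in> fock_space" "?y j \<in> fock_space" if "j < n (r + t)" for j using that s r t rt st \<xi> \<eta> by simp_all
  have cl': "?x' j \<in> fock_space" "?y' j \<in> fock_space" if "j < n (s + t)" for j using that s r t rt st \<xi> \<eta> by simp_all
  have lin: "clinear_on (cs_carrier C) (\<lambda>c. \<Sum>j<k. rho c (x j) (y j))" for k :: nat and x y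
    using rho_linear by (simp add: clinear_on_def scaleC_fun_def sum.distrib scaleC_complex_def sum_distrib_left)
  have bound: "cmod (\<Sum>j<k. rho c (x j) (y j)) \<le> (\<Sum>j<k. nrm (x j) * nrm (y j)) * cs_norm C c"
    if "c \<in> cs_carrier C" "\<And>j. j < k \<Longrightarrow> x j \<in> fock_space" "\<And>j. j < k \<Longrightarrow> y j \<in> fock_space" for c and k :: nat and x y
    unfolding sum_distrib_right using that star_hom_bound(2)[OF rho] by (intro sum_norm_le) simp
  show ?thesis
  proof (rule functional_eqI[OF lin bound lin bound _ c])
    fix a \<alpha> g \<gamma> assume a: "0 \<le> a" and g: "0 \<le> g" and \<alpha>: "\<alpha> \<in> ps_carrier X a" and \<gamma>: "\<gamma> \<in> ps_carrier X g"
    have rho_e: "rho (R.elem a \<alpha> g \<gamma>) (single p x) (single q y) =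
       (if g \<le> q \<and> p = a + (q - g) then \<tau> (ps_inner X p x (shift a \<alpha> g \<gamma> (q - g) y)) else 0)"
      if "0 \<le> p" "0 \<le> q" "x \<in> ps_carrier X p" "y \<in> ps_carrier X q" for p q x y
    proof -
      have "rho (R.elem a \<alpha> g \<gamma>) (single p x) (single q y) = fock_ip (single p x) (create a \<alpha> (annih g \<gamma> (single q y)))"
        using that a g \<alpha> \<gamma> by (simp add: rho_elem form_def)
      then show ?thesis
        using that a g \<alpha> \<gamma> shift_closed[OF a g _ \<alpha> \<gamma>, of "q - g" y]
        by (auto simp: elem_single fock_ip_single add_nonneg_nonneg)
    qed
    show "(\<Sum>j<n (r + t). rho (R.elem a \<alpha> g \<gamma>) (?x j) (?y j)) = (\<Sum>k<n (s + t). rho (R.elem a \<alpha> g \<gamma>) (?x' k) (?y' k))"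
    \<comment> \<open>Outside this case the block of the element from the fibre \<open>s + t\<close>
      to the fibre \<open>r + t\<close> vanishes.\<close>
    proof (cases "g \<le> s + t \<and> r + t = a + (s + t - g)")
      case False
      have "rho (R.elem a \<alpha> g \<gamma>) (?x j) (?y j) = 0" if "j < n (r + t)" for j
        by (subst rho_e) (use False that s r t rt st \<xi> \<eta> in auto)
      moreover have "rho (R.elem a \<alpha> g \<gamma>) (?x' k) (?y' k) = 0" if "k < n (s + t)" for k
        by (subst rho_e) (use False that s r t rt st \<xi> \<eta> in auto)
      ultimately show ?thesis by simp
    next
      case True
      define u where "u = s + t - g"
      have u: "0 \<le> u" and gu: "g + u = s + t" and au: "a + u = r + t" using True by (simp_all add: u_def)
      let ?K = "shift a \<alpha> g \<gamma> u"
      have K: "?K x \<in> ps_carrier X (r + t)" if "x \<in> ps_carrier X (s + t)" for x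
        using shift_closed[OF a g u \<alpha> \<gamma>, of x] that by (simp add: gu au)
      have "(\<Sum>j<n (r + t). \<tau> (ps_inner X (r + t) (b (r + t) j) (?K (shift s \<xi> r \<eta> t (b (r + t) j))))) =
          (\<Sum>k<n (s + t). \<tau> (ps_inner X (r + t) (shift r \<eta> s \<xi> t (b (s + t) k)) (?K (b (s + t) k))))"
      proof (rule trace_commute[OF tracial rt st K])
        have lc: "clinear_on (ps_carrier X (s + t)) (contract g u \<gamma>)" using contract_linear[OF g u \<gamma>] by (simp add: gu)
        have cc: "contract g u \<gamma> x \<in> ps_carrier X u" if "x \<in> ps_carrier X (s + t)" for x
          using contract_closed[OF g u \<gamma>, of x] that by (simp add: gu)
        show "clinear_on (ps_carrier X (s + t)) ?K"
          using lc cc ps_mult_linear_right[OF a u \<alpha>] by (simp add: clinear_on_def shift_def)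
        show "?K (ps_ract X (s + t) x k) = ps_ract X (r + t) (?K x) k"
          if x: "x \<in> ps_carrier X (s + t)" and k: "k \<in> cs_carrier A" for x k
        proof -
          have "contract g u \<gamma> (ps_ract X (s + t) x k) = ps_ract X u (contract g u \<gamma> x) k"
          proof (rule hilbert_module.inner_eqI[OF fib_module[OF u]])
            fix \<zeta> assume \<zeta>: "\<zeta> \<in> ps_carrier X u"
            have gz: "ps_mult X g u \<gamma> \<zeta> \<in> ps_carrier X (s + t)" using ps_mult_closed[OF g u \<gamma> \<zeta>] by (simp add: gu)
            show "ps_inner X u \<zeta> (contract g u \<gamma> (ps_ract X (s + t) x k)) = ps_inner X u \<zeta> (ps_ract X u (contract g u \<gamma> x) k)"
              using inner_contract(1)[OF g u \<gamma> \<zeta>] x k gz st cc[OF x] u \<zeta>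
              by (simp add: gu hilbert_module.inner_ract[OF fib_module])
          qed (use cc x k st u in simp_all)
          then show ?thesis using ps_mult_ract[OF a u \<alpha> cc[OF x] k] by (simp add: shift_def au)
        qed
        show "ps_inner X (s + t) y (shift s \<xi> r \<eta> t x) = ps_inner X (r + t) (shift r \<eta> s \<xi> t y) x"
          if "x \<in> ps_carrier X (r + t)" "y \<in> ps_carrier X (s + t)" for x y
          using that s r t \<xi> \<eta> by (simp add: shift_def flip: inner_contract)
      qed (use s r t \<xi> \<eta> in simp_all)
      moreover have "rho (R.elem a \<alpha> g \<gamma>) (?x j) (?y j) = \<tau> (ps_inner X (r + t) (b (r + t) j) (?K (shift s \<xi> r \<eta> t (b (r + t) j))))"
        if "j < n (r + t)" for j
      proof -
        have B: "b (r + t) j \<in> ps_carrier X (r + t)" "shift s \<xi> r \<eta> t (b (r + t) j) \<in> ps_carrier X (s + t)"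
          using that s r t rt \<xi> \<eta> by simp_all
        show ?thesis using rho_e[OF rt st B] unfolding if_P[OF True] u_def .
      qed
      moreover have "rho (R.elem a \<alpha> g \<gamma>) (?x' k) (?y' k) = \<tau> (ps_inner X (r + t) (shift r \<eta> s \<xi> t (b (s + t) k)) (?K (b (s + t) k)))"
        if "k < n (s + t)" for k
      proof -
        have B: "shift r \<eta> s \<xi> t (b (s + t) k) \<in> ps_carrier X (r + t)" "b (s + t) k \<in> ps_carrier X (s + t)"
          using that s r t st \<xi> \<eta> by simp_all
        show ?thesis using rho_e[OF rt st B] unfolding if_P[OF True] u_def .
      qed
      ultimately show ?thesis by simp
    qed
  qed (use cl cl' in auto)
qed

text \<open>Multiplying by \<open>\<iota>\<^sub>s(\<xi>)\<iota>\<^sub>r(\<eta>)\<^sup>*\<close> on either side leaves one block in each row of the Fock matrix.\<close>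

lemma omega_mult_elem:
  assumes c: "c \<in> cs_carrier C" and s: "0 \<le> s" and r: "0 \<le> r" and \<xi>: "\<xi> \<in> ps_carrier X s" and \<eta>: "\<eta> \<in> ps_carrier X r"
  shows "((\<lambda>t. complex_of_real (weight (r + t)) * (\<Sum>j<n (r + t). rho c (single (r + t) (b (r + t) j))
        (single (s + t) (shift s \<xi> r \<eta> t (b (r + t) j))))) has_sum omega (cs_mult C c (R.elem s \<xi> r \<eta>))) {t. 0 \<le> t}"
    and "((\<lambda>t. complex_of_real (weight (s + t)) * (\<Sum>k<n (s + t). rho c (single (r + t) (shift r \<eta> s \<xi> t (b (s + t) k)))
        (single (s + t) (b (s + t) k)))) has_sum omega (cs_mult C (R.elem s \<xi> r \<eta>) c)) {t. 0 \<le> t}"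
proof -
  let ?D = "\<lambda>v. create s \<xi> (annih r \<eta> v)" and ?D' = "\<lambda>v. create r \<eta> (annih s \<xi> v)"
  have e: "R.elem s \<xi> r \<eta> \<in> cs_carrier C" using assms by simp
  have adj: "adjoint_ops ?D ?D'" by (rule fock_rep_star_form(2)[OF s \<xi> r \<eta>])
  have img: "(\<lambda>t. q + t) ` {t. 0 \<le> t} = {p. q \<le> p}" for q :: 'g
  proof
    show "{p. q \<le> p} \<subseteq> (\<lambda>t. q + t) ` {t. 0 \<le> t}"
    proof
      fix p assume "p \<in> {p. q \<le> p}"
      then show "p \<in> (\<lambda>t. q + t) ` {t. 0 \<le> t}" by (intro image_eqI[of _ _ "p - q"]) auto
    qed
  qed auto
  have inj: "inj_on (\<lambda>t. q + t) {t. 0 \<le> t}" for q :: 'g by (simp add: inj_on_def)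
  \<comment> \<open>Linearity in the second variable at the scalar \<open>0\<close>; for the first
    variable the same is applied to \<open>form_star (rho c)\<close>.\<close>
  have zero: "rho c x 0 = 0" "rho c 0 x = 0" if "x \<in> fock_space" for x
    using form_set_right_scale[OF rho_closed[OF c] that, of 0 0]
      form_set_right_scale[OF form_star_closed[OF rho_closed[OF c]] that, of 0 0] by (simp_all add: form_star_def)
  \<comment> \<open>Fibres not above \<open>q\<close> contribute nothing, so the remaining ones are
    indexed by \<open>t = p - q\<close>. This lets the two series be compared for the same
    \<open>t\<close>.\<close>
  have reindex: "((\<lambda>t. f (q + t)) has_sum S) {t. 0 \<le> t}"
    if "(f has_sum S) {p. 0 \<le> p}" "\<And>p. 0 \<le> p \<Longrightarrow> \<not> q \<le> p \<Longrightarrow> f p = 0" "0 \<le> q" for f :: "'g \<Rightarrow> complex" and S q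
  proof -
    have "(f has_sum S) {p. q \<le> p}"
      using that(1) by (rule has_sum_cong_neutral[THEN iffD1, rotated -1]) (use that le_index[OF that(3)] in auto)
    then show ?thesis using has_sum_reindex[OF inj[of q], where g = f and x = S] unfolding img by (simp add: o_def)
  qed
  define f where "f p = complex_of_real (weight p) * (\<Sum>j<n p. rho c (single p (b p j)) (?D (single p (b p j))))" for p
  have "(f has_sum omega (cs_mult C c (R.elem s \<xi> r \<eta>))) {p. 0 \<le> p}"
  proof (rule has_sum_cong[THEN iffD1, OF _ omega_has_sum])
    fix p :: 'g assume "p \<in> {p. 0 \<le> p}"
    then show "complex_of_real (weight p) * fib_trace (rho (cs_mult C c (R.elem s \<xi> r \<eta>))) p = f p"
      using c e s r \<xi> \<eta> by (simp add: f_def fib_trace_def rho_mult rho_elem form_mult_form_right[OF rho_closed[OF c] adj])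
  qed (use c e in simp)
  moreover have "f p = 0" if "0 \<le> p" "\<not> r \<le> p" for p
    using that s r \<xi> \<eta> by (simp add: f_def elem_single zero)
  ultimately have "((\<lambda>t. f (r + t)) has_sum omega (cs_mult C c (R.elem s \<xi> r \<eta>))) {t. 0 \<le> t}"
    using r by (rule reindex)
  then show "((\<lambda>t. complex_of_real (weight (r + t)) * (\<Sum>j<n (r + t). rho c (single (r + t) (b (r + t) j))
        (single (s + t) (shift s \<xi> r \<eta> t (b (r + t) j))))) has_sum omega (cs_mult C c (R.elem s \<xi> r \<eta>))) {t. 0 \<le> t}"
    by (rule has_sum_cong[THEN iffD1, rotated]) (use s r \<xi> \<eta> in \<open>simp add: f_def elem_single\<close>)
  define f' where "f' p = complex_of_real (weight p) * (\<Sum>j<n p. rho c (?D' (single p (b p j))) (single p (b p j)))" for p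
  have "(f' has_sum omega (cs_mult C (R.elem s \<xi> r \<eta>) c)) {p. 0 \<le> p}"
  proof (rule has_sum_cong[THEN iffD1, OF _ omega_has_sum])
    fix p :: 'g assume "p \<in> {p. 0 \<le> p}"
    then show "complex_of_real (weight p) * fib_trace (rho (cs_mult C (R.elem s \<xi> r \<eta>) c)) p = f' p"
      using c e s r \<xi> \<eta> by (simp add: f'_def fib_trace_def rho_mult rho_elem form_mult_form_left[OF adj rho_closed[OF c]])
  qed (use c e in simp)
  moreover have "f' p = 0" if "0 \<le> p" "\<not> s \<le> p" for p
    using that s r \<xi> \<eta> by (simp add: f'_def elem_single zero)
  ultimately have "((\<lambda>t. f' (s + t)) has_sum omega (cs_mult C (R.elem s \<xi> r \<eta>) c)) {t. 0 \<le> t}"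
    using s by (rule reindex)
  then show "((\<lambda>t. complex_of_real (weight (s + t)) * (\<Sum>k<n (s + t). rho c (single (r + t) (shift r \<eta> s \<xi> t (b (s + t) k)))
        (single (s + t) (b (s + t) k)))) has_sum omega (cs_mult C (R.elem s \<xi> r \<eta>) c)) {t. 0 \<le> t}"
    by (rule has_sum_cong[THEN iffD1, rotated]) (use s r \<xi> \<eta> in \<open>simp add: f'_def elem_single\<close>)
qed

text \<open>Both sides are bounded and linear in \<open>c\<close>, so
  \<open>c = elem s \<xi> r \<eta>\<close> suffices, where \<open>\<sigma> t\<close> is the factor
  \<open>(N s / N r)^(i t)\<close>. If the block \<open>(p, q)\<close> is nonzero, then
  \<open>p = s + (q - r)\<close>, and multiplicativity of \<open>N\<close> gives
  \<open>N s / N r = N p / N q\<close>.\<close>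

lemma rho_dynamics:
  assumes \<sigma>: "nt_dynamics A X C \<iota> N \<sigma>" and c: "c \<in> cs_carrier C"
    and p: "0 \<le> p" and q: "0 \<le> q" and x: "x \<in> ps_carrier X p" and y: "y \<in> ps_carrier X q"
  shows "rho (\<sigma> t c) (single p x) (single q y) =
    exp (\<i> * complex_of_real (t * (ln (N p) - ln (N q)))) * rho c (single p x) (single q y)"
proof -
  let ?k = "exp (\<i> * complex_of_real (t * (ln (N p) - ln (N q))))"
  have hom: "star_hom C C (\<sigma> t)" using \<sigma> by (simp add: nt_dynamics_def dynamics_def)
  have sx: "single p x \<in> fock_space" and sy: "single q y \<in> fock_space" using p q x y by simp_all
  note bd = star_hom_bound[OF star_hom_comp[OF hom rho] sx sy] and bd' = star_hom_bound[OF rho sx sy]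
  show ?thesis
  proof (rule functional_eqI[OF bd _ _ _ c])
    show "clinear_on (cs_carrier C) (\<lambda>c. ?k * rho c (single p x) (single q y))"
      using bd'(1) by (simp add: clinear_on_def scaleC_complex_def algebra_simps)
    show "cmod (?k * rho c (single p x) (single q y)) \<le> (nrm (single p x) * nrm (single q y)) * cs_norm C c"
      if "c \<in> cs_carrier C" for c
    proof -
      have "cmod ?k = 1" unfolding norm_exp_i_times by simp
      then show ?thesis using bd'(2)[OF that] unfolding Real_Vector_Spaces.norm_mult by simp
    qed
    fix s \<xi> r \<eta> assume s: "0 \<le> s" and r: "0 \<le> r" and \<xi>: "\<xi> \<in> ps_carrier X s" and \<eta>: "\<eta> \<in> ps_carrier X r"
    have pw: "complex_of_real (N u) powr (\<i> * complex_of_real t) = exp (\<i> * complex_of_real (t * ln (N u)))" for u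
      using N_pos[of u] by (simp add: powr_def Ln_of_real mult.assoc)
    have gen: "\<sigma> t (\<iota> u \<zeta>) = exp (\<i> * complex_of_real (t * ln (N u))) *\<^sub>C \<iota> u \<zeta>" if "0 \<le> u" "\<zeta> \<in> ps_carrier X u" for u \<zeta>
      using \<sigma> that pw by (simp add: nt_dynamics_def)
    have "\<sigma> t (R.elem s \<xi> r \<eta>) = cs_mult C (\<sigma> t (\<iota> s \<xi>)) (cs_star C (\<sigma> t (\<iota> r \<eta>)))"
      using hom s r \<xi> \<eta> by (simp add: R.elem_def star_hom_def)
    also have "\<dots> = (exp (\<i> * complex_of_real (t * ln (N s))) * exp (- (\<i> * complex_of_real (t * ln (N r))))) *\<^sub>C R.elem s \<xi> r \<eta>"
      using s r \<xi> \<eta> by (simp add: gen NT.C.star_scale NT.C.mult_scale NT.C.scale_mult R.elem_def exp_cnj mult.commute)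
    also have "exp (\<i> * complex_of_real (t * ln (N s))) * exp (- (\<i> * complex_of_real (t * ln (N r)))) = exp (\<i> * complex_of_real (t * (ln (N s) - ln (N r))))"
      by (simp add: algebra_simps flip: exp_add)
    finally have "rho (\<sigma> t (R.elem s \<xi> r \<eta>)) (single p x) (single q y) =
        exp (\<i> * complex_of_real (t * (ln (N s) - ln (N r)))) * rho (R.elem s \<xi> r \<eta>) (single p x) (single q y)"
      using s r \<xi> \<eta> by (simp add: clinear_on_scale[OF rho_linear] scaleC_fun_def scaleC_complex_def)
    moreover have "ln (N s) - ln (N r) = ln (N p) - ln (N q)" if "rho (R.elem s \<xi> r \<eta>) (single p x) (single q y) \<noteq> 0"
    proof -
      have *: "rho (R.elem s \<xi> r \<eta>) (single p x) (single q y) = fock_ip (single p x) (create s \<xi> (annih r \<eta> (single q y)))"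
        using s r \<xi> \<eta> p q x y by (simp add: rho_elem form_def)
      have rq: "r \<le> q" using that s r \<xi> \<eta> sx by (auto simp: * elem_single split: if_splits)
      have "shift s \<xi> r \<eta> (q - r) y \<in> ps_carrier X (s + (q - r))"
        using shift_closed[OF s r _ \<xi> \<eta>, of "q - r" y] y rq by simp
      then have "p = s + (q - r)"
        using that s r \<xi> \<eta> p q x rq by (auto simp: * elem_single fock_ip_single add_nonneg_nonneg split: if_splits)
      then have "p + r = s + q" by (simp add: algebra_simps)
      then have "N p * N r = N s * N q" by (metis N_add)
      then have "ln (N p * N r) = ln (N s * N q)" by simp
      moreover have "ln (N u * N v) = ln (N u) + ln (N v)" for u v by (rule ln_mult_pos[OF N_pos N_pos])
      ultimately show ?thesis by simp
    qed
    ultimately show "rho (\<sigma> t (R.elem s \<xi> r \<eta>)) (single p x) (single q y) = ?k * rho (R.elem s \<xi> r \<eta>) (single p x) (single q y)"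
      by (cases "rho (R.elem s \<xi> r \<eta>) (single p x) (single q y) = 0") simp_all
  qed
qed

text \<open>With \<open>z\<close> in place of \<open>i \<beta>\<close> both sides are entire, and
  for real \<open>z\<close> they agree by \<open>rho_dynamics\<close>. The identity theorem gives
  equality at \<open>i \<beta>\<close>, where \<open>exp (i z l)\<close> becomes
  \<open>exp (- \<beta> l)\<close>.\<close>

lemma rho_analytic:
  assumes \<sigma>: "nt_dynamics A X C \<iota> N \<sigma>" and c: "c \<in> cs_carrier C" and f: "analytic_extension C \<sigma> c f"
    and p: "0 \<le> p" and q: "0 \<le> q" and x: "x \<in> ps_carrier X p" and y: "y \<in> ps_carrier X q"
  shows "rho (f (\<i> * complex_of_real \<beta>)) (single p x) (single q y) =
    complex_of_real (N p powr - \<beta> / N q powr - \<beta>) * rho c (single p x) (single q y)"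
proof -
  define l where "l = ln (N p) - ln (N q)"
  have sx: "single p x \<in> fock_space" and sy: "single q y \<in> fock_space" using p q x y by simp_all
  note bd = star_hom_bound[OF rho sx sy]
  define g where "g z = rho (f z) (single p x) (single q y)" for z
  define h where "h z = exp (\<i> * z * complex_of_real l) * rho c (single p x) (single q y)" for z
  have fc: "f z \<in> cs_carrier C" for z using f by (simp add: analytic_extension_def entire_in_def)
  \<comment> \<open>An entry of \<open>rho\<close> is a bounded functional, so norm
    differentiability of \<open>f\<close> becomes scalar differentiability of
    \<open>g\<close>.\<close>
  have "g field_differentiable (at z)" for z
  proof -
    have "\<exists>d\<in>cs_carrier C. ((\<lambda>w. cs_norm C (inverse (w - z) *\<^sub>C (f w - f z) - d)) \<longlongrightarrow> 0) (at z)"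
      using f by (simp add: analytic_extension_def entire_in_def)
    then obtain d where d: "d \<in> cs_carrier C"
      "((\<lambda>w. cs_norm C (inverse (w - z) *\<^sub>C (f w - f z) - d)) \<longlongrightarrow> 0) (at z)" by blast
    let ?D = "rho d (single p x) (single q y)"
    have "((\<lambda>w. (g w - g z) / (w - z) - ?D) \<longlongrightarrow> 0) (at z)"
    proof (rule Lim_null_comparison)
      show "\<forall>\<^sub>F w in at z. cmod ((g w - g z) / (w - z) - ?D)
         \<le> (nrm (single p x) * nrm (single q y)) * cs_norm C (inverse (w - z) *\<^sub>C (f w - f z) - d)"
      proof (rule always_eventually, rule allI)
        fix w
        have "(g w - g z) / (w - z) - ?D = rho (inverse (w - z) *\<^sub>C (f w - f z) - d) (single p x) (single q y)"
          using fc d(1) by (simp add: g_def clinear_on_diff[OF bd(1) NT.C.subspace] clinear_on_scale[OF bd(1)]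
              scaleC_complex_def divide_inverse mult.commute)
        then show "cmod ((g w - g z) / (w - z) - ?D) \<le> (nrm (single p x) * nrm (single q y)) * cs_norm C (inverse (w - z) *\<^sub>C (f w - f z) - d)"
          using bd(2)[of "inverse (w - z) *\<^sub>C (f w - f z) - d"] fc d(1) by simp
      qed
      show "((\<lambda>w. (nrm (single p x) * nrm (single q y)) * cs_norm C (inverse (w - z) *\<^sub>C (f w - f z) - d)) \<longlongrightarrow> 0) (at z)"
        by (rule tendsto_mult_right_zero[OF d(2)])
    qed
    then have "(g has_field_derivative ?D) (at z)"
      unfolding has_field_derivative_iff by (rule LIM_zero_cancel)
    then show ?thesis by (auto simp: field_differentiable_def)
  qed
  then have hol: "(\<lambda>z. g z - h z) holomorphic_on UNIV"
    unfolding h_def by (intro holomorphic_intros) (simp add: holomorphic_on_def)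
  have zero: "g z - h z = 0" if z: "z \<in> range complex_of_real" for z
  proof -
    obtain t where t: "z = complex_of_real t" using z by (rule rangeE)
    have "f z = \<sigma> t c" using f by (simp add: analytic_extension_def t)
    then show ?thesis using rho_dynamics[OF \<sigma> c p q x y, of t] by (simp add: g_def h_def t l_def mult.assoc)
  qed
  have lim: "(0::complex) islimpt range complex_of_real"
    unfolding islimpt_approachable
  proof (intro allI impI)
    fix e :: real assume "0 < e"
    then have "complex_of_real (e / 2) \<noteq> 0 \<and> dist (complex_of_real (e / 2)) 0 < e"
      by (simp only: dist_norm diff_zero norm_of_real of_real_eq_0_iff) simp
    then show "\<exists>x'\<in>range complex_of_real. x' \<noteq> 0 \<and> dist x' 0 < e"
      by (rule bexI[OF _ rangeI])
  qed
  have "g (\<i> * complex_of_real \<beta>) - h (\<i> * complex_of_real \<beta>) = 0"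
    by (rule analytic_continuation[OF hol open_UNIV connected_UNIV subset_UNIV UNIV_I lim zero UNIV_I])
  moreover have "exp (\<i> * (\<i> * complex_of_real \<beta>) * complex_of_real l) = complex_of_real (N p powr - \<beta> / N q powr - \<beta>)"
  proof -
    have "\<i> * (\<i> * complex_of_real \<beta>) * complex_of_real l = complex_of_real (- \<beta> * ln (N p) - - \<beta> * ln (N q))"
      by (simp add: l_def algebra_simps flip: mult.assoc)
    then have "exp (\<i> * (\<i> * complex_of_real \<beta>) * complex_of_real l) = complex_of_real (exp (- \<beta> * ln (N p) - - \<beta> * ln (N q)))"
      by (simp only: exp_of_real)
    moreover have "exp (- \<beta> * ln (N p) - - \<beta> * ln (N q)) = N p powr - \<beta> / N q powr - \<beta>"
      using N_pos[of p] N_pos[of q] by (simp add: powr_def flip: exp_diff)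
    ultimately show ?thesis by simp
  qed
  ultimately show ?thesis by (simp add: g_def h_def)
qed

text \<open>For fixed \<open>c\<close> both sides are bounded and linear in \<open>d\<close>, so
  \<open>d = elem s \<xi> r \<eta>\<close> suffices. Then \<open>omega_mult_elem\<close> writes both
  sides as series over \<open>t\<close> that agree term by term: \<open>rho_analytic\<close>
  accounts for the weights and \<open>trace_shift\<close> for the traces.\<close>

lemma omega_kms:
  assumes \<sigma>: "nt_dynamics A X C \<iota> N \<sigma>" shows "omega \<in> kms_states C \<sigma> \<beta>"
proof -
  have "omega (cs_mult C c d) = omega (cs_mult C d (f (\<i> * complex_of_real \<beta>)))"
    if c: "c \<in> cs_carrier C" and d: "d \<in> cs_carrier C" and f: "analytic_extension C \<sigma> c f" for c d f
  proof -
    define c' where "c' = f (\<i> * complex_of_real \<beta>)"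
    have c': "c' \<in> cs_carrier C" using f by (simp add: c'_def analytic_extension_def entire_in_def)
    have "omega (cs_mult C c d) = omega (cs_mult C d c')"
    proof (rule functional_eqI[where f = "\<lambda>d. omega (cs_mult C c d)" and g = "\<lambda>d. omega (cs_mult C d c')", OF _ _ _ _ _ d])
      show "clinear_on (cs_carrier C) (\<lambda>d. omega (cs_mult C c d))"
        using NT.C.mult_linear_right[OF c] omega_linear c by (simp add: clinear_on_def)
      show "clinear_on (cs_carrier C) (\<lambda>d. omega (cs_mult C d c'))"
        using NT.C.mult_linear_left[OF c'] omega_linear c' by (simp add: clinear_on_def)
      show "cmod (omega (cs_mult C c x)) \<le> cs_norm C c * cs_norm C x" if "x \<in> cs_carrier C" for x
        using omega_le[of "cs_mult C c x"] NT.C.norm_mult[OF c that] c that by simp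
      show "cmod (omega (cs_mult C x c')) \<le> cs_norm C c' * cs_norm C x" if "x \<in> cs_carrier C" for x
        using omega_le[of "cs_mult C x c'"] NT.C.norm_mult[OF that c'] c' that by (simp add: mult.commute)
      fix s \<xi> r \<eta> assume s: "0 \<le> s" and r: "0 \<le> r" and \<xi>: "\<xi> \<in> ps_carrier X s" and \<eta>: "\<eta> \<in> ps_carrier X r"
      note 1 = omega_mult_elem(1)[OF c s r \<xi> \<eta>] and 2 = omega_mult_elem(2)[OF c' s r \<xi> \<eta>]
      have "complex_of_real (weight (r + t)) * (\<Sum>j<n (r + t). rho c (single (r + t) (b (r + t) j))
           (single (s + t) (shift s \<xi> r \<eta> t (b (r + t) j)))) =
         complex_of_real (weight (s + t)) * (\<Sum>k<n (s + t). rho c' (single (r + t) (shift r \<eta> s \<xi> t (b (s + t) k)))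
           (single (s + t) (b (s + t) k)))" if t: "0 \<le> t" for t
      proof -
        let ?w = "complex_of_real (N (r + t) powr - \<beta> / N (s + t) powr - \<beta>)"
        have an: "rho c' (single (r + t) x) (single (s + t) y) = ?w * rho c (single (r + t) x) (single (s + t) y)"
          if "x \<in> ps_carrier X (r + t)" "y \<in> ps_carrier X (s + t)" for x y
          unfolding c'_def using rho_analytic[OF \<sigma> c f _ _ that] r s t by simp
        \<comment> \<open>The reason for weights proportional to \<open>N p powr - \<beta>\<close>:
          the factor produced by the analytic continuation to \<open>i \<beta>\<close> turns the
          weight of one fibre into that of the other.\<close>
        have w: "complex_of_real (weight (s + t)) * ?w = complex_of_real (weight (r + t))"
        proof -
          have "weight (s + t) * (N (r + t) powr - \<beta> / N (s + t) powr - \<beta>) = weight (r + t)"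
            using N_pos[of "s + t"] by (simp add: weight_def)
          then show ?thesis by (simp only: of_real_mult[symmetric])
        qed
        have "complex_of_real (weight (s + t)) * (\<Sum>k<n (s + t). rho c' (single (r + t) (shift r \<eta> s \<xi> t (b (s + t) k)))
           (single (s + t) (b (s + t) k))) = complex_of_real (weight (s + t)) * (\<Sum>k<n (s + t). ?w * rho c (single (r + t) (shift r \<eta> s \<xi> t (b (s + t) k)))
           (single (s + t) (b (s + t) k)))"
          using s r t \<xi> \<eta> by (intro arg_cong2[where f = "(*)"] sum.cong refl an) simp_all
        also have "\<dots> = (complex_of_real (weight (s + t)) * ?w) * (\<Sum>k<n (s + t). rho c (single (r + t) (shift r \<eta> s \<xi> t (b (s + t) k)))
           (single (s + t) (b (s + t) k)))"
          by (simp only: sum_distrib_left mult.assoc)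
        finally show ?thesis unfolding w trace_shift[OF c s r t \<xi> \<eta>] by simp
      qed
      then have "((\<lambda>t. complex_of_real (weight (s + t)) * (\<Sum>k<n (s + t). rho c' (single (r + t) (shift r \<eta> s \<xi> t (b (s + t) k)))
           (single (s + t) (b (s + t) k)))) has_sum omega (cs_mult C c (R.elem s \<xi> r \<eta>))) {t. 0 \<le> t}"
        using 1 by (subst (asm) has_sum_cong) auto
      then show "omega (cs_mult C c (R.elem s \<xi> r \<eta>)) = omega (cs_mult C (R.elem s \<xi> r \<eta>) c')"
        using 2 by (rule has_sum_unique)
    qed
    then show ?thesis by (simp add: c'_def)
  qed
  then show ?thesis using omega_state by (auto simp: kms_states_def analytic_elements_def)
qed

end

section \<open>Dependence on the trace\<close>

text \<open>The three-epsilon argument for uniform limits, with the domain an abstract topology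
  \<open>T\<close>, as the weak* topology is one.\<close>

lemma continuous_map_uniform_approx:
  fixes f :: "'a \<Rightarrow> 'b::metric_space"
  assumes "\<And>e. 0 < e \<Longrightarrow> \<exists>g. continuous_map T euclidean g \<and> (\<forall>x\<in>topspace T. dist (f x) (g x) < e)"
  shows "continuous_map T euclidean f"
proof -
  have "\<exists>U. openin T U \<and> x \<in> U \<and> (\<forall>y\<in>U. f y \<in> ball (f x) e)" if x: "x \<in> topspace T" and e: "0 < e" for x e
  proof -
    obtain g where g: "continuous_map T euclidean g" "\<And>x. x \<in> topspace T \<Longrightarrow> dist (f x) (g x) < e / 3"
      using assms[of "e / 3"] e by auto
    define U where "U = {y \<in> topspace T. g y \<in> ball (g x) (e / 3)}"
    have "openin T U" unfolding U_def by (rule openin_continuous_map_preimage[OF g(1)]) simp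
    moreover have "f y \<in> ball (f x) e" if y: "y \<in> U" for y
    proof -
      have "dist (f x) (f y) \<le> dist (f x) (g x) + dist (g x) (g y) + dist (f y) (g y)"
        using dist_triangle[of "f x" "f y" "g x"] dist_triangle[of "g x" "f y" "g y"] by (simp add: dist_commute)
      then show ?thesis using g(2)[OF x] g(2)[of y] y by (simp add: U_def)
    qed
    ultimately show ?thesis using x e by (intro exI[of _ U]) (auto simp: U_def)
  qed
  then show ?thesis
    using Met_TC.continuous_map_to_metric[of T f] by (simp add: mball_eq_ball)
qed

lemma continuous_map_cmult:
  fixes f :: "'a \<Rightarrow> 'b::real_normed_algebra"
  shows "continuous_map T euclidean f \<Longrightarrow> continuous_map T euclidean (\<lambda>x. c * f x)"
  by (simp add: continuous_map_atin tendsto_mult_left)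

lemma convex_comb_tracial_states:
  assumes "unital_cstar_algebra A" and \<tau>: "\<tau>\<^sub>1 \<in> tracial_states A" "\<tau>\<^sub>2 \<in> tracial_states A" and t: "t \<in> {0..1}"
  shows "convex_comb A t \<tau>\<^sub>1 \<tau>\<^sub>2 \<in> tracial_states A"
proof -
  interpret unital_cstar_algebra A by fact
  obtain u where u: "is_unit A u" using unit_exists by blast
  have st: "\<tau>\<^sub>1 \<in> states A" "\<tau>\<^sub>2 \<in> states A" using \<tau> by (simp_all add: tracial_states_def)
  have lin: "clinear_on (cs_carrier A) \<tau>\<^sub>1" "clinear_on (cs_carrier A) \<tau>\<^sub>2" using st by (simp_all add: states_def)
  have one: "\<tau>\<^sub>1 u = 1" "\<tau>\<^sub>2 u = 1" using st by (simp_all add: state_unit[OF u])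
  have "convex_comb A t \<tau>\<^sub>1 \<tau>\<^sub>2 \<in> states A"
  proof (rule stateI[OF u])
    show "convex_comb A t \<tau>\<^sub>1 \<tau>\<^sub>2 \<in> extensional (cs_carrier A)" by (simp add: convex_comb_def)
    show "clinear_on (cs_carrier A) (convex_comb A t \<tau>\<^sub>1 \<tau>\<^sub>2)"
      using lin by (simp add: clinear_on_def convex_comb_def scaleC_complex_def algebra_simps)
    show "convex_comb A t \<tau>\<^sub>1 \<tau>\<^sub>2 (cs_mult A (cs_star A a) a) \<in> \<real>\<^sub>\<ge>\<^sub>0" if a: "a \<in> cs_carrier A" for a
    proof -
      have "\<tau>\<^sub>1 (cs_mult A (cs_star A a) a) \<in> \<real>\<^sub>\<ge>\<^sub>0" "\<tau>\<^sub>2 (cs_mult A (cs_star A a) a) \<in> \<real>\<^sub>\<ge>\<^sub>0"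
        using st a by (simp_all only: states_def mem_Collect_eq)
      then show ?thesis
        using t a mult_closed[OF star_closed[OF a] a]
        by (auto simp: convex_comb_def simp del: of_real_diff intro!: nonneg_Reals_add_I nonneg_Reals_mult_I)
    qed
    show "convex_comb A t \<tau>\<^sub>1 \<tau>\<^sub>2 u = 1" using u one by (simp add: convex_comb_def is_unit_def)
  qed
  then show ?thesis using \<tau> by (simp add: tracial_states_def convex_comb_def mult_closed)
qed

text \<open>States are extensional, so they are points of the product space.\<close>

lemma topspace_weak_star: "S \<subseteq> states A \<Longrightarrow> topspace (weak_star A S) = S"
  by (auto simp: weak_star_def states_def PiE_def)

lemma continuous_map_weak_star_eval:
  assumes "a \<in> cs_carrier A" shows "continuous_map (weak_star A S) euclidean (\<lambda>\<tau>. \<tau> a)"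
  unfolding weak_star_def
  by (rule continuous_map_from_subtopology[OF continuous_map_product_projection[OF assms]])

lemma continuous_map_weak_star:
  assumes "\<And>a. a \<in> cs_carrier A \<Longrightarrow> continuous_map T euclidean (\<lambda>x. f x a)"
    and "f ` topspace T \<subseteq> S" "S \<subseteq> states A"
  shows "continuous_map T (weak_star A S) f"
  unfolding weak_star_def continuous_map_in_subtopology continuous_map_componentwise
  using assms by (auto simp: states_def)

section \<open>Continuity and affinity of the state in the trace\<close>

context nt_system
begin

abbreviation "state_of \<tau> \<equiv> nt_state.omega X n b \<tau> C \<iota> N \<beta>"

lemma nt_state:
  assumes "\<tau> \<in> tracial_states A" shows "nt_state A X n b m \<tau> C \<iota> N \<beta>"
proof (intro nt_state.intro fock.intro fock_axioms.intro nt_state_axioms.intro)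
  show "nt_system A X n b m C \<iota> N \<beta>" by (rule nt_system_axioms)
  show "\<tau> \<in> states A" using assms by (simp add: tracial_states_def)
  show "\<tau> (cs_mult A a c) = \<tau> (cs_mult A c a)" if "a \<in> cs_carrier A" "c \<in> cs_carrier A" for a c
    using assms that by (simp add: tracial_states_def)
qed (rule finite_type_product_system_axioms)

text \<open>The elements \<open>a j\<close> are chosen before \<open>\<tau>\<close>: each term of
  the series is a fixed finite combination of evaluations of \<open>\<tau>\<close>, which yields
  both its weak* continuity and its affinity.\<close>

lemma omega_term_eval:
  assumes r: "0 \<le> r" and \<xi>: "\<xi> \<in> ps_carrier X r" and \<eta>: "\<eta> \<in> ps_carrier X r" and rs: "r \<le> s"
  obtains a where "\<And>j. j < n s \<Longrightarrow> a j \<in> cs_carrier A"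
    and "\<And>\<tau>. omega_term X n b m N \<beta> \<tau> r \<xi> \<eta> s = complex_of_real (N s powr - \<beta> / zeta_N N n \<beta>) * (\<Sum>j<n s. \<tau> (a j))"
proof
  define p where "p = s - r"
  have p: "0 \<le> p" and s: "s = r + p" using rs by (simp_all add: p_def)
  have bij: "bij_betw (m r p) ({..<n r} \<times> {..<n p}) {..<n s}"
    using bij r p s by (auto simp: bijective_maps_def)
  define a where "a j = (let (i, k) = the_inv_into ({..<n r} \<times> {..<n p}) (m r p) j
    in ps_inner X p (ps_lact X p (ps_inner X r \<xi> (b r i)) (b p k)) (ps_lact X p (ps_inner X r \<eta> (b r i)) (b p k)))" for j
  show "a j \<in> cs_carrier A" if j: "j < n s" for j
  proof -
    have "the_inv_into ({..<n r} \<times> {..<n p}) (m r p) j \<in> {..<n r} \<times> {..<n p}"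
      by (rule the_inv_into_into) (use bij j in \<open>auto simp: bij_betw_def\<close>)
    then show ?thesis using r p \<xi> \<eta> by (auto simp: a_def Let_def split: prod.splits)
  qed
  show "omega_term X n b m N \<beta> \<tau> r \<xi> \<eta> s = complex_of_real (N s powr - \<beta> / zeta_N N n \<beta>) * (\<Sum>j<n s. \<tau> (a j))" for \<tau>
    by (simp add: omega_term_def a_def p_def Let_def prod.case_distrib)
qed

abbreviation "W \<equiv> weak_star A (tracial_states A)"

lemma topspace_W [simp]: "topspace W = tracial_states A"
  by (rule topspace_weak_star) (auto simp: tracial_states_def)

lemma continuous_map_omega_term:
  assumes "0 \<le> r" "\<xi> \<in> ps_carrier X r" "\<eta> \<in> ps_carrier X r" "r \<le> s"
  shows "continuous_map W euclidean (\<lambda>\<tau>. omega_term X n b m N \<beta> \<tau> r \<xi> \<eta> s)"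
proof -
  obtain a where a: "\<And>j. j < n s \<Longrightarrow> a j \<in> cs_carrier A"
    "\<And>\<tau>. omega_term X n b m N \<beta> \<tau> r \<xi> \<eta> s = complex_of_real (N s powr - \<beta> / zeta_N N n \<beta>) * (\<Sum>j<n s. \<tau> (a j))"
    by (rule omega_term_eval[OF assms]) (rule that)
  have "continuous_map W euclidean (\<lambda>\<tau>. \<Sum>j<n s. \<tau> (a j))"
    by (rule continuous_map_sum) (use a(1) in \<open>auto intro: continuous_map_weak_star_eval\<close>)
  then show ?thesis unfolding a(2) by (rule continuous_map_cmult)
qed

text \<open>The tail of the series for \<open>\<omega>\<^sub>\<tau>\<close> is bounded by that of \<open>\<zeta>\<^sub>N(\<beta>)\<close>, uniformly in \<open>\<tau>\<close>.\<close>

lemma continuous_map_state_of_elem: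
  assumes s: "0 \<le> s" and r: "0 \<le> r" and \<xi>: "\<xi> \<in> ps_carrier X s" and \<eta>: "\<eta> \<in> ps_carrier X r"
  shows "continuous_map W euclidean (\<lambda>\<tau>. state_of \<tau> (R.elem s \<xi> r \<eta>))"
proof (cases "s = r")
  case False
  then show ?thesis
    using nt_state.omega_elem_zero[OF nt_state s r \<xi> \<eta>] by (intro continuous_map_eq[OF continuous_map_const[THEN iffD2]]) auto
next
  case True
  note \<xi> = \<xi>[unfolded True]
  define K where "K = cs_norm C (R.elem r \<xi> r \<eta>)"
  define w where "w p = N p powr - \<beta> / zeta_N N n \<beta> * real (n p)" for p
  have "w summable_on {p. r \<le> p}"
  proof (rule summable_on_subset_banach)
    show "w summable_on {p. 0 \<le> p}"
      unfolding w_def using summable_on_cmult_right[OF summable, of "1 / zeta_N N n \<beta>"] by simp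
    show "{p. r \<le> p} \<subseteq> {p. 0 \<le> p}" using r by auto
  qed
  then have sw: "(\<lambda>p. w p * K) summable_on {p. r \<le> p}" by (rule summable_on_cmult_left)
  define V where "V = (\<Sum>\<^sub>\<infinity>p\<in>{p. r \<le> p}. w p * K)"
  have "\<exists>g. continuous_map W euclidean g \<and> (\<forall>\<tau>\<in>topspace W. dist (state_of \<tau> (R.elem r \<xi> r \<eta>)) (g \<tau>) < e)" if e: "0 < e" for e
  proof -
    \<comment> \<open>\<open>F\<close> is chosen for the dominating series, hence serves all
      \<open>\<tau>\<close> at once.\<close>
    obtain F where F: "finite F" "F \<subseteq> {p. r \<le> p}"
      and Fe: "dist (\<Sum>p\<in>F. w p * K) V \<le> e / 2"
      unfolding V_def using has_sum_finite_approximation[OF has_sum_infsum[OF sw], of "e / 2"] e by auto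
    have "dist (state_of \<tau> (R.elem r \<xi> r \<eta>)) (\<Sum>p\<in>F. omega_term X n b m N \<beta> \<tau> r \<xi> \<eta> p) < e"
      if \<tau>: "\<tau> \<in> tracial_states A" for \<tau>
    proof -
      interpret S: nt_state A X n b m \<tau> C \<iota> N \<beta> by (rule nt_state[OF \<tau>])
      let ?f = "omega_term X n b m N \<beta> \<tau> r \<xi> \<eta>"
      have le: "cmod (?f p) \<le> w p * K" if "p \<in> {p. r \<le> p} - F" for p
        using S.omega_term_bound[OF r \<xi> \<eta>, of p] that by (simp add: w_def K_def S.weight_def)
      have f: "(?f has_sum (S.omega (R.elem r \<xi> r \<eta>) - sum ?f F)) ({p. r \<le> p} - F)"
        by (rule has_sum_Diff[OF S.omega_elem_has_sum[OF r \<xi> \<eta>] has_sum_finite[OF F(1)] F(2)])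
      have g: "((\<lambda>p. w p * K) has_sum (V - (\<Sum>p\<in>F. w p * K))) ({p. r \<le> p} - F)"
        unfolding V_def by (rule has_sum_Diff[OF has_sum_infsum[OF sw] has_sum_finite[OF F(1)] F(2)])
      have "cmod (S.omega (R.elem r \<xi> r \<eta>) - sum ?f F) \<le> V - (\<Sum>p\<in>F. w p * K)"
        by (rule norm_infsum_le[OF f g le])
      also have "\<dots> \<le> dist (\<Sum>p\<in>F. w p * K) V" unfolding dist_real_def by (subst abs_minus_commute) (rule abs_ge_self)
      also have "\<dots> < e" by (rule le_less_trans[OF Fe]) (use e in simp)
      finally show ?thesis by (simp add: dist_norm)
    qed
    moreover have "continuous_map W euclidean (\<lambda>\<tau>. \<Sum>p\<in>F. omega_term X n b m N \<beta> \<tau> r \<xi> \<eta> p)"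
      by (rule continuous_map_sum[OF F(1)]) (use F(2) in \<open>auto intro: continuous_map_omega_term[OF r \<xi> \<eta>]\<close>)
    ultimately show ?thesis by auto
  qed
  then show ?thesis unfolding True by (rule continuous_map_uniform_approx)
qed

text \<open>Continuity passes from \<open>elems\<close> to the span by linearity, and to the closure
  because every \<open>state_of \<tau>\<close> is contractive, so that approximating
  \<open>c\<close> is uniform in \<open>\<tau>\<close>.\<close>

lemma continuous_map_state_of:
  assumes c: "c \<in> cs_carrier C"
  shows "continuous_map W euclidean (\<lambda>\<tau>. state_of \<tau> c)"
proof -
  have span: "cspan R.elems \<subseteq> {c \<in> cs_carrier C. continuous_map W euclidean (\<lambda>\<tau>. state_of \<tau> c)}"
  proof (rule complex_vector.span_minimal)
    show "R.elems \<subseteq> {c \<in> cs_carrier C. continuous_map W euclidean (\<lambda>\<tau>. state_of \<tau> c)}"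
      using continuous_map_state_of_elem R.elems_carrier by (auto simp: R.elems_def)
    have lin: "clinear_on (cs_carrier C) (state_of \<tau>)" if "\<tau> \<in> tracial_states A" for \<tau>
      by (rule nt_state.omega_linear[OF nt_state[OF that]])
    show "csubspace {c \<in> cs_carrier C. continuous_map W euclidean (\<lambda>\<tau>. state_of \<tau> c)}"
      unfolding complex_vector.subspace_def
    proof (intro conjI ballI allI CollectI; (elim CollectE conjE)?)
      show "continuous_map W euclidean (\<lambda>\<tau>. state_of \<tau> 0)"
        by (rule continuous_map_eq[of _ _ "\<lambda>_. 0"]) (simp_all add: clinear_on_zero[OF lin NT.C.subspace])
    next
      fix x y assume x: "x \<in> cs_carrier C" "continuous_map W euclidean (\<lambda>\<tau>. state_of \<tau> x)"
        and y: "y \<in> cs_carrier C" "continuous_map W euclidean (\<lambda>\<tau>. state_of \<tau> y)"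
      show "continuous_map W euclidean (\<lambda>\<tau>. state_of \<tau> (x + y))"
        by (rule continuous_map_eq[OF continuous_map_add[OF x(2) y(2)]]) (simp add: clinear_on_add[OF lin] x y)
    next
      fix k x assume x: "x \<in> cs_carrier C" "continuous_map W euclidean (\<lambda>\<tau>. state_of \<tau> x)"
      show "continuous_map W euclidean (\<lambda>\<tau>. state_of \<tau> (k *\<^sub>C x))"
        by (rule continuous_map_eq[OF continuous_map_cmult[OF x(2), of k]])
          (simp add: clinear_on_scale[OF lin] x scaleC_complex_def)
    qed simp_all
  qed
  show ?thesis
  proof (rule continuous_map_uniform_approx)
    fix e :: real assume e: "0 < e"
    have "c \<in> NT.C.cl (cspan R.elems)" using c span_dense by simp
    then obtain d where d: "d \<in> cspan R.elems" "cs_norm C (c - d) < e" using e by (rule NT.C.cl_approx)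
    have dc: "d \<in> cs_carrier C" "continuous_map W euclidean (\<lambda>\<tau>. state_of \<tau> d)" using d(1) span by auto
    have "dist (state_of \<tau> c) (state_of \<tau> d) < e" if \<tau>: "\<tau> \<in> tracial_states A" for \<tau>
    proof -
      interpret S: nt_state A X n b m \<tau> C \<iota> N \<beta> by (rule nt_state[OF \<tau>])
      show ?thesis
        using S.omega_le[of "c - d"] c dc(1) d(2) by (simp add: dist_norm clinear_on_diff[OF S.omega_linear NT.C.subspace])
    qed
    then show "\<exists>g. continuous_map W euclidean g \<and> (\<forall>\<tau>\<in>topspace W. dist (state_of \<tau> c) (g \<tau>) < e)"
      using dc(2) by (intro exI[of _ "\<lambda>\<tau>. state_of \<tau> d"]) simp
  qed
qed

text \<open>On generators of equal degrees each term of the series is affine in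
  \<open>\<tau>\<close> by \<open>omega_term_eval\<close>; on those of different degrees all three
  states vanish. Boundedness and density extend the identity to \<open>C\<close>.\<close>

lemma state_of_convex_comb:
  assumes \<tau>: "\<tau>\<^sub>1 \<in> tracial_states A" "\<tau>\<^sub>2 \<in> tracial_states A" and t: "t \<in> {0..1}"
  shows "state_of (convex_comb A t \<tau>\<^sub>1 \<tau>\<^sub>2) = convex_comb C t (state_of \<tau>\<^sub>1) (state_of \<tau>\<^sub>2)"
proof -
  let ?\<tau> = "convex_comb A t \<tau>\<^sub>1 \<tau>\<^sub>2"
  have \<tau>3: "?\<tau> \<in> tracial_states A"
    by (rule convex_comb_tracial_states[OF unital_cstar_algebra_axioms \<tau> t])
  interpret S1: nt_state A X n b m \<tau>\<^sub>1 C \<iota> N \<beta> by (rule nt_state[OF \<tau>(1)])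
  interpret S2: nt_state A X n b m \<tau>\<^sub>2 C \<iota> N \<beta> by (rule nt_state[OF \<tau>(2)])
  interpret S3: nt_state A X n b m ?\<tau> C \<iota> N \<beta> by (rule nt_state[OF \<tau>3])
  let ?f = "\<lambda>c. complex_of_real t * S1.omega c + complex_of_real (1 - t) * S2.omega c"
  have "S3.omega c = ?f c" if c: "c \<in> cs_carrier C" for c
  proof (rule functional_eqI[OF S3.omega_linear S3.omega_le _ _ _ c])
    show "clinear_on (cs_carrier C) ?f"
      using S1.omega_linear S2.omega_linear by (simp add: clinear_on_def scaleC_complex_def algebra_simps)
    show "cmod (?f x) \<le> 1 * cs_norm C x" if "x \<in> cs_carrier C" for x
    proof -
      have "cmod (?f x) \<le> t * cmod (S1.omega x) + (1 - t) * cmod (S2.omega x)"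
        using norm_triangle_ineq[of "complex_of_real t * S1.omega x" "complex_of_real (1 - t) * S2.omega x"] t
        by (simp add: Real_Vector_Spaces.norm_mult del: of_real_diff)
      also have "\<dots> \<le> t * cs_norm C x + (1 - t) * cs_norm C x"
        using t S1.omega_le[OF that] S2.omega_le[OF that] by (intro add_mono mult_left_mono) auto
      finally show ?thesis by (simp add: algebra_simps)
    qed
    fix s \<xi> r \<eta> assume s: "0 \<le> s" and r: "0 \<le> r" and \<xi>: "\<xi> \<in> ps_carrier X s" and \<eta>: "\<eta> \<in> ps_carrier X r"
    show "S3.omega (R.elem s \<xi> r \<eta>) = ?f (R.elem s \<xi> r \<eta>)"
    proof (cases "s = r")
      case False
      then show ?thesis
        using S1.omega_elem_zero[OF s r \<xi> \<eta>] S2.omega_elem_zero[OF s r \<xi> \<eta>] S3.omega_elem_zero[OF s r \<xi> \<eta>] by simp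
    next
      case True
      note \<xi> = \<xi>[unfolded True]
      have "omega_term X n b m N \<beta> ?\<tau> r \<xi> \<eta> p =
        complex_of_real t * omega_term X n b m N \<beta> \<tau>\<^sub>1 r \<xi> \<eta> p + complex_of_real (1 - t) * omega_term X n b m N \<beta> \<tau>\<^sub>2 r \<xi> \<eta> p"
        if p: "p \<in> {p. r \<le> p}" for p
      proof -
        have rp: "r \<le> p" using p by simp
        obtain a where a: "\<And>j. j < n p \<Longrightarrow> a j \<in> cs_carrier A"
          "\<And>\<tau>. omega_term X n b m N \<beta> \<tau> r \<xi> \<eta> p = complex_of_real (N p powr - \<beta> / zeta_N N n \<beta>) * (\<Sum>j<n p. \<tau> (a j))"
          by (rule omega_term_eval[OF r \<xi> \<eta> rp]) (rule that)
        have "(\<Sum>j<n p. ?\<tau> (a j)) = (\<Sum>j<n p. complex_of_real t * \<tau>\<^sub>1 (a j) + complex_of_real (1 - t) * \<tau>\<^sub>2 (a j))"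
          using a(1) by (intro sum.cong) (simp_all add: convex_comb_def)
        then show ?thesis
          unfolding a(2) by (simp only: sum.distrib sum_distrib_left[symmetric] distrib_left mult.left_commute)
      qed
      then have cong: "(omega_term X n b m N \<beta> ?\<tau> r \<xi> \<eta> has_sum ?f (R.elem r \<xi> r \<eta>)) {p. r \<le> p} \<longleftrightarrow>
        ((\<lambda>p. complex_of_real t * omega_term X n b m N \<beta> \<tau>\<^sub>1 r \<xi> \<eta> p +
          complex_of_real (1 - t) * omega_term X n b m N \<beta> \<tau>\<^sub>2 r \<xi> \<eta> p) has_sum ?f (R.elem r \<xi> r \<eta>)) {p. r \<le> p}"
        by (rule has_sum_cong)
      have "(omega_term X n b m N \<beta> ?\<tau> r \<xi> \<eta> has_sum ?f (R.elem r \<xi> r \<eta>)) {p. r \<le> p}"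
        unfolding cong
        by (intro has_sum_add has_sum_cmult_right S1.omega_elem_has_sum S2.omega_elem_has_sum r \<xi> \<eta>)
      from has_sum_unique[OF S3.omega_elem_has_sum[OF r \<xi> \<eta>] this] show ?thesis unfolding True .
    qed
  qed
  moreover have "S3.omega \<in> extensional (cs_carrier C)" using S3.omega_state unfolding states_def by blast
  ultimately show ?thesis
    by (intro extensionalityI[where A = "cs_carrier C"]) (simp_all add: convex_comb_def)
qed

end

theorem theorem4p10:
  fixes A :: "'u::complex_vector cstar"
    and X :: "('g::lattice_ab_group_add, 'u, 't::complex_vector) prod_sys"
    and n :: "'g \<Rightarrow> nat" and b :: "'g \<Rightarrow> nat \<Rightarrow> 'u" and m :: "'g \<Rightarrow> 'g \<Rightarrow> nat \<times> nat \<Rightarrow> nat"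
    and C :: "'c::complex_vector cstar" and \<iota> :: "'g \<Rightarrow> 'u \<Rightarrow> 'c" and \<Phi> :: "'c \<Rightarrow> 'c"
    and N :: "'g \<Rightarrow> real" and \<sigma> :: "real \<Rightarrow> 'c \<Rightarrow> 'c" and \<beta>\<^sub>c \<beta> :: real
  assumes "finite_type_system A X n b m"
    and "associative_ps X"
    and "bijective_maps n m"
    and "respects_coprime_pairs n m"
    and "nica_toeplitz_algebra A X C \<iota>"
    and "core_expectation A X C \<iota> \<Phi>"
    and "\<And>s. N s > 0" and "\<And>s r. N (s + r) = N s * N r" and "inj N"
    and "nt_dynamics A X C \<iota> N \<sigma>"
    and "\<beta>\<^sub>c > 0"
    and "\<And>\<beta>'. \<beta>' > \<beta>\<^sub>c \<Longrightarrow> (\<lambda>s. N s powr - \<beta>' * real (n s)) summable_on {s. 0 \<le> s}"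
    and "\<beta> > \<beta>\<^sub>c"
  shows "(\<forall>\<tau>\<in>tracial_states A. \<exists>!\<omega>. is_omega A X n b m N \<beta> C \<iota> \<tau> \<omega>) \<and>
    (\<forall>\<omega>. (\<forall>\<tau>\<in>tracial_states A. is_omega A X n b m N \<beta> C \<iota> \<tau> (\<omega> \<tau>)) \<longrightarrow>
      (let \<Theta> = (\<lambda>\<tau>. \<lambda>c\<in>cs_carrier C. \<omega> \<tau> (\<Phi> c)) in
        \<Theta> ` tracial_states A \<subseteq> kms_states C \<sigma> \<beta> \<and>
        continuous_map (weak_star A (tracial_states A)) (weak_star C (kms_states C \<sigma> \<beta>)) \<Theta> \<and>
        (\<forall>\<tau>\<^sub>1\<in>tracial_states A. \<forall>\<tau>\<^sub>2\<in>tracial_states A. \<forall>t\<in>{0..1}.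
           \<Theta> (convex_comb A t \<tau>\<^sub>1 \<tau>\<^sub>2) = convex_comb C t (\<Theta> \<tau>\<^sub>1) (\<Theta> \<tau>\<^sub>2))))"
proof (intro conjI ballI allI impI)
  interpret finite_type_system A X n b m by fact
  interpret finite_type_product_system A X n b m by unfold_locales fact+
  interpret NT: nica_toeplitz_algebra A X C \<iota> by fact
  interpret nt_system A X n b m C \<iota> N \<beta>
    by (intro nt_system.intro nt_system_axioms.intro finite_type_product_system_axioms assms(5,7,8) assms(12)[OF assms(13)])
  {
    fix \<tau> assume \<tau>: "\<tau> \<in> tracial_states A"
    interpret S: nt_state A X n b m \<tau> C \<iota> N \<beta> by (rule nt_state[OF \<tau>])
    show "\<exists>!\<omega>. is_omega A X n b m N \<beta> C \<iota> \<tau> \<omega>"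
      using S.is_omega_omega S.is_omega_unique by blast
  next
    fix \<omega> assume \<omega>: "\<forall>\<tau>\<in>tracial_states A. is_omega A X n b m N \<beta> C \<iota> \<tau> (\<omega> \<tau>)"
    define \<Theta> where "\<Theta> = (\<lambda>\<tau>. \<lambda>c\<in>cs_carrier C. \<omega> \<tau> (\<Phi> c))"
    \<comment> \<open>Whatever family \<open>\<omega>\<close> is given, uniqueness on the core
      identifies its composite with \<open>\<Phi>\<close> as the state built from the Fock
      representation, to which the preceding results apply.\<close>
    have \<Theta>: "\<Theta> \<tau> = state_of \<tau>" if "\<tau> \<in> tracial_states A" for \<tau>
      unfolding \<Theta>_def using nt_state.omega_expectation[OF nt_state[OF that] _ assms(6)] \<omega> that by blast
    have kms: "\<Theta> ` tracial_states A \<subseteq> kms_states C \<sigma> \<beta>"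
      using nt_state.omega_kms[OF nt_state assms(10)] \<Theta> by auto
    have "continuous_map (weak_star A (tracial_states A)) (weak_star C (kms_states C \<sigma> \<beta>)) \<Theta>"
    proof (rule continuous_map_weak_star)
      show "continuous_map W euclidean (\<lambda>\<tau>. \<Theta> \<tau> c)" if "c \<in> cs_carrier C" for c
        by (rule continuous_map_eq[OF continuous_map_state_of[OF that]]) (simp add: \<Theta>)
    qed (use kms in \<open>auto simp: kms_states_def\<close>)
    moreover have "\<Theta> (convex_comb A t \<tau>\<^sub>1 \<tau>\<^sub>2) = convex_comb C t (\<Theta> \<tau>\<^sub>1) (\<Theta> \<tau>\<^sub>2)"
      if "\<tau>\<^sub>1 \<in> tracial_states A" "\<tau>\<^sub>2 \<in> tracial_states A" "t \<in> {0..1}" for \<tau>\<^sub>1 \<tau>\<^sub>2 t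
      using state_of_convex_comb[OF that] convex_comb_tracial_states[OF unital_cstar_algebra_axioms that] that
      by (simp add: \<Theta>)
    ultimately show "let \<Theta> = (\<lambda>\<tau>. \<lambda>c\<in>cs_carrier C. \<omega> \<tau> (\<Phi> c)) in
        \<Theta> ` tracial_states A \<subseteq> kms_states C \<sigma> \<beta> \<and>
        continuous_map (weak_star A (tracial_states A)) (weak_star C (kms_states C \<sigma> \<beta>)) \<Theta> \<and>
        (\<forall>\<tau>\<^sub>1\<in>tracial_states A. \<forall>\<tau>\<^sub>2\<in>tracial_states A. \<forall>t\<in>{0..1}.
           \<Theta> (convex_comb A t \<tau>\<^sub>1 \<tau>\<^sub>2) = convex_comb C t (\<Theta> \<tau>\<^sub>1) (\<Theta> \<tau>\<^sub>2))"
      unfolding Let_def \<Theta>_def[symmetric] using kms by simp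
  }
qed

end
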